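(* Consider the loss reveal process on the configuration model with type-dependent parameters described in the context. Assume: (1) there is a probability distribution $\mu=(\mu_x)_{x\in\mathcal{X}}$ on $\mathcal{X}$, independent of $n$, such that $\mu_x^{(n)}\to\mu_x$ as $n\to\infty$ for all $x\in\mathcal{X}$; (2) $\lambda^{(n)}:=\sum_{x\in\mathcal{X}}d_x^+\mu_x^{(n)}=\sum_{x\in\mathcal{X}}d_x^-\mu_x^{(n)}\to\lambda:=\sum_{x\in\mathcal{X}}d_x^+\mu_x\in(0,\infty)$ as $n\to\infty$; (3) the loss intensity function satisfies $\mathcal{R}_n(t)=0$ for $t>\tau_n^\star$ and $\mathcal{R}_n(t)=n\mathfrak{R}(t)+o_p(n)$ for $t\le\tau_n^\star$, where $\mathfrak{R}$ is continuous, positive and $\|\mathfrak{R}\|_{L^1}=\int_0^\infty\mathfrak{R}(s)\,ds<\infty$. Then for all $x\in\mathcal{X}$ and $\theta=0,\dots,d_x^+$, as $n\to\infty$, $$\sup_{t\le\tau_n^\star}\Bigl|\frac{S^{(n)}_{x,\theta}(t)}{n}-\mu_x\,b(d_x^+,\phi^{\mathfrak{R}}(t),\theta)\,\mathcal{S}^{\mathfrak{R}}_{x,\theta}(t)\Bigr|\to0\quad\text{in probability.}$$ Further, as $n\to\infty$, $$\sup_{t\le\tau_n^\star}\Bigl|\frac{S^{(n)}(t)}{n}-f_S^{\mathfrak{R}}(t)\Bigr|\to0,\qquad \sup_{t\le\tau_n^\star}\Bigl|\frac{D^{(n)}(t)}{n}-f_D^{\mathfrak{R}}(t)\Bigr|\to0,\qquad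 \sup_{t\le\tau_n^\star}\Bigl|\frac{W_n(t)}{n}-f_W^{\mathfrak{R}}(t)\Bigr|\to0\quad\text{in probability.}$$
   Context: **Agents and types.** For each $n$ there are agents $[n]=\{1,\dots,n\}$. Each agent has a type in a countable set $\mathcal{X}$; $\mu_x^{(n)}$ is the fraction of agents of type $x$. An agent of type $x$ has $d_x^+$ incoming and $d_x^-$ outgoing half-edges, initial capital $\gamma_x>0$, total end-user claims $\delta_x$, and a continuous non-decreasing premium accumulation function $\alpha_x(t)$, $t\ge0$. Each agent of type $x$ receives an initial proportional shock in $[0,1]$ with cdf $F_x^{(\epsilon)}$ and density $f_x^{(\epsilon)}$, and its incoming losses are i.i.d. positive random variables with cdf $F_x$ and density $f_x$; all shocks and losses are independent. Set $q_{x,0}:=1-F_x^{(\epsilon)}\bigl(\frac{\gamma_x+\alpha_x(0)-\delta_x}{\gamma_x}\bigr)$ (expected fraction of initially ruined agents of type $x$). **Loss reveal process on the configuration model.** The configuration model is the uniformly random matching of all outgoing half-edges with all incoming half-edges (their total numbers are equal); it is constructed simultaneously with the ruin process. An agent of type $x$ with shock $\epsilon$ which has incurred losses $\ell_1,\dots,\ell_k$ by time $t$ has capital $\gamma_x(1-\epsilon)+\alpha_x(t)-\delta_x-\sum_{i=1}^k\ell_i$; it becomes ruined, and remains so forever, at the first time its capital is $\le0$ (possibly at time $0$). All outgoing half-edges of ruined agents are called ruinous. Losses are revealed one by one: at each reveal a not yet revealed ruinous outgoing half-edge is matched with an incoming half-edge chosen uniformly at random among all remaining incoming half-edges, and the agent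 owning that incoming half-edge, if of type $x$, incurs a random loss with cdf $F_x$. If a loss is revealed at time $t_1$, the waiting time until the next reveal is exponential with parameter $\mathcal{R}_n(t_1)$, where the loss reveal intensity $\mathcal{R}_n(t)$ (which may depend on the state of the process at time $t$) does not change between two successive reveals. $W_n(t)$ is the number of unrevealed ruinous outgoing half-edges at time $t$, and $\tau_n^\star$ is the first time at which $W_n(\tau_n^\star)=0$, when the process stops. $S^{(n)}(t)$ and $D^{(n)}(t)$ are the numbers of solvent and ruined agents at time $t$; $S^{(n)}_{x,\theta}(t)$ is the number of solvent agents of type $x$ at time $t$ with exactly $\theta$ ruined incoming neighbours, i.e. exactly $\theta$ losses revealed to them by time $t$. $X_n=o_p(n)$ means $|X_n|/n\to0$ in probability. **Limit functions.** Let $b(d,z,\ell):=\binom{d}{\ell}z^\ell(1-z)^{d-\ell}$. Let $t_{\mathfrak{R}}(\lambda):=\inf\{t\ge0:\int_0^t\mathfrak{R}(s)ds\ge\lambda\}$, with $t_{\mathfrak{R}}(\lambda):=\infty$ if $\|\mathfrak{R}\|_{L^1}\le\lambda$, and $$\phi^{\mathfrak{R}}(t):=\frac1\lambda\int_0^{t\wedge t_{\mathfrak{R}}(\lambda)}\mathfrak{R}(s)\,ds.$$ For a shock $\epsilon_x$ and losses $\boldsymbol{\ell}_x=(\ell_x^{(1)},\dots,\ell_x^{(d_x^+)})$, let for $\theta=0,\dots,d_x^+$ $$\tau_{x,\theta}(\epsilon_x,\boldsymbol{\ell}_x):=\inf\Bigl\{t\ge0:\gamma_x(1-\epsilon_x)+\alpha_x(t)-\delta_x\ge\sum_{i=1}^\theta\ell_x^{(i)}\Bigr\}\qquad(\inf\emptyset=\infty).$$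 Let $U^{\mathfrak{R},t}_{(1)}\le\dots\le U^{\mathfrak{R},t}_{(\theta)}$ be the order statistics of $\theta$ i.i.d. random variables with $\mathbb{P}(U\le y)=\int_0^y\mathfrak{R}(s)ds\big/\int_0^t\mathfrak{R}(s)ds$, $y\le t$. Let $\mathcal{S}^{\mathfrak{R}}_{x,0}(t):=1-q_{x,0}$ and, for $\theta=1,\dots,d_x^+$, $$\mathcal{S}^{\mathfrak{R}}_{x,\theta}(t):=\mathbb{P}\bigl(\tau_{x,0}(\epsilon_x,\boldsymbol{L}_x)=0,\ U^{\mathfrak{R},t}_{(1)}>\tau_{x,1}(\epsilon_x,\boldsymbol{L}_x),\dots,U^{\mathfrak{R},t}_{(\theta)}>\tau_{x,\theta}(\epsilon_x,\boldsymbol{L}_x)\bigr),$$ where $\boldsymbol{L}_x=(L_x^{(1)},\dots,L_x^{(d_x^+)})$ is i.i.d. with cdf $F_x$, $\epsilon_x$ has cdf $F_x^{(\epsilon)}$, and these are independent of each other and of the $U$'s. Finally $$f_S^{\mathfrak{R}}(t):=\sum_{x\in\mathcal{X}}\mu_x\sum_{\theta=0}^{d_x^+}b(d_x^+,\phi^{\mathfrak{R}}(t),\theta)\,\mathcal{S}^{\mathfrak{R}}_{x,\theta}(t),\qquad f_D^{\mathfrak{R}}(t):=1-f_S^{\mathfrak{R}}(t),$$ $$f_W^{\mathfrak{R}}(t):=\lambda(1-\phi^{\mathfrak{R}}(t))-\sum_{x\in\mathcal{X}}\mu_xd_x^-\sum_{\theta=0}^{d_x^+}b(d_x^+,\ph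i^{\mathfrak{R}}(t),\theta)\,\mathcal{S}^{\mathfrak{R}}_{x,\theta}(t).$$
   Formalization: The error o_p(n) in (3) is taken in L^1: the integral of |R_n(t)/n - R(t)| over t ≤ τ_n^* tends to 0 in probability; the claim on W_n additionally assumes that the sum of d_x^- μ_x over x equals λ (automatic for finitely many types). Both fail otherwise. *)

theory Defs
  imports "HOL-Probability.Probability"
begin

section \<open>Agent types\<close>

text \<open>
  \<open>d_in\<close> and \<open>d_out\<close> are $d_x^+$ and $d_x^-$. The shock and loss cdfs are those of the laws
  given by the densities.
\<close>

record agent_class =
  d_in :: nat
  d_out :: nat
  init_capital :: real
  claims :: real
  premium :: "real \<Rightarrow> real"
  shock_density :: "real \<Rightarrow> real"
  loss_density :: "real \<Rightarrow> real"

definition shock_law :: "agent_class \<Rightarrow> real measure" where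
  "shock_law a = density lborel (\<lambda>s. ennreal (shock_density a s))"

definition loss_law :: "agent_class \<Rightarrow> real measure" where
  "loss_law a = density lborel (\<lambda>y. ennreal (loss_density a y))"

definition valid_class :: "agent_class \<Rightarrow> bool" where
  "valid_class a \<longleftrightarrow>
     0 < init_capital a \<and>
     continuous_on {0..} (premium a) \<and> mono_on {0..} (premium a) \<and>
     shock_density a \<in> borel_measurable borel \<and> (\<forall>s. 0 \<le> shock_density a s) \<and>
     prob_space (shock_law a) \<and> (AE s in shock_law a. 0 \<le> s \<and> s \<le> 1) \<and>
     loss_density a \<in> borel_measurable borel \<and> (\<forall>y. 0 \<le> loss_density a y) \<and>
     prob_space (loss_law a) \<and> (AE y in loss_law a. 0 < y)"


section \<open>The loss reveal process on the configuration model\<close>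

text \<open>
  In a network with agents \<open>{1..n}\<close>, agent \<open>i\<close> has class \<open>par (ty i)\<close>. Half-edges are pairs
  (owner, position).
\<close>

definition type_fraction :: "nat \<Rightarrow> (nat \<Rightarrow> 'x) \<Rightarrow> 'x \<Rightarrow> real" where
  "type_fraction n ty x = real (card {i \<in> {1..n}. ty i = x}) / real n"

definition in_edges :: "('x \<Rightarrow> agent_class) \<Rightarrow> nat \<Rightarrow> (nat \<Rightarrow> 'x) \<Rightarrow> (nat \<times> nat) set" where
  "in_edges par n ty = (SIGMA i:{1..n}. {1..d_in (par (ty i))})"

definition out_edges :: "('x \<Rightarrow> agent_class) \<Rightarrow> nat \<Rightarrow> (nat \<Rightarrow> 'x) \<Rightarrow> (nat \<times> nat) set" where
  "out_edges par n ty = (SIGMA i:{1..n}. {1..d_out (par (ty i))})"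

text \<open>
  The random objects of one network. For \<open>k = 1, 2, \<dots>\<close>, the \<open>k\<close>-th reveal matches the outgoing
  half-edge \<open>out_edge k\<close> with the incoming half-edge \<open>in_edge k\<close>, whose owner incurs \<open>loss k\<close>; it
  takes place \<open>wait k\<close> time units after the previous one (after time 0 if \<open>k = 1\<close>). \<open>rate k\<close> is
  the value of the loss reveal intensity from the \<open>k\<close>-th reveal (from time 0 if \<open>k = 0\<close>) until
  the next one. \<open>hist k\<close> is the information available right after the \<open>k\<close>-th reveal; it may
  contain additional randomness, so the rate and the choice of the next ruinous half-edge are
  arbitrary non-anticipating functions of the state.

  A rate 0 means that the next waiting time is infinite. Draws whose reveal time is infinite are
  not part of the process in time: they only complete the uniform matching.
\<close>

record 'w reveal_data =
  prb :: "'w measure"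
  hist :: "nat \<Rightarrow> 'w measure"
  shock :: "nat \<Rightarrow> 'w \<Rightarrow> real"
  out_edge :: "nat \<Rightarrow> 'w \<Rightarrow> nat \<times> nat"
  in_edge :: "nat \<Rightarrow> 'w \<Rightarrow> nat \<times> nat"
  loss :: "nat \<Rightarrow> 'w \<Rightarrow> real"
  wait :: "nat \<Rightarrow> 'w \<Rightarrow> ereal"
  rate :: "nat \<Rightarrow> 'w \<Rightarrow> real"

definition reveal_time :: "'w reveal_data \<Rightarrow> nat \<Rightarrow> 'w \<Rightarrow> ereal" where
  "reveal_time p k \<omega> = (\<Sum>j = 1..k. wait p j \<omega>)"

definition revealed ::
  "('x \<Rightarrow> agent_class) \<Rightarrow> nat \<Rightarrow> (nat \<Rightarrow> 'x) \<Rightarrow> 'w reveal_data \<Rightarrow> real \<Rightarrow> 'w \<Rightarrow> nat set" where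
  "revealed par n ty p t \<omega> =
     {k \<in> {1..card (in_edges par n ty)}. reveal_time p k \<omega> \<le> ereal t}"

definition agent_losses ::
  "('x \<Rightarrow> agent_class) \<Rightarrow> nat \<Rightarrow> (nat \<Rightarrow> 'x) \<Rightarrow> 'w reveal_data \<Rightarrow> nat \<Rightarrow> real \<Rightarrow> 'w \<Rightarrow> nat set" where
  "agent_losses par n ty p i t \<omega> = {k \<in> revealed par n ty p t \<omega>. fst (in_edge p k \<omega>) = i}"

definition capital ::
  "('x \<Rightarrow> agent_class) \<Rightarrow> nat \<Rightarrow> (nat \<Rightarrow> 'x) \<Rightarrow> 'w reveal_data \<Rightarrow> nat \<Rightarrow> real \<Rightarrow> 'w \<Rightarrow> real" where
  "capital par n ty p i t \<omega> =
     init_capital (par (ty i)) * (1 - shock p i \<omega>) + premium (par (ty i)) t - claims (par (ty i))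
       - (\<Sum>k\<in>agent_losses par n ty p i t \<omega>. loss p k \<omega>)"

definition ruined ::
  "('x \<Rightarrow> agent_class) \<Rightarrow> nat \<Rightarrow> (nat \<Rightarrow> 'x) \<Rightarrow> 'w reveal_data \<Rightarrow> nat \<Rightarrow> real \<Rightarrow> 'w \<Rightarrow> bool" where
  "ruined par n ty p i t \<omega> \<longleftrightarrow> (\<exists>s\<in>{0..t}. capital par n ty p i s \<omega> \<le> 0)"

definition ruinous ::
  "('x \<Rightarrow> agent_class) \<Rightarrow> nat \<Rightarrow> (nat \<Rightarrow> 'x) \<Rightarrow> 'w reveal_data \<Rightarrow> real \<Rightarrow> 'w \<Rightarrow> (nat \<times> nat) set" where
  "ruinous par n ty p t \<omega> =
     {e \<in> out_edges par n ty. ruined par n ty p (fst e) t \<omega> \<and>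
        (\<forall>k\<in>revealed par n ty p t \<omega>. out_edge p k \<omega> \<noteq> e)}"

definition num_ruinous ::
  "('x \<Rightarrow> agent_class) \<Rightarrow> nat \<Rightarrow> (nat \<Rightarrow> 'x) \<Rightarrow> 'w reveal_data \<Rightarrow> real \<Rightarrow> 'w \<Rightarrow> nat" where
  "num_ruinous par n ty p t \<omega> = card (ruinous par n ty p t \<omega>)"

definition stop_time ::
  "('x \<Rightarrow> agent_class) \<Rightarrow> nat \<Rightarrow> (nat \<Rightarrow> 'x) \<Rightarrow> 'w reveal_data \<Rightarrow> 'w \<Rightarrow> ereal" where
  "stop_time par n ty p \<omega> = Inf (ereal ` {t. 0 \<le> t \<and> num_ruinous par n ty p t \<omega> = 0})"

definition intensity ::
  "('x \<Rightarrow> agent_class) \<Rightarrow> nat \<Rightarrow> (nat \<Rightarrow> 'x) \<Rightarrow> 'w reveal_data \<Rightarrow> real \<Rightarrow> 'w \<Rightarrow> real" where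
  "intensity par n ty p t \<omega> = rate p (card (revealed par n ty p t \<omega>)) \<omega>"

definition num_solvent_type ::
  "('x \<Rightarrow> agent_class) \<Rightarrow> nat \<Rightarrow> (nat \<Rightarrow> 'x) \<Rightarrow> 'w reveal_data \<Rightarrow> 'x \<Rightarrow> nat \<Rightarrow> real \<Rightarrow> 'w \<Rightarrow> nat" where
  "num_solvent_type par n ty p x \<theta> t \<omega> =
     card {i \<in> {1..n}. ty i = x \<and> \<not> ruined par n ty p i t \<omega> \<and>
                        card (agent_losses par n ty p i t \<omega>) = \<theta>}"

definition num_solvent ::
  "('x \<Rightarrow> agent_class) \<Rightarrow> nat \<Rightarrow> (nat \<Rightarrow> 'x) \<Rightarrow> 'w reveal_data \<Rightarrow> real \<Rightarrow> 'w \<Rightarrow> nat" where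
  "num_solvent par n ty p t \<omega> = card {i \<in> {1..n}. \<not> ruined par n ty p i t \<omega>}"

definition num_ruined ::
  "('x \<Rightarrow> agent_class) \<Rightarrow> nat \<Rightarrow> (nat \<Rightarrow> 'x) \<Rightarrow> 'w reveal_data \<Rightarrow> real \<Rightarrow> 'w \<Rightarrow> nat" where
  "num_ruined par n ty p t \<omega> = card {i \<in> {1..n}. ruined par n ty p i t \<omega>}"

text \<open>
  The last clause is the law of one reveal step conditionally on the past: the incoming half-edge
  is uniform among the remaining ones, its owner incurs a loss with the cdf of its type, the
  waiting time is exponential with the current intensity as parameter, and, given the past and
  the incoming half-edge, loss and waiting time are independent.
\<close>

definition loss_reveal_process ::
  "('x \<Rightarrow> agent_class) \<Rightarrow> nat \<Rightarrow> (nat \<Rightarrow> 'x) \<Rightarrow> 'w reveal_data \<Rightarrow> bool" where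
  "loss_reveal_process par n ty p \<longleftrightarrow>
     (let M = prb p; H = in_edges par n ty; m = card H in
       prob_space M \<and>
       filtration (space M) (hist p) \<and> (\<forall>k. subalgebra M (hist p k)) \<and>
       (\<forall>i\<in>{1..n}. shock p i \<in> borel_measurable (hist p 0) \<and>
                    distr M borel (shock p i) = shock_law (par (ty i))) \<and>
       prob_space.indep_vars M (\<lambda>_. borel) (shock p) {1..n} \<and>
       (\<forall>k\<le>m. rate p k \<in> borel_measurable (hist p k) \<and> (\<forall>\<omega>\<in>space M. 0 \<le> rate p k \<omega>) \<and>
          (AE \<omega> in M. reveal_time p k \<omega> < \<infinity> \<longrightarrow>
             num_ruinous par n ty p (real_of_ereal (reveal_time p k \<omega>)) \<omega> = 0 \<longrightarrow> rate p k \<omega> = 0)) \<and>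
       (\<forall>k<m.
          out_edge p (Suc k) \<in> measurable (hist p k) (count_space UNIV) \<and>
          in_edge p (Suc k) \<in> measurable (hist p (Suc k)) (count_space UNIV) \<and>
          loss p (Suc k) \<in> borel_measurable (hist p (Suc k)) \<and>
          wait p (Suc k) \<in> borel_measurable (hist p (Suc k)) \<and>
          (\<forall>\<omega>\<in>space M. 0 \<le> wait p (Suc k) \<omega>) \<and>
          (AE \<omega> in M. out_edge p (Suc k) \<omega> \<in>
             out_edges par n ty - (\<lambda>j. out_edge p j \<omega>) ` {1..k}) \<and>
          (AE \<omega> in M. reveal_time p k \<omega> < \<infinity> \<longrightarrow>
             num_ruinous par n ty p (real_of_ereal (reveal_time p k \<omega>)) \<omega> \<noteq> 0 \<longrightarrow>
             out_edge p (Suc k) \<omega> \<in>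
               ruinous par n ty p (real_of_ereal (reveal_time p k \<omega>)) \<omega>) \<and>
          (\<forall>h\<in>H. \<forall>y. \<forall>s\<ge>0. AE \<omega> in M.
             real_cond_exp M (hist p k)
               (indicator {\<omega> \<in> space M. in_edge p (Suc k) \<omega> = h \<and> loss p (Suc k) \<omega> \<le> y \<and>
                                         ereal s < wait p (Suc k) \<omega>}) \<omega>
             = (if h \<in> (\<lambda>j. in_edge p j \<omega>) ` {1..k} then 0 else 1 / real (m - k))
               * cdf (loss_law (par (ty (fst h)))) y
               * exp (- rate p k \<omega> * s))))"


section \<open>Limit functions\<close>

definition binom_prob :: "nat \<Rightarrow> real \<Rightarrow> nat \<Rightarrow> real" where
  "binom_prob d z l = real (d choose l) * z ^ l * (1 - z) ^ (d - l)"

definition t_limit :: "(real \<Rightarrow> real) \<Rightarrow> real \<Rightarrow> ereal" where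
  "t_limit R lam =
     (if (LBINT s:{0..}. R s) \<le> lam then \<infinity>
      else Inf (ereal ` {t. 0 \<le> t \<and> lam \<le> (LBINT s:{0..t}. R s)}))"

definition phi :: "(real \<Rightarrow> real) \<Rightarrow> real \<Rightarrow> real \<Rightarrow> real" where
  "phi R lam t =
     1 / lam * (LBINT s:{0..real_of_ereal (min (ereal t) (t_limit R lam))}. R s)"

definition initial_ruin_prob :: "agent_class \<Rightarrow> real" where
  "initial_ruin_prob a =
     1 - cdf (shock_law a) ((init_capital a + premium a 0 - claims a) / init_capital a)"

definition threshold_time :: "agent_class \<Rightarrow> nat \<Rightarrow> real \<Rightarrow> (nat \<Rightarrow> real) \<Rightarrow> ereal" where
  "threshold_time a \<theta> e l =
     Inf (ereal ` {t. 0 \<le> t \<and>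
       (\<Sum>i = 1..\<theta>. l i) \<le> init_capital a * (1 - e) + premium a t - claims a})"

definition order_stat :: "nat \<Rightarrow> (nat \<Rightarrow> real) \<Rightarrow> nat \<Rightarrow> real" where
  "order_stat \<theta> u j = sort (map u [1..<Suc \<theta>]) ! (j - 1)"

text \<open>
  For \<open>t = 0\<close> the quotient is 0/0 and this is the null measure; the resulting value of
  \<open>survival_prob\<close> for \<open>\<theta> \<ge> 1\<close> is then always multiplied by \<open>binom_prob d 0 \<theta> = 0\<close>.
\<close>

definition arrival_law :: "(real \<Rightarrow> real) \<Rightarrow> real \<Rightarrow> real measure" where
  "arrival_law R t =
     density lborel (\<lambda>s. ennreal (indicator {0..t} s * R s / (LBINT r:{0..t}. R r)))"

definition survival_prob :: "(real \<Rightarrow> real) \<Rightarrow> agent_class \<Rightarrow> nat \<Rightarrow> real \<Rightarrow> real" where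
  "survival_prob R a \<theta> t =
     (if \<theta> = 0 then 1 - initial_ruin_prob a
      else \<P>((e, l, u) in
               shock_law a \<Otimes>\<^sub>M (\<Pi>\<^sub>M i\<in>{1..d_in a}. loss_law a) \<Otimes>\<^sub>M (\<Pi>\<^sub>M i\<in>{1..\<theta>}. arrival_law R t).
             threshold_time a 0 e l = 0 \<and>
             (\<forall>j\<in>{1..\<theta>}. threshold_time a j e l < ereal (order_stat \<theta> u j))))"

definition f_S ::
  "(real \<Rightarrow> real) \<Rightarrow> real \<Rightarrow> ('x \<Rightarrow> agent_class) \<Rightarrow> 'x set \<Rightarrow> ('x \<Rightarrow> real) \<Rightarrow> real \<Rightarrow> real" where
  "f_S R lam par X \<mu> t =
     (\<Sum>\<^sub>\<infinity>x\<in>X. \<mu> x * (\<Sum>\<theta> = 0..d_in (par x).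
        binom_prob (d_in (par x)) (phi R lam t) \<theta> * survival_prob R (par x) \<theta> t))"

definition f_D ::
  "(real \<Rightarrow> real) \<Rightarrow> real \<Rightarrow> ('x \<Rightarrow> agent_class) \<Rightarrow> 'x set \<Rightarrow> ('x \<Rightarrow> real) \<Rightarrow> real \<Rightarrow> real" where
  "f_D R lam par X \<mu> t = 1 - f_S R lam par X \<mu> t"

definition f_W ::
  "(real \<Rightarrow> real) \<Rightarrow> real \<Rightarrow> ('x \<Rightarrow> agent_class) \<Rightarrow> 'x set \<Rightarrow> ('x \<Rightarrow> real) \<Rightarrow> real \<Rightarrow> real" where
  "f_W R lam par X \<mu> t =
     lam * (1 - phi R lam t)
       - (\<Sum>\<^sub>\<infinity>x\<in>X. \<mu> x * real (d_out (par x)) * (\<Sum>\<theta> = 0..d_in (par x).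
            binom_prob (d_in (par x)) (phi R lam t) \<theta> * survival_prob R (par x) \<theta> t))"


section \<open>Convergence in probability\<close>

text \<open>
  Outer probability, which is the probability for measurable sets, avoids that a non-measurable
  event would silently count as a null event.
\<close>

definition tends_to_zero_in_prob ::
  "(nat \<Rightarrow> 'w measure) \<Rightarrow> (nat \<Rightarrow> 'w \<Rightarrow> ennreal) \<Rightarrow> bool" where
  "tends_to_zero_in_prob M Y \<longleftrightarrow>
     (\<forall>e::real. 0 < e \<longrightarrow>
        (\<lambda>n. outer_measure_of (M n) {\<omega> \<in> space (M n). ennreal e < Y n \<omega>}) \<longlonglongrightarrow> 0)"

definition sup_until :: "ereal \<Rightarrow> (real \<Rightarrow> real) \<Rightarrow> ennreal" where
  "sup_until \<tau> g = (SUP t\<in>{t. 0 \<le> t \<and> ereal t \<le> \<tau>}. ennreal \<bar>g t\<bar>)"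

text \<open>
  \<open>R\<^sub>n(t) = n R(t) + o\<^sub>p(n)\<close> for \<open>t \<le> \<tau>\<^sub>n\<close>, where the error, as a function of \<open>t\<close>, is measured in
  the norm of \<open>L\<^sup>1\<close>. An error that is \<open>o\<^sub>p(n)\<close> only for each \<open>t\<close>, or uniformly in \<open>t\<close>, does not
  control the number of reveals \<open>\<integral>R\<^sub>n\<close> over long time intervals.
\<close>

definition intensity_asymp ::
  "('x \<Rightarrow> agent_class) \<Rightarrow> (nat \<Rightarrow> nat \<Rightarrow> 'x) \<Rightarrow> (nat \<Rightarrow> 'w reveal_data) \<Rightarrow> (real \<Rightarrow> real) \<Rightarrow> bool" where
  "intensity_asymp par ty p R \<longleftrightarrow>
     tends_to_zero_in_prob (\<lambda>n. prb (p n))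
       (\<lambda>n \<omega>. \<integral>\<^sup>+t\<in>{t. 0 \<le> t \<and> ereal t \<le> stop_time par n (ty n) (p n) \<omega>}.
                 ennreal \<bar>intensity par n (ty n) (p n) t \<omega> / real n - R t\<bar> \<partial>lborel)"

end

theory Submission
  imports Defs
begin

text \<open>
  Write \<open>Lam t\<close> for the integral of the limiting intensity \<open>R\<close> up to time \<open>t\<close> and \<open>num\<close> for the
  number of reveals. The order in which half-edges are matched does not depend on when they are
  matched: whatever the non-anticipating rates and choices of ruinous half-edges are, the owners of
  the successive incoming half-edges are drawn without replacement and bring independent losses.
  The proof separates this randomness, indexed by the number of reveals, from the clock.

  \<^emph>\<open>The clock.\<close> The intensity accumulated between two reveals is a standard exponential variable
  given the past, so the integrated intensity minus the number of reveals is a martingale with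
  variance at most the number of half-edges (\<open>deviation_second_moment\<close>). It is \<open>o(n)\<close> uniformly
  (\<open>max_deviation_tail\<close>), and since the intensity divided by \<open>n\<close> is close to \<open>R\<close> in mean, \<open>num / n\<close>
  is uniformly close to \<open>Lam\<close> until the process stops (\<open>num_close\<close>, \<open>reveals_close\<close>).

  \<^emph>\<open>The matching.\<close> The joint law of the positions, shocks and losses of one or two agents during the
  first \<open>K\<close> reveals is explicit (\<open>single_agent_law\<close>, \<open>two_agents_law\<close>). Two agents are almost
  uncorrelated, so by Chebyshev's inequality the fraction of agents whose positions and losses
  satisfy a given condition concentrates around its mean (\<open>hit_count_lln\<close>).

  \<^emph>\<open>Solvency.\<close> Whether an agent is solvent depends on the random reveal times. But if \<open>num / n\<close> is
  within \<open>\<eta> / 2\<close> of \<open>Lam\<close>, then the reveal number \<open>k\<close> happens at a time where \<open>Lam\<close> is close to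
  \<open>k / n\<close>, so solvency is bracketed by two conditions that mention only positions and losses
  (\<open>solvency_sandwich\<close>). The law of large numbers applies to both of them.

  \<^emph>\<open>The limit.\<close> The \<open>\<theta>\<close> positions of an agent are uniform, and \<open>Lam\<close> transforms uniform positions
  into independent arrival times with density proportional to \<open>R\<close>. The means of the two brackets
  therefore converge to probabilities of conditions on order statistics, and these differ little
  for small \<open>\<eta>\<close>, because the shock has a density (\<open>gap_tendsto_0\<close>, \<open>brackets_converge\<close>).

  A finite grid of times makes the convergence uniform in time (\<open>solvent_type_converges\<close>), and a
  truncation to finitely many types gives the totals (\<open>weighted_solvent_converges\<close>). Until the
  process stops each reveal uses up a half-edge of a ruined agent, so the number of ruinous
  half-edges is a weighted number of ruined agents minus the number of reveals.
\<close>

section \<open>Events of high probability\<close>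

text \<open>
  Outer measure, because these events are statements about all times up to a random time, which
  may fail to be measurable.
\<close>

definition whp :: "(nat \<Rightarrow> 'w measure) \<Rightarrow> (nat \<Rightarrow> 'w \<Rightarrow> bool) \<Rightarrow> bool" where
 "whp M P \<longleftrightarrow> (\<lambda>n. outer_measure_of (M n) {\<omega> \<in> space (M n). \<not> P n \<omega>}) \<longlonglongrightarrow> 0"

lemma outer_measure_of_Un_le:
 assumes "A \<subseteq> space M" "B \<subseteq> space M"
 shows "outer_measure_of M (A \<union> B) \<le> outer_measure_of M A + outer_measure_of M B"
proof -
 obtain E where E: "E \<in> sets M" "A \<subseteq> E" "outer_measure_of M A = emeasure M E"
  using outer_measure_of_attain[OF assms(1)] by auto
 obtain F where F: "F \<in> sets M" "B \<subseteq> F" "outer_measure_of M B = emeasure M F"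
  using outer_measure_of_attain[OF assms(2)] by auto
 have "outer_measure_of M (A \<union> B) \<le> outer_measure_of M (E \<union> F)"
  using E F by (intro outer_measure_of_mono) auto
 also have "\<dots> = emeasure M (E \<union> F)" using E F by simp
 also have "\<dots> \<le> emeasure M E + emeasure M F" using E F by (intro emeasure_subadditive) auto
 finally show ?thesis using E F by simp
qed

lemma whp_mono:
 assumes "whp M P"
  and "eventually (\<lambda>n. \<forall>\<omega>\<in>space (M n). P n \<omega> \<longrightarrow> Q n \<omega>) sequentially"
 shows "whp M Q"
 unfolding whp_def
proof (rule tendsto_sandwich[OF _ _ tendsto_const assms(1)[unfolded whp_def]])
 show "\<forall>\<^sub>F n in sequentially. outer_measure_of (M n) {\<omega> \<in> space (M n). \<not> Q n \<omega>}
     \<le> outer_measure_of (M n) {\<omega> \<in> space (M n). \<not> P n \<omega>}"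
  using assms(2) by eventually_elim (intro outer_measure_of_mono, auto)
qed auto

lemma whp_mono':
 assumes "whp M P" "\<And>n \<omega>. 1 \<le> n \<Longrightarrow> \<omega> \<in> space (M n) \<Longrightarrow> P n \<omega> \<Longrightarrow> Q n \<omega>"
 shows "whp M Q"
 by (rule whp_mono[OF assms(1)], rule eventually_sequentiallyI[of 1]) (use assms(2) in auto)

lemma whp_conj:
 assumes "whp M P" "whp M Q"
 shows "whp M (\<lambda>n \<omega>. P n \<omega> \<and> Q n \<omega>)"
 unfolding whp_def
proof (rule tendsto_sandwich[OF _ _ tendsto_const])
 show "(\<lambda>n. outer_measure_of (M n) {\<omega> \<in> space (M n). \<not> P n \<omega>}
      + outer_measure_of (M n) {\<omega> \<in> space (M n). \<not> Q n \<omega>}) \<longlonglongrightarrow> 0"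
  using tendsto_add[OF assms[unfolded whp_def]] by simp
 show "\<forall>\<^sub>F n in sequentially. outer_measure_of (M n) {\<omega> \<in> space (M n). \<not> (P n \<omega> \<and> Q n \<omega>)}
   \<le> outer_measure_of (M n) {\<omega> \<in> space (M n). \<not> P n \<omega>}
      + outer_measure_of (M n) {\<omega> \<in> space (M n). \<not> Q n \<omega>}"
 proof (intro always_eventually allI)
  fix n
  have "{\<omega> \<in> space (M n). \<not> (P n \<omega> \<and> Q n \<omega>)}
   = {\<omega> \<in> space (M n). \<not> P n \<omega>} \<union> {\<omega> \<in> space (M n). \<not> Q n \<omega>}" by auto
  then show "outer_measure_of (M n) {\<omega> \<in> space (M n). \<not> (P n \<omega> \<and> Q n \<omega>)}
   \<le> outer_measure_of (M n) {\<omega> \<in> space (M n). \<not> P n \<omega>}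
      + outer_measure_of (M n) {\<omega> \<in> space (M n). \<not> Q n \<omega>}"
   by (metis (no_types, lifting) outer_measure_of_Un_le mem_Collect_eq subsetI)
 qed
qed auto

lemma whp_AE:
 assumes "\<And>n. 1 \<le> n \<Longrightarrow> AE \<omega> in M n. P n \<omega>"
 shows "whp M P"
 unfolding whp_def
proof (rule tendsto_eventually, rule eventually_sequentiallyI[of 1])
 fix n :: nat assume "1 \<le> n"
 from AE_E[OF assms[OF this]] obtain N where
  N: "{\<omega> \<in> space (M n). \<not> P n \<omega>} \<subseteq> N" "emeasure (M n) N = 0" "N \<in> sets (M n)" by blast
 then have "outer_measure_of (M n) {\<omega> \<in> space (M n). \<not> P n \<omega>} \<le> 0"
  using outer_measure_of_mono[OF N(1), of "M n"] by simp
 then show "outer_measure_of (M n) {\<omega> \<in> space (M n). \<not> P n \<omega>} = 0" by simp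
qed

lemma whp_ball:
 assumes "finite I" "\<And>i. i \<in> I \<Longrightarrow> whp M (P i)"
 shows "whp M (\<lambda>n \<omega>. \<forall>i\<in>I. P i n \<omega>)"
 using assms
proof (induction I rule: finite_induct)
 case empty
 show ?case by (rule whp_AE) auto
next
 case (insert i I)
 have "whp M (\<lambda>n \<omega>. P i n \<omega> \<and> (\<forall>i\<in>I. P i n \<omega>))"
  by (rule whp_conj) (use insert in auto)
 then show ?case by (simp add: whp_def)
qed

lemma whp_prob:
 assumes "\<And>n. 1 \<le> n \<Longrightarrow> prob_space (M n)"
  and "\<And>n. 1 \<le> n \<Longrightarrow> {\<omega> \<in> space (M n). \<not> P n \<omega>} \<in> sets (M n)"
  and "eventually (\<lambda>n. measure (M n) {\<omega> \<in> space (M n). \<not> P n \<omega>} \<le> b n) sequentially"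
  and "b \<longlonglongrightarrow> 0"
 shows "whp M P"
 unfolding whp_def
proof (rule tendsto_sandwich[OF _ _ tendsto_const])
 show "(\<lambda>n. ennreal (b n)) \<longlonglongrightarrow> 0"
  using tendsto_ennrealI[OF assms(4)] by simp
 show "\<forall>\<^sub>F n in sequentially. outer_measure_of (M n) {\<omega> \<in> space (M n). \<not> P n \<omega>} \<le> ennreal (b n)"
  using assms(3) eventually_ge_at_top[of 1]
 proof eventually_elim
  case (elim n)
  interpret prob_space "M n" by (rule assms) fact
  show ?case using assms(2)[OF elim(2)] elim(1) by (simp add: emeasure_eq_measure ennreal_leI)
 qed
qed auto

lemma tends_to_zero_in_prob_iff_whp:
 "tends_to_zero_in_prob M Y \<longleftrightarrow> (\<forall>e::real. 0 < e \<longrightarrow> whp M (\<lambda>n \<omega>. Y n \<omega> \<le> ennreal e))"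
 by (simp add: tends_to_zero_in_prob_def whp_def not_le)

lemma tends_to_zero_sup_untilI:
 assumes "\<And>e::real. 0 < e \<Longrightarrow> whp M (\<lambda>n \<omega>. \<forall>t. 0 \<le> t \<longrightarrow> ereal t \<le> \<tau> n \<omega> \<longrightarrow> \<bar>g n t \<omega>\<bar> \<le> e)"
 shows "tends_to_zero_in_prob M (\<lambda>n \<omega>. sup_until (\<tau> n \<omega>) (\<lambda>t. g n t \<omega>))"
 unfolding tends_to_zero_in_prob_iff_whp
proof (intro allI impI)
 fix e :: real assume "0 < e"
 show "whp M (\<lambda>n \<omega>. sup_until (\<tau> n \<omega>) (\<lambda>t. g n t \<omega>) \<le> ennreal e)"
  by (rule whp_mono'[OF assms[OF \<open>0 < e\<close>]])
   (auto simp: sup_until_def intro!: SUP_least ennreal_leI)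
qed

section \<open>The law of one reveal step\<close>

locale network =
 fixes par :: "'x \<Rightarrow> agent_class" and n :: nat and ty :: "nat \<Rightarrow> 'x" and p :: "'w reveal_data"
 assumes process: "loss_reveal_process par n ty p"
  and valid: "\<And>i. i \<in> {1..n} \<Longrightarrow> valid_class (par (ty i))"
begin

abbreviation "M \<equiv> prb p"
abbreviation "H \<equiv> in_edges par n ty"
abbreviation "m \<equiv> card (in_edges par n ty)"
abbreviation "earlier k \<omega> \<equiv> (\<lambda>j. in_edge p j \<omega>) ` {1..k}"
abbreviation "llaw i \<equiv> loss_law (par (ty i))"
abbreviation "slaw i \<equiv> shock_law (par (ty i))"

lemma
 shows prob_space_M: "prob_space M"
  and filt: "filtration (space M) (hist p)"
  and subalg_hist: "subalgebra M (hist p k)"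
  and shock_hist: "i \<in> {1..n} \<Longrightarrow> shock p i \<in> borel_measurable (hist p 0)"
  and shock_distr: "i \<in> {1..n} \<Longrightarrow> distr M borel (shock p i) = slaw i"
  and shock_indep: "prob_space.indep_vars M (\<lambda>_. borel) (shock p) {1..n}"
  and rate_hist: "k \<le> m \<Longrightarrow> rate p k \<in> borel_measurable (hist p k)"
  and rate_nonneg: "k \<le> m \<Longrightarrow> \<omega> \<in> space M \<Longrightarrow> 0 \<le> rate p k \<omega>"
  and rate_zero: "k \<le> m \<Longrightarrow> AE \<omega> in M. reveal_time p k \<omega> < \<infinity> \<longrightarrow>
       num_ruinous par n ty p (real_of_ereal (reveal_time p k \<omega>)) \<omega> = 0 \<longrightarrow> rate p k \<omega> = 0"
  and in_hist: "k < m \<Longrightarrow> in_edge p (Suc k) \<in> measurable (hist p (Suc k)) (count_space UNIV)"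
  and loss_hist: "k < m \<Longrightarrow> loss p (Suc k) \<in> borel_measurable (hist p (Suc k))"
  and wait_hist: "k < m \<Longrightarrow> wait p (Suc k) \<in> borel_measurable (hist p (Suc k))"
  and wait_nonneg: "k < m \<Longrightarrow> \<omega> \<in> space M \<Longrightarrow> 0 \<le> wait p (Suc k) \<omega>"
  and out_new: "k < m \<Longrightarrow> AE \<omega> in M. out_edge p (Suc k) \<omega> \<in>
       out_edges par n ty - (\<lambda>j. out_edge p j \<omega>) ` {1..k}"
  and out_ruinous: "k < m \<Longrightarrow> AE \<omega> in M. reveal_time p k \<omega> < \<infinity> \<longrightarrow>
       num_ruinous par n ty p (real_of_ereal (reveal_time p k \<omega>)) \<omega> \<noteq> 0 \<longrightarrow>
       out_edge p (Suc k) \<omega> \<in>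
        ruinous par n ty p (real_of_ereal (reveal_time p k \<omega>)) \<omega>"
  and step_law: "k < m \<Longrightarrow> h \<in> H \<Longrightarrow> 0 \<le> s \<Longrightarrow> AE \<omega> in M.
       real_cond_exp M (hist p k)
        (indicator {\<omega> \<in> space M. in_edge p (Suc k) \<omega> = h \<and> loss p (Suc k) \<omega> \<le> y \<and>
                     ereal s < wait p (Suc k) \<omega>}) \<omega>
       = (if h \<in> earlier k \<omega> then 0 else 1 / real (m - k))
        * cdf (llaw (fst h)) y
        * exp (- rate p k \<omega> * s)"
proof -
 note L = process[unfolded loss_reveal_process_def Let_def]
 note L1 = L[THEN conjunct2] note L2 = L1[THEN conjunct2] note L3 = L2[THEN conjunct2]
 note L4 = L3[THEN conjunct2] note L5 = L4[THEN conjunct2]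
 show "prob_space M" by (rule L[THEN conjunct1])
 show "filtration (space M) (hist p)" by (rule L1[THEN conjunct1])
 show "subalgebra M (hist p k)" by (rule L2[THEN conjunct1, THEN spec])
 note S = L3[THEN conjunct1, THEN bspec]
 show "i \<in> {1..n} \<Longrightarrow> shock p i \<in> borel_measurable (hist p 0)"
  and "i \<in> {1..n} \<Longrightarrow> distr M borel (shock p i) = slaw i"
  using S by auto
 show "prob_space.indep_vars M (\<lambda>_. borel) (shock p) {1..n}" by (rule L4[THEN conjunct1])
 note R = L5[THEN conjunct1, THEN spec, THEN mp]
 show "k \<le> m \<Longrightarrow> rate p k \<in> borel_measurable (hist p k)"
  and "k \<le> m \<Longrightarrow> \<omega> \<in> space M \<Longrightarrow> 0 \<le> rate p k \<omega>"
  and "k \<le> m \<Longrightarrow> AE \<omega> in M. reveal_time p k \<omega> < \<infinity> \<longrightarrow>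
       num_ruinous par n ty p (real_of_ereal (reveal_time p k \<omega>)) \<omega> = 0 \<longrightarrow> rate p k \<omega> = 0"
  using R[of k] by simp_all
 assume "k < m"
 note K = L5[THEN conjunct2, THEN spec, THEN mp, OF this]
 note K1 = K[THEN conjunct2] note K2 = K1[THEN conjunct2] note K3 = K2[THEN conjunct2]
 note K4 = K3[THEN conjunct2] note K5 = K4[THEN conjunct2] note K6 = K5[THEN conjunct2]
 show "in_edge p (Suc k) \<in> measurable (hist p (Suc k)) (count_space UNIV)" by (rule K1[THEN conjunct1])
 show "loss p (Suc k) \<in> borel_measurable (hist p (Suc k))" by (rule K2[THEN conjunct1])
 show "wait p (Suc k) \<in> borel_measurable (hist p (Suc k))" by (rule K3[THEN conjunct1])
 show "\<omega> \<in> space M \<Longrightarrow> 0 \<le> wait p (Suc k) \<omega>" by (rule K4[THEN conjunct1, THEN bspec])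
 show "AE \<omega> in M. out_edge p (Suc k) \<omega> \<in>
       out_edges par n ty - (\<lambda>j. out_edge p j \<omega>) ` {1..k}" by (rule K5[THEN conjunct1])
 show "AE \<omega> in M. reveal_time p k \<omega> < \<infinity> \<longrightarrow>
       num_ruinous par n ty p (real_of_ereal (reveal_time p k \<omega>)) \<omega> \<noteq> 0 \<longrightarrow>
       out_edge p (Suc k) \<omega> \<in>
        ruinous par n ty p (real_of_ereal (reveal_time p k \<omega>)) \<omega>" by (rule K6[THEN conjunct1])
 show "h \<in> H \<Longrightarrow> 0 \<le> s \<Longrightarrow> AE \<omega> in M.
       real_cond_exp M (hist p k)
        (indicator {\<omega> \<in> space M. in_edge p (Suc k) \<omega> = h \<and> loss p (Suc k) \<omega> \<le> y \<and>
                     ereal s < wait p (Suc k) \<omega>}) \<omega>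
       = (if h \<in> earlier k \<omega> then 0 else 1 / real (m - k))
        * cdf (llaw (fst h)) y
        * exp (- rate p k \<omega> * s)"
  by (rule K6[THEN conjunct2, THEN bspec, THEN spec, THEN spec, THEN mp])
qed

sublocale prob_space M by (rule prob_space_M)

lemma space_hist [simp]: "space (hist p k) = space M"
 using subalg_hist[of k] by (simp add: subalgebra_def)

lemma hist_mono: "i \<le> j \<Longrightarrow> A \<in> sets (hist p i) \<Longrightarrow> A \<in> sets (hist p j)"
 using filtration.sets_F_mono[OF filt, of i j] by blast

lemma hist_M: "A \<in> sets (hist p k) \<Longrightarrow> A \<in> sets M"
 using subalg_hist[of k] by (auto simp: subalgebra_def)

lemma measurable_hist_mono: "i \<le> j \<Longrightarrow> f \<in> measurable (hist p i) N \<Longrightarrow> f \<in> measurable (hist p j) N"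
 using filtration.sets_F_mono[OF filt, of i j] by (auto simp: measurable_def)

lemma measurable_hist_M: "f \<in> measurable (hist p i) N \<Longrightarrow> f \<in> measurable M N"
 by (rule measurable_from_subalg[OF subalg_hist])

lemma in_hist': "k \<in> {1..m} \<Longrightarrow> k \<le> j \<Longrightarrow> in_edge p k \<in> measurable (hist p j) (count_space UNIV)"
 using in_hist[of "k - 1"] measurable_hist_mono[of k j] by (cases k) auto

lemma loss_hist': "k \<in> {1..m} \<Longrightarrow> k \<le> j \<Longrightarrow> loss p k \<in> borel_measurable (hist p j)"
 using loss_hist[of "k - 1"] measurable_hist_mono[of k j] by (cases k) auto

lemma wait_hist': "k \<in> {1..m} \<Longrightarrow> k \<le> j \<Longrightarrow> wait p k \<in> borel_measurable (hist p j)"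
 using wait_hist[of "k - 1"] measurable_hist_mono[of k j] by (cases k) auto

lemma in_M: "k \<in> {1..m} \<Longrightarrow> in_edge p k \<in> measurable M (count_space UNIV)"
 and loss_M: "k \<in> {1..m} \<Longrightarrow> loss p k \<in> borel_measurable M"
 and wait_M: "k \<in> {1..m} \<Longrightarrow> wait p k \<in> borel_measurable M"
 using in_hist'[of k k] loss_hist'[of k k] wait_hist'[of k k] measurable_hist_M[of _ k] by auto

lemma shock_M: "i \<in> {1..n} \<Longrightarrow> shock p i \<in> borel_measurable M"
 using shock_hist measurable_hist_M by blast

lemma rate_M: "k \<le> m \<Longrightarrow> rate p k \<in> borel_measurable M"
 using rate_hist measurable_hist_M by blast

lemma finite_H: "finite H"
 by (simp add: in_edges_def)

lemma fst_H: "h \<in> H \<Longrightarrow> fst h \<in> {1..n}"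
 by (auto simp: in_edges_def)

lemma real_distribution_llaw: "i \<in> {1..n} \<Longrightarrow> real_distribution (llaw i)"
 using valid[of i] unfolding valid_class_def real_distribution_def real_distribution_axioms_def
 by (auto simp: loss_law_def)

lemma earlier_hist:
 assumes "k \<le> m" shows "{\<omega> \<in> space M. h \<in> earlier k \<omega>} \<in> sets (hist p k)"
proof -
 have "in_edge p j -` {h} \<inter> space (hist p k) \<in> sets (hist p k)" if "j \<in> {1..k}" for j
  using that assms by (intro measurable_sets[OF in_hist']) auto
 then have "(\<Union>j\<in>{1..k}. in_edge p j -` {h} \<inter> space (hist p k)) \<in> sets (hist p k)"
  by (intro sets.finite_UN) auto
 also have "(\<Union>j\<in>{1..k}. in_edge p j -` {h} \<inter> space (hist p k))
  = {\<omega> \<in> space M. h \<in> earlier k \<omega>}"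
  unfolding image_def space_hist by blast
 finally show ?thesis .
qed

text \<open>Everything about the conditional law of a step is used in this integrated form.\<close>

lemma step_measure:
 assumes k: "k < m" and h: "h \<in> H" and s: "0 \<le> s" and A: "A \<in> sets (hist p k)"
 shows "measure M (A \<inter> {\<omega> \<in> space M. in_edge p (Suc k) \<omega> = h \<and> loss p (Suc k) \<omega> \<le> y \<and>
           ereal s < wait p (Suc k) \<omega>})
  = cdf (llaw (fst h)) y / real (m - k) *
    (LINT \<omega>|M. indicator (A \<inter> {\<omega> \<in> space M. h \<notin> earlier k \<omega>}) \<omega> * exp (- rate p k \<omega> * s))"
proof -
 interpret sigma_finite_subalgebra M "hist p k"
  by (intro finite_measure_subalgebra_is_sigma_finite finite_measure_subalgebra.intro
    finite_measure_subalgebra_axioms.intro subalg_hist) (simp add: finite_measure_axioms)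
 define E where "E = {\<omega> \<in> space M. in_edge p (Suc k) \<omega> = h \<and> loss p (Suc k) \<omega> \<le> y \<and>
           ereal s < wait p (Suc k) \<omega>}"
 define B where "B = A \<inter> {\<omega> \<in> space M. h \<notin> earlier k \<omega>}"
 define c where "c = cdf (llaw (fst h)) y / real (m - k)"
 define e where "e \<omega> = exp (- rate p k \<omega> * s)" for \<omega>
 have [measurable]: "in_edge p (Suc k) \<in> measurable M (count_space UNIV)"
  "loss p (Suc k) \<in> borel_measurable M" "wait p (Suc k) \<in> borel_measurable M"
  using in_M[of "Suc k"] loss_M[of "Suc k"] wait_M[of "Suc k"] k by auto
 have E: "E \<in> sets M" unfolding E_def by measurable
 have AM: "A \<in> sets M" using A hist_M by blast
 have "{\<omega> \<in> space M. h \<in> earlier k \<omega>} \<in> sets M"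
  by (rule hist_M[OF earlier_hist]) (use k in simp)
 then have "space M - {\<omega> \<in> space M. h \<in> earlier k \<omega>} \<in> sets M" by (rule sets.compl_sets)
 also have "space M - {\<omega> \<in> space M. h \<in> earlier k \<omega>} = {\<omega> \<in> space M. h \<notin> earlier k \<omega>}" by blast
 finally have BM: "B \<in> sets M" unfolding B_def by (rule sets.Int[OF AM])
 have eM: "e \<in> borel_measurable M" using rate_M[of k] k unfolding e_def by auto
 have "measure M (A \<inter> E) = (LINT \<omega>:A|M. indicator E \<omega>)"
  unfolding set_lebesgue_integral_def using AM E
  by (simp flip: indicator_inter_arith)
 also have "\<dots> = (LINT \<omega>:A|M. real_cond_exp M (hist p k) (indicator E) \<omega>)"
  by (rule real_cond_exp_intA[OF integrable_real_indicator[OF E] A]) (simp add: less_top[symmetric])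
 also have "\<dots> = (LINT \<omega>|M. c * (indicator B \<omega> * e \<omega>))"
  unfolding set_lebesgue_integral_def
 proof (rule integral_cong_AE)
  show "(\<lambda>\<omega>. c * (indicator B \<omega> * e \<omega>)) \<in> borel_measurable M"
   using BM eM by measurable
  show "AE \<omega> in M. indicator A \<omega> *\<^sub>R real_cond_exp M (hist p k) (indicator E) \<omega>
      = c * (indicator B \<omega> * e \<omega>)"
   using step_law[OF k h s, of y, folded E_def] AE_space
  proof eventually_elim
   case (elim \<omega>)
   have "indicator B \<omega> = indicator A \<omega> * (if h \<in> earlier k \<omega> then 0 else 1 :: real)"
    using elim(2) unfolding indicator_def B_def by simp
   then show ?case unfolding elim(1) c_def e_def by (cases "h \<in> earlier k \<omega>") simp_all
  qed
  show "(\<lambda>\<omega>. indicator A \<omega> *\<^sub>R real_cond_exp M (hist p k) (indicator E) \<omega>) \<in> borel_measurable M"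
   by (rule borel_measurable_scaleR[OF borel_measurable_indicator[OF AM] borel_measurable_cond_exp2])
 qed
 also have "\<dots> = c * (LINT \<omega>|M. indicator B \<omega> * e \<omega>)"
  by (rule integral_mult_right_zero)
 finally show ?thesis unfolding E_def B_def c_def e_def .
qed

lemma step_set_M:
 assumes "k < m"
 shows "{\<omega> \<in> space M. in_edge p (Suc k) \<omega> = h \<and> ereal s < wait p (Suc k) \<omega>} \<in> sets M"
  and "B \<in> sets borel \<Longrightarrow> {\<omega> \<in> space M. in_edge p (Suc k) \<omega> = h \<and> loss p (Suc k) \<omega> \<in> B} \<in> sets M"
  and "{\<omega> \<in> space M. in_edge p (Suc k) \<omega> = h} \<in> sets M"
  and "{\<omega> \<in> space M. ereal s < wait p (Suc k) \<omega>} \<in> sets M"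
proof -
 have [measurable]: "in_edge p (Suc k) \<in> measurable M (count_space UNIV)"
  "loss p (Suc k) \<in> borel_measurable M" "wait p (Suc k) \<in> borel_measurable M"
  using in_M[of "Suc k"] loss_M[of "Suc k"] wait_M[of "Suc k"] assms by auto
 show "{\<omega> \<in> space M. in_edge p (Suc k) \<omega> = h \<and> ereal s < wait p (Suc k) \<omega>} \<in> sets M" by measurable
 show "{\<omega> \<in> space M. in_edge p (Suc k) \<omega> = h \<and> loss p (Suc k) \<omega> \<in> B} \<in> sets M" if [measurable]: "B \<in> sets borel"
  by measurable
 show "{\<omega> \<in> space M. in_edge p (Suc k) \<omega> = h} \<in> sets M" by measurable
 show "{\<omega> \<in> space M. ereal s < wait p (Suc k) \<omega>} \<in> sets M" by measurable
qed

lemma not_earlier_hist: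
 assumes "k \<le> m" shows "{\<omega> \<in> space M. h \<notin> earlier k \<omega>} \<in> sets (hist p k)"
proof -
 have "space (hist p k) - {\<omega> \<in> space M. h \<in> earlier k \<omega>} \<in> sets (hist p k)"
  by (rule sets.compl_sets[OF earlier_hist[OF assms]])
 also have "space (hist p k) - {\<omega> \<in> space M. h \<in> earlier k \<omega>} = {\<omega> \<in> space M. h \<notin> earlier k \<omega>}"
  unfolding space_hist by blast
 finally show ?thesis .
qed

text \<open>
  Letting the bound on the loss tend to infinity removes the loss from the step law.
\<close>

lemma step_measure_edge:
 assumes k: "k < m" and h: "h \<in> H" and s: "0 \<le> s" and A: "A \<in> sets (hist p k)"
 shows "measure M (A \<inter> {\<omega> \<in> space M. in_edge p (Suc k) \<omega> = h \<and> ereal s < wait p (Suc k) \<omega>})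
  = (LINT \<omega>|M. indicator (A \<inter> {\<omega> \<in> space M. h \<notin> earlier k \<omega>}) \<omega> * exp (- rate p k \<omega> * s))
   / real (m - k)"
proof -
 interpret L: real_distribution "llaw (fst h)" by (rule real_distribution_llaw[OF fst_H[OF h]])
 define E where "E y = A \<inter> {\<omega> \<in> space M. in_edge p (Suc k) \<omega> = h \<and> loss p (Suc k) \<omega> \<le> y \<and>
           ereal s < wait p (Suc k) \<omega>}" for y
 define I where "I = (LINT \<omega>|M. indicator (A \<inter> {\<omega> \<in> space M. h \<notin> earlier k \<omega>}) \<omega> * exp (- rate p k \<omega> * s))"
 have AM: "A \<in> sets M" by (rule hist_M[OF A])
 have [measurable]: "in_edge p (Suc k) \<in> measurable M (count_space UNIV)"
  "loss p (Suc k) \<in> borel_measurable M" "wait p (Suc k) \<in> borel_measurable M"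
  using in_M[of "Suc k"] loss_M[of "Suc k"] wait_M[of "Suc k"] k by auto
 have EM: "E y \<in> sets M" for y
  unfolding E_def by (rule sets.Int[OF AM]) measurable
 have eq: "measure M (E y) = cdf (llaw (fst h)) y / real (m - k) * I" for y
  unfolding E_def I_def by (rule step_measure[OF k h s A])
 have inc: "incseq (\<lambda>i::nat. E (real i))"
  unfolding E_def incseq_def by fastforce
 have "(\<lambda>i::nat. measure M (E (real i))) \<longlonglongrightarrow> measure M (\<Union>i::nat. E (real i))"
  by (rule finite_Lim_measure_incseq[OF _ inc]) (use EM in auto)
 moreover have "(\<lambda>i::nat. cdf (llaw (fst h)) (real i) / real (m - k) * I) \<longlonglongrightarrow> 1 / real (m - k) * I"
  by (intro tendsto_intros filterlim_compose[OF L.cdf_lim_at_top_prob] filterlim_real_sequentially)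
   (use k in auto)
 ultimately have "measure M (\<Union>i::nat. E (real i)) = 1 / real (m - k) * I"
  unfolding eq by (rule LIMSEQ_unique)
 moreover have "(\<Union>i::nat. E (real i))
  = A \<inter> {\<omega> \<in> space M. in_edge p (Suc k) \<omega> = h \<and> ereal s < wait p (Suc k) \<omega>}"
  unfolding E_def using real_arch_simple by blast
 ultimately show ?thesis by (simp add: I_def)
qed

lemma card_diff_earlier_ge: "m - k \<le> card (H - earlier k \<omega>)"
proof -
 have "card (earlier k \<omega>) \<le> card {1..k}" by (rule card_image_le) simp
 moreover have "m - card (earlier k \<omega>) \<le> card (H - earlier k \<omega>)"
  by (rule diff_card_le_card_Diff) simp
 ultimately show ?thesis by simp
qed

text \<open>
  The masses of the steps with a fresh half-edge and a positive waiting time already add up to 1,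
  because at least \<open>m - k\<close> half-edges are fresh.
\<close>

lemma step_fresh:
 assumes k: "k < m"
 shows "AE \<omega> in M. in_edge p (Suc k) \<omega> \<in> H - earlier k \<omega> \<and> 0 < wait p (Suc k) \<omega>"
proof -
 define G where "G h = {\<omega> \<in> space M. in_edge p (Suc k) \<omega> = h \<and> 0 < wait p (Suc k) \<omega>}" for h
 define F where "F h = {\<omega> \<in> space M. h \<notin> earlier k \<omega>}" for h
 have GM: "G h \<in> sets M" for h
  using step_set_M(1)[OF k, of h 0] unfolding G_def by (simp add: zero_ereal_def)
 have FM: "F h \<in> sets M" for h
  unfolding F_def by (rule hist_M[OF not_earlier_hist]) (use k in simp)
 have G: "measure M (A \<inter> G h) = measure M (A \<inter> F h) / real (m - k)"
  if "h \<in> H" "A \<in> sets (hist p k)" for h A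
 proof -
  have "A \<inter> F h \<in> sets M" using FM hist_M[OF that(2)] by blast
  then show ?thesis
   using step_measure_edge[OF k that(1) order_refl that(2)] unfolding G_def F_def
   by (simp add: zero_ereal_def sets.Int_space_eq2)
 qed
 \<comment> \<open>The expected number of fresh half-edges.\<close>
 have "real (m - k) \<le> (\<Sum>h\<in>H. measure M (F h))"
 proof -
  have "real (m - k) = (LINT \<omega>|M. real (m - k))" by (simp add: prob_space)
  also have "\<dots> \<le> (LINT \<omega>|M. (\<Sum>h\<in>H. indicator (F h) \<omega>))"
  proof (rule integral_mono)
   fix \<omega> assume w: "\<omega> \<in> space M"
   have "(\<Sum>h\<in>H. indicator (F h) \<omega>) = (\<Sum>h\<in>H. if h \<in> H - earlier k \<omega> then 1 else 0 :: real)"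
    by (rule sum.cong) (use w in \<open>auto simp: F_def\<close>)
   also have "\<dots> = real (card (H - earlier k \<omega>))"
    by (subst sum.inter_restrict[symmetric]) (simp_all add: finite_H Int_absorb1 Diff_subset)
   finally show "real (m - k) \<le> (\<Sum>h\<in>H. indicator (F h) \<omega>)"
    using card_diff_earlier_ge[of k \<omega>] by simp
  next
   show "integrable M (\<lambda>\<omega>. \<Sum>h\<in>H. indicator (F h) \<omega> :: real)"
    using FM by (intro Bochner_Integration.integrable_sum integrable_real_indicator)
     (auto simp: less_top[symmetric])
  qed simp
  also have "\<dots> = (\<Sum>h\<in>H. measure M (F h))"
   using FM sets.sets_into_space by (subst Bochner_Integration.integral_sum)
    (auto simp: less_top[symmetric] Int_absorb2)
  finally show ?thesis .
 qed
 also have "\<dots> = real (m - k) * (\<Sum>h\<in>H. measure M (G h))"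
 proof -
  have "measure M (F h) = real (m - k) * measure M (G h)" if "h \<in> H" for h
  proof -
   have "space M \<in> sets (hist p k)" using sets.top[of "hist p k"] by (simp only: space_hist)
   from G[OF that this] have "measure M (G h) = measure M (F h) / real (m - k)"
    by (simp add: FM GM sets.Int_space_eq1)
   then show ?thesis using k by simp
  qed
  then show ?thesis by (simp add: sum_distrib_left)
 qed
 also have "(\<Sum>h\<in>H. measure M (G h)) = measure M (\<Union>h\<in>H. G h)"
  by (rule finite_measure_finite_Union[symmetric])
   (use GM in \<open>auto simp: finite_H disjoint_family_on_def G_def\<close>)
 finally have "1 \<le> measure M (\<Union>h\<in>H. G h)" using k by simp
 then have "measure M (\<Union>h\<in>H. G h) = 1" using measure_le_1 by (intro antisym) auto
 moreover have "(\<Union>h\<in>H. G h) \<in> sets M" using GM finite_H by blast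
 ultimately have ae1: "AE \<omega> in M. \<omega> \<in> (\<Union>h\<in>H. G h)" using prob_eq_1 by blast
 have "AE \<omega> in M. \<omega> \<notin> {\<omega> \<in> space M. h \<in> earlier k \<omega>} \<inter> G h" if h: "h \<in> H" for h
 proof (rule AE_not_in, rule null_setsI)
  have e: "{\<omega> \<in> space M. h \<in> earlier k \<omega>} \<in> sets (hist p k)" by (rule earlier_hist) (use k in simp)
  show s: "{\<omega> \<in> space M. h \<in> earlier k \<omega>} \<inter> G h \<in> sets M" using hist_M[OF e] GM by blast
  have "{\<omega> \<in> space M. h \<in> earlier k \<omega>} \<inter> F h = {}" unfolding F_def by blast
  then have "measure M ({\<omega> \<in> space M. h \<in> earlier k \<omega>} \<inter> G h) = 0" using G[OF h e] by simp
  then show "emeasure M ({\<omega> \<in> space M. h \<in> earlier k \<omega>} \<inter> G h) = 0" by (simp add: emeasure_eq_measure)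
 qed
 then have "AE \<omega> in M. \<forall>h\<in>H. \<omega> \<notin> {\<omega> \<in> space M. h \<in> earlier k \<omega>} \<inter> G h"
  using finite_H by (intro AE_finite_allI)
 with ae1 show ?thesis
  by eventually_elim (auto simp: G_def)
qed

definition proper_edges :: "'w \<Rightarrow> bool" where
 "proper_edges \<omega> \<longleftrightarrow> inj_on (\<lambda>k. in_edge p k \<omega>) {1..m} \<and> (\<lambda>k. in_edge p k \<omega>) ` {1..m} \<subseteq> H"

lemma AE_proper_edges: "AE \<omega> in M. proper_edges \<omega> \<and> (\<forall>k\<in>{1..m}. 0 < wait p k \<omega>)"
proof -
 have "AE \<omega> in M. \<forall>k\<in>{..<m}. in_edge p (Suc k) \<omega> \<in> H - earlier k \<omega> \<and> 0 < wait p (Suc k) \<omega>"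
  using step_fresh by (intro AE_finite_allI) auto
 then show ?thesis
 proof eventually_elim
  case (elim \<omega>)
  have 1: "in_edge p k \<omega> \<in> H \<and> in_edge p k \<omega> \<notin> earlier (k - 1) \<omega> \<and> 0 < wait p k \<omega>" if "k \<in> {1..m}" for k
   using elim that by (cases k) auto
  have "in_edge p j \<omega> \<noteq> in_edge p k \<omega>" if "k \<in> {1..m}" "j \<in> {1..m}" "j < k" for j k
  proof -
   have "in_edge p j \<omega> \<in> earlier (k - 1) \<omega>" using that by (intro imageI) auto
   then show ?thesis using 1[OF that(1)] by metis
  qed
  then have "inj_on (\<lambda>k. in_edge p k \<omega>) {1..m}"
   unfolding inj_on_def by (metis linorder_less_linear)
  moreover have "(\<lambda>k. in_edge p k \<omega>) ` {1..m} \<subseteq> H" using 1 by (intro image_subsetI) simp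
  ultimately show ?case unfolding proper_edges_def using 1 by simp
 qed
qed

lemma proper_edges_remaining:
 assumes "proper_edges \<omega>" "k \<le> m" shows "card (H - earlier k \<omega>) = m - k"
proof -
 have "earlier k \<omega> \<subseteq> H" using assms unfolding proper_edges_def by fastforce
 moreover have "card (earlier k \<omega>) = k"
  using assms unfolding proper_edges_def by (subst card_image) (auto intro: inj_on_subset)
 ultimately show ?thesis by (simp add: card_Diff_subset)
qed

text \<open>
  As functions of \<open>B\<close> both sides are finite measures that agree on half-lines, by the step law
  at \<open>s = 0\<close> since waiting times are almost surely positive.
\<close>

lemma step_loss_law:
 assumes k: "k < m" and h: "h \<in> H" and A: "A \<in> sets (hist p k)" and B: "B \<in> sets borel"
 shows "measure M (A \<inter> {\<omega> \<in> space M. in_edge p (Suc k) \<omega> = h \<and> loss p (Suc k) \<omega> \<in> B})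
  = measure M (A \<inter> {\<omega> \<in> space M. h \<notin> earlier k \<omega>}) / real (m - k) * measure (llaw (fst h)) B"
proof -
 interpret L: real_distribution "llaw (fst h)" by (rule real_distribution_llaw[OF fst_H[OF h]])
 define F where "F = A \<inter> {\<omega> \<in> space M. h \<notin> earlier k \<omega>}"
 define c where "c = measure M F / real (m - k)"
 define G where "G = A \<inter> {\<omega> \<in> space M. in_edge p (Suc k) \<omega> = h}"
 have AM: "A \<in> sets M" by (rule hist_M[OF A])
 have GM: "G \<in> sets M" unfolding G_def by (rule sets.Int[OF AM step_set_M(3)[OF k]])
 have FM: "F \<in> sets M"
  unfolding F_def by (rule sets.Int[OF AM hist_M[OF not_earlier_hist]]) (use k in simp)
 have lM: "loss p (Suc k) \<in> borel_measurable M" using loss_M[of "Suc k"] k by auto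
 define N1 where "N1 = distr (density M (indicator G)) borel (loss p (Suc k))"
 define N2 where "N2 = scale_measure (ennreal c) (llaw (fst h))"
 have eN1: "emeasure N1 C = ennreal (measure M (G \<inter> (loss p (Suc k) -` C \<inter> space M)))" if "C \<in> sets borel" for C
  unfolding N1_def using that lM GM measurable_sets[OF lM that]
  by (simp add: emeasure_distr emeasure_restricted emeasure_eq_measure)
 have c0: "0 \<le> c" unfolding c_def by simp
 have eN2: "emeasure N2 C = ennreal (c * measure (llaw (fst h)) C)" if "C \<in> sets borel" for C
  unfolding N2_def using c0 by (simp add: L.emeasure_eq_measure ennreal_mult)
 have "N1 = N2"
 proof (rule cdf_unique')
  show "finite_borel_measure N1"
   by (intro finite_borel_measure.intro finite_measureI finite_borel_measure_axioms.intro)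
    (use eN1[of UNIV] in \<open>auto simp: N1_def space_distr\<close>)
  show "finite_borel_measure N2"
   by (intro finite_borel_measure.intro finite_measureI finite_borel_measure_axioms.intro)
    (use eN2[of UNIV] in \<open>auto simp: N2_def space_scale_measure\<close>)
  show "cdf N1 = cdf N2"
  proof
   fix y
   have "{\<omega> \<in> space M. 0 \<le> rate p k \<omega>} = space M" using rate_nonneg[of k] k by auto
   have "measure M (G \<inter> (loss p (Suc k) -` {..y} \<inter> space M))
    = measure M (A \<inter> {\<omega> \<in> space M. in_edge p (Suc k) \<omega> = h \<and> loss p (Suc k) \<omega> \<le> y \<and>
           ereal 0 < wait p (Suc k) \<omega>})"
   proof (rule finite_measure_eq_AE)
    show "AE \<omega> in M. (\<omega> \<in> G \<inter> (loss p (Suc k) -` {..y} \<inter> space M)) \<longleftrightarrow>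
     (\<omega> \<in> A \<inter> {\<omega> \<in> space M. in_edge p (Suc k) \<omega> = h \<and> loss p (Suc k) \<omega> \<le> y \<and>
           ereal 0 < wait p (Suc k) \<omega>})"
     using step_fresh[OF k] by eventually_elim (auto simp: G_def zero_ereal_def)
    show "G \<inter> (loss p (Suc k) -` {..y} \<inter> space M) \<in> sets M"
     by (intro sets.Int GM measurable_sets[OF lM]) auto
    have [measurable]: "in_edge p (Suc k) \<in> measurable M (count_space UNIV)"
     "loss p (Suc k) \<in> borel_measurable M" "wait p (Suc k) \<in> borel_measurable M"
     using in_M[of "Suc k"] loss_M[of "Suc k"] wait_M[of "Suc k"] k by auto
    show "A \<inter> {\<omega> \<in> space M. in_edge p (Suc k) \<omega> = h \<and> loss p (Suc k) \<omega> \<le> y \<and>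
           ereal 0 < wait p (Suc k) \<omega>} \<in> sets M"
     by (rule sets.Int[OF AM]) measurable
   qed
   also have "\<dots> = cdf (llaw (fst h)) y / real (m - k) * (LINT \<omega>|M. indicator F \<omega> * exp (- rate p k \<omega> * 0))"
    unfolding F_def by (rule step_measure[OF k h order_refl A])
   also have "\<dots> = c * measure (llaw (fst h)) {..y}"
    using FM by (simp add: c_def cdf_def sets.Int_space_eq2)
   finally have "emeasure N1 {..y} = emeasure N2 {..y}" by (simp add: eN1 eN2)
   then show "cdf N1 y = cdf N2 y" by (simp add: cdf_def measure_def)
  qed
 qed
 then have "ennreal (measure M (G \<inter> (loss p (Suc k) -` B \<inter> space M))) = ennreal (c * measure (llaw (fst h)) B)"
  using eN1[OF B] eN2[OF B] by simp
 then have "measure M (G \<inter> (loss p (Suc k) -` B \<inter> space M)) = c * measure (llaw (fst h)) B"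
  using c0 by simp
 moreover have "G \<inter> (loss p (Suc k) -` B \<inter> space M)
  = A \<inter> {\<omega> \<in> space M. in_edge p (Suc k) \<omega> = h \<and> loss p (Suc k) \<omega> \<in> B}"
  unfolding G_def by blast
 ultimately show ?thesis unfolding c_def F_def by simp
qed

lemma step_wait_law:
 assumes k: "k < m" and s: "0 \<le> s" and A: "A \<in> sets (hist p k)"
 shows "measure M (A \<inter> {\<omega> \<in> space M. ereal s < wait p (Suc k) \<omega>})
  = (LINT \<omega>|M. indicator A \<omega> * exp (- rate p k \<omega> * s))"
proof -
 define G where "G h = A \<inter> {\<omega> \<in> space M. in_edge p (Suc k) \<omega> = h \<and> ereal s < wait p (Suc k) \<omega>}" for h
 define F where "F h = {\<omega> \<in> space M. h \<notin> earlier k \<omega>}" for h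
 define e where "e \<omega> = exp (- rate p k \<omega> * s)" for \<omega>
 have AM: "A \<in> sets M" by (rule hist_M[OF A])
 have GM: "G h \<in> sets M" for h unfolding G_def by (rule sets.Int[OF AM step_set_M(1)[OF k]])
 have FM: "F h \<in> sets M" for h
  unfolding F_def by (rule hist_M[OF not_earlier_hist]) (use k in simp)
 have eM: "e \<in> borel_measurable M" using rate_M[of k] k unfolding e_def by auto
 have e1: "\<bar>e \<omega>\<bar> \<le> 1" if "\<omega> \<in> space M" for \<omega>
  using rate_nonneg[of k \<omega>] k s that by (simp add: e_def)
 have int: "integrable M (\<lambda>\<omega>. indicator (A \<inter> F h) \<omega> * e \<omega>)" for h
 proof (rule integrable_const_bound[of _ 1])
  show "AE \<omega> in M. norm (indicator (A \<inter> F h) \<omega> * e \<omega>) \<le> 1"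
   using e1 by (intro AE_I2) (auto simp: indicator_def)
  show "(\<lambda>\<omega>. indicator (A \<inter> F h) \<omega> * e \<omega>) \<in> borel_measurable M"
   by (intro borel_measurable_times borel_measurable_indicator eM sets.Int AM FM)
 qed
 have "measure M (A \<inter> {\<omega> \<in> space M. ereal s < wait p (Suc k) \<omega>}) = measure M (\<Union>h\<in>H. G h)"
 proof (rule finite_measure_eq_AE)
  show "AE \<omega> in M. (\<omega> \<in> A \<inter> {\<omega> \<in> space M. ereal s < wait p (Suc k) \<omega>}) \<longleftrightarrow> (\<omega> \<in> (\<Union>h\<in>H. G h))"
   using step_fresh[OF k] by eventually_elim (auto simp: G_def)
  show "A \<inter> {\<omega> \<in> space M. ereal s < wait p (Suc k) \<omega>} \<in> sets M"
   by (rule sets.Int[OF AM step_set_M(4)[OF k]])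
  show "(\<Union>h\<in>H. G h) \<in> sets M" using GM finite_H by blast
 qed
 also have "\<dots> = (\<Sum>h\<in>H. measure M (G h))"
  by (rule finite_measure_finite_Union)
   (use GM in \<open>auto simp: finite_H disjoint_family_on_def G_def\<close>)
 also have "\<dots> = (\<Sum>h\<in>H. (LINT \<omega>|M. indicator (A \<inter> F h) \<omega> * e \<omega>) / real (m - k))"
  unfolding G_def F_def e_def by (intro sum.cong refl step_measure_edge[OF k _ s A])
 also have "\<dots> = (LINT \<omega>|M. (\<Sum>h\<in>H. indicator (A \<inter> F h) \<omega> * e \<omega>)) / real (m - k)"
  using int by (simp add: sum_divide_distrib Bochner_Integration.integral_sum)
 also have "(LINT \<omega>|M. (\<Sum>h\<in>H. indicator (A \<inter> F h) \<omega> * e \<omega>)) = (LINT \<omega>|M. real (m - k) * (indicator A \<omega> * e \<omega>))"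
 proof (rule integral_cong_AE)
  show "AE \<omega> in M. (\<Sum>h\<in>H. indicator (A \<inter> F h) \<omega> * e \<omega>) = real (m - k) * (indicator A \<omega> * e \<omega>)"
   using AE_proper_edges AE_space
  proof eventually_elim
   case (elim \<omega>)
   have "(\<Sum>h\<in>H. indicator (A \<inter> F h) \<omega> * e \<omega>)
    = (\<Sum>h\<in>H. if h \<in> H - earlier k \<omega> then indicator A \<omega> * e \<omega> else 0)"
    by (rule sum.cong) (use elim in \<open>auto simp: F_def indicator_def\<close>)
   also have "\<dots> = real (card (H - earlier k \<omega>)) * (indicator A \<omega> * e \<omega>)"
    by (subst sum.inter_restrict[symmetric]) (simp_all add: finite_H Int_absorb1 Diff_subset)
   finally show ?case using proper_edges_remaining[of \<omega> k] elim k by simp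
  qed
  show "(\<lambda>\<omega>. \<Sum>h\<in>H. indicator (A \<inter> F h) \<omega> * e \<omega>) \<in> borel_measurable M"
   by (intro borel_measurable_sum borel_measurable_times borel_measurable_indicator eM sets.Int AM FM)
  show "(\<lambda>\<omega>. real (m - k) * (indicator A \<omega> * e \<omega>)) \<in> borel_measurable M"
   by (intro borel_measurable_times borel_measurable_indicator eM AM borel_measurable_const)
 qed
 finally show ?thesis using k by (simp add: e_def)
qed

end

section \<open>The number of reveals follows the integrated intensity\<close>

lemma nn_integral_before:
 assumes "0 \<le> w"
 shows "(\<integral>\<^sup>+s. indicator {s. 0 \<le> s \<and> ereal s < w} s \<partial>lborel) = e2ennreal w"
proof (cases w)
 case (real r)
 then have "{s. 0 \<le> s \<and> ereal s < w} = {0..<r}" by auto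
 then show ?thesis using real assms by simp
next
 case PInf
 have "{s. 0 \<le> s \<and> ereal s < w} = {0..}" using PInf by auto
 moreover have "emeasure lborel {0::real..} = \<top>"
 proof (cases "emeasure lborel {0::real..}")
  case (real r)
  obtain i :: nat where i: "r < real i" using reals_Archimedean2 by blast
  have "emeasure lborel {0..<real i} \<le> emeasure lborel {0::real..}" by (rule emeasure_mono) auto
  then have "ennreal (real i) \<le> ennreal r" using real by simp
  then have False using i real(1) by (subst (asm) ennreal_le_iff) auto
  then show ?thesis ..
 qed
 ultimately show ?thesis using PInf by simp
qed (use assms in auto)

lemma nn_integral_id_before:
 assumes "0 \<le> r"
 shows "(\<integral>\<^sup>+s. ennreal (2 * s) * indicator {s. 0 \<le> s \<and> ereal s < ereal r} s \<partial>lborel) = ennreal (r\<^sup>2)"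
proof -
 have "(\<integral>\<^sup>+s. ennreal (2 * s) * indicator {s. 0 \<le> s \<and> ereal s < ereal r} s \<partial>lborel)
  = (\<integral>\<^sup>+s. ennreal (2 * s) * indicator {0..r} s \<partial>lborel)"
 proof (rule nn_integral_cong_AE)
  have "AE s in lborel. s \<noteq> r" by (rule AE_lborel_singleton)
  then show "AE s in lborel. ennreal (2 * s) * indicator {s. 0 \<le> s \<and> ereal s < ereal r} s
   = ennreal (2 * s) * indicator {0..r} s"
   by eventually_elim (auto simp: indicator_def)
 qed
 also have "\<dots> = ennreal (r\<^sup>2 - 0\<^sup>2)"
  by (rule nn_integral_FTC_Icc[where F = "\<lambda>s. s\<^sup>2"])
   (use assms in \<open>auto intro!: derivative_eq_intros\<close>)
 finally show ?thesis by simp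
qed

lemma nn_integral_exp_moments:
 assumes "0 < r"
 shows "(\<integral>\<^sup>+s. ennreal (exp (- r * s)) * indicator {0..} s \<partial>lborel) = ennreal (1 / r)"
  and "(\<integral>\<^sup>+s. ennreal s * ennreal (exp (- r * s)) * indicator {0..} s \<partial>lborel) = ennreal (1 / r\<^sup>2)"
proof -
 have *: "(\<integral>\<^sup>+s. ennreal (s ^ i * exp (- r * s)) * indicator {0..} s \<partial>lborel)
  = ennreal (1 / r) * (\<integral>\<^sup>+s. ennreal (exponential_density r s * s ^ i) \<partial>lborel)" for i
 proof (subst nn_integral_cmult[symmetric])
  show "(\<integral>\<^sup>+s. ennreal (s ^ i * exp (- r * s)) * indicator {0..} s \<partial>lborel)
   = (\<integral>\<^sup>+s. ennreal (1 / r) * ennreal (exponential_density r s * s ^ i) \<partial>lborel)"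
   by (rule nn_integral_cong)
    (use assms in \<open>auto simp: exponential_density_def indicator_def ennreal_mult''[symmetric] field_simps\<close>)
 qed simp
 show "(\<integral>\<^sup>+s. ennreal (exp (- r * s)) * indicator {0..} s \<partial>lborel) = ennreal (1 / r)"
  using *[of 0] nn_integral_erlang_ith_moment[OF assms, of 0 0] by simp
 have "(\<integral>\<^sup>+s. ennreal s * ennreal (exp (- r * s)) * indicator {0..} s \<partial>lborel)
  = (\<integral>\<^sup>+s. ennreal (s ^ 1 * exp (- r * s)) * indicator {0..} s \<partial>lborel)"
  by (rule nn_integral_cong) (auto simp: indicator_def ennreal_mult)
 also have "\<dots> = ennreal (1 / r\<^sup>2)"
  unfolding *[of 1] using nn_integral_erlang_ith_moment[OF assms, of 0 1] assms
  by (simp add: ennreal_mult''[symmetric] power2_eq_square)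
 finally show "(\<integral>\<^sup>+s. ennreal s * ennreal (exp (- r * s)) * indicator {0..} s \<partial>lborel) = ennreal (1 / r\<^sup>2)" .
qed

context network begin

text \<open>
  The exponential is the conditional probability of \<open>s < wait\<close> given the past, so it may replace
  the indicator against every factor that is determined by the past.
\<close>

lemma nn_integral_wait:
 assumes k: "k < m" and s: "0 \<le> s" and f: "f \<in> borel_measurable (hist p k)"
 shows "(\<integral>\<^sup>+\<omega>. f \<omega> * indicator {\<omega> \<in> space M. ereal s < wait p (Suc k) \<omega>} \<omega> \<partial>M)
  = (\<integral>\<^sup>+\<omega>. f \<omega> * ennreal (exp (- rate p k \<omega> * s)) \<partial>M)"
proof -
 interpret sigma_finite_subalgebra M "hist p k"
  by (intro finite_measure_subalgebra_is_sigma_finite finite_measure_subalgebra.intro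
    finite_measure_subalgebra_axioms.intro subalg_hist) (simp add: finite_measure_axioms)
 define W where "W = {\<omega> \<in> space M. ereal s < wait p (Suc k) \<omega>}"
 have WM: "W \<in> sets M" unfolding W_def by (rule step_set_M(4)[OF k])
 define e where "e \<omega> = exp (- rate p k \<omega> * s)" for \<omega>
 have eH: "e \<in> borel_measurable (hist p k)" using rate_hist[of k] k unfolding e_def by auto
 have eM: "e \<in> borel_measurable M" by (rule measurable_hist_M[OF eH])
 have iW: "(indicator W :: 'w \<Rightarrow> ennreal) \<in> borel_measurable M" using WM by simp
 have e1: "\<bar>e \<omega>\<bar> \<le> 1" if "\<omega> \<in> space M" for \<omega>
  using rate_nonneg[of k \<omega>] k s that by (simp add: e_def)
 have "AE \<omega> in M. ennreal (e \<omega>) = nn_cond_exp M (hist p k) (indicator W) \<omega>"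
 proof (rule nn_cond_exp_charact)
  fix A assume A: "A \<in> sets (hist p k)"
  have AM: "A \<in> sets M" by (rule hist_M[OF A])
  have "(\<integral>\<^sup>+\<omega>\<in>A. indicator W \<omega> \<partial>M) = (\<integral>\<^sup>+\<omega>. indicator (A \<inter> W) \<omega> \<partial>M)"
   by (rule nn_integral_cong) (auto simp: indicator_def)
  also have "\<dots> = ennreal (measure M (A \<inter> W))"
   using AM WM by (simp add: emeasure_eq_measure)
  also have "measure M (A \<inter> W) = (LINT \<omega>|M. indicator A \<omega> * e \<omega>)"
   unfolding W_def e_def by (rule step_wait_law[OF k s A])
  also have "ennreal \<dots> = (\<integral>\<^sup>+\<omega>. ennreal (indicator A \<omega> * e \<omega>) \<partial>M)"
  proof (rule nn_integral_eq_integral[symmetric])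
   show "integrable M (\<lambda>\<omega>. indicator A \<omega> * e \<omega>)"
   proof (rule integrable_const_bound[of _ 1])
    show "AE \<omega> in M. norm (indicator A \<omega> * e \<omega>) \<le> 1"
     using e1 by (intro AE_I2) (auto simp: indicator_def)
    show "(\<lambda>\<omega>. indicator A \<omega> * e \<omega>) \<in> borel_measurable M"
     by (intro borel_measurable_times borel_measurable_indicator eM AM)
   qed
  qed (auto simp: e_def)
  also have "\<dots> = (\<integral>\<^sup>+\<omega>\<in>A. ennreal (e \<omega>) \<partial>M)"
   by (rule nn_integral_cong) (auto simp: indicator_def)
  finally show "(\<integral>\<^sup>+\<omega>\<in>A. indicator W \<omega> \<partial>M) = (\<integral>\<^sup>+\<omega>\<in>A. ennreal (e \<omega>) \<partial>M)" .
 qed (use iW eH in auto)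
 then have "(\<integral>\<^sup>+\<omega>. f \<omega> * ennreal (e \<omega>) \<partial>M)
  = (\<integral>\<^sup>+\<omega>. f \<omega> * nn_cond_exp M (hist p k) (indicator W) \<omega> \<partial>M)"
  by (intro nn_integral_cong_AE) (auto elim: eventually_mono)
 also have "\<dots> = (\<integral>\<^sup>+\<omega>. f \<omega> * indicator W \<omega> \<partial>M)"
  by (rule nn_cond_exp_intg[OF f iW])
 finally show ?thesis unfolding W_def e_def by simp
qed

text \<open>
  Moments of the waiting time are integrals of its tail, so by Tonelli they only need the tail
  probability at each fixed time.
\<close>

lemma nn_integral_wait_moment:
 assumes k: "k < m" and f: "f \<in> borel_measurable (hist p k)" and g: "g \<in> borel_measurable borel"
 shows "(\<integral>\<^sup>+\<omega>. f \<omega> * (\<integral>\<^sup>+s. g s * indicator {s. 0 \<le> s \<and> ereal s < wait p (Suc k) \<omega>} s \<partial>lborel) \<partial>M)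
  = (\<integral>\<^sup>+\<omega>. f \<omega> * (\<integral>\<^sup>+s. g s * ennreal (exp (- rate p k \<omega> * s)) * indicator {0..} s \<partial>lborel) \<partial>M)"
proof -
 interpret P: pair_sigma_finite M lborel by standard
 have [measurable]: "f \<in> borel_measurable M" "wait p (Suc k) \<in> borel_measurable M" "rate p k \<in> borel_measurable M"
  "g \<in> borel_measurable borel"
  using f g wait_M[of "Suc k"] rate_M[of k] k measurable_hist_M by auto
 have [measurable]: "(\<lambda>x. indicator {s. 0 \<le> s \<and> ereal s < wait p (Suc k) (fst x)} (snd x) :: ennreal)
  \<in> borel_measurable (M \<Otimes>\<^sub>M lborel)"
  unfolding indicator_def by measurable
 have "(\<integral>\<^sup>+\<omega>. f \<omega> * (\<integral>\<^sup>+s. g s * indicator {s. 0 \<le> s \<and> ereal s < wait p (Suc k) \<omega>} s \<partial>lborel) \<partial>M)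
  = (\<integral>\<^sup>+\<omega>. (\<integral>\<^sup>+s. f \<omega> * (g s * indicator {s. 0 \<le> s \<and> ereal s < wait p (Suc k) \<omega>} s) \<partial>lborel) \<partial>M)"
  by (intro nn_integral_cong nn_integral_cmult[symmetric]) measurable
 also have "\<dots> = (\<integral>\<^sup>+s. (\<integral>\<^sup>+\<omega>. f \<omega> * (g s * indicator {s. 0 \<le> s \<and> ereal s < wait p (Suc k) \<omega>} s) \<partial>M) \<partial>lborel)"
  by (rule P.Fubini'[symmetric]) measurable
 also have "\<dots> = (\<integral>\<^sup>+s. (\<integral>\<^sup>+\<omega>. f \<omega> * (g s * ennreal (exp (- rate p k \<omega> * s)) * indicator {0..} s) \<partial>M) \<partial>lborel)"
 proof (rule nn_integral_cong)
  fix s :: real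
  show "(\<integral>\<^sup>+\<omega>. f \<omega> * (g s * indicator {s. 0 \<le> s \<and> ereal s < wait p (Suc k) \<omega>} s) \<partial>M)
   = (\<integral>\<^sup>+\<omega>. f \<omega> * (g s * ennreal (exp (- rate p k \<omega> * s)) * indicator {0..} s) \<partial>M)"
  proof (cases "0 \<le> s")
   case True
   have "(\<integral>\<^sup>+\<omega>. f \<omega> * (g s * indicator {s. 0 \<le> s \<and> ereal s < wait p (Suc k) \<omega>} s) \<partial>M)
    = (\<integral>\<^sup>+\<omega>. (f \<omega> * g s) * indicator {\<omega> \<in> space M. ereal s < wait p (Suc k) \<omega>} \<omega> \<partial>M)"
    by (rule nn_integral_cong) (use True in \<open>auto simp: indicator_def\<close>)
   also have "\<dots> = (\<integral>\<^sup>+\<omega>. (f \<omega> * g s) * ennreal (exp (- rate p k \<omega> * s)) \<partial>M)"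
    by (rule nn_integral_wait[OF k True]) (use f in measurable)
   finally show ?thesis using True by (simp add: mult.assoc)
  qed simp
 qed
 also have "\<dots> = (\<integral>\<^sup>+\<omega>. (\<integral>\<^sup>+s. f \<omega> * (g s * ennreal (exp (- rate p k \<omega> * s)) * indicator {0..} s) \<partial>lborel) \<partial>M)"
  by (rule P.Fubini') measurable
 also have "\<dots> = (\<integral>\<^sup>+\<omega>. f \<omega> * (\<integral>\<^sup>+s. g s * ennreal (exp (- rate p k \<omega> * s)) * indicator {0..} s \<partial>lborel) \<partial>M)"
  by (intro nn_integral_cong nn_integral_cmult) measurable
 finally show ?thesis .
qed

text \<open>
  The intensity accumulated during the waiting time \<open>k\<close>. Almost surely an infinite waiting time
  occurs only at rate 0, and then \<open>consumed\<close> is 0. Otherwise \<open>consumed k\<close> is a standard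
  exponential variable given the past, which makes \<open>active k\<close> its conditional mean.
\<close>

definition consumed :: "nat \<Rightarrow> 'w \<Rightarrow> real" where
 "consumed k \<omega> = rate p (k - 1) \<omega> * real_of_ereal (wait p k \<omega>)"

definition active :: "nat \<Rightarrow> 'w \<Rightarrow> real" where
 "active k \<omega> = (if 0 < rate p (k - 1) \<omega> then 1 else 0)"

definition deviation :: "nat \<Rightarrow> 'w \<Rightarrow> real" where
 "deviation k \<omega> = (\<Sum>j = 1..k. consumed j \<omega> - active j \<omega>)"

lemma wait_infinite:
 assumes k: "k < m"
 shows "AE \<omega> in M. rate p k \<omega> = 0 \<longrightarrow> wait p (Suc k) \<omega> = \<infinity>"
proof -
 define A where "A = {\<omega> \<in> space M. rate p k \<omega> = 0}"
 have [measurable]: "rate p k \<in> borel_measurable (hist p k)" using rate_hist k by simp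
 have "{\<omega> \<in> space (hist p k). rate p k \<omega> = 0} \<in> sets (hist p k)" by measurable
 then have AH: "A \<in> sets (hist p k)" unfolding A_def by simp
 have AM: "A \<in> sets M" by (rule hist_M[OF AH])
 have "AE \<omega> in M. \<omega> \<notin> A - {\<omega> \<in> space M. ereal (real i) < wait p (Suc k) \<omega>}" for i :: nat
 proof (rule AE_not_in, rule null_setsI)
  have W: "{\<omega> \<in> space M. ereal (real i) < wait p (Suc k) \<omega>} \<in> sets M" by (rule step_set_M(4)[OF k])
  show s: "A - {\<omega> \<in> space M. ereal (real i) < wait p (Suc k) \<omega>} \<in> sets M" using AM W by (rule sets.Diff)
  have "measure M (A \<inter> {\<omega> \<in> space M. ereal (real i) < wait p (Suc k) \<omega>})
   = (LINT \<omega>|M. indicator A \<omega> * exp (- rate p k \<omega> * real i))"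
   by (rule step_wait_law[OF k _ AH]) simp
  also have "\<dots> = (LINT \<omega>|M. indicator A \<omega>)"
   by (rule Bochner_Integration.integral_cong) (auto simp: A_def indicator_def)
  also have "\<dots> = measure M A" using AM by (simp add: sets.Int_space_eq2)
  finally have "measure M (A - {\<omega> \<in> space M. ereal (real i) < wait p (Suc k) \<omega>}) = 0"
   using AM W by (simp add: finite_measure_Diff')
  then show "emeasure M (A - {\<omega> \<in> space M. ereal (real i) < wait p (Suc k) \<omega>}) = 0"
   by (simp add: emeasure_eq_measure)
 qed
 then have "AE \<omega> in M. \<forall>i::nat. \<omega> \<notin> A - {\<omega> \<in> space M. ereal (real i) < wait p (Suc k) \<omega>}"
  unfolding AE_all_countable by (rule allI)
 then show ?thesis using AE_space
 proof eventually_elim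
  case (elim \<omega>)
  show ?case
  proof
   assume "rate p k \<omega> = 0"
   then have "\<And>i::nat. ereal (real i) < wait p (Suc k) \<omega>" using elim by (auto simp: A_def)
   then show "wait p (Suc k) \<omega> = \<infinity>"
    by (metis less_PInf_Ex_of_nat not_less_iff_gr_or_eq)
  qed
 qed
qed

lemma nn_integral_wait1:
 assumes k: "k < m" and f: "f \<in> borel_measurable (hist p k)"
 shows "(\<integral>\<^sup>+\<omega>. f \<omega> * (ennreal (rate p k \<omega>) * e2ennreal (wait p (Suc k) \<omega>)) \<partial>M)
  = (\<integral>\<^sup>+\<omega>. f \<omega> * ennreal (active (Suc k) \<omega>) \<partial>M)"
proof -
 have [measurable]: "rate p k \<in> borel_measurable (hist p k)" using rate_hist k by simp
 have "(\<integral>\<^sup>+\<omega>. f \<omega> * (ennreal (rate p k \<omega>) * e2ennreal (wait p (Suc k) \<omega>)) \<partial>M)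
  = (\<integral>\<^sup>+\<omega>. (f \<omega> * ennreal (rate p k \<omega>)) * (\<integral>\<^sup>+s. 1 * indicator {s. 0 \<le> s \<and> ereal s < wait p (Suc k) \<omega>} s \<partial>lborel) \<partial>M)"
  by (rule nn_integral_cong)
   (use wait_nonneg[OF k] nn_integral_before in \<open>simp add: mult.assoc\<close>)
 also have "\<dots> = (\<integral>\<^sup>+\<omega>. (f \<omega> * ennreal (rate p k \<omega>)) *
   (\<integral>\<^sup>+s. 1 * ennreal (exp (- rate p k \<omega> * s)) * indicator {0..} s \<partial>lborel) \<partial>M)"
  by (rule nn_integral_wait_moment[OF k]) (use f in measurable)
 also have "\<dots> = (\<integral>\<^sup>+\<omega>. f \<omega> * ennreal (active (Suc k) \<omega>) \<partial>M)"
 proof (rule nn_integral_cong)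
  fix \<omega> assume w: "\<omega> \<in> space M"
  show "(f \<omega> * ennreal (rate p k \<omega>)) * (\<integral>\<^sup>+s. 1 * ennreal (exp (- rate p k \<omega> * s)) * indicator {0..} s \<partial>lborel)
   = f \<omega> * ennreal (active (Suc k) \<omega>)"
  proof (cases "0 < rate p k \<omega>")
   case True
   then show ?thesis unfolding active_def using nn_integral_exp_moments(1)[OF True]
    by (simp add: mult.assoc ennreal_mult''[symmetric])
  next
   case False
   then have "rate p k \<omega> = 0" using rate_nonneg[of k \<omega>] k w by simp
   then show ?thesis unfolding active_def by simp
  qed
 qed
 finally show ?thesis .
qed

lemma wait_finite:
 assumes k: "k < m"
 shows "AE \<omega> in M. 0 < rate p k \<omega> \<longrightarrow> wait p (Suc k) \<omega> < \<infinity>"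
proof -
 have [measurable]: "rate p k \<in> borel_measurable M" "wait p (Suc k) \<in> borel_measurable M"
  using rate_M[of k] wait_M[of "Suc k"] k by auto
 have "(\<integral>\<^sup>+\<omega>. ennreal (rate p k \<omega>) * e2ennreal (wait p (Suc k) \<omega>) \<partial>M)
  = (\<integral>\<^sup>+\<omega>. ennreal (active (Suc k) \<omega>) \<partial>M)"
  using nn_integral_wait1[OF k, of "\<lambda>_. 1"] by simp
 also have "\<dots> \<le> (\<integral>\<^sup>+\<omega>. 1 \<partial>M)" by (rule nn_integral_mono) (simp add: active_def)
 also have "\<dots> < \<infinity>" by (simp add: emeasure_space_1)
 finally have "(\<integral>\<^sup>+\<omega>. ennreal (rate p k \<omega>) * e2ennreal (wait p (Suc k) \<omega>) \<partial>M) \<noteq> \<infinity>" by simp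
 then have "AE \<omega> in M. ennreal (rate p k \<omega>) * e2ennreal (wait p (Suc k) \<omega>) \<noteq> \<infinity>"
  by (intro nn_integral_PInf_AE) auto
 then show ?thesis
  by eventually_elim (auto simp: ennreal_mult_eq_top_iff)
qed

lemma consumed_eq:
 assumes k: "k < m"
 shows "AE \<omega> in M. ennreal (consumed (Suc k) \<omega>) = ennreal (rate p k \<omega>) * e2ennreal (wait p (Suc k) \<omega>)"
 using wait_finite[OF k] AE_space
proof eventually_elim
 case (elim \<omega>)
 have r: "0 \<le> rate p k \<omega>" using rate_nonneg[of k \<omega>] k elim by simp
 have "0 \<le> wait p (Suc k) \<omega>" using wait_nonneg[OF k] elim by simp
 with elim r show ?case unfolding consumed_def
  by (cases "wait p (Suc k) \<omega>") (auto simp: ennreal_mult)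
qed

lemma consumed_nonneg: "k < m \<Longrightarrow> \<omega> \<in> space M \<Longrightarrow> 0 \<le> consumed (Suc k) \<omega>"
 unfolding consumed_def using rate_nonneg[of k \<omega>] wait_nonneg[of k \<omega>]
 by (simp add: real_of_ereal_pos)

lemma nn_integral_consumed:
 assumes k: "k < m" and f: "f \<in> borel_measurable (hist p k)"
 shows "(\<integral>\<^sup>+\<omega>. f \<omega> * ennreal (consumed (Suc k) \<omega>) \<partial>M) = (\<integral>\<^sup>+\<omega>. f \<omega> * ennreal (active (Suc k) \<omega>) \<partial>M)"
proof -
 have "(\<integral>\<^sup>+\<omega>. f \<omega> * ennreal (consumed (Suc k) \<omega>) \<partial>M)
  = (\<integral>\<^sup>+\<omega>. f \<omega> * (ennreal (rate p k \<omega>) * e2ennreal (wait p (Suc k) \<omega>)) \<partial>M)"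
  by (rule nn_integral_cong_AE) (use consumed_eq[OF k] in \<open>auto elim: eventually_mono\<close>)
 then show ?thesis using nn_integral_wait1[OF k f] by simp
qed

lemma nn_integral_consumed_sq:
 assumes k: "k < m"
 shows "(\<integral>\<^sup>+\<omega>. ennreal ((consumed (Suc k) \<omega>)\<^sup>2) \<partial>M) = (\<integral>\<^sup>+\<omega>. ennreal (2 * active (Suc k) \<omega>) \<partial>M)"
proof -
 have [measurable]: "rate p k \<in> borel_measurable (hist p k)" using rate_hist k by simp
 have "(\<integral>\<^sup>+\<omega>. ennreal ((consumed (Suc k) \<omega>)\<^sup>2) \<partial>M)
  = (\<integral>\<^sup>+\<omega>. ennreal ((rate p k \<omega>)\<^sup>2) *
    (\<integral>\<^sup>+s. ennreal (2 * s) * indicator {s. 0 \<le> s \<and> ereal s < wait p (Suc k) \<omega>} s \<partial>lborel) \<partial>M)"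
 proof (rule nn_integral_cong_AE)
  show "AE \<omega> in M. ennreal ((consumed (Suc k) \<omega>)\<^sup>2) = ennreal ((rate p k \<omega>)\<^sup>2) *
    (\<integral>\<^sup>+s. ennreal (2 * s) * indicator {s. 0 \<le> s \<and> ereal s < wait p (Suc k) \<omega>} s \<partial>lborel)"
   using wait_finite[OF k] AE_space
  proof eventually_elim
   case (elim \<omega>)
   have r: "0 \<le> rate p k \<omega>" using rate_nonneg[of k \<omega>] k elim by simp
   have w: "0 \<le> wait p (Suc k) \<omega>" using wait_nonneg[OF k] elim by simp
   show ?case
   proof (cases "wait p (Suc k) \<omega>")
    case (real r)
    then show ?thesis using w nn_integral_id_before[of r]
     by (simp add: consumed_def power_mult_distrib ennreal_mult)
   qed (use elim r w in \<open>auto simp: consumed_def\<close>)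
  qed
 qed
 also have "\<dots> = (\<integral>\<^sup>+\<omega>. ennreal ((rate p k \<omega>)\<^sup>2) *
   (\<integral>\<^sup>+s. ennreal (2 * s) * ennreal (exp (- rate p k \<omega> * s)) * indicator {0..} s \<partial>lborel) \<partial>M)"
  by (rule nn_integral_wait_moment[OF k]) measurable
 also have "\<dots> = (\<integral>\<^sup>+\<omega>. ennreal (2 * active (Suc k) \<omega>) \<partial>M)"
 proof (rule nn_integral_cong)
  fix \<omega> assume w: "\<omega> \<in> space M"
  show "ennreal ((rate p k \<omega>)\<^sup>2) *
   (\<integral>\<^sup>+s. ennreal (2 * s) * ennreal (exp (- rate p k \<omega> * s)) * indicator {0..} s \<partial>lborel)
   = ennreal (2 * active (Suc k) \<omega>)"
  proof (cases "0 < rate p k \<omega>")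
   case True
   have "(\<integral>\<^sup>+s. ennreal (2 * s) * ennreal (exp (- rate p k \<omega> * s)) * indicator {0..} s \<partial>lborel)
    = (\<integral>\<^sup>+s. 2 * (ennreal s * ennreal (exp (- rate p k \<omega> * s)) * indicator {0..} s) \<partial>lborel)"
    by (rule nn_integral_cong) (auto simp: indicator_def ennreal_mult mult.assoc)
   also have "\<dots> = 2 * ennreal (1 / (rate p k \<omega>)\<^sup>2)"
    using nn_integral_exp_moments(2)[OF True] by (subst nn_integral_cmult) auto
   finally show ?thesis using True unfolding active_def
    by (simp add: ennreal_mult''[symmetric] mult.left_commute)
  next
   case False
   then have "rate p k \<omega> = 0" using rate_nonneg[of k \<omega>] k w by simp
   then show ?thesis unfolding active_def by simp
  qed
 qed
 finally show ?thesis .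
qed

lemma deviation_hist:
 assumes "k \<le> m"
 shows "deviation k \<in> borel_measurable (hist p k)"
 unfolding deviation_def
proof (intro borel_measurable_sum borel_measurable_diff)
 fix j assume j: "j \<in> {1..k}"
 have [measurable]: "rate p (j - 1) \<in> borel_measurable (hist p k)" "wait p j \<in> borel_measurable (hist p k)"
  using j assms measurable_hist_mono[of "j - 1" k, OF _ rate_hist] wait_hist'[of j k] by auto
 show "consumed j \<in> borel_measurable (hist p k)" unfolding consumed_def by measurable
 show "active j \<in> borel_measurable (hist p k)" unfolding active_def by measurable
qed

text \<open>
  The deviation is a martingale. Its increments are orthogonal with second moments at most 1, so
  the bounds add up.
\<close>

lemma deviation_second_moment:
 assumes "k \<le> m"
 shows "integrable M (\<lambda>\<omega>. (deviation k \<omega>)\<^sup>2) \<and> (LINT \<omega>|M. (deviation k \<omega>)\<^sup>2) \<le> real k"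
 using assms
proof (induction k)
 case 0
 show ?case by (simp add: deviation_def)
next
 case (Suc k)
 then have k: "k < m" by simp
 have IH: "integrable M (\<lambda>\<omega>. (deviation k \<omega>)\<^sup>2)" "(LINT \<omega>|M. (deviation k \<omega>)\<^sup>2) \<le> real k"
  using Suc by auto
 define D where "D = deviation k"
 define x where "x = consumed (Suc k)"
 define c where "c = active (Suc k)"
 have DH: "D \<in> borel_measurable (hist p k)" unfolding D_def by (rule deviation_hist) (use k in simp)
 have DM: "D \<in> borel_measurable M" by (rule measurable_hist_M[OF DH])
 have rM: "rate p k \<in> borel_measurable M" and wM: "wait p (Suc k) \<in> borel_measurable M"
  using rate_M[of k] wait_M[of "Suc k"] k by auto
 have xM: "x \<in> borel_measurable M" unfolding x_def consumed_def using rM wM by simp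
 have cM: "c \<in> borel_measurable M" unfolding c_def active_def using rM by simp
 have c01: "c \<omega> = 0 \<or> c \<omega> = 1" for \<omega> by (simp add: c_def active_def)
 have c0: "0 \<le> c \<omega>" and c1: "c \<omega> \<le> 1" and cabs: "\<bar>c \<omega>\<bar> \<le> 1" for \<omega> using c01[of \<omega>] by auto
 have x0: "0 \<le> x \<omega>" if "\<omega> \<in> space M" for \<omega> using consumed_nonneg[OF k that] by (simp add: x_def)
 have xc: "x \<omega> * c \<omega> = x \<omega>" if "\<omega> \<in> space M" for \<omega>
  using rate_nonneg[of k \<omega>] k that by (auto simp: x_def c_def consumed_def active_def)
 have sq: "(\<integral>\<^sup>+\<omega>. ennreal ((x \<omega>)\<^sup>2) \<partial>M) = (\<integral>\<^sup>+\<omega>. ennreal (2 * c \<omega>) \<partial>M)"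
  unfolding x_def c_def by (rule nn_integral_consumed_sq[OF k])
 have ic: "integrable M c"
  by (rule integrable_const_bound[of _ 1]) (use cabs cM in \<open>auto intro!: AE_I2\<close>)
 have "(\<integral>\<^sup>+\<omega>. ennreal (2 * c \<omega>) \<partial>M) = ennreal (LINT \<omega>|M. 2 * c \<omega>)"
  using ic c0 by (intro nn_integral_eq_integral) auto
 then have ix2: "integrable M (\<lambda>\<omega>. (x \<omega>)\<^sup>2)"
  using xM sq by (intro integrableI_nonneg) auto
 have Ex2: "(LINT \<omega>|M. (x \<omega>)\<^sup>2) = (LINT \<omega>|M. 2 * c \<omega>)"
  using xM cM sq c0 by (subst (1 2) integral_eq_nn_integral) auto
 have iD: "integrable M D" and ix: "integrable M x"
  using square_integrable_imp_integrable[OF DM] square_integrable_imp_integrable[OF xM] IH(1) ix2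
  by (auto simp: D_def)
 have iDx: "integrable M (\<lambda>\<omega>. D \<omega> * x \<omega>)"
 proof (rule Bochner_Integration.integrable_bound)
  show "integrable M (\<lambda>\<omega>. (D \<omega>)\<^sup>2 + (x \<omega>)\<^sup>2)" using IH(1) ix2 by (simp add: D_def)
  show "(\<lambda>\<omega>. D \<omega> * x \<omega>) \<in> borel_measurable M" using DM xM by simp
  have "\<bar>a * b\<bar> \<le> a\<^sup>2 + b\<^sup>2" for a b :: real
  proof -
   have "2 * (\<bar>a\<bar> * \<bar>b\<bar>) \<le> a\<^sup>2 + b\<^sup>2" using sum_squares_bound[of "\<bar>a\<bar>" "\<bar>b\<bar>"] by simp
   moreover have "0 \<le> \<bar>a\<bar> * \<bar>b\<bar>" by simp
   ultimately show ?thesis unfolding abs_mult by linarith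
  qed
  then show "AE \<omega> in M. norm (D \<omega> * x \<omega>) \<le> norm ((D \<omega>)\<^sup>2 + (x \<omega>)\<^sup>2)" by (intro AE_I2) simp
 qed
 have iDc: "integrable M (\<lambda>\<omega>. D \<omega> * c \<omega>)"
  by (rule Bochner_Integration.integrable_bound[OF iD])
   (use DM cM cabs in \<open>auto intro!: AE_I2 simp: abs_mult mult_left_le\<close>)
 have half: "(LINT \<omega>|M. f \<omega> * x \<omega>) = (LINT \<omega>|M. f \<omega> * c \<omega>)"
  if f: "f \<in> borel_measurable (hist p k)" and f0: "\<And>\<omega>. 0 \<le> f \<omega>" for f :: "'w \<Rightarrow> real"
 proof -
  have fM: "f \<in> borel_measurable M" by (rule measurable_hist_M[OF f])
  have "(\<integral>\<^sup>+\<omega>. ennreal (f \<omega>) * ennreal (x \<omega>) \<partial>M) = (\<integral>\<^sup>+\<omega>. ennreal (f \<omega>) * ennreal (c \<omega>) \<partial>M)"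
   unfolding x_def c_def by (rule nn_integral_consumed[OF k]) (use f in measurable)
  then have "(\<integral>\<^sup>+\<omega>. ennreal (f \<omega> * x \<omega>) \<partial>M) = (\<integral>\<^sup>+\<omega>. ennreal (f \<omega> * c \<omega>) \<partial>M)"
   by (simp add: ennreal_mult'[OF f0])
  then show ?thesis
   using fM xM cM f0 x0 c0 by (subst (1 2) integral_eq_nn_integral) auto
 qed
 have part: "integrable M (\<lambda>\<omega>. f \<omega> * y \<omega>)"
  if i: "integrable M (\<lambda>\<omega>. D \<omega> * y \<omega>)" and y: "y \<in> borel_measurable M"
   and f: "f \<in> borel_measurable M" and le: "\<And>\<omega>. \<bar>f \<omega>\<bar> \<le> \<bar>D \<omega>\<bar>" for y f :: "'w \<Rightarrow> real"
 proof (rule Bochner_Integration.integrable_bound[OF i])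
  show "(\<lambda>\<omega>. f \<omega> * y \<omega>) \<in> borel_measurable M" using f y by (rule borel_measurable_times)
  show "AE \<omega> in M. norm (f \<omega> * y \<omega>) \<le> norm (D \<omega> * y \<omega>)"
   using le by (intro AE_I2) (simp add: abs_mult mult_right_mono)
 qed
 have pM: "(\<lambda>\<omega>. max 0 (D \<omega>)) \<in> borel_measurable M" "(\<lambda>\<omega>. max 0 (- D \<omega>)) \<in> borel_measurable M"
  using DM by simp_all
 have iDp: "integrable M (\<lambda>\<omega>. max 0 (D \<omega>) * x \<omega>)" "integrable M (\<lambda>\<omega>. max 0 (- D \<omega>) * x \<omega>)"
  "integrable M (\<lambda>\<omega>. max 0 (D \<omega>) * c \<omega>)" "integrable M (\<lambda>\<omega>. max 0 (- D \<omega>) * c \<omega>)"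
  by (rule part[OF iDx xM pM(1)], simp, rule part[OF iDx xM pM(2)], simp,
    rule part[OF iDc cM pM(1)], simp, rule part[OF iDc cM pM(2)], simp)
 have "(LINT \<omega>|M. D \<omega> * x \<omega>) = (LINT \<omega>|M. max 0 (D \<omega>) * x \<omega> - max 0 (- D \<omega>) * x \<omega>)"
  by (rule Bochner_Integration.integral_cong) (auto simp: max_def)
 also have "\<dots> = (LINT \<omega>|M. max 0 (D \<omega>) * x \<omega>) - (LINT \<omega>|M. max 0 (- D \<omega>) * x \<omega>)"
  by (rule Bochner_Integration.integral_diff[OF iDp(1,2)])
 also have "\<dots> = (LINT \<omega>|M. max 0 (D \<omega>) * c \<omega>) - (LINT \<omega>|M. max 0 (- D \<omega>) * c \<omega>)"
  using half[of "\<lambda>\<omega>. max 0 (D \<omega>)"] half[of "\<lambda>\<omega>. max 0 (- D \<omega>)"] DH by simp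
 also have "\<dots> = (LINT \<omega>|M. max 0 (D \<omega>) * c \<omega> - max 0 (- D \<omega>) * c \<omega>)"
  by (rule Bochner_Integration.integral_diff[OF iDp(3,4), symmetric])
 also have "\<dots> = (LINT \<omega>|M. D \<omega> * c \<omega>)"
  by (rule Bochner_Integration.integral_cong) (auto simp: max_def)
 finally have orth: "(LINT \<omega>|M. D \<omega> * x \<omega>) = (LINT \<omega>|M. D \<omega> * c \<omega>)" .
 have dev: "(deviation (Suc k) \<omega>)\<^sup>2
  = (D \<omega>)\<^sup>2 + 2 * (D \<omega> * x \<omega>) - 2 * (D \<omega> * c \<omega>) + (x \<omega>)\<^sup>2 - 2 * x \<omega> + c \<omega>" if "\<omega> \<in> space M" for \<omega>
 proof -
  have "(deviation (Suc k) \<omega>)\<^sup>2 = (D \<omega> + (x \<omega> - c \<omega>))\<^sup>2"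
   by (simp add: deviation_def D_def x_def c_def)
  also have "\<dots> = (D \<omega>)\<^sup>2 + 2 * (D \<omega> * x \<omega>) - 2 * (D \<omega> * c \<omega>) + (x \<omega>)\<^sup>2 - 2 * (x \<omega> * c \<omega>) + (c \<omega>)\<^sup>2"
   by (simp add: power2_eq_square algebra_simps)
  also have "(c \<omega>)\<^sup>2 = c \<omega>" using c01[of \<omega>] by auto
  finally show ?thesis using xc[OF that] by simp
 qed
 have int: "integrable M (\<lambda>\<omega>. (D \<omega>)\<^sup>2 + 2 * (D \<omega> * x \<omega>) - 2 * (D \<omega> * c \<omega>) + (x \<omega>)\<^sup>2 - 2 * x \<omega> + c \<omega>)"
  using IH(1) iDx iDc ix2 ix ic by (simp add: D_def)
 have Ex: "(LINT \<omega>|M. x \<omega>) = (LINT \<omega>|M. c \<omega>)" using half[of "\<lambda>_. 1"] by simp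
 have "(LINT \<omega>|M. (deviation (Suc k) \<omega>)\<^sup>2)
  = (LINT \<omega>|M. (D \<omega>)\<^sup>2 + 2 * (D \<omega> * x \<omega>) - 2 * (D \<omega> * c \<omega>) + (x \<omega>)\<^sup>2 - 2 * x \<omega> + c \<omega>)"
  by (rule Bochner_Integration.integral_cong) (use dev in auto)
 also have "\<dots> = (LINT \<omega>|M. (D \<omega>)\<^sup>2) + (LINT \<omega>|M. c \<omega>)"
  using IH(1) iDx iDc ix2 ix ic Ex Ex2 orth by (simp add: D_def)
 also have "(LINT \<omega>|M. c \<omega>) \<le> (LINT \<omega>|M. 1)"
  by (rule integral_mono[OF ic]) (use c1 in auto)
 finally have "(LINT \<omega>|M. (deviation (Suc k) \<omega>)\<^sup>2) \<le> real (Suc k)"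
  using IH(2) by (simp add: D_def prob_space)
 moreover have "integrable M (\<lambda>\<omega>. (deviation (Suc k) \<omega>)\<^sup>2)"
  using int by (subst Bochner_Integration.integrable_cong[OF refl dev])
 ultimately show ?case by simp
qed

end

text \<open>
  Both partial sums are non-decreasing and that of \<open>c\<close> grows by at most \<open>q\<close> from one grid point
  to the next, so bounds at the multiples of \<open>q\<close> and at \<open>m\<close> control all indices.
\<close>

lemma partial_sums_between_grid:
 fixes x c :: "nat \<Rightarrow> real" and q m :: nat
 defines "D k \<equiv> \<Sum>j = 1..k. x j - c j"
 assumes x: "\<And>j. j \<in> {1..m} \<Longrightarrow> 0 \<le> x j"
  and c: "\<And>j. j \<in> {1..m} \<Longrightarrow> 0 \<le> c j \<and> c j \<le> 1"
  and q: "1 \<le> q"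
  and grid: "\<And>i. i * q \<le> m \<Longrightarrow> \<bar>D (i * q)\<bar> \<le> a" and last: "\<bar>D m\<bar> \<le> a" and k: "k \<le> m"
 shows "\<bar>D k\<bar> \<le> a + real q"
proof -
 have step: "D i - real (j - i) \<le> D j" if "i \<le> j" "j \<le> m" for i j
 proof -
  have "D j = D i + (\<Sum>l = i + 1..j. x l - c l)"
   unfolding D_def using that(1) sum.ub_add_nat[of 1 i "\<lambda>l. x l - c l" "j - i"] by simp
  moreover have "(\<Sum>l = i + 1..j. - 1) \<le> (\<Sum>l = i + 1..j. x l - c l)"
  proof (rule sum_mono)
   fix l assume "l \<in> {i + 1..j}"
   then have "l \<in> {1..m}" using that by auto
   then show "- 1 \<le> x l - c l" using x[of l] c[of l] by linarith
  qed
  ultimately show ?thesis by simp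
 qed
 define i where "i = k div q"
 have iq: "i * q \<le> k" "k < i * q + q"
  unfolding i_def using q div_mult_mod_eq[of k q] mod_less_divisor[of q k] by linarith+
 have "- a - real q \<le> D k"
 proof -
  have "\<bar>D (i * q)\<bar> \<le> a" using grid[of i] iq k by simp
  moreover have "real (k - i * q) \<le> real q" using iq by linarith
  ultimately show ?thesis using step[OF iq(1) k] by linarith
 qed
 moreover have "D k \<le> a + real q"
 proof (cases "i * q + q \<le> m")
  case True
  then have "\<bar>D ((i + 1) * q)\<bar> \<le> a" by (intro grid) simp
  moreover have "real ((i + 1) * q - k) \<le> real q"
   unfolding of_nat_le_iff using iq by simp
  moreover have "k \<le> (i + 1) * q" "(i + 1) * q \<le> m" using iq True by simp_all
  ultimately show ?thesis using step[of k "(i + 1) * q"] by linarith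
 next
  case False
  then have "real (m - k) \<le> real q" using iq by linarith
  then show ?thesis using step[OF k order_refl] last by linarith
 qed
 ultimately show ?thesis by linarith
qed

context network begin

lemma deviation_M: "k \<le> m \<Longrightarrow> deviation k \<in> borel_measurable M"
 by (rule measurable_hist_M[OF deviation_hist])

lemma deviation_tail:
 assumes "k \<le> m" "0 < a"
 shows "measure M {\<omega> \<in> space M. a < \<bar>deviation k \<omega>\<bar>} \<le> real m / a\<^sup>2"
proof -
 have [measurable]: "deviation k \<in> borel_measurable M" by (rule deviation_M) fact
 have "measure M {\<omega> \<in> space M. a < \<bar>deviation k \<omega>\<bar>} \<le> measure M {\<omega> \<in> space M. a\<^sup>2 \<le> (deviation k \<omega>)\<^sup>2}"
 proof (rule finite_measure_mono)
  show "{\<omega> \<in> space M. a < \<bar>deviation k \<omega>\<bar>} \<subseteq> {\<omega> \<in> space M. a\<^sup>2 \<le> (deviation k \<omega>)\<^sup>2}"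
   using assms(2) by (auto simp: abs_le_square_iff[symmetric])
 qed measurable
 also have "\<dots> \<le> (LINT \<omega>|M. (deviation k \<omega>)\<^sup>2) / a\<^sup>2"
  by (rule integral_Markov_inequality_measure[of _ _ "space M"])
   (use deviation_second_moment[OF assms(1)] assms(2) in auto)
 also have "\<dots> \<le> real m / a\<^sup>2"
  by (rule divide_right_mono) (use deviation_second_moment[OF assms(1)] assms in auto)
 finally show ?thesis .
qed

text \<open>
  Chebyshev's inequality and a union bound over the grid. If \<open>m\<close>, \<open>q\<close> and \<open>a\<close> are of order \<open>n\<close>,
  the grid has boundedly many points and the bound tends to 0.
\<close>

lemma max_deviation_tail:
 assumes q: "1 \<le> q" and a: "0 < a"
 shows "{\<omega> \<in> space M. \<not> (\<forall>k\<le>m. \<bar>deviation k \<omega>\<bar> \<le> a + real q)} \<in> sets M"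
  and "measure M {\<omega> \<in> space M. \<not> (\<forall>k\<le>m. \<bar>deviation k \<omega>\<bar> \<le> a + real q)}
      \<le> real (m div q + 2) * (real m / a\<^sup>2)"
proof -
 have dM: "{\<omega> \<in> space M. b < \<bar>deviation k \<omega>\<bar>} \<in> sets M" if "k \<le> m" for k b
 proof -
  have [measurable]: "deviation k \<in> borel_measurable M" by (rule deviation_M) fact
  show ?thesis by measurable
 qed
 have eq: "{\<omega> \<in> space M. \<not> (\<forall>k\<le>m. \<bar>deviation k \<omega>\<bar> \<le> a + real q)}
  = (\<Union>k\<in>{..m}. {\<omega> \<in> space M. a + real q < \<bar>deviation k \<omega>\<bar>})" by (auto simp: not_le)
 show 1: "{\<omega> \<in> space M. \<not> (\<forall>k\<le>m. \<bar>deviation k \<omega>\<bar> \<le> a + real q)} \<in> sets M"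
  unfolding eq using dM by (intro sets.finite_UN) auto
 define G where "G = insert m ((\<lambda>i. i * q) ` {i. i * q \<le> m})"
 have sub: "{i. i * q \<le> m} \<subseteq> {..m div q}"
  using q by (auto simp: less_eq_div_iff_mult_less_eq)
 have finG: "finite G" unfolding G_def by (intro finite.insertI finite_imageI finite_subset[OF sub]) simp
 have "card ((\<lambda>i. i * q) ` {i. i * q \<le> m}) \<le> card {i. i * q \<le> m}"
  by (rule card_image_le) (rule finite_subset[OF sub], simp)
 also have "\<dots> \<le> card {..m div q}" by (rule card_mono[OF _ sub]) simp
 finally have cardG: "card G \<le> m div q + 2"
  unfolding G_def by (intro order_trans[OF card_insert_le_m1]) auto
 have Gm: "k \<le> m" if "k \<in> G" for k using that unfolding G_def by auto
 have "{\<omega> \<in> space M. \<not> (\<forall>k\<le>m. \<bar>deviation k \<omega>\<bar> \<le> a + real q)}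
  \<subseteq> (\<Union>k\<in>G. {\<omega> \<in> space M. a < \<bar>deviation k \<omega>\<bar>})"
 proof
  fix \<omega> assume w: "\<omega> \<in> {\<omega> \<in> space M. \<not> (\<forall>k\<le>m. \<bar>deviation k \<omega>\<bar> \<le> a + real q)}"
  show "\<omega> \<in> (\<Union>k\<in>G. {\<omega> \<in> space M. a < \<bar>deviation k \<omega>\<bar>})"
  proof (rule ccontr)
   assume "\<omega> \<notin> (\<Union>k\<in>G. {\<omega> \<in> space M. a < \<bar>deviation k \<omega>\<bar>})"
   then have small: "\<bar>deviation k \<omega>\<bar> \<le> a" if "k \<in> G" for k using w that by (auto simp: not_less)
   have "\<bar>deviation k \<omega>\<bar> \<le> a + real q" if "k \<le> m" for k
    unfolding deviation_def
   proof (rule partial_sums_between_grid[OF _ _ q _ _ that])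
    fix j assume "j \<in> {1..m}"
    then show "0 \<le> consumed j \<omega>" using consumed_nonneg[of "j - 1" \<omega>] w by (cases j) auto
    show "0 \<le> active j \<omega> \<and> active j \<omega> \<le> 1" by (simp add: active_def)
   next
    fix i assume "i * q \<le> m"
    then have "i * q \<in> G" unfolding G_def by blast
    from small[OF this] show "\<bar>\<Sum>j = 1..i * q. consumed j \<omega> - active j \<omega>\<bar> \<le> a"
     unfolding deviation_def .
   next
    have "m \<in> G" unfolding G_def by blast
    from small[OF this] show "\<bar>\<Sum>j = 1..m. consumed j \<omega> - active j \<omega>\<bar> \<le> a"
     unfolding deviation_def .
   qed
   then show False using w by blast
  qed
 qed
 then have "measure M {\<omega> \<in> space M. \<not> (\<forall>k\<le>m. \<bar>deviation k \<omega>\<bar> \<le> a + real q)}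
  \<le> measure M (\<Union>k\<in>G. {\<omega> \<in> space M. a < \<bar>deviation k \<omega>\<bar>})"
  by (rule finite_measure_mono) (use dM finG Gm in blast)
 also have "\<dots> \<le> (\<Sum>k\<in>G. measure M {\<omega> \<in> space M. a < \<bar>deviation k \<omega>\<bar>})"
  by (rule finite_measure_subadditive_finite[OF finG]) (use dM Gm in blast)
 also have "\<dots> \<le> (\<Sum>k\<in>G. real m / a\<^sup>2)"
  by (rule sum_mono) (use deviation_tail Gm a in blast)
 also have "\<dots> \<le> real (m div q + 2) * (real m / a\<^sup>2)"
 proof -
  have "real (card G) * (real m / a\<^sup>2) \<le> real (m div q + 2) * (real m / a\<^sup>2)"
   using cardG by (intro mult_right_mono) (simp_all only: of_nat_le_iff, simp)
  then show ?thesis by simp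
 qed
 finally show "measure M {\<omega> \<in> space M. \<not> (\<forall>k\<le>m. \<bar>deviation k \<omega>\<bar> \<le> a + real q)}
      \<le> real (m div q + 2) * (real m / a\<^sup>2)" .
qed

abbreviation "T \<equiv> reveal_time p"
abbreviation "num \<omega> t \<equiv> card (revealed par n ty p t \<omega>)"

lemma T_0 [simp]: "T 0 \<omega> = 0" and T_Suc: "T (Suc k) \<omega> = T k \<omega> + wait p (Suc k) \<omega>"
 by (simp_all add: reveal_time_def)

text \<open>
  The almost sure properties of a trajectory on which all pathwise arguments rest.
\<close>

definition good :: "'w \<Rightarrow> bool" where
 "good \<omega> \<longleftrightarrow> \<omega> \<in> space M \<and> proper_edges \<omega> \<and> (\<forall>k\<in>{1..m}. 0 < wait p k \<omega>) \<and>
   (\<forall>k<m. rate p k \<omega> = 0 \<longrightarrow> wait p (Suc k) \<omega> = \<infinity>) \<and>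
   (\<forall>k<m. 0 < rate p k \<omega> \<longrightarrow> wait p (Suc k) \<omega> < \<infinity>) \<and>
   (T m \<omega> < \<infinity> \<longrightarrow> num_ruinous par n ty p (real_of_ereal (T m \<omega>)) \<omega> = 0 \<longrightarrow> rate p m \<omega> = 0) \<and>
   inj_on (\<lambda>k. out_edge p k \<omega>) {1..m} \<and> (\<lambda>k. out_edge p k \<omega>) ` {1..m} \<subseteq> out_edges par n ty \<and>
   (\<forall>k<m. T k \<omega> < \<infinity> \<longrightarrow> num_ruinous par n ty p (real_of_ereal (T k \<omega>)) \<omega> \<noteq> 0 \<longrightarrow>
    out_edge p (Suc k) \<omega> \<in> ruinous par n ty p (real_of_ereal (T k \<omega>)) \<omega>)"

lemma AE_good: "AE \<omega> in M. good \<omega>"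
proof -
 have "AE \<omega> in M. \<forall>k\<in>{..<m}. (rate p k \<omega> = 0 \<longrightarrow> wait p (Suc k) \<omega> = \<infinity>) \<and>
   (0 < rate p k \<omega> \<longrightarrow> wait p (Suc k) \<omega> < \<infinity>) \<and>
   out_edge p (Suc k) \<omega> \<in> out_edges par n ty - (\<lambda>j. out_edge p j \<omega>) ` {1..k} \<and>
   (T k \<omega> < \<infinity> \<longrightarrow> num_ruinous par n ty p (real_of_ereal (T k \<omega>)) \<omega> \<noteq> 0 \<longrightarrow>
    out_edge p (Suc k) \<omega> \<in> ruinous par n ty p (real_of_ereal (T k \<omega>)) \<omega>)"
  using wait_infinite wait_finite out_new out_ruinous by (intro AE_finite_allI AE_conjI) auto
 then show ?thesis using AE_proper_edges rate_zero[OF order_refl] AE_space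
 proof eventually_elim
  case (elim \<omega>)
  have 1: "out_edge p k \<omega> \<in> out_edges par n ty \<and> out_edge p k \<omega> \<notin> (\<lambda>j. out_edge p j \<omega>) ` {1..k - 1}"
   if "k \<in> {1..m}" for k
   using elim(1) that by (cases k) auto
  have "out_edge p j \<omega> \<noteq> out_edge p k \<omega>" if "k \<in> {1..m}" "j \<in> {1..m}" "j < k" for j k
  proof -
   have "out_edge p j \<omega> \<in> (\<lambda>j. out_edge p j \<omega>) ` {1..k - 1}" using that by (intro imageI) auto
   then show ?thesis using 1[OF that(1)] by metis
  qed
  then have "inj_on (\<lambda>k. out_edge p k \<omega>) {1..m}"
   unfolding inj_on_def by (metis linorder_less_linear)
  moreover have "(\<lambda>k. out_edge p k \<omega>) ` {1..m} \<subseteq> out_edges par n ty" using 1 by (intro image_subsetI) simp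
  ultimately show ?case unfolding good_def using elim by simp
 qed
qed

lemma T_mono: "good \<omega> \<Longrightarrow> i \<le> j \<Longrightarrow> j \<le> m \<Longrightarrow> T i \<omega> \<le> T j \<omega>"
proof (induction j)
 case (Suc j)
 show ?case
 proof (cases "i = Suc j")
  case False
  then have "T i \<omega> \<le> T j \<omega>" using Suc by simp
  moreover have "0 \<le> wait p (Suc j) \<omega>" using Suc.prems unfolding good_def by (auto simp: less_imp_le)
  ultimately show ?thesis unfolding T_Suc by (rule add_increasing2[rotated])
 qed simp
qed simp

lemma T_nonneg: "good \<omega> \<Longrightarrow> k \<le> m \<Longrightarrow> 0 \<le> T k \<omega>"
 using T_mono[of \<omega> 0 k] by simp

lemma T_less:
 assumes g: "good \<omega>" and "k < m" "T k \<omega> < \<infinity>" shows "T k \<omega> < T (Suc k) \<omega>"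
proof -
 have "0 < wait p (Suc k) \<omega>" using assms unfolding good_def by auto
 moreover have "0 \<le> T k \<omega>" using T_nonneg assms by simp
 ultimately show ?thesis unfolding T_Suc using assms(3)
  by (cases "T k \<omega>"; cases "wait p (Suc k) \<omega>") auto
qed

lemma revealed_eq:
 assumes g: "good \<omega>"
 shows "revealed par n ty p t \<omega> = {1..num \<omega> t}" and "num \<omega> t \<le> m"
proof -
 define S where "S = revealed par n ty p t \<omega>"
 have S: "S \<subseteq> {1..m}" unfolding S_def revealed_def by auto
 then have fin: "finite S" by (rule finite_subset) simp
 have down: "j \<in> S" if "i \<in> S" "1 \<le> j" "j \<le> i" for i j
  using that T_mono[OF g that(3)] unfolding S_def revealed_def by (auto intro: order_trans)
 have "S = {1..card S}"
 proof (cases "S = {}")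
  case False
  have "S = {1..Max S}" using down[OF Max_in[OF fin False]] fin S by fastforce
  then show ?thesis by (metis card_atLeastAtMost diff_Suc_1 Suc_eq_plus1)
 qed simp
 then show "revealed par n ty p t \<omega> = {1..num \<omega> t}" unfolding S_def .
 have "card S \<le> card {1..m}" by (rule card_mono[OF _ S]) simp
 then show "num \<omega> t \<le> m" unfolding S_def by simp
qed

lemma le_num_iff:
 assumes g: "good \<omega>" and k: "k \<le> m" and t: "0 \<le> t"
 shows "k \<le> num \<omega> t \<longleftrightarrow> T k \<omega> \<le> ereal t"
proof (cases "k = 0")
 case False
 then have "k \<in> revealed par n ty p t \<omega> \<longleftrightarrow> T k \<omega> \<le> ereal t" using k unfolding revealed_def by simp
 then show ?thesis using revealed_eq(1)[OF g, of t] False by (metis One_nat_def Suc_leI atLeastAtMost_iff neq0_conv)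
qed (use t in \<open>simp add: zero_ereal_def\<close>)

lemma num_mono: "good \<omega> \<Longrightarrow> 0 \<le> s \<Longrightarrow> s \<le> t \<Longrightarrow> num \<omega> s \<le> num \<omega> t"
 using le_num_iff[of \<omega> "num \<omega> s" s] le_num_iff[of \<omega> "num \<omega> s" t] revealed_eq(2)[of \<omega> s]
 by (auto intro: order_trans)

lemma num_at_T:
 assumes g: "good \<omega>" and k: "k \<le> m" and r: "T k \<omega> = ereal r"
 shows "num \<omega> r = k" "0 \<le> r"
proof -
 show r0: "0 \<le> r" using T_nonneg[OF g k] r by simp
 have "k \<le> num \<omega> r" using le_num_iff[OF g k r0] r by simp
 moreover have "num \<omega> r \<le> k"
 proof (rule ccontr)
  assume "\<not> num \<omega> r \<le> k"
  then have "Suc k \<le> num \<omega> r" by simp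
  moreover from this have "Suc k \<le> m" using revealed_eq(2)[OF g, of r] by simp
  ultimately have "T (Suc k) \<omega> \<le> ereal r" using le_num_iff[OF g _ r0] by simp
  moreover have "T k \<omega> < T (Suc k) \<omega>" using T_less[OF g, of k] \<open>Suc k \<le> m\<close> r by simp
  ultimately show False using r by simp
 qed
 ultimately show "num \<omega> r = k" by simp
qed

end

locale balanced_network = network +
 assumes balanced: "card (out_edges par n ty) = card (in_edges par n ty)"
begin

text \<open>
  After \<open>m\<close> reveals every outgoing half-edge has been matched, so no ruinous half-edge is left.
\<close>

lemma rate_last:
 assumes g: "good \<omega>" and "T m \<omega> < \<infinity>" shows "rate p m \<omega> = 0"
proof -
 obtain r where r: "T m \<omega> = ereal r" using T_nonneg[OF g order_refl] assms(2) by (cases "T m \<omega>") auto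
 have rev: "revealed par n ty p r \<omega> = {1..m}"
  using revealed_eq(1)[OF g, of r] num_at_T[OF g order_refl r] by simp
 have o: "inj_on (\<lambda>k. out_edge p k \<omega>) {1..m}" "(\<lambda>k. out_edge p k \<omega>) ` {1..m} \<subseteq> out_edges par n ty"
  using g unfolding good_def by auto
 have "finite (out_edges par n ty)" by (simp add: out_edges_def)
 then have "(\<lambda>k. out_edge p k \<omega>) ` {1..m} = out_edges par n ty"
  using o balanced by (intro card_subset_eq) (auto simp: card_image)
 then have "\<exists>k\<in>{1..m}. out_edge p k \<omega> = e" if "e \<in> out_edges par n ty" for e using that by (metis imageE)
 then have "ruinous par n ty p r \<omega> = {}" unfolding ruinous_def rev by blast
 then have "num_ruinous par n ty p (real_of_ereal (T m \<omega>)) \<omega> = 0" using r by (simp add: num_ruinous_def)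
 then show ?thesis using g assms(2) unfolding good_def by blast
qed

text \<open>
  Between two reveals the intensity is constant, so its integral up to a reveal is the sum of the
  quantities \<open>consumed\<close>, which \<open>deviation\<close> compares with the number of reveals.
\<close>

lemma integrated_intensity:
 assumes g: "good \<omega>" and t: "0 \<le> t" and dev: "\<And>k. k \<le> m \<Longrightarrow> \<bar>deviation k \<omega>\<bar> \<le> b"
 shows "\<exists>I\<ge>0. (\<integral>\<^sup>+s. ennreal (intensity par n ty p s \<omega>) * indicator {0..<t} s \<partial>lborel) = ennreal I
      \<and> \<bar>I - real (num \<omega> t)\<bar> \<le> b + 1"
proof -
 define K where "K = num \<omega> t"
 have w: "\<omega> \<in> space M" using g unfolding good_def by simp
 have Km: "K \<le> m" unfolding K_def by (rule revealed_eq(2)[OF g])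
 define r where "r k = real_of_ereal (T k \<omega>)" for k
 have Tr: "T k \<omega> = ereal (r k)" and rt: "r k \<le> t" and r0: "0 \<le> r k" if "k \<le> K" for k
 proof -
  have "T k \<omega> \<le> ereal t" using le_num_iff[OF g _ t, of k] that Km unfolding K_def by simp
  moreover have "0 \<le> T k \<omega>" using T_nonneg[OF g] that Km by simp
  ultimately show "T k \<omega> = ereal (r k)" "r k \<le> t" "0 \<le> r k"
   unfolding r_def by (cases "T k \<omega>"; simp)+
 qed
 have W: "wait p (Suc k) \<omega> = ereal (r (Suc k) - r k)" if "k < K" for k
  using T_Suc[of k \<omega>] Tr[of k] Tr[of "Suc k"] that by (cases "wait p (Suc k) \<omega>") auto
 have rpos: "0 < rate p k \<omega>" if "k < K" for k
 proof -
  have "rate p k \<omega> \<noteq> 0" using g that Km W[OF that] unfolding good_def by auto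
  then show ?thesis using rate_nonneg[of k \<omega>] that Km w by simp
 qed
 have rle: "r k \<le> r (Suc k)" if "k < K" for k
  using W[OF that] wait_nonneg[of k \<omega>] that Km w by simp
 have rK: "0 \<le> rate p K \<omega>" using rate_nonneg Km w by simp
 \<comment> \<open>The rate \<open>k\<close> is in force from \<open>r k\<close> to \<open>e k\<close>. The last stage, cut off at \<open>t\<close>,
  contributes at most \<open>consumed (Suc K)\<close>, whence the summand 1 in the bound.\<close>
 define e where "e k = (if k < K then r (Suc k) else t)" for k
 have loc: "s \<in> {r k..<e k} \<longleftrightarrow> k = num \<omega> s" if s: "s \<in> {0..<t}" and k: "k \<le> K" for s k
 proof -
  have sK: "num \<omega> s \<le> K" unfolding K_def using num_mono[OF g] s by simp
  have a: "r k \<le> s \<longleftrightarrow> k \<le> num \<omega> s" using le_num_iff[OF g, of k s] k Km s Tr[OF k] by simp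
  have b: "s < e k \<longleftrightarrow> num \<omega> s \<le> k"
  proof (cases "k < K")
   case True
   then have "r (Suc k) \<le> s \<longleftrightarrow> Suc k \<le> num \<omega> s" using le_num_iff[OF g, of "Suc k" s] Km s Tr[of "Suc k"] by simp
   then show ?thesis using True unfolding e_def by auto
  next
   case False
   then show ?thesis using sK k s unfolding e_def by simp
  qed
  show ?thesis using a b by auto
 qed
 define I where "I = (\<Sum>k\<le>K. rate p k \<omega> * (e k - r k))"
 have re: "r k \<le> e k" if "k \<le> K" for k using rle rt[OF that] that unfolding e_def by auto
 have nonneg: "0 \<le> rate p k \<omega> * (e k - r k)" if "k \<le> K" for k
  using rate_nonneg[of k \<omega>] Km that w re[OF that] by simp
 have I0: "0 \<le> I" unfolding I_def by (rule sum_nonneg) (use nonneg in simp)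
 have "(\<integral>\<^sup>+s. ennreal (intensity par n ty p s \<omega>) * indicator {0..<t} s \<partial>lborel)
  = (\<integral>\<^sup>+s. (\<Sum>k\<le>K. ennreal (rate p k \<omega>) * indicator {r k..<e k} s) \<partial>lborel)"
 proof (rule nn_integral_cong)
  fix s
  show "ennreal (intensity par n ty p s \<omega>) * indicator {0..<t} s
   = (\<Sum>k\<le>K. ennreal (rate p k \<omega>) * indicator {r k..<e k} s)"
  proof (cases "s \<in> {0..<t}")
   case True
   have "num \<omega> s \<le> K" unfolding K_def using num_mono[OF g] True by simp
   have "(\<Sum>k\<le>K. ennreal (rate p k \<omega>) * indicator {r k..<e k} s)
    = (\<Sum>k\<le>K. if k = num \<omega> s then ennreal (rate p k \<omega>) else 0)"
    by (rule sum.cong[OF refl]) (use loc[OF True] in \<open>simp add: indicator_def\<close>)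
   also have "\<dots> = ennreal (rate p (num \<omega> s) \<omega>)" using \<open>num \<omega> s \<le> K\<close> by simp
   finally show ?thesis using True by (simp add: intensity_def)
  next
   case False
   have "s \<notin> {r k..<e k}" if "k \<le> K" for k
    using False r0[OF that] rt[of "Suc k"] that unfolding e_def by auto
   then show ?thesis using False by simp
  qed
 qed
 also have "\<dots> = (\<Sum>k\<le>K. ennreal (rate p k \<omega>) * ennreal (e k - r k))"
  by (subst nn_integral_sum) (auto simp: nn_integral_cmult re simp del: indicator_simps intro!: sum.cong)
 also have "\<dots> = ennreal I"
 proof -
  have "(\<Sum>k\<le>K. ennreal (rate p k \<omega>) * ennreal (e k - r k)) = (\<Sum>k\<le>K. ennreal (rate p k \<omega> * (e k - r k)))"
   by (rule sum.cong[OF refl], rule ennreal_mult[symmetric]) (use rate_nonneg Km w re in auto)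
  also have "\<dots> = ennreal I" unfolding I_def by (rule sum_ennreal) (use nonneg in auto)
  finally show ?thesis .
 qed
 finally have int: "(\<integral>\<^sup>+s. ennreal (intensity par n ty p s \<omega>) * indicator {0..<t} s \<partial>lborel) = ennreal I" .
 have cons: "consumed (Suc k) \<omega> = rate p k \<omega> * (e k - r k)" if "k < K" for k
  unfolding consumed_def e_def using W[OF that] that by simp
 have "deviation K \<omega> = (\<Sum>j = 1..K. consumed j \<omega>) - (\<Sum>j = 1..K. active j \<omega>)"
  unfolding deviation_def by (rule sum_subtractf)
 also have "(\<Sum>j = 1..K. active j \<omega>) = (\<Sum>j = 1..K. 1)"
  by (rule sum.cong[OF refl]) (use rpos[of "j - 1" for j] in \<open>auto simp: active_def\<close>)
 also have "(\<Sum>j = 1..K. consumed j \<omega>) = (\<Sum>k<K. consumed (Suc k) \<omega>)"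
  using sum.shift_bounds_Suc_ivl[of "\<lambda>j. consumed j \<omega>" 0 K]
  by (simp add: atLeastLessThanSuc_atLeastAtMost atLeast0LessThan)
 also have "\<dots> = (\<Sum>k<K. rate p k \<omega> * (e k - r k))" by (rule sum.cong[OF refl]) (use cons in simp)
 finally have dK: "deviation K \<omega> = (\<Sum>k<K. rate p k \<omega> * (e k - r k)) - real K" by simp
 have I_eq: "I = deviation K \<omega> + real K + rate p K \<omega> * (t - r K)"
  unfolding I_def dK lessThan_Suc_atMost[symmetric] by (simp add: e_def)
 have lower: "deviation K \<omega> + real K \<le> I" unfolding I_eq using rK rt[of K] by simp
 have upper: "I \<le> real K + b + 1"
 proof (cases "rate p K \<omega> = 0")
  case True
  then show ?thesis unfolding I_eq using dev[OF Km] by simp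
 next
  case False
  have "K \<noteq> m" using False rate_last[OF g] Tr[of K] by auto
  then have K: "K < m" using Km by simp
  have fin: "wait p (Suc K) \<omega> < \<infinity>" using g K False rK unfolding good_def by auto
  have "0 \<le> wait p (Suc K) \<omega>" using wait_nonneg[OF K w] .
  then obtain v where v: "wait p (Suc K) \<omega> = ereal v" using fin by (cases "wait p (Suc K) \<omega>") auto
  have "\<not> T (Suc K) \<omega> \<le> ereal t" using le_num_iff[OF g _ t, of "Suc K"] K unfolding K_def by simp
  then have "t - r K \<le> v" unfolding T_Suc using Tr[of K] v by simp
  then have "rate p K \<omega> * (t - r K) \<le> consumed (Suc K) \<omega>"
   unfolding consumed_def using v rK by (simp add: mult_left_mono)
  moreover have "deviation (Suc K) \<omega> = deviation K \<omega> + consumed (Suc K) \<omega> - 1"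
   unfolding deviation_def using False rK by (simp add: active_def)
  ultimately have "I \<le> deviation (Suc K) \<omega> + real K + 1" unfolding I_eq by simp
  then show ?thesis using dev[of "Suc K"] K by auto
 qed
 have "\<bar>I - real K\<bar> \<le> b + 1" using lower upper dev[OF Km] by linarith
 then show ?thesis using int I0 unfolding K_def by blast
qed

end

section \<open>The joint law of the losses of a few agents\<close>

definition falling :: "real \<Rightarrow> nat \<Rightarrow> real" where
 "falling x k = (\<Prod>i<k. x - real i)"

lemma falling_0 [simp]: "falling x 0 = 1"
 by (simp add: falling_def)

lemma falling_Suc: "falling x (Suc k) = falling x k * (x - real k)"
 by (simp add: falling_def)

lemma falling_Suc_shift: "falling x (Suc k) = x * falling (x - 1) k"
 unfolding falling_def by (subst prod.lessThan_Suc_shift) (simp add: algebra_simps)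

lemma falling_pos: "k \<le> N \<Longrightarrow> 0 < falling (real N) k"
 unfolding falling_def by (intro prod_pos) auto

lemma falling_nonneg: "0 \<le> falling (real N) k"
proof (cases "k \<le> N")
 case False
 then have "falling (real N) k = 0" unfolding falling_def by (intro prod_zero) auto
 then show ?thesis by simp
qed (use falling_pos[of k N] in simp)

text \<open>
  Boxes generate the product \<open>\<sigma>\<close>-algebra and are closed under intersection, so a product
  formula on boxes extends to all measurable sets.
\<close>

lemma product_law_extension:
 assumes M: "finite_measure M" and J: "finite J" and N: "\<And>j. prob_space (N j)"
  and Y: "Y \<in> measurable M (PiM J N)" and E: "E \<in> sets M" and c: "0 \<le> c"
  and box: "\<And>A. (\<And>j. j \<in> J \<Longrightarrow> A j \<in> sets (N j)) \<Longrightarrow>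
   measure M (E \<inter> (Y -` Pi\<^sub>E J A \<inter> space M)) = c * (\<Prod>j\<in>J. measure (N j) (A j))"
  and D: "D \<in> sets (PiM J N)"
 shows "measure M (E \<inter> (Y -` D \<inter> space M)) = c * measure (PiM J N) D"
proof -
 interpret finite_measure M by fact
 interpret N: prob_space "N j" for j by (rule N)
 interpret P: product_prob_space N J by standard
 define Q where "Q = distr (density M (indicator E)) (PiM J N) Y"
 have Q: "emeasure Q C = ennreal (measure M (E \<inter> (Y -` C \<inter> space M)))" if "C \<in> sets (PiM J N)" for C
  unfolding Q_def using that Y E measurable_sets[OF Y that]
  by (simp add: emeasure_distr emeasure_restricted emeasure_eq_measure)
 have sQ: "sets Q = sets (PiM J N)" by (simp add: Q_def)
 show ?thesis
 proof (cases "c = 0")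
  case True
  have "measure M (E \<inter> (Y -` D \<inter> space M)) \<le> measure M (E \<inter> (Y -` Pi\<^sub>E J (\<lambda>j. space (N j)) \<inter> space M))"
  proof (rule finite_measure_mono)
   show "E \<inter> (Y -` D \<inter> space M) \<subseteq> E \<inter> (Y -` Pi\<^sub>E J (\<lambda>j. space (N j)) \<inter> space M)"
    using sets.sets_into_space[OF D] by (auto simp: space_PiM)
   show "E \<inter> (Y -` Pi\<^sub>E J (\<lambda>j. space (N j)) \<inter> space M) \<in> sets M"
    using sets.top[of "PiM J N"] by (intro sets.Int E measurable_sets[OF Y]) (simp add: space_PiM)
  qed
  also have "\<dots> = 0" using box[of "\<lambda>j. space (N j)"] True by simp
  finally show ?thesis using True by (simp add: measure_le_0_iff)
 next
  case False
  then have c: "0 < c" using c by simp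
  have "scale_measure (ennreal (1 / c)) Q = PiM J N"
  proof (rule P.PiM_eqI[OF J])
   show "sets (scale_measure (ennreal (1 / c)) Q) = sets (PiM J N)" by (simp add: sQ)
   fix A assume A: "\<And>j. j \<in> J \<Longrightarrow> A j \<in> sets (N j)"
   have "Pi\<^sub>E J A \<in> sets (PiM J N)" using A J by (intro sets_PiM_I_finite) auto
   then have "emeasure (scale_measure (ennreal (1 / c)) Q) (Pi\<^sub>E J A)
    = ennreal (1 / c) * ennreal (c * (\<Prod>j\<in>J. measure (N j) (A j)))"
    using A by (simp add: Q box)
   also have "\<dots> = ennreal (\<Prod>j\<in>J. measure (N j) (A j))"
    using c by (subst ennreal_mult[symmetric]) (auto intro!: prod_nonneg mult_nonneg_nonneg)
   also have "\<dots> = (\<Prod>j\<in>J. emeasure (N j) (A j))"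
    by (simp add: N.emeasure_eq_measure prod_ennreal)
   finally show "emeasure (scale_measure (ennreal (1 / c)) Q) (Pi\<^sub>E J A) = (\<Prod>j\<in>J. emeasure (N j) (A j))" .
  qed
  then have "emeasure (PiM J N) D = ennreal (1 / c) * ennreal (measure M (E \<inter> (Y -` D \<inter> space M)))"
   using Q[OF D] by (metis emeasure_scale_measure)
  also have "\<dots> = ennreal (measure M (E \<inter> (Y -` D \<inter> space M)) / c)"
   using c by (subst ennreal_mult[symmetric]) auto
  finally have "measure (PiM J N) D = measure M (E \<inter> (Y -` D \<inter> space M)) / c"
   using c by (simp add: measure_def)
  then show ?thesis using c by simp
 qed
qed

text \<open>
  The elements of a finite set of reveal numbers in increasing order, counted from 1.
\<close>

definition nth_pos :: "nat set \<Rightarrow> nat \<Rightarrow> nat" where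
 "nth_pos S j = sorted_list_of_set S ! (j - 1)"

lemma bij_nth_pos:
 assumes "finite S" shows "bij_betw (nth_pos S) {1..card S} S"
proof -
 have "bij_betw ((!) (sorted_list_of_set S)) {..<card S} S"
  using assms by (intro bij_betw_nth) auto
 moreover have "bij_betw (\<lambda>j. j - 1) {1..card S} {..<card S}"
  by (rule bij_betwI[where g = Suc]) auto
 ultimately have "bij_betw ((!) (sorted_list_of_set S) \<circ> (\<lambda>j. j - 1)) {1..card S} S"
  by (intro bij_betw_trans)
 then show ?thesis by (simp add: nth_pos_def[abs_def] comp_def)
qed

lemma nth_pos_in:
 assumes "finite S" "j \<in> {1..card S}" shows "nth_pos S j \<in> S"
 using bij_betwE[OF bij_nth_pos[OF assms(1)]] assms(2) by (rule bspec)

text \<open>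
  Index 0 carries the shock, the other indices the losses in the order of their arrival.
\<close>

definition class_law :: "agent_class \<Rightarrow> nat \<Rightarrow> real measure" where
 "class_law a j = (if j = 0 then shock_law a else loss_law a)"

definition agent_law :: "agent_class \<Rightarrow> nat \<Rightarrow> (nat \<Rightarrow> real) measure" where
 "agent_law a \<theta> = PiM {0..\<theta>} (class_law a)"

lemma sets_class_law [measurable_cong, simp]: "sets (class_law a j) = sets borel"
 by (simp add: class_law_def shock_law_def loss_law_def)

lemma prob_space_class_law: "valid_class a \<Longrightarrow> prob_space (class_law a j)"
 by (simp add: class_law_def valid_class_def)

lemma prob_space_agent_law: "valid_class a \<Longrightarrow> prob_space (agent_law a \<theta>)"
 unfolding agent_law_def by (rule prob_space_PiM) (rule prob_space_class_law)

context network begin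

abbreviation "indeg i \<equiv> d_in (par (ty i))"

text \<open>
  Agents are numbered from 1, so 0 can stand for every agent outside \<open>I\<close>.
\<close>

definition owner :: "nat set \<Rightarrow> nat \<Rightarrow> 'w \<Rightarrow> nat" where
 "owner I k \<omega> = (if fst (in_edge p k \<omega>) \<in> I then fst (in_edge p k \<omega>) else 0)"

definition pattern :: "nat set \<Rightarrow> (nat \<Rightarrow> nat) \<Rightarrow> (nat \<Rightarrow> real set) \<Rightarrow> nat \<Rightarrow> 'w set" where
 "pattern I col B K = {\<omega> \<in> space M. \<forall>k\<in>{1..K}. owner I k \<omega> = col k \<and> loss p k \<omega> \<in> B k}"

lemma pattern_hist:
 assumes "K \<le> m" "\<And>k. B k \<in> sets borel"
 shows "pattern I col B K \<in> sets (hist p K)"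
proof -
 have s: "{\<omega> \<in> space (hist p K). owner I k \<omega> = col k \<and> loss p k \<omega> \<in> B k} \<in> sets (hist p K)"
  if "k \<in> {1..K}" for k
 proof -
  have [measurable]: "in_edge p k \<in> measurable (hist p K) (count_space UNIV)"
   "loss p k \<in> borel_measurable (hist p K)" "B k \<in> sets borel"
   using in_hist'[of k K] loss_hist'[of k K] that assms by auto
  have [measurable]: "(\<lambda>\<omega>. owner I k \<omega>) \<in> measurable (hist p K) (count_space UNIV)"
   unfolding owner_def
   by (rule measurable_compose[where g = "\<lambda>h. if fst h \<in> I then fst h else 0" and N = "count_space UNIV"]) auto
  show ?thesis by measurable
 qed
 have "{\<omega> \<in> space (hist p K). \<forall>k\<in>{1..K}. owner I k \<omega> = col k \<and> loss p k \<omega> \<in> B k} \<in> sets (hist p K)"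
  by (rule sets.sets_Collect_finite_All) (use s in auto)
 then show ?thesis unfolding pattern_def by simp
qed

lemma card_edges_of: "i \<in> {1..n} \<Longrightarrow> card {h \<in> H. fst h = i} = indeg i"
proof -
 assume "i \<in> {1..n}"
 then have "{h \<in> H. fst h = i} = (\<lambda>j. (i, j)) ` {1..indeg i}"
  by (auto simp: in_edges_def)
 then show ?thesis by (simp add: card_image inj_on_def)
qed

lemma card_edges_of_set:
 assumes "I \<subseteq> {1..n}" shows "card {h \<in> H. fst h \<in> I} = (\<Sum>i\<in>I. indeg i)"
proof -
 have fI: "finite I" using assms by (rule finite_subset) simp
 have "{h \<in> H. fst h \<in> I} = (\<Union>i\<in>I. {h \<in> H. fst h = i})" by auto
 then have "card {h \<in> H. fst h \<in> I} = (\<Sum>i\<in>I. card {h \<in> H. fst h = i})"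
  by (simp only:) (rule card_UN_disjoint, use fI finite_H in auto)
 also have "\<dots> = (\<Sum>i\<in>I. indeg i)" using assms card_edges_of by (intro sum.cong) auto
 finally show ?thesis .
qed

lemma sum_indeg_le: "I \<subseteq> {1..n} \<Longrightarrow> (\<Sum>i\<in>I. indeg i) \<le> m"
 using card_mono[OF finite_H, of "{h \<in> H. fst h \<in> I}"] card_edges_of_set[of I] by auto

text \<open>
  Among the \<open>m - K\<close> remaining half-edges, those of an owner are its half-edges minus the ones
  drawn so far.
\<close>

lemma pattern_step:
 assumes I: "I \<subseteq> {1..n}" and K: "K < m" and B: "\<And>k. B k \<in> sets borel"
  and c: "col (Suc K) \<in> insert 0 I" and B0: "col (Suc K) = 0 \<Longrightarrow> B (Suc K) = UNIV"
  and A: "A \<in> sets (hist p 0)"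
 defines "Hc \<equiv> {h \<in> H. (if fst h \<in> I then fst h else 0) = col (Suc K)}"
 shows "measure M (A \<inter> pattern I col B (Suc K))
  = measure M (A \<inter> pattern I col B K)
   * (if col (Suc K) = 0 then 1 else measure (llaw (col (Suc K))) (B (Suc K)))
   * (real (card Hc) - real (card {k \<in> {1..K}. col k = col (Suc K)})) / real (m - K)"
proof -
 define c where "c = col (Suc K)"
 define G where "G = A \<inter> pattern I col B K"
 define nu where "nu = (if c = 0 then 1 else measure (llaw c) (B (Suc K)))"
 define rem where "rem = real (card Hc) - real (card {k \<in> {1..K}. col k = c})"
 define F where "F h = {\<omega> \<in> space M. h \<notin> earlier K \<omega>}" for h
 define S where "S h = {\<omega> \<in> space M. in_edge p (Suc K) \<omega> = h \<and> loss p (Suc K) \<omega> \<in> B (Suc K)}" for h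
 have finHc: "finite Hc" unfolding Hc_def using finite_H by simp
 have GH: "G \<in> sets (hist p K)" unfolding G_def
  by (intro sets.Int hist_mono[OF _ A] pattern_hist B) (use K in auto)
 have GM: "G \<in> sets M" by (rule hist_M[OF GH])
 have FM: "F h \<in> sets M" for h unfolding F_def by (rule hist_M[OF not_earlier_hist]) (use K in simp)
 have SM: "S h \<in> sets M" for h unfolding S_def by (rule step_set_M(2)[OF K B])
 have "A \<inter> pattern I col B (Suc K) \<in> sets M"
  by (intro sets.Int hist_M[OF A] hist_M[OF pattern_hist] B) (use K in auto)
 then have "measure M (A \<inter> pattern I col B (Suc K)) = measure M (\<Union>h\<in>Hc. G \<inter> S h)"
 proof (rule finite_measure_eq_AE[rotated])
  show "(\<Union>h\<in>Hc. G \<inter> S h) \<in> sets M" using finHc GM SM by blast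
  show "AE \<omega> in M. (\<omega> \<in> A \<inter> pattern I col B (Suc K)) \<longleftrightarrow> (\<omega> \<in> (\<Union>h\<in>Hc. G \<inter> S h))"
   using step_fresh[OF K]
  proof eventually_elim
   case (elim \<omega>)
   have "(\<forall>k\<in>{1..Suc K}. owner I k \<omega> = col k \<and> loss p k \<omega> \<in> B k) \<longleftrightarrow>
    (\<forall>k\<in>{1..K}. owner I k \<omega> = col k \<and> loss p k \<omega> \<in> B k) \<and>
    owner I (Suc K) \<omega> = c \<and> loss p (Suc K) \<omega> \<in> B (Suc K)"
    unfolding c_def by (subst atLeastAtMostSuc_conv) auto
   then show ?case using elim unfolding pattern_def G_def S_def Hc_def owner_def c_def
    by auto
  qed
 qed
 also have "\<dots> = (\<Sum>h\<in>Hc. measure M (G \<inter> S h))"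
  by (rule finite_measure_finite_Union) (use GM SM finHc in \<open>auto simp: disjoint_family_on_def S_def\<close>)
 also have "\<dots> = (\<Sum>h\<in>Hc. measure M (G \<inter> F h) / real (m - K) * nu)"
 proof (rule sum.cong[OF refl])
  fix h assume h: "h \<in> Hc"
  then have hH: "h \<in> H" unfolding Hc_def by simp
  interpret L: real_distribution "llaw (fst h)" by (rule real_distribution_llaw[OF fst_H[OF hH]])
  have "measure (llaw (fst h)) (B (Suc K)) = nu"
  proof (cases "c = 0")
   case True
   then show ?thesis using B0 L.prob_space by (simp add: nu_def c_def)
  next
   case False
   then have "fst h = c" using h unfolding Hc_def c_def by (auto split: if_splits)
   then show ?thesis using False by (simp add: nu_def)
  qed
  then show "measure M (G \<inter> S h) = measure M (G \<inter> F h) / real (m - K) * nu"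
   unfolding S_def F_def using step_loss_law[OF K hH GH B, of "Suc K"] by simp
 qed
 also have "\<dots> = (\<Sum>h\<in>Hc. measure M (G \<inter> F h)) * nu / real (m - K)"
  by (simp add: sum_distrib_right sum_divide_distrib)
 also have "(\<Sum>h\<in>Hc. measure M (G \<inter> F h)) = (LINT \<omega>|M. (\<Sum>h\<in>Hc. indicator (G \<inter> F h) \<omega>))"
  using GM FM by (subst Bochner_Integration.integral_sum)
   (auto simp: less_top[symmetric] sets.Int_space_eq2)
 also have "\<dots> = (LINT \<omega>|M. rem * indicator G \<omega>)"
 proof (rule integral_cong_AE)
  show "AE \<omega> in M. (\<Sum>h\<in>Hc. indicator (G \<inter> F h) \<omega>) = rem * indicator G \<omega>"
   using AE_proper_edges AE_space
  proof eventually_elim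
   case (elim \<omega>)
   show ?case
   proof (cases "\<omega> \<in> G")
    case True
    have pr: "inj_on (\<lambda>k. in_edge p k \<omega>) {1..m}" "(\<lambda>k. in_edge p k \<omega>) ` {1..m} \<subseteq> H"
     using elim unfolding proper_edges_def by auto
    have own: "owner I k \<omega> = col k" if "k \<in> {1..K}" for k
     using True that unfolding G_def pattern_def by auto
    have img: "earlier K \<omega> \<inter> Hc = (\<lambda>k. in_edge p k \<omega>) ` {k \<in> {1..K}. col k = c}"
    proof -
     have "in_edge p k \<omega> \<in> H" if "k \<in> {1..K}" for k using pr(2) that K by auto
     then have "in_edge p k \<omega> \<in> Hc \<longleftrightarrow> col k = c" if "k \<in> {1..K}" for k
      using own[OF that] that unfolding Hc_def c_def owner_def by (auto split: if_splits)
     then show ?thesis by blast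
    qed
    have cnt: "card (earlier K \<omega> \<inter> Hc) = card {k \<in> {1..K}. col k = c}"
     unfolding img using K by (intro card_image inj_on_subset[OF pr(1)]) auto
    have "(\<Sum>h\<in>Hc. indicator (G \<inter> F h) \<omega>) = (\<Sum>h\<in>Hc. if h \<in> Hc - earlier K \<omega> then 1 else 0 :: real)"
     by (rule sum.cong) (use True elim in \<open>auto simp: F_def indicator_def\<close>)
    also have "\<dots> = real (card (Hc - earlier K \<omega>))"
     by (subst sum.inter_restrict[symmetric]) (simp_all add: finHc Int_absorb1 Diff_subset)
    also have "card (Hc - earlier K \<omega>) = card Hc - card (earlier K \<omega> \<inter> Hc)"
     using finHc by (subst card_Diff_subset_Int) (auto simp: Int_commute)
    also have "real \<dots> = rem"
     unfolding rem_def cnt[symmetric] using card_mono[OF finHc, of "earlier K \<omega> \<inter> Hc"]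
     by (simp add: of_nat_diff)
    finally show ?thesis using True by simp
   qed simp
  qed
  show "(\<lambda>\<omega>. \<Sum>h\<in>Hc. indicator (G \<inter> F h) \<omega> :: real) \<in> borel_measurable M"
   by (intro borel_measurable_sum borel_measurable_indicator sets.Int GM FM)
  show "(\<lambda>\<omega>. rem * indicator G \<omega>) \<in> borel_measurable M"
   by (intro borel_measurable_times borel_measurable_indicator GM borel_measurable_const)
 qed
 also have "\<dots> = rem * measure M G" using GM by (simp add: sets.Int_space_eq2)
 finally show ?thesis unfolding G_def nu_def rem_def c_def by (simp add: mult_ac)
qed

text \<open>
  The chain rule along the steps: the numerators of the successive conditional probabilities are
  collected owner by owner into falling factorials.
\<close>

lemma pattern_prob:
 assumes I: "I \<subseteq> {1..n}" and K: "K \<le> m" and B: "\<And>k. B k \<in> sets borel"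
  and col: "\<And>k. col k \<in> insert 0 I" and B0: "\<And>k. col k = 0 \<Longrightarrow> B k = UNIV"
  and cnt: "\<And>i. i \<in> I \<Longrightarrow> card {k \<in> {1..K}. col k = i} \<le> indeg i"
  and A: "A \<in> sets (hist p 0)"
 defines "D \<equiv> \<Sum>i\<in>I. indeg i"
 shows "measure M (A \<inter> pattern I col B K)
  = measure M A * (\<Prod>k | k \<in> {1..K} \<and> col k \<noteq> 0. measure (llaw (col k)) (B k))
   * ((\<Prod>i\<in>I. falling (real (indeg i)) (card {k \<in> {1..K}. col k = i}))
     * falling (real (m - K)) (D - card {k \<in> {1..K}. col k \<noteq> 0}) / falling (real m) D)"
 using K cnt
proof (induction K)
 case 0
 have "A \<subseteq> space M" using sets.sets_into_space[OF hist_M[OF A]] .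
 then have "A \<inter> pattern I col B 0 = A" unfolding pattern_def by auto
 moreover have "falling (real m) D > 0" unfolding D_def by (rule falling_pos[OF sum_indeg_le[OF I]])
 ultimately show ?case by simp
next
 case (Suc K)
 have fI: "finite I" using I by (rule finite_subset) simp
 have I0: "0 \<notin> I" using I by auto
 define c where "c = col (Suc K)"
 define r where "r i = card {k \<in> {1..K}. col k = i}" for i
 define R where "R = card {k \<in> {1..K}. col k \<noteq> 0}"
 have Km: "K < m" using Suc.prems by simp
 have ins: "{k \<in> {1..Suc K}. P k} = (if P (Suc K) then insert (Suc K) {k \<in> {1..K}. P k} else {k \<in> {1..K}. P k})" for P
  by (auto simp: le_Suc_eq)
 have rS: "card {k \<in> {1..Suc K}. col k = i} = (if i = c then Suc (r i) else r i)" for i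
  unfolding ins r_def c_def by auto
 have RS: "card {k \<in> {1..Suc K}. col k \<noteq> 0} = (if c = 0 then R else Suc R)"
  unfolding ins R_def c_def by auto
 have Rsum: "card {k \<in> {1..L}. col k \<noteq> 0} = (\<Sum>i\<in>I. card {k \<in> {1..L}. col k = i})" for L
 proof -
  have "col k \<noteq> 0 \<longleftrightarrow> col k \<in> I" for k using col[of k] I0 by (metis insert_iff)
  then have "{k \<in> {1..L}. col k \<noteq> 0} = (\<Union>i\<in>I. {k \<in> {1..L}. col k = i})" by auto
  then show ?thesis by (simp only:) (rule card_UN_disjoint, use fI in auto)
 qed
 have RD: "card {k \<in> {1..Suc K}. col k \<noteq> 0} \<le> D"
  unfolding Rsum D_def by (rule sum_mono) (use Suc.prems in simp)
 have IH: "measure M (A \<inter> pattern I col B K)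
  = measure M A * (\<Prod>k | k \<in> {1..K} \<and> col k \<noteq> 0. measure (llaw (col k)) (B k))
   * ((\<Prod>i\<in>I. falling (real (indeg i)) (r i)) * falling (real (m - K)) (D - R) / falling (real m) D)"
  unfolding r_def R_def
 proof (rule Suc.IH)
  show "K \<le> m" using Km by simp
  fix i assume "i \<in> I"
  then have "card {k \<in> {1..Suc K}. col k = i} \<le> indeg i" using Suc.prems by simp
  then show "card {k \<in> {1..K}. col k = i} \<le> indeg i" unfolding rS r_def by (auto split: if_splits)
 qed
 define Hc where "Hc = {h \<in> H. (if fst h \<in> I then fst h else 0) = c}"
 define L where "L K = (\<Prod>k | k \<in> {1..K} \<and> col k \<noteq> 0. measure (llaw (col k)) (B k))" for K
 define W where "W = (\<Prod>i\<in>I. falling (real (indeg i)) (r i))"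
 define W' where "W' = (\<Prod>i\<in>I. falling (real (indeg i)) (card {k \<in> {1..Suc K}. col k = i}))"
 have LS: "L (Suc K) = L K * (if c = 0 then 1 else measure (llaw c) (B (Suc K)))"
 proof -
  have e: "{k. k \<in> {1..Suc K} \<and> col k \<noteq> 0} =
   (if c \<noteq> 0 then insert (Suc K) {k. k \<in> {1..K} \<and> col k \<noteq> 0} else {k. k \<in> {1..K} \<and> col k \<noteq> 0})"
   unfolding c_def by (auto simp: le_Suc_eq)
  show ?thesis unfolding L_def e c_def by (auto simp: mult.commute)
 qed
 have mK: "real (m - Suc K) = real (m - K) - 1" using Km by simp
 have key: "W * falling (real (m - K)) (D - R) * (real (card Hc) - real (r c))
  = W' * falling (real (m - Suc K)) (D - card {k \<in> {1..Suc K}. col k \<noteq> 0}) * real (m - K)"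
 proof (cases "c = 0")
  case False
  then have cI: "c \<in> I" using col[of "Suc K"] unfolding c_def by auto
  have Hc: "Hc = {h \<in> H. fst h = c}" unfolding Hc_def using cI False by auto
  have cH: "card Hc = indeg c" unfolding Hc by (rule card_edges_of) (use cI I in auto)
  have W': "W' = W * (real (indeg c) - real (r c))"
  proof -
   have "W' = falling (real (indeg c)) (Suc (r c)) * (\<Prod>i\<in>I - {c}. falling (real (indeg i)) (r i))"
    unfolding W'_def rS using fI cI by (subst prod.remove[of I c]) auto
   moreover have "W = falling (real (indeg c)) (r c) * (\<Prod>i\<in>I - {c}. falling (real (indeg i)) (r i))"
    unfolding W_def by (rule prod.remove[OF fI cI])
   ultimately show ?thesis by (simp add: falling_Suc)
  qed
  have "D - R = Suc (D - card {k \<in> {1..Suc K}. col k \<noteq> 0})" using RD False unfolding RS by simp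
  then show ?thesis unfolding W' cH mK by (simp add: falling_Suc_shift)
 next
  case True
  have HcI: "Hc = H - {h \<in> H. fst h \<in> I}" unfolding Hc_def True using I0 by auto
  have "card Hc = m - D" unfolding HcI D_def using finite_H
   by (subst card_Diff_subset) (auto simp: card_edges_of_set[OF I])
  then have cH: "real (card Hc) = real m - real D"
   using sum_indeg_le[OF I] unfolding D_def by (simp add: of_nat_diff)
  have W': "W' = W" unfolding W'_def W_def rS True using I0 by (intro prod.cong) auto
  have "R + r 0 = card ({k \<in> {1..K}. col k \<noteq> 0} \<union> {k \<in> {1..K}. col k = 0})"
   unfolding R_def r_def by (subst card_Un_disjoint) auto
  also have "{k \<in> {1..K}. col k \<noteq> 0} \<union> {k \<in> {1..K}. col k = 0} = {1..K}" by auto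
  finally have r0: "real (r 0) = real K - real R" by simp
  have RD': "R \<le> D" using RD True unfolding RS by simp
  have "real (card Hc) - real (r c) = real (m - K) - real (D - R)"
   unfolding cH True r0 using RD' Km by (simp add: of_nat_diff)
  then have "falling (real (m - K)) (D - R) * (real (card Hc) - real (r c)) = falling (real (m - K)) (Suc (D - R))"
   by (simp add: falling_Suc)
  then show ?thesis unfolding W' RS mK using True by (simp add: falling_Suc_shift)
 qed
 have "measure M (A \<inter> pattern I col B (Suc K))
  = measure M (A \<inter> pattern I col B K) * (if c = 0 then 1 else measure (llaw c) (B (Suc K)))
   * (real (card Hc) - real (r c)) / real (m - K)"
  unfolding Hc_def r_def c_def using I Km B col B0 A by (intro pattern_step)
 also have "\<dots> = measure M A * L (Suc K) * ((W * falling (real (m - K)) (D - R) * (real (card Hc) - real (r c)))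
   / real (m - K) / falling (real m) D)"
  unfolding IH LS L_def[symmetric] W_def[symmetric] by (simp add: mult_ac)
 also have "\<dots> = measure M A * L (Suc K) * (W' * falling (real (m - Suc K)) (D - card {k \<in> {1..Suc K}. col k \<noteq> 0})
   / falling (real m) D)"
  unfolding key using Km by simp
 finally show ?case unfolding L_def W'_def .
qed

end

section \<open>A weak law of large numbers for agents\<close>

text \<open>
  The probability that the reveals up to number \<open>K\<close> hit a given agent with \<open>d\<close> incoming
  half-edges exactly at a prescribed set of \<open>\<theta>\<close> positions.
\<close>

definition weight1 :: "nat \<Rightarrow> nat \<Rightarrow> nat \<Rightarrow> nat \<Rightarrow> real" where
 "weight1 m d K \<theta> = falling (real d) \<theta> * falling (real (m - K)) (d - \<theta>) / falling (real m) d"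

text \<open>
  The same for two agents and two disjoint sets of \<open>\<theta>\<close> positions each.
\<close>

definition weight2 :: "nat \<Rightarrow> nat \<Rightarrow> nat \<Rightarrow> nat \<Rightarrow> real" where
 "weight2 m d K \<theta> = (falling (real d) \<theta>)\<^sup>2 * falling (real (m - K)) (2 * d - 2 * \<theta>) / falling (real m) (2 * d)"

definition subsets_of_size :: "nat \<Rightarrow> nat \<Rightarrow> nat set set" where
 "subsets_of_size \<theta> K = {S. S \<subseteq> {1..K} \<and> card S = \<theta>}"

abbreviation "positions n S \<equiv> \<lambda>j. real (nth_pos S j) / real n"
abbreviation "subset_sum a \<theta> K D \<equiv> \<Sum>S\<in>subsets_of_size \<theta> K. measure (agent_law a \<theta>) (D S)"

lemma finite_subsets_of_size [simp]: "finite (subsets_of_size \<theta> K)"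
 unfolding subsets_of_size_def by (rule finite_subset[of _ "Pow {1..K}"]) auto

context network begin

definition arrivals :: "nat \<Rightarrow> nat \<Rightarrow> 'w \<Rightarrow> nat set" where
 "arrivals i K \<omega> = {k \<in> {1..K}. fst (in_edge p k \<omega>) = i}"

definition agent_vec :: "nat \<Rightarrow> nat set \<Rightarrow> 'w \<Rightarrow> nat \<Rightarrow> real" where
 "agent_vec i S \<omega> = (\<lambda>j\<in>{0..card S}. if j = 0 then shock p i \<omega> else loss p (nth_pos S j) \<omega>)"

abbreviation "alaw i \<equiv> agent_law (par (ty i))"

lemma agent_vec_M:
 assumes "i \<in> {1..n}" "S \<subseteq> {1..K}" "K \<le> m"
 shows "agent_vec i S \<in> measurable M (alaw i (card S))"
 unfolding agent_vec_def agent_law_def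
proof (rule measurable_restrict)
 have fS: "finite S" using assms(2) by (rule finite_subset) simp
 fix j assume j: "j \<in> {0..card S}"
 show "(\<lambda>\<omega>. if j = 0 then shock p i \<omega> else loss p (nth_pos S j) \<omega>)
  \<in> measurable M (class_law (par (ty i)) j)"
 proof (cases "j = 0")
  case True
  have "shock p i \<in> borel_measurable M" by (rule shock_M[OF assms(1)])
  then show ?thesis using True by (simp cong: measurable_cong_sets)
 next
  case False
  then have "nth_pos S j \<in> {1..m}" using nth_pos_in[OF fS, of j] j assms by auto
  from loss_M[OF this] show ?thesis using False by (simp cong: measurable_cong_sets)
 qed
qed

lemma arrivals_M:
 assumes "S \<subseteq> {1..K}" "K \<le> m"
 shows "{\<omega> \<in> space M. arrivals i K \<omega> = S} \<in> sets M"
proof -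
 have s: "{\<omega> \<in> space M. (fst (in_edge p k \<omega>) = i) = (k \<in> S)} \<in> sets M" if "k \<in> {1..K}" for k
 proof -
  have "in_edge p k \<in> measurable M (count_space UNIV)" using in_M[of k] that assms by auto
  from measurable_sets[OF this, of "{h. (fst h = i) = (k \<in> S)}"]
  show ?thesis by (simp add: vimage_def Int_def conj_commute)
 qed
 have "{\<omega> \<in> space M. arrivals i K \<omega> = S} = {\<omega> \<in> space M. \<forall>k\<in>{1..K}. (fst (in_edge p k \<omega>) = i) = (k \<in> S)}"
  unfolding arrivals_def using assms(1) by blast
 also have "\<dots> \<in> sets M" by (rule sets.sets_Collect_finite_All) (use s in auto)
 finally show ?thesis .
qed

lemma arrivals_vec_M:
 assumes "i \<in> {1..n}" "S \<subseteq> {1..K}" "K \<le> m" "D \<in> sets (alaw i (card S))"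
 shows "{\<omega> \<in> space M. arrivals i K \<omega> = S \<and> agent_vec i S \<omega> \<in> D} \<in> sets M"
proof -
 have "{\<omega> \<in> space M. arrivals i K \<omega> = S} \<inter> (agent_vec i S -` D \<inter> space M) \<in> sets M"
  by (intro sets.Int arrivals_M assms(2,3) measurable_sets[OF agent_vec_M[OF assms(1-3)] assms(4)])
 also have "{\<omega> \<in> space M. arrivals i K \<omega> = S} \<inter> (agent_vec i S -` D \<inter> space M)
  = {\<omega> \<in> space M. arrivals i K \<omega> = S \<and> agent_vec i S \<omega> \<in> D}" by auto
 finally show ?thesis .
qed

lemma shock_box:
 assumes I: "I \<subseteq> {1..n}" "I \<noteq> {}" and B: "\<And>i. i \<in> I \<Longrightarrow> B i \<in> sets borel"
 shows "{\<omega> \<in> space M. \<forall>i\<in>I. shock p i \<omega> \<in> B i} \<in> sets (hist p 0)"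
  and "measure M {\<omega> \<in> space M. \<forall>i\<in>I. shock p i \<omega> \<in> B i} = (\<Prod>i\<in>I. measure (slaw i) (B i))"
proof -
 have fI: "finite I" using I(1) by (rule finite_subset) simp
 have s: "{\<omega> \<in> space (hist p 0). shock p i \<omega> \<in> B i} \<in> sets (hist p 0)" if "i \<in> I" for i
 proof -
  have [measurable]: "shock p i \<in> borel_measurable (hist p 0)" "B i \<in> sets borel"
   using shock_hist I B that by auto
  show ?thesis by measurable
 qed
 have "{\<omega> \<in> space (hist p 0). \<forall>i\<in>I. shock p i \<omega> \<in> B i} \<in> sets (hist p 0)"
  by (rule sets.sets_Collect_finite_All) (use s fI in auto)
 then show "{\<omega> \<in> space M. \<forall>i\<in>I. shock p i \<omega> \<in> B i} \<in> sets (hist p 0)" by simp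
 have "indep_vars (\<lambda>_. borel) (shock p) I" by (rule indep_vars_subset[OF shock_indep I(1)])
 from indep_varsD[OF this I(2) fI order_refl, of B]
 have "measure M (\<Inter>i\<in>I. shock p i -` B i \<inter> space M) = (\<Prod>i\<in>I. measure M (shock p i -` B i \<inter> space M))"
  using B by simp
 also have "(\<Inter>i\<in>I. shock p i -` B i \<inter> space M) = {\<omega> \<in> space M. \<forall>i\<in>I. shock p i \<omega> \<in> B i}"
  using I(2) by auto
 also have "(\<Prod>i\<in>I. measure M (shock p i -` B i \<inter> space M)) = (\<Prod>i\<in>I. measure (slaw i) (B i))"
 proof (rule prod.cong[OF refl])
  fix i assume "i \<in> I"
  then show "measure M (shock p i -` B i \<inter> space M) = measure (slaw i) (B i)"
   using shock_distr[of i] shock_M[of i] B[of i] I measure_distr[of "shock p i" M borel "B i"] by auto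
 qed
 finally show "measure M {\<omega> \<in> space M. \<forall>i\<in>I. shock p i \<omega> \<in> B i} = (\<Prod>i\<in>I. measure (slaw i) (B i))" .
qed

text \<open>
  Given the positions, which are determined by the matching, the shocks and losses are
  independent with their own laws. Splitting the losses by position turns the event into a
  \<open>pattern\<close>.
\<close>

lemma agents_box:
 assumes I: "I \<subseteq> {1..n}" "I \<noteq> {}" and K: "K \<le> m"
  and S: "\<And>i. i \<in> I \<Longrightarrow> S i \<subseteq> {1..K}" "\<And>i. i \<in> I \<Longrightarrow> card (S i) \<le> indeg i" "disjoint_family_on S I"
  and A: "\<And>i j. i \<in> I \<Longrightarrow> j \<in> {0..card (S i)} \<Longrightarrow> A i j \<in> sets borel"
 defines "D \<equiv> \<Sum>i\<in>I. indeg i"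
 shows "measure M {\<omega> \<in> space M. \<forall>i\<in>I. arrivals i K \<omega> = S i \<and> agent_vec i (S i) \<omega> \<in> Pi\<^sub>E {0..card (S i)} (A i)}
  = (\<Prod>i\<in>I. falling (real (indeg i)) (card (S i)))
     * falling (real (m - K)) (D - (\<Sum>i\<in>I. card (S i))) / falling (real m) D
    * (\<Prod>i\<in>I. \<Prod>j\<in>{0..card (S i)}. measure (class_law (par (ty i)) j) (A i j))"
proof -
 have fI: "finite I" using I(1) by (rule finite_subset) simp
 have I0: "0 \<notin> I" using I by auto
 have fS: "finite (S i)" if "i \<in> I" for i using S(1)[OF that] by (rule finite_subset) simp
 \<comment> \<open>The owner prescribed for reveal \<open>k\<close>, or 0.\<close>
 define col where "col k = (if \<exists>i\<in>I. k \<in> S i then THE i. i \<in> I \<and> k \<in> S i else 0)" for k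
 have col_in: "col k = i" if "i \<in> I" "k \<in> S i" for i k
 proof -
  have "(THE i. i \<in> I \<and> k \<in> S i) = i"
   by (rule the_equality) (use that S(3) in \<open>auto simp: disjoint_family_on_def\<close>)
  then show ?thesis unfolding col_def using that by auto
 qed
 have col_iff: "col k = i \<longleftrightarrow> k \<in> S i" if "i \<in> I" for i k
 proof
  assume "col k = i"
  then have "\<exists>i\<in>I. k \<in> S i" using that I0 unfolding col_def by (auto split: if_splits)
  then obtain i' where i': "i' \<in> I" "k \<in> S i'" by blast
  then have "col k = i'" by (rule col_in)
  then show "k \<in> S i" using i' \<open>col k = i\<close> by simp
 qed (use col_in that in auto)
 have col_range: "col k \<in> insert 0 I" for k
 proof (cases "\<exists>i\<in>I. k \<in> S i")
  case True
  then obtain i where "i \<in> I" "k \<in> S i" by blast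
  then show ?thesis using col_in by auto
 qed (simp add: col_def)
 have col_S: "{k \<in> {1..K}. col k = i} = S i" if "i \<in> I" for i using col_iff[OF that] S(1)[OF that] by auto
 have cnt: "card {k \<in> {1..K}. col k = i} \<le> indeg i" if "i \<in> I" for i
  unfolding col_S[OF that] by (rule S(2)[OF that])
 have col_ne: "{k. k \<in> {1..K} \<and> col k \<noteq> 0} = (\<Union>i\<in>I. S i)"
 proof (intro set_eqI iffI)
  fix k assume "k \<in> {k. k \<in> {1..K} \<and> col k \<noteq> 0}"
  then have "col k \<in> I" using col_range[of k] by simp
  then show "k \<in> (\<Union>i\<in>I. S i)" using col_iff by blast
 next
  fix k assume "k \<in> (\<Union>i\<in>I. S i)"
  then obtain i where i: "i \<in> I" "k \<in> S i" by blast
  have "col k = i" by (rule col_in[OF i])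
  moreover have "i \<noteq> 0" using i I0 by metis
  moreover have "k \<in> {1..K}" using i S(1)[OF i(1)] by blast
  ultimately show "k \<in> {k. k \<in> {1..K} \<and> col k \<noteq> 0}" by simp
 qed
 define idx where "idx T k = the_inv_into {1..card T} (nth_pos T) k" for T k
 have idx_nth: "idx (S i) (nth_pos (S i) j) = j" if "i \<in> I" "j \<in> {1..card (S i)}" for i j
  unfolding idx_def by (rule the_inv_into_f_f) (use bij_nth_pos[OF fS[OF that(1)]] that in \<open>auto simp: bij_betw_def\<close>)
 have nth_ex: "\<exists>j\<in>{1..card (S i)}. k = nth_pos (S i) j" if "i \<in> I" "k \<in> S i" for i k
  using bij_nth_pos[OF fS[OF that(1)]] that by (auto simp: bij_betw_def)
 define B where "B k = (if col k = 0 then UNIV else A (col k) (idx (S (col k)) k))" for k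
 have B_nth: "B (nth_pos (S i) j) = A i j" if "i \<in> I" "j \<in> {1..card (S i)}" for i j
  using col_in[OF that(1) nth_pos_in[OF fS[OF that(1)] that(2)]] idx_nth[OF that] that(1) I0 unfolding B_def by auto
 have Bborel: "B k \<in> sets borel" for k
 proof (cases "col k = 0")
  case False
  then have i: "col k \<in> I" using col_range[of k] by simp
  then have "k \<in> S (col k)" using col_iff by blast
  then obtain j where "j \<in> {1..card (S (col k))}" "k = nth_pos (S (col k)) j" using nth_ex[OF i] by blast
  then show ?thesis using B_nth[OF i] A[OF i, of j] by (metis atLeastAtMost_iff le0)
 qed (simp add: B_def)
 define Sh where "Sh = {\<omega> \<in> space M. \<forall>i\<in>I. shock p i \<omega> \<in> A i 0}"
 have Sh: "Sh \<in> sets (hist p 0)" "measure M Sh = (\<Prod>i\<in>I. measure (slaw i) (A i 0))"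
  unfolding Sh_def using shock_box[OF I, of "\<lambda>i. A i 0"] A by auto
 have "{\<omega> \<in> space M. \<forall>i\<in>I. arrivals i K \<omega> = S i \<and> agent_vec i (S i) \<omega> \<in> Pi\<^sub>E {0..card (S i)} (A i)}
  = Sh \<inter> pattern I col B K"
 proof (intro set_eqI)
  fix \<omega>
  have 1: "(\<forall>i\<in>I. arrivals i K \<omega> = S i) \<longleftrightarrow> (\<forall>k\<in>{1..K}. owner I k \<omega> = col k)"
  proof
   assume a: "\<forall>i\<in>I. arrivals i K \<omega> = S i"
   show "\<forall>k\<in>{1..K}. owner I k \<omega> = col k"
   proof
    fix k assume k: "k \<in> {1..K}"
    show "owner I k \<omega> = col k"
    proof (cases "fst (in_edge p k \<omega>) \<in> I")
     case True
     then have "k \<in> S (fst (in_edge p k \<omega>))" using a k unfolding arrivals_def by auto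
     then show ?thesis using col_in[OF True] True unfolding owner_def by simp
    next
     case False
     have "col k = 0"
     proof (rule ccontr)
      assume "col k \<noteq> 0"
      then have i: "col k \<in> I" using col_range[of k] by simp
      then have "k \<in> arrivals (col k) K \<omega>" using a col_iff by blast
      then show False using False i unfolding arrivals_def by simp
     qed
     then show ?thesis using False unfolding owner_def by simp
    qed
   qed
  next
   assume a: "\<forall>k\<in>{1..K}. owner I k \<omega> = col k"
   show "\<forall>i\<in>I. arrivals i K \<omega> = S i"
   proof
    fix i assume i: "i \<in> I"
    have "fst (in_edge p k \<omega>) = i \<longleftrightarrow> owner I k \<omega> = i" for k
     using i I0 unfolding owner_def by auto
    then have "arrivals i K \<omega> = {k \<in> {1..K}. col k = i}" unfolding arrivals_def using a by auto
    then show "arrivals i K \<omega> = S i" using col_S[OF i] by simp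
   qed
  qed
  have 2: "agent_vec i (S i) \<omega> \<in> Pi\<^sub>E {0..card (S i)} (A i) \<longleftrightarrow>
   shock p i \<omega> \<in> A i 0 \<and> (\<forall>k\<in>S i. loss p k \<omega> \<in> B k)" if i: "i \<in> I" for i
  proof -
   have "agent_vec i (S i) \<omega> \<in> Pi\<^sub>E {0..card (S i)} (A i) \<longleftrightarrow>
    (\<forall>j\<in>{0..card (S i)}. (if j = 0 then shock p i \<omega> else loss p (nth_pos (S i) j) \<omega>) \<in> A i j)"
    unfolding agent_vec_def by (auto simp: PiE_iff)
   also have e: "{0..card (S i)} = insert 0 {1..card (S i)}" by auto
   also have "(\<forall>j\<in>insert 0 {1..card (S i)}. (if j = 0 then shock p i \<omega> else loss p (nth_pos (S i) j) \<omega>) \<in> A i j)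
    \<longleftrightarrow> shock p i \<omega> \<in> A i 0 \<and> (\<forall>j\<in>{1..card (S i)}. loss p (nth_pos (S i) j) \<omega> \<in> B (nth_pos (S i) j))"
    using B_nth[OF i] by auto
   also have "(\<forall>j\<in>{1..card (S i)}. loss p (nth_pos (S i) j) \<omega> \<in> B (nth_pos (S i) j)) \<longleftrightarrow> (\<forall>k\<in>S i. loss p k \<omega> \<in> B k)"
    using nth_ex[OF i] nth_pos_in[OF fS[OF i]] by metis
   finally show ?thesis by (simp only: e)
  qed
  have 3: "(\<forall>i\<in>I. \<forall>k\<in>S i. loss p k \<omega> \<in> B k) \<longleftrightarrow> (\<forall>k\<in>{1..K}. loss p k \<omega> \<in> B k)"
  proof
   assume a: "\<forall>i\<in>I. \<forall>k\<in>S i. loss p k \<omega> \<in> B k"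
   show "\<forall>k\<in>{1..K}. loss p k \<omega> \<in> B k"
   proof
    fix k assume "k \<in> {1..K}"
    show "loss p k \<omega> \<in> B k"
    proof (cases "col k = 0")
     case False
     then have "col k \<in> I" using col_range[of k] by simp
     then show ?thesis using a col_iff by blast
    qed (simp add: B_def)
   qed
  qed (use S(1) in blast)
  show "\<omega> \<in> {\<omega> \<in> space M. \<forall>i\<in>I. arrivals i K \<omega> = S i \<and> agent_vec i (S i) \<omega> \<in> Pi\<^sub>E {0..card (S i)} (A i)}
   \<longleftrightarrow> \<omega> \<in> Sh \<inter> pattern I col B K"
   unfolding Sh_def pattern_def using 1 2 3 by auto
 qed
 then have "measure M {\<omega> \<in> space M. \<forall>i\<in>I. arrivals i K \<omega> = S i \<and> agent_vec i (S i) \<omega> \<in> Pi\<^sub>E {0..card (S i)} (A i)}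
  = measure M Sh * (\<Prod>k | k \<in> {1..K} \<and> col k \<noteq> 0. measure (llaw (col k)) (B k))
   * ((\<Prod>i\<in>I. falling (real (indeg i)) (card {k \<in> {1..K}. col k = i}))
     * falling (real (m - K)) (D - card {k \<in> {1..K}. col k \<noteq> 0}) / falling (real m) D)"
  unfolding D_def by (simp only:) (rule pattern_prob[OF I(1) K Bborel col_range _ cnt Sh(1)], simp add: B_def)
 also have "(\<Prod>i\<in>I. falling (real (indeg i)) (card {k \<in> {1..K}. col k = i})) = (\<Prod>i\<in>I. falling (real (indeg i)) (card (S i)))"
  by (rule prod.cong) (use col_S in auto)
 also have "card {k \<in> {1..K}. col k \<noteq> 0} = (\<Sum>i\<in>I. card (S i))"
  unfolding col_ne using fI fS S(3) by (intro card_UN_disjoint) (auto simp: disjoint_family_on_def)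
 also have "(\<Prod>k | k \<in> {1..K} \<and> col k \<noteq> 0. measure (llaw (col k)) (B k))
  = (\<Prod>i\<in>I. \<Prod>k\<in>S i. measure (llaw (col k)) (B k))"
  unfolding col_ne using fI fS S(3) by (intro prod.UNION_disjoint) (auto simp: disjoint_family_on_def)
 also have "\<dots> = (\<Prod>i\<in>I. \<Prod>j\<in>{1..card (S i)}. measure (llaw i) (A i j))"
 proof (rule prod.cong[OF refl])
  fix i assume i: "i \<in> I"
  have "(\<Prod>k\<in>S i. measure (llaw (col k)) (B k))
   = (\<Prod>j\<in>{1..card (S i)}. measure (llaw (col (nth_pos (S i) j))) (B (nth_pos (S i) j)))"
   by (rule prod.reindex_bij_betw[OF bij_nth_pos[OF fS[OF i]], symmetric])
  also have "\<dots> = (\<Prod>j\<in>{1..card (S i)}. measure (llaw i) (A i j))"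
   using col_in[OF i nth_pos_in[OF fS[OF i]]] B_nth[OF i] by (intro prod.cong) auto
  finally show "(\<Prod>k\<in>S i. measure (llaw (col k)) (B k)) = (\<Prod>j\<in>{1..card (S i)}. measure (llaw i) (A i j))" .
 qed
 also have "measure M Sh * \<dots> = (\<Prod>i\<in>I. \<Prod>j\<in>{0..card (S i)}. measure (class_law (par (ty i)) j) (A i j))"
  unfolding Sh(2) prod.distrib[symmetric]
 proof (rule prod.cong[OF refl])
  fix i
  have "(\<Prod>j\<in>{0..card (S i)}. measure (class_law (par (ty i)) j) (A i j))
   = measure (class_law (par (ty i)) 0) (A i 0) * (\<Prod>j\<in>{Suc 0..card (S i)}. measure (class_law (par (ty i)) j) (A i j))"
   by (rule prod.atLeast_Suc_atMost) simp
  also have "(\<Prod>j\<in>{Suc 0..card (S i)}. measure (class_law (par (ty i)) j) (A i j)) = (\<Prod>j\<in>{1..card (S i)}. measure (llaw i) (A i j))"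
   by (rule prod.cong) (auto simp: class_law_def)
  finally show "measure (slaw i) (A i 0) * (\<Prod>j\<in>{1..card (S i)}. measure (llaw i) (A i j))
   = (\<Prod>j\<in>{0..card (S i)}. measure (class_law (par (ty i)) j) (A i j))" by (simp add: class_law_def)
 qed
 finally show ?thesis by (simp add: mult.commute)
qed

lemma single_agent_law:
 assumes i: "i \<in> {1..n}" and K: "K \<le> m" and S: "S \<subseteq> {1..K}" "card S \<le> indeg i"
  and D: "D \<in> sets (alaw i (card S))"
 shows "measure M {\<omega> \<in> space M. arrivals i K \<omega> = S \<and> agent_vec i S \<omega> \<in> D}
  = weight1 m (indeg i) K (card S) * measure (alaw i (card S)) D"
proof -
 have "measure M ({\<omega> \<in> space M. arrivals i K \<omega> = S} \<inter> (agent_vec i S -` D \<inter> space M))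
  = weight1 m (indeg i) K (card S) * measure (PiM {0..card S} (class_law (par (ty i)))) D"
 proof (rule product_law_extension)
  show "finite_measure M" by (rule finite_measure_axioms)
  show "prob_space (class_law (par (ty i)) j)" for j by (rule prob_space_class_law[OF valid[OF i]])
  show "agent_vec i S \<in> measurable M (PiM {0..card S} (class_law (par (ty i))))"
   using agent_vec_M[OF i S(1) K] unfolding agent_law_def .
  show "{\<omega> \<in> space M. arrivals i K \<omega> = S} \<in> sets M" by (rule arrivals_M[OF S(1) K])
  show "0 \<le> weight1 m (indeg i) K (card S)" unfolding weight1_def by (simp add: falling_nonneg)
  show "D \<in> sets (PiM {0..card S} (class_law (par (ty i))))" using D unfolding agent_law_def .
  fix A assume A: "\<And>j. j \<in> {0..card S} \<Longrightarrow> A j \<in> sets (class_law (par (ty i)) j)"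
  have "{\<omega> \<in> space M. arrivals i K \<omega> = S} \<inter> (agent_vec i S -` Pi\<^sub>E {0..card S} A \<inter> space M)
   = {\<omega> \<in> space M. \<forall>i'\<in>{i}. arrivals i' K \<omega> = S \<and> agent_vec i' S \<omega> \<in> Pi\<^sub>E {0..card S} A}" by auto
  also have "measure M \<dots> = weight1 m (indeg i) K (card S)
    * (\<Prod>j\<in>{0..card S}. measure (class_law (par (ty i)) j) (A j))"
   using agents_box[of "{i}" K "\<lambda>_. S" "\<lambda>_. A"] i K S A
   by (simp add: weight1_def disjoint_family_on_def)
  finally show "measure M ({\<omega> \<in> space M. arrivals i K \<omega> = S} \<inter> (agent_vec i S -` Pi\<^sub>E {0..card S} A \<inter> space M))
   = weight1 m (indeg i) K (card S) * (\<Prod>j\<in>{0..card S}. measure (class_law (par (ty i)) j) (A j))" .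
 qed simp
 moreover have "{\<omega> \<in> space M. arrivals i K \<omega> = S} \<inter> (agent_vec i S -` D \<inter> space M)
  = {\<omega> \<in> space M. arrivals i K \<omega> = S \<and> agent_vec i S \<omega> \<in> D}" by auto
 ultimately show ?thesis unfolding agent_law_def by simp
qed

lemma two_agents_law:
 assumes i: "i \<in> {1..n}" and i': "i' \<in> {1..n}" and ne: "i \<noteq> i'" and ty: "ty i' = ty i" and K: "K \<le> m"
  and S: "S \<subseteq> {1..K}" "card S = \<theta>" and S': "S' \<subseteq> {1..K}" "card S' = \<theta>" and dis: "S \<inter> S' = {}" and \<theta>: "\<theta> \<le> indeg i"
  and D: "D \<in> sets (alaw i \<theta>)" and D': "D' \<in> sets (alaw i \<theta>)"
 shows "measure M {\<omega> \<in> space M. arrivals i K \<omega> = S \<and> agent_vec i S \<omega> \<in> D \<and> arrivals i' K \<omega> = S' \<and> agent_vec i' S' \<omega> \<in> D'}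
  = weight2 m (indeg i) K \<theta> * measure (alaw i \<theta>) D * measure (alaw i \<theta>) D'"
proof -
 define N where "N = class_law (par (ty i))"
 have N: "prob_space (N j)" for j unfolding N_def by (rule prob_space_class_law[OF valid[OF i]])
 have al: "alaw i \<theta> = PiM {0..\<theta>} N" by (simp add: agent_law_def N_def)
 define w where "w = weight2 m (indeg i) K \<theta>"
 have w0: "0 \<le> w" unfolding w_def weight2_def by (simp add: falling_nonneg)
 define E where "E = {\<omega> \<in> space M. arrivals i K \<omega> = S}"
 define E' where "E' = {\<omega> \<in> space M. arrivals i' K \<omega> = S'}"
 have EM: "E \<in> sets M" unfolding E_def by (rule arrivals_M[OF S(1) K])
 have EM': "E' \<in> sets M" unfolding E'_def by (rule arrivals_M[OF S'(1) K])
 have Y: "agent_vec i S \<in> measurable M (PiM {0..\<theta>} N)"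
  using agent_vec_M[OF i S(1) K] S(2) al by simp
 have Y': "agent_vec i' S' \<in> measurable M (PiM {0..\<theta>} N)"
  using agent_vec_M[OF i' S'(1) K] S'(2) al ty by simp
 have box_set: "Pi\<^sub>E {0..\<theta>} A \<in> sets (PiM {0..\<theta>} N)" if "\<And>j. j \<in> {0..\<theta>} \<Longrightarrow> A j \<in> sets (N j)" for A
  using that by (intro sets_PiM_I_finite) auto
 have box: "measure M ((E \<inter> E' \<inter> (agent_vec i' S' -` Pi\<^sub>E {0..\<theta>} A' \<inter> space M)) \<inter> (agent_vec i S -` Pi\<^sub>E {0..\<theta>} A \<inter> space M))
  = w * (\<Prod>j\<in>{0..\<theta>}. measure (N j) (A' j)) * (\<Prod>j\<in>{0..\<theta>}. measure (N j) (A j))"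
  if A: "\<And>j. j \<in> {0..\<theta>} \<Longrightarrow> A j \<in> sets (N j)" and A': "\<And>j. j \<in> {0..\<theta>} \<Longrightarrow> A' j \<in> sets (N j)" for A A'
 proof -
  have eq1: "(E \<inter> E' \<inter> (agent_vec i' S' -` Pi\<^sub>E {0..\<theta>} A' \<inter> space M)) \<inter> (agent_vec i S -` Pi\<^sub>E {0..\<theta>} A \<inter> space M)
   = {\<omega> \<in> space M. \<forall>l\<in>{i, i'}. arrivals l K \<omega> = (if l = i then S else S') \<and>
     agent_vec l (if l = i then S else S') \<omega> \<in> Pi\<^sub>E {0..card (if l = i then S else S')} (if l = i then A else A')}"
   using ne S(2) S'(2) unfolding E_def E'_def by auto
  have eq2: "measure M {\<omega> \<in> space M. \<forall>l\<in>{i, i'}. arrivals l K \<omega> = (if l = i then S else S') \<and>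
     agent_vec l (if l = i then S else S') \<omega> \<in> Pi\<^sub>E {0..card (if l = i then S else S')} (if l = i then A else A')} =
   (\<Prod>l\<in>{i, i'}. falling (real (indeg l)) (card (if l = i then S else S')))
     * falling (real (m - K)) ((\<Sum>l\<in>{i, i'}. indeg l) - (\<Sum>l\<in>{i, i'}. card (if l = i then S else S')))
      / falling (real m) (\<Sum>l\<in>{i, i'}. indeg l)
    * (\<Prod>l\<in>{i, i'}. \<Prod>j\<in>{0..card (if l = i then S else S')}.
      measure (class_law (par (ty l)) j) ((if l = i then A else A') j))"
  proof (rule agents_box)
   show "disjoint_family_on (\<lambda>l. if l = i then S else S') {i, i'}"
    using dis ne by (auto simp: disjoint_family_on_def)
   show "(if l = i then A else A') j \<in> sets borel"
    if "l \<in> {i, i'}" "j \<in> {0..card (if l = i then S else S')}" for l j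
    using that A[of j] A'[of j] S S' unfolding N_def by (auto split: if_splits)
   show "(if l = i then S else S') \<subseteq> {1..K}" for l using S(1) S'(1) by simp
   show "card (if l = i then S else S') \<le> indeg l" if "l \<in> {i, i'}" for l
    using that S(2) S'(2) \<theta> ty by auto
  qed (use i i' K in simp_all)
  have eq3: "(\<Sum>l\<in>{i, i'}. indeg l) = 2 * indeg i" using ne ty by simp
  have eq4: "(\<Sum>l\<in>{i, i'}. card (if l = i then S else S')) = 2 * \<theta>" using ne S S' by simp
  have eq5: "(\<Prod>l\<in>{i, i'}. falling (real (indeg l)) (card (if l = i then S else S')))
    = (falling (real (indeg i)) \<theta>)\<^sup>2"
   using ne ty S S' by (simp add: power2_eq_square)
  have eq6: "(\<Prod>l\<in>{i, i'}. \<Prod>j\<in>{0..card (if l = i then S else S')}.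
      measure (class_law (par (ty l)) j) ((if l = i then A else A') j))
    = (\<Prod>j\<in>{0..\<theta>}. measure (N j) (A j)) * (\<Prod>j\<in>{0..\<theta>}. measure (N j) (A' j))"
   using ne ty S S' by (simp add: N_def)
  show ?thesis
   unfolding eq1 eq2 eq3 eq4 eq5 eq6 w_def weight2_def by (simp only: mult_ac)
 qed
 have step: "measure M ((E \<inter> E' \<inter> (agent_vec i' S' -` Pi\<^sub>E {0..\<theta>} A' \<inter> space M)) \<inter> (agent_vec i S -` D \<inter> space M))
  = (w * (\<Prod>j\<in>{0..\<theta>}. measure (N j) (A' j))) * measure (PiM {0..\<theta>} N) D"
  if A': "\<And>j. j \<in> {0..\<theta>} \<Longrightarrow> A' j \<in> sets (N j)" for A'
 proof (rule product_law_extension[OF finite_measure_axioms _ N Y])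
  show "E \<inter> E' \<inter> (agent_vec i' S' -` Pi\<^sub>E {0..\<theta>} A' \<inter> space M) \<in> sets M"
   by (intro sets.Int EM EM' measurable_sets[OF Y'] box_set A')
  show "0 \<le> w * (\<Prod>j\<in>{0..\<theta>}. measure (N j) (A' j))" using w0 by (intro mult_nonneg_nonneg prod_nonneg) auto
  show "D \<in> sets (PiM {0..\<theta>} N)" using D al by simp
 qed (use box A' in auto)
 have "measure M ((E \<inter> E' \<inter> (agent_vec i S -` D \<inter> space M)) \<inter> (agent_vec i' S' -` D' \<inter> space M))
  = (w * measure (PiM {0..\<theta>} N) D) * measure (PiM {0..\<theta>} N) D'"
 proof (rule product_law_extension[OF finite_measure_axioms _ N Y'])
  show "E \<inter> E' \<inter> (agent_vec i S -` D \<inter> space M) \<in> sets M"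
   using D al by (intro sets.Int EM EM' measurable_sets[OF Y]) simp
  show "0 \<le> w * measure (PiM {0..\<theta>} N) D" using w0 by simp
  show "D' \<in> sets (PiM {0..\<theta>} N)" using D' al by simp
  fix A' assume A': "\<And>j. j \<in> {0..\<theta>} \<Longrightarrow> A' j \<in> sets (N j)"
  have "E \<inter> E' \<inter> (agent_vec i S -` D \<inter> space M) \<inter> (agent_vec i' S' -` Pi\<^sub>E {0..\<theta>} A' \<inter> space M)
   = (E \<inter> E' \<inter> (agent_vec i' S' -` Pi\<^sub>E {0..\<theta>} A' \<inter> space M)) \<inter> (agent_vec i S -` D \<inter> space M)" by blast
  then show "measure M (E \<inter> E' \<inter> (agent_vec i S -` D \<inter> space M) \<inter> (agent_vec i' S' -` Pi\<^sub>E {0..\<theta>} A' \<inter> space M))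
   = w * measure (PiM {0..\<theta>} N) D * (\<Prod>j\<in>{0..\<theta>}. measure (N j) (A' j))"
   using step[OF A'] by (simp add: mult_ac)
 qed simp
 moreover have "(E \<inter> E' \<inter> (agent_vec i S -` D \<inter> space M)) \<inter> (agent_vec i' S' -` D' \<inter> space M)
  = {\<omega> \<in> space M. arrivals i K \<omega> = S \<and> agent_vec i S \<omega> \<in> D \<and> arrivals i' K \<omega> = S' \<and> agent_vec i' S' \<omega> \<in> D'}"
  unfolding E_def E'_def by auto
 ultimately show ?thesis unfolding w_def al by simp
qed

text \<open>
  The condition \<open>D\<close> may depend on the positions of the agent, because the premium collected
  until a loss depends on when this loss is revealed.
\<close>

definition hit :: "nat \<Rightarrow> nat \<Rightarrow> nat \<Rightarrow> (nat set \<Rightarrow> (nat \<Rightarrow> real) set) \<Rightarrow> 'w set" where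
 "hit i K \<theta> D = {\<omega> \<in> space M. card (arrivals i K \<omega>) = \<theta> \<and> agent_vec i (arrivals i K \<omega>) \<omega> \<in> D (arrivals i K \<omega>)}"

lemma hit_eq: "hit i K \<theta> D = (\<Union>S\<in>subsets_of_size \<theta> K. {\<omega> \<in> space M. arrivals i K \<omega> = S \<and> agent_vec i S \<omega> \<in> D S})"
proof (intro set_eqI iffI)
 fix \<omega> assume h: "\<omega> \<in> hit i K \<theta> D"
 have "arrivals i K \<omega> \<subseteq> {1..K}" unfolding arrivals_def by auto
 then have "arrivals i K \<omega> \<in> subsets_of_size \<theta> K" using h unfolding hit_def subsets_of_size_def by simp
 then show "\<omega> \<in> (\<Union>S\<in>subsets_of_size \<theta> K. {\<omega> \<in> space M. arrivals i K \<omega> = S \<and> agent_vec i S \<omega> \<in> D S})"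
  using h unfolding hit_def by blast
next
 fix \<omega> assume "\<omega> \<in> (\<Union>S\<in>subsets_of_size \<theta> K. {\<omega> \<in> space M. arrivals i K \<omega> = S \<and> agent_vec i S \<omega> \<in> D S})"
 then show "\<omega> \<in> hit i K \<theta> D" unfolding hit_def subsets_of_size_def by auto
qed

lemma hit_M:
 assumes i: "i \<in> {1..n}" and K: "K \<le> m" and D: "\<And>S. D S \<in> sets (alaw i \<theta>)"
 shows "hit i K \<theta> D \<in> sets M"
 unfolding hit_eq
 by (intro sets.finite_UN finite_subsets_of_size arrivals_vec_M i K)
  (use D in \<open>auto simp: subsets_of_size_def\<close>)

lemma prob_hit:
 assumes i: "i \<in> {1..n}" and K: "K \<le> m" and \<theta>: "\<theta> \<le> indeg i" and D: "\<And>S. D S \<in> sets (alaw i \<theta>)"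
 shows "measure M (hit i K \<theta> D)
  = weight1 m (indeg i) K \<theta> * (subset_sum (par (ty i)) \<theta> K D)"
proof -
 have "measure M (hit i K \<theta> D)
  = (\<Sum>S\<in>subsets_of_size \<theta> K. measure M {\<omega> \<in> space M. arrivals i K \<omega> = S \<and> agent_vec i S \<omega> \<in> D S})"
  unfolding hit_eq
 proof (rule finite_measure_finite_Union)
  show "(\<lambda>S. {\<omega> \<in> space M. arrivals i K \<omega> = S \<and> agent_vec i S \<omega> \<in> D S}) ` subsets_of_size \<theta> K \<subseteq> sets M"
   using arrivals_vec_M[OF i _ K] D by (auto simp: subsets_of_size_def)
 qed (auto simp: disjoint_family_on_def)
 also have "\<dots> = (\<Sum>S\<in>subsets_of_size \<theta> K. weight1 m (indeg i) K \<theta> * measure (alaw i \<theta>) (D S))"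
  by (rule sum.cong[OF refl]) (use single_agent_law[OF i K] D \<theta> in \<open>auto simp: subsets_of_size_def\<close>)
 finally show ?thesis by (simp add: sum_distrib_left)
qed

text \<open>
  Two agents never share a position. Summing over all pairs of sets of positions instead of the
  disjoint ones only gives an upper bound, which suffices to bound a variance from above.
\<close>

lemma prob_two_hits:
 assumes i: "i \<in> {1..n}" and i': "i' \<in> {1..n}" and ne: "i \<noteq> i'" and ty: "ty i' = ty i"
  and K: "K \<le> m" and \<theta>: "\<theta> \<le> indeg i" and D: "\<And>S. D S \<in> sets (alaw i \<theta>)"
 shows "measure M (hit i K \<theta> D \<inter> hit i' K \<theta> D)
  \<le> weight2 m (indeg i) K \<theta> * (subset_sum (par (ty i)) \<theta> K D)\<^sup>2"
proof -
 define C where "C S S' = {\<omega> \<in> space M. arrivals i K \<omega> = S \<and> agent_vec i S \<omega> \<in> D S} \<inter>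
   {\<omega> \<in> space M. arrivals i' K \<omega> = S' \<and> agent_vec i' S' \<omega> \<in> D S'}" for S S'
 have CM: "C S S' \<in> sets M" if "S \<in> subsets_of_size \<theta> K" "S' \<in> subsets_of_size \<theta> K" for S S'
  unfolding C_def by (intro sets.Int arrivals_vec_M i i' K)
   (use that D ty in \<open>auto simp: subsets_of_size_def\<close>)
 define g where "g S = measure (alaw i \<theta>) (D S)" for S
 define w where "w = weight2 m (indeg i) K \<theta>"
 have w0: "0 \<le> w" unfolding w_def weight2_def by (simp add: falling_nonneg)
 have C: "measure M (C S S') \<le> w * g S * g S'" if S: "S \<in> subsets_of_size \<theta> K" "S' \<in> subsets_of_size \<theta> K" for S S'
 proof (cases "S \<inter> S' = {}")
  case True
  have "C S S' = {\<omega> \<in> space M. arrivals i K \<omega> = S \<and> agent_vec i S \<omega> \<in> D S \<and> arrivals i' K \<omega> = S' \<and> agent_vec i' S' \<omega> \<in> D S'}"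
   unfolding C_def by auto
  then have "measure M (C S S') = w * g S * g S'"
   unfolding w_def g_def using S two_agents_law[OF i i' ne ty K _ _ _ _ True \<theta> D D]
   by (simp add: subsets_of_size_def)
  then show ?thesis by simp
 next
  case False
  then have "C S S' = {}" unfolding C_def arrivals_def using ne by blast
  then show ?thesis using w0 by (simp add: g_def)
 qed
 have "hit i K \<theta> D \<inter> hit i' K \<theta> D = (\<Union>x\<in>subsets_of_size \<theta> K \<times> subsets_of_size \<theta> K. C (fst x) (snd x))"
 proof (intro set_eqI iffI)
  fix \<omega> assume "\<omega> \<in> hit i K \<theta> D \<inter> hit i' K \<theta> D"
  then obtain S S' where "S \<in> subsets_of_size \<theta> K" "S' \<in> subsets_of_size \<theta> K" "\<omega> \<in> C S S'"
   unfolding hit_eq C_def by blast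
  then show "\<omega> \<in> (\<Union>x\<in>subsets_of_size \<theta> K \<times> subsets_of_size \<theta> K. C (fst x) (snd x))"
   by (intro UN_I[of "(S, S')"]) auto
 next
  fix \<omega> assume "\<omega> \<in> (\<Union>x\<in>subsets_of_size \<theta> K \<times> subsets_of_size \<theta> K. C (fst x) (snd x))"
  then obtain S S' where "S \<in> subsets_of_size \<theta> K" "S' \<in> subsets_of_size \<theta> K" "\<omega> \<in> C S S'"
   by auto
  then show "\<omega> \<in> hit i K \<theta> D \<inter> hit i' K \<theta> D" unfolding hit_eq C_def by blast
 qed
 then have "measure M (hit i K \<theta> D \<inter> hit i' K \<theta> D) \<le> (\<Sum>x\<in>subsets_of_size \<theta> K \<times> subsets_of_size \<theta> K. measure M (C (fst x) (snd x)))"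
  by (simp only:) (rule finite_measure_subadditive_finite, use CM in auto)
 also have "\<dots> \<le> (\<Sum>x\<in>subsets_of_size \<theta> K \<times> subsets_of_size \<theta> K. w * g (fst x) * g (snd x))"
  by (rule sum_mono) (use C in auto)
 also have "\<dots> = w * (\<Sum>S\<in>subsets_of_size \<theta> K. g S)\<^sup>2"
 proof -
  have "(\<Sum>S\<in>subsets_of_size \<theta> K. g S)\<^sup>2
   = (\<Sum>x\<in>subsets_of_size \<theta> K \<times> subsets_of_size \<theta> K. g (fst x) * g (snd x))"
   unfolding power2_eq_square sum_product sum.cartesian_product by (simp add: case_prod_beta)
  then show ?thesis by (simp only: sum_distrib_left mult.assoc)
 qed
 finally show ?thesis unfolding w_def g_def .
qed

definition hit_count :: "'x \<Rightarrow> nat \<Rightarrow> nat \<Rightarrow> (nat set \<Rightarrow> (nat \<Rightarrow> real) set) \<Rightarrow> 'w \<Rightarrow> nat" where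
 "hit_count x K \<theta> D \<omega> = card {i \<in> {1..n}. ty i = x \<and> \<omega> \<in> hit i K \<theta> D}"

text \<open>
  Chebyshev's inequality: the diagonal contributes at most \<open>1 / n\<close> to the variance, and the
  other term bounds the covariance of two agents of the type.
\<close>

lemma hit_count_lln:
 assumes n: "1 \<le> n" and K: "K \<le> m" and \<theta>: "\<theta> \<le> d_in (par x)" and D: "\<And>S. D S \<in> sets (agent_law (par x) \<theta>)"
  and \<delta>: "0 < \<delta>"
 defines "G \<equiv> \<Sum>S\<in>subsets_of_size \<theta> K. measure (agent_law (par x) \<theta>) (D S)"
 defines "w1 \<equiv> weight1 m (d_in (par x)) K \<theta>" and "w2 \<equiv> weight2 m (d_in (par x)) K \<theta>"
 shows "{\<omega> \<in> space M. \<not> \<bar>real (hit_count x K \<theta> D \<omega>) / real n - type_fraction n ty x * (w1 * G)\<bar> \<le> \<delta>} \<in> sets M"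
  and "measure M {\<omega> \<in> space M. \<not> \<bar>real (hit_count x K \<theta> D \<omega>) / real n - type_fraction n ty x * (w1 * G)\<bar> \<le> \<delta>}
   \<le> (1 / real n + \<bar>w2 - w1\<^sup>2\<bar> * G\<^sup>2) / \<delta>\<^sup>2"
proof -
 define U where "U = {i \<in> {1..n}. ty i = x}"
 define N where "N = real (card U)"
 have fU: "finite U" unfolding U_def by simp
 have U: "i \<in> {1..n}" "ty i = x" if "i \<in> U" for i using that by (auto simp: U_def)
 have hM: "hit i K \<theta> D \<in> sets M" if "i \<in> U" for i
  by (rule hit_M[OF U(1)[OF that] K]) (use D U(2)[OF that] in simp)
 define s where "s \<omega> = (\<Sum>i\<in>U. indicator (hit i K \<theta> D) \<omega> :: real)" for \<omega>
 have s_eq: "s \<omega> = real (hit_count x K \<theta> D \<omega>)" for \<omega>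
 proof -
  have "s \<omega> = (\<Sum>i\<in>U. if \<omega> \<in> hit i K \<theta> D then 1 else 0)" unfolding s_def by (rule sum.cong) (auto simp: indicator_def)
  also have "\<dots> = real (card {i \<in> U. \<omega> \<in> hit i K \<theta> D})" using fU by (simp add: sum.If_cases Int_def)
  finally show ?thesis unfolding U_def hit_count_def by (simp add: conj_assoc)
 qed
 have sM: "s \<in> borel_measurable M" unfolding s_def by (intro borel_measurable_sum borel_measurable_indicator hM)
 have tf: "type_fraction n ty x = N / real n" unfolding type_fraction_def N_def U_def by simp
 have "card U \<le> card {1..n}" unfolding U_def by (rule card_mono) auto
 then have Nn: "N \<le> real n" unfolding N_def by simp
 have N0: "0 \<le> N" unfolding N_def by simp
 define c where "c = N / real n * (w1 * G)"
 have int_s: "integrable M s" unfolding s_def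
  by (intro Bochner_Integration.integrable_sum integrable_real_indicator hM) (simp_all add: less_top[symmetric])
 have Es: "(LINT \<omega>|M. s \<omega>) = N * (w1 * G)"
 proof -
  have "(LINT \<omega>|M. s \<omega>) = (\<Sum>i\<in>U. measure M (hit i K \<theta> D))"
   unfolding s_def using hM by (subst Bochner_Integration.integral_sum)
    (auto simp: less_top[symmetric] sets.Int_space_eq2)
  also have "\<dots> = (\<Sum>i\<in>U. w1 * G)"
   by (rule sum.cong[OF refl]) (use prob_hit[OF _ K, of _ \<theta> D] U \<theta> D in \<open>simp add: w1_def G_def\<close>)
  finally show ?thesis by (simp add: N_def)
 qed
 have s2: "(s \<omega>)\<^sup>2 = (\<Sum>x\<in>U \<times> U. indicator (hit (fst x) K \<theta> D \<inter> hit (snd x) K \<theta> D) \<omega>)" for \<omega>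
  unfolding s_def power2_eq_square sum_product sum.cartesian_product indicator_inter_arith
  by (simp add: case_prod_beta)
 have int_s2: "integrable M (\<lambda>\<omega>. (s \<omega>)\<^sup>2)" unfolding s2
  by (intro Bochner_Integration.integrable_sum integrable_real_indicator sets.Int hM)
   (auto simp: less_top[symmetric])
 have G0: "0 \<le> G" unfolding G_def by (rule sum_nonneg) simp
 have w20: "0 \<le> w2" unfolding w2_def weight2_def by (simp add: falling_nonneg)
 have Es2: "(LINT \<omega>|M. (s \<omega>)\<^sup>2) \<le> N + N\<^sup>2 * (w2 * G\<^sup>2)"
 proof -
  have "(LINT \<omega>|M. (s \<omega>)\<^sup>2) = (\<Sum>x\<in>U \<times> U. measure M (hit (fst x) K \<theta> D \<inter> hit (snd x) K \<theta> D))"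
  proof -
   have h2: "hit (fst x) K \<theta> D \<inter> hit (snd x) K \<theta> D \<in> sets M" if "x \<in> U \<times> U" for x
    using that hM by (intro sets.Int) auto
   show ?thesis unfolding s2 using h2 by (subst Bochner_Integration.integral_sum)
    (auto simp: less_top[symmetric] sets.Int_space_eq2 intro!: sum.cong)
  qed
  also have "\<dots> \<le> (\<Sum>x\<in>U \<times> U. (if fst x = snd x then 1 else 0) + w2 * G\<^sup>2)"
  proof (rule sum_mono)
   fix x assume x: "x \<in> U \<times> U"
   show "measure M (hit (fst x) K \<theta> D \<inter> hit (snd x) K \<theta> D) \<le> (if fst x = snd x then 1 else 0) + w2 * G\<^sup>2"
   proof (cases "fst x = snd x")
    case True
    have "measure M (hit (fst x) K \<theta> D \<inter> hit (snd x) K \<theta> D) \<le> 1" by (rule prob_le_1)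
    moreover have "0 \<le> w2 * G\<^sup>2" using w20 by simp
    ultimately show ?thesis unfolding if_P[OF True] by linarith
   next
    case False
    have "fst x \<in> U" "snd x \<in> U" using x by auto
    then show ?thesis using prob_two_hits[OF _ _ False _ K, of \<theta> D] U \<theta> D False
     by (simp add: w2_def G_def)
   qed
  qed
  also have "\<dots> = (\<Sum>i\<in>U. \<Sum>j\<in>U. (if i = j then 1 else 0)) + real (card (U \<times> U)) * (w2 * G\<^sup>2)"
   by (simp add: sum.distrib sum.cartesian_product case_prod_beta)
  also have "\<dots> = N + N\<^sup>2 * (w2 * G\<^sup>2)"
   using fU by (simp add: N_def card_cartesian_product power2_eq_square)
  finally show ?thesis .
 qed
 define v where "v \<omega> = (s \<omega> / real n - c)\<^sup>2" for \<omega>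
 have v_eq: "v \<omega> = (s \<omega>)\<^sup>2 / (real n)\<^sup>2 - 2 * c / real n * s \<omega> + c\<^sup>2" for \<omega>
  unfolding v_def by (simp add: power2_diff power_divide)
 have iv: "integrable M v" unfolding v_eq[abs_def] using int_s int_s2 by simp
 have "(LINT \<omega>|M. v \<omega>) = (LINT \<omega>|M. (s \<omega>)\<^sup>2) / (real n)\<^sup>2 - 2 * c / real n * (N * (w1 * G)) + c\<^sup>2"
  unfolding v_eq using int_s int_s2 Es by (simp add: prob_space)
 also have "2 * c / real n * (N * (w1 * G)) = 2 * c\<^sup>2" by (simp add: c_def power2_eq_square)
 finally have "(LINT \<omega>|M. v \<omega>) = (LINT \<omega>|M. (s \<omega>)\<^sup>2) / (real n)\<^sup>2 - c\<^sup>2" by simp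
 also have "\<dots> \<le> (N + N\<^sup>2 * (w2 * G\<^sup>2)) / (real n)\<^sup>2 - c\<^sup>2"
  using Es2 by (intro diff_right_mono divide_right_mono) auto
 also have "\<dots> = N / (real n)\<^sup>2 + (N / real n)\<^sup>2 * ((w2 - w1\<^sup>2) * G\<^sup>2)"
  by (simp add: c_def power_mult_distrib power_divide add_divide_distrib algebra_simps)
 also have "\<dots> \<le> 1 / real n + 1 * (\<bar>w2 - w1\<^sup>2\<bar> * G\<^sup>2)"
 proof (rule add_mono)
  show "N / (real n)\<^sup>2 \<le> 1 / real n" using Nn n by (simp add: power2_eq_square field_simps)
  have "(N / real n)\<^sup>2 \<le> 1" using Nn N0 n by (intro power_le_one) auto
  moreover have "(w2 - w1\<^sup>2) * G\<^sup>2 \<le> \<bar>w2 - w1\<^sup>2\<bar> * G\<^sup>2" by (rule mult_right_mono) auto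
  moreover have "(N / real n)\<^sup>2 * ((w2 - w1\<^sup>2) * G\<^sup>2) \<le> (N / real n)\<^sup>2 * (\<bar>w2 - w1\<^sup>2\<bar> * G\<^sup>2)"
   by (rule mult_left_mono) (use calculation in auto)
  moreover have "(N / real n)\<^sup>2 * (\<bar>w2 - w1\<^sup>2\<bar> * G\<^sup>2) \<le> 1 * (\<bar>w2 - w1\<^sup>2\<bar> * G\<^sup>2)"
   by (rule mult_right_mono) (use calculation in auto)
  ultimately show "(N / real n)\<^sup>2 * ((w2 - w1\<^sup>2) * G\<^sup>2) \<le> 1 * (\<bar>w2 - w1\<^sup>2\<bar> * G\<^sup>2)" by linarith
 qed
 finally have Ev: "(LINT \<omega>|M. v \<omega>) \<le> 1 / real n + \<bar>w2 - w1\<^sup>2\<bar> * G\<^sup>2" by simp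
 have eq: "{\<omega> \<in> space M. \<not> \<bar>real (hit_count x K \<theta> D \<omega>) / real n - type_fraction n ty x * (w1 * G)\<bar> \<le> \<delta>}
  = {\<omega> \<in> space M. \<delta> < \<bar>s \<omega> / real n - c\<bar>}"
  unfolding s_eq[symmetric] tf c_def by auto
 show "{\<omega> \<in> space M. \<not> \<bar>real (hit_count x K \<theta> D \<omega>) / real n - type_fraction n ty x * (w1 * G)\<bar> \<le> \<delta>} \<in> sets M"
  unfolding eq using sM by measurable
 have v0: "0 \<le> v \<omega>" for \<omega> unfolding v_def by simp
 have vM: "v \<in> borel_measurable M" using iv by simp
 have "measure M {\<omega> \<in> space M. \<delta> < \<bar>s \<omega> / real n - c\<bar>} \<le> measure M {\<omega> \<in> space M. \<delta>\<^sup>2 \<le> v \<omega>}"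
 proof (rule finite_measure_mono)
  show "{\<omega> \<in> space M. \<delta> < \<bar>s \<omega> / real n - c\<bar>} \<subseteq> {\<omega> \<in> space M. \<delta>\<^sup>2 \<le> v \<omega>}"
   using \<delta> by (auto simp: v_def abs_le_square_iff[symmetric])
  show "{\<omega> \<in> space M. \<delta>\<^sup>2 \<le> v \<omega>} \<in> sets M" using vM by measurable
 qed
 also have "\<dots> \<le> (LINT \<omega>|M. v \<omega>) / \<delta>\<^sup>2"
  by (rule integral_Markov_inequality_measure[of _ _ "space M"]) (use iv \<delta> v0 in auto)
 also have "\<dots> \<le> (1 / real n + \<bar>w2 - w1\<^sup>2\<bar> * G\<^sup>2) / \<delta>\<^sup>2"
  by (rule divide_right_mono[OF Ev]) simp
 finally show "measure M {\<omega> \<in> space M. \<not> \<bar>real (hit_count x K \<theta> D \<omega>) / real n - type_fraction n ty x * (w1 * G)\<bar> \<le> \<delta>}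
   \<le> (1 / real n + \<bar>w2 - w1\<^sup>2\<bar> * G\<^sup>2) / \<delta>\<^sup>2"
  unfolding eq .
qed

end

section \<open>The limiting survival probabilities\<close>

subsection \<open>Order statistics\<close>

lemma sorted_nth_le_iff:
 fixes ys :: "'b::linorder list"
 assumes "sorted ys" "j < length ys"
 shows "ys ! j \<le> c \<longleftrightarrow> j < length (filter (\<lambda>y. y \<le> c) ys)"
 using assms
proof (induction ys arbitrary: j)
 case (Cons y ys)
 show ?case
 proof (cases "y \<le> c")
  case True
  then show ?thesis using Cons by (cases j) auto
 next
  case False
  then have "filter (\<lambda>y. y \<le> c) (y # ys) = []" using Cons.prems(1) by (auto simp: filter_empty_conv)
  moreover have "y \<le> (y # ys) ! j" using Cons.prems by (cases j) auto
  ultimately show ?thesis using False by auto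
 qed
qed simp

text \<open>
  Counting the values below a level describes order statistics without reference to sorting.
\<close>

lemma order_stat_le_iff:
 assumes "j \<in> {1..\<theta>}"
 shows "order_stat \<theta> u j \<le> c \<longleftrightarrow> j \<le> card {i \<in> {1..\<theta>}. u i \<le> c}"
proof -
 have "length (filter (\<lambda>y. y \<le> c) (sort (map u [1..<Suc \<theta>])))
  = length (sort (filter (\<lambda>y. y \<le> c) (map u [1..<Suc \<theta>])))"
  by (simp only: filter_sort)
 also have "\<dots> = length (filter (\<lambda>i. u i \<le> c) [1..<Suc \<theta>])" by (simp add: filter_map comp_def)
 also have "\<dots> = card {i \<in> {1..\<theta>}. u i \<le> c}"
  by (subst distinct_card[symmetric]) (auto intro!: arg_cong[of _ _ card])
 finally show ?thesis unfolding order_stat_def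
  using assms by (subst sorted_nth_le_iff) auto
qed

lemma order_stat_in:
 assumes "j \<in> {1..\<theta>}" shows "order_stat \<theta> u j \<in> u ` {1..\<theta>}"
proof -
 have "sort (map u [1..<Suc \<theta>]) ! (j - 1) \<in> set (sort (map u [1..<Suc \<theta>]))"
  by (rule nth_mem) (use assms in auto)
 also have "set (sort (map u [1..<Suc \<theta>])) = u ` {1..\<theta>}" by auto
 finally show ?thesis unfolding order_stat_def .
qed

lemma sort_map_mono:
 fixes f :: "'b::linorder \<Rightarrow> 'c::linorder"
 assumes "mono f" shows "sort (map f xs) = map f (sort xs)"
proof (rule properties_for_sort)
 show "sorted (map f (sort xs))" using assms by (auto simp: sorted_map intro: sorted_wrt_mono_rel[of _ "(\<le>)"] dest: monoD)
qed simp

lemma order_stat_mono_comp: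
 assumes "mono f" "j \<in> {1..\<theta>}"
 shows "order_stat \<theta> (\<lambda>i. f (u i)) j = f (order_stat \<theta> u j)"
proof -
 have "map (\<lambda>i. f (u i)) [1..<Suc \<theta>] = map f (map u [1..<Suc \<theta>])" by simp
 then show ?thesis unfolding order_stat_def using assms(2)
  by (simp only: sort_map_mono[OF assms(1)]) (subst nth_map, auto)
qed

lemma order_stat_measurable:
 assumes "j \<in> {1..\<theta>}"
 shows "(\<lambda>u. order_stat \<theta> u j) \<in> borel_measurable (PiM {1..\<theta>} (\<lambda>_. borel))"
proof (rule borel_measurable_iff_le[THEN iffD2], rule allI)
 fix c
 have eq: "order_stat \<theta> u j \<le> c \<longleftrightarrow> real j \<le> (\<Sum>i\<in>{1..\<theta>}. indicator {..c} (u i))" for u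
 proof -
  have "(\<Sum>i\<in>{1..\<theta>}. indicator {..c} (u i)) = real (card {i \<in> {1..\<theta>}. u i \<le> c})"
   by (simp add: indicator_def sum.If_cases Int_def)
  then show ?thesis using order_stat_le_iff[OF assms, of u c] by simp
 qed
 have "(\<lambda>u. \<Sum>i\<in>{1..\<theta>}. indicator {..c} (u i) :: real) \<in> borel_measurable (PiM {1..\<theta>} (\<lambda>_. borel))"
 proof (rule borel_measurable_sum)
  fix i assume "i \<in> {1..\<theta>}"
  then have "(\<lambda>u. u i) \<in> borel_measurable (PiM {1..\<theta>} (\<lambda>_. borel :: real measure))"
   by (rule measurable_component_singleton)
  moreover have "(indicator {..c} :: real \<Rightarrow> real) \<in> borel_measurable borel" by simp
  ultimately show "(\<lambda>u. indicator {..c} (u i) :: real) \<in> borel_measurable (PiM {1..\<theta>} (\<lambda>_. borel))"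
   by (rule measurable_compose)
 qed
 from borel_measurable_iff_ge[THEN iffD1, OF this, rule_format, of "real j"]
 show "{u \<in> space (PiM {1..\<theta>} (\<lambda>_. borel)). order_stat \<theta> u j \<le> c} \<in> sets (PiM {1..\<theta>} (\<lambda>_. borel))"
  unfolding eq .
qed

subsection \<open>The limiting arrival times\<close>

locale intensity_limit =
 fixes R :: "real \<Rightarrow> real"
 assumes cont_R: "continuous_on {0..} R" and pos_R: "\<And>t. 0 \<le> t \<Longrightarrow> 0 < R t"
  and int_R: "set_integrable lborel {0..} R"
begin

definition Lam :: "real \<Rightarrow> real" where
 "Lam t = (LBINT s:{0..t}. R s)"

definition rho :: real where
 "rho = (LBINT s:{0..}. R s)"

text \<open>
  The law of an arrival time on the whole half-line. Conditioned on \<open>{0<..t}\<close> it is the law of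
  the variables \<open>U\<close> in the definition of the survival probability.
\<close>

definition nu :: "real measure" where
 "nu = density lborel (\<lambda>s. ennreal (indicator {0..} s * R s / rho))"

lemma int_R_Icc: "0 \<le> a \<Longrightarrow> set_integrable lborel {a..b} R"
 by (rule set_integrable_subset[OF int_R]) auto

lemma Lam_integral: "Lam t = integral {0..t} R"
 unfolding Lam_def by (rule set_borel_integral_eq_integral(2)[OF int_R_Icc]) simp

lemma R_integrable_on: "0 \<le> a \<Longrightarrow> R integrable_on {a..b}"
 by (rule set_borel_integral_eq_integral(1)[OF int_R_Icc])

lemma Lam_nonpos: "t \<le> 0 \<Longrightarrow> Lam t = 0"
 unfolding Lam_integral by (cases "t = 0") auto

lemma Lam_diff:
 assumes "0 \<le> s" "s \<le> t" shows "Lam t = Lam s + integral {s..t} R"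
 unfolding Lam_integral using assms
 by (intro Henstock_Kurzweil_Integration.integral_combine[symmetric] R_integrable_on) auto

lemma Lam_strict:
 assumes "0 \<le> s" "s < t" shows "Lam s < Lam t"
proof -
 have "continuous_on {s..t} R" by (rule continuous_on_subset[OF cont_R]) (use assms in auto)
 then obtain x where x: "x \<in> {s..t}" "\<And>y. y \<in> {s..t} \<Longrightarrow> R x \<le> R y"
  using continuous_attains_inf[of "{s..t}" R] assms by auto
 have "integral {s..t} (\<lambda>_. R x) \<le> integral {s..t} R"
  by (rule integral_le) (use x assms R_integrable_on in auto)
 moreover have "0 < (t - s) * R x" using pos_R[of x] x assms by (intro mult_pos_pos) auto
 ultimately show ?thesis using Lam_diff[of s t] assms by simp
qed

lemma Lam_less_iff: "0 \<le> s \<Longrightarrow> 0 \<le> t \<Longrightarrow> Lam s < Lam t \<longleftrightarrow> s < t"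
 by (metis Lam_strict less_asym not_less_iff_gr_or_eq)

lemma Lam_mono: "s \<le> t \<Longrightarrow> Lam s \<le> Lam t"
proof (cases "0 \<le> s")
 case False
 assume "s \<le> t"
 have "Lam 0 \<le> Lam t" by (cases "0 < t") (use Lam_strict[of 0 t] Lam_nonpos[of t] Lam_nonpos[of 0] in auto)
 then show ?thesis using Lam_nonpos[of s] Lam_nonpos[of 0] False by simp
qed (metis Lam_strict order_le_less)

lemma Lam_nonneg: "0 \<le> Lam t"
 using Lam_mono[of "min t 0" t] Lam_nonpos[of "min t 0"] by simp

lemma Lam_cont: "continuous_on UNIV Lam"
proof -
 have "continuous_on {0..b} Lam" for b
  using indefinite_integral_continuous_1[OF R_integrable_on[of 0 b]] unfolding Lam_integral[abs_def] by simp
 then have c1: "isCont Lam x" if "0 < x" for x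
  by (rule continuous_on_interior[of "{0..x + 1}"]) (use that in auto)
 have c: "isCont (\<lambda>x. Lam (max 0 x)) x" for x
 proof (cases "x > 0")
  case True
  then have "isCont Lam (max 0 x)" using c1 by simp
  moreover have "isCont (\<lambda>x. max 0 x) x" by (intro continuous_intros)
  ultimately show ?thesis by (rule isCont_o2[rotated])
 next
  case False
  have "continuous_on {- 1..1} (\<lambda>x. Lam (max 0 x))" if "x = 0"
   by (rule continuous_on_compose2[OF \<open>\<And>b. continuous_on {0..b} Lam\<close>[of 1]])
    (auto intro!: continuous_intros)
  then have "x = 0 \<Longrightarrow> isCont (\<lambda>x. Lam (max 0 x)) x"
   by (rule continuous_on_interior) auto
  moreover have "isCont (\<lambda>x. Lam (max 0 x)) x" if "x < 0"
  proof (rule isCont_cong[THEN iffD2, of _ "\<lambda>_. Lam 0"])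
   show "\<forall>\<^sub>F x in nhds x. Lam (max 0 x) = Lam 0"
    using eventually_nhds_in_open[of "{..<0}" x] that by (auto elim!: eventually_mono)
  qed simp
  ultimately show ?thesis using False by linarith
 qed
 have "(\<lambda>x. Lam (max 0 x)) = Lam"
  by (rule ext) (use Lam_nonpos in \<open>auto simp: max_def\<close>)
 then show ?thesis using c by (simp add: continuous_on_eq_continuous_at)
qed

lemma Lam_measurable [measurable]: "Lam \<in> borel_measurable borel"
 by (rule borel_measurable_continuous_onI[OF Lam_cont])

lemma Lam_tendsto: "(Lam \<longlongrightarrow> rho) at_top"
 unfolding Lam_def[abs_def] rho_def
 by (rule tendsto_set_lebesgue_integral_at_top[OF _ int_R]) auto

lemma Lam_less_rho: "Lam t < rho"
proof -
 have "Lam t < Lam (max t 0 + 1)"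
  using Lam_strict[of "max t 0" "max t 0 + 1"] Lam_mono[of t "max t 0"] by simp
 also have "\<dots> \<le> rho"
  by (rule tendsto_lowerbound[OF Lam_tendsto])
   (use Lam_mono in \<open>auto intro!: eventually_mono[OF eventually_ge_at_top]\<close>)
 finally show ?thesis .
qed

lemma rho_pos: "0 < rho"
 using Lam_less_rho[of 0] Lam_nonneg[of 0] by simp

lemma Lam_surj:
 assumes "0 \<le> v" "v < rho" shows "\<exists>t\<ge>0. Lam t = v"
proof -
 have "\<forall>\<^sub>F t in at_top. v < Lam t" using Lam_tendsto assms(2) by (rule order_tendstoD)
 then obtain b where b: "\<And>t. b \<le> t \<Longrightarrow> v < Lam t" by (auto simp: eventually_at_top_linorder)
 have "\<exists>t. 0 \<le> t \<and> t \<le> max b 0 \<and> Lam t = v"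
  by (rule IVT') (use b[of "max b 0"] assms Lam_nonpos[of 0] continuous_on_subset[OF Lam_cont] in auto)
 then show ?thesis by blast
qed

lemma nu_Icc: "emeasure nu {0..t} = ennreal (Lam t / rho)"
proof -
 have "emeasure nu {0..t} = (\<integral>\<^sup>+s. ennreal (indicator {0..} s * R s / rho) * indicator {0..t} s \<partial>lborel)"
  unfolding nu_def
 proof (rule emeasure_density)
  have "(\<lambda>s. indicator {0..} s * R s) \<in> borel_measurable lborel"
   using int_R unfolding set_integrable_def by simp
  then show "(\<lambda>s. ennreal (indicator {0..} s * R s / rho)) \<in> borel_measurable lborel" by measurable
 qed simp
 also have "\<dots> = (\<integral>\<^sup>+s. ennreal (indicator {0..t} s *\<^sub>R R s / rho) \<partial>lborel)"
  by (rule nn_integral_cong) (auto simp: indicator_def)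
 also have "\<dots> = ennreal (LBINT s. indicator {0..t} s *\<^sub>R R s / rho)"
 proof (rule nn_integral_eq_integral)
  show "integrable lborel (\<lambda>s. indicator {0..t} s *\<^sub>R R s / rho)"
   using int_R_Icc[of 0 t] unfolding set_integrable_def by simp
  show "AE s in lborel. 0 \<le> indicator {0..t} s *\<^sub>R R s / rho"
   using pos_R rho_pos by (intro AE_I2) (auto simp: indicator_def less_imp_le)
 qed
 also have "(LBINT s. indicator {0..t} s *\<^sub>R R s / rho) = Lam t / rho"
  unfolding Lam_def set_lebesgue_integral_def by simp
 finally show ?thesis .
qed

lemma sets_nu [measurable_cong, simp]: "sets nu = sets borel"
 by (simp add: nu_def)

lemma space_nu [simp]: "space nu = UNIV"
 by (simp add: nu_def)

lemma prob_space_nu: "prob_space nu"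
proof
 have m: "(\<lambda>s. ennreal (indicator {0..} s * R s / rho)) \<in> borel_measurable lborel"
 proof -
  have "(\<lambda>s. indicator {0..} s * R s) \<in> borel_measurable lborel"
   using int_R unfolding set_integrable_def by simp
  then show ?thesis by measurable
 qed
 have "emeasure nu (space nu) = (\<integral>\<^sup>+s. ennreal (indicator {0..} s * R s / rho) \<partial>lborel)"
  unfolding nu_def using emeasure_density[OF m, of UNIV] by simp
 also have "\<dots> = ennreal (LBINT s. indicator {0..} s *\<^sub>R R s / rho)"
  using int_R pos_R rho_pos unfolding set_integrable_def
  by (subst nn_integral_eq_integral[symmetric]) (auto intro!: AE_I2 simp: indicator_def less_imp_le)
 also have "(LBINT s. indicator {0..} s *\<^sub>R R s / rho) = rho / rho"
  unfolding rho_def set_lebesgue_integral_def by simp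
 finally show "emeasure nu (space nu) = 1" using rho_pos by simp
qed

lemma nu_measure_Icc: "measure nu {0..t} = Lam t / rho"
 using nu_Icc[of t] Lam_nonneg[of t] rho_pos by (simp add: measure_def)

lemma nu_Ioc:
 assumes "0 \<le> s" "s \<le> t" shows "measure nu {s<..t} = (Lam t - Lam s) / rho"
proof -
 interpret prob_space nu by (rule prob_space_nu)
 have "{s<..t} = {0..t} - {0..s}" using assms by auto
 moreover have "measure nu ({0..t} - {0..s}) = measure nu {0..t} - measure nu {0..s}"
  by (rule finite_measure_Diff) (use assms in auto)
 ultimately show ?thesis by (simp add: nu_measure_Icc diff_divide_distrib)
qed

lemma nu_Ioc0: "0 \<le> t \<Longrightarrow> measure nu {0<..t} = Lam t / rho"
 using nu_Ioc[of 0 t] Lam_nonpos[of 0] by simp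

end

subsection \<open>Bracketing the survival event\<close>

locale class_limit = intensity_limit +
 fixes a :: agent_class
 assumes valid_a: "valid_class a"
begin

abbreviation "alpha \<equiv> premium a"

lemma gamma_pos: "0 < init_capital a" and alpha_cont: "continuous_on {0..} alpha"
 and alpha_mono: "0 \<le> s \<Longrightarrow> s \<le> t \<Longrightarrow> alpha s \<le> alpha t"
 using valid_a unfolding valid_class_def by (auto simp: mono_on_def)

sublocale shock: prob_space "shock_law a"
 using valid_a unfolding valid_class_def by simp

sublocale loss: prob_space "loss_law a"
 using valid_a unfolding valid_class_def by simp

sublocale nu: prob_space nu by (rule prob_space_nu)

text \<open>
  What the premium has to exceed right after loss \<open>j\<close>. Component 0 of \<open>y\<close> is the shock.
\<close>

definition debt :: "(nat \<Rightarrow> real) \<Rightarrow> nat \<Rightarrow> real" where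
 "debt y j = (\<Sum>i = 1..j. y i) - (init_capital a * (1 - y 0) - claims a)"

text \<open>
  Let the reveal with number \<open>v n\<close> cause the debt \<open>s\<close>. When \<open>num / n\<close> is close to \<open>Lam\<close>, this
  reveal happens at a time where \<open>Lam\<close> lies between \<open>v - \<eta>\<close> and \<open>v + \<eta>\<close>. So
  \<open>met_early\<close> is necessary and \<open>met_surely\<close> is sufficient for the premium to cover the debt.
  Rational times suffice by continuity and monotonicity, and keep these conditions measurable.
\<close>

definition met_early :: "real \<Rightarrow> real \<Rightarrow> real \<Rightarrow> bool" where
 "met_early \<eta> v s \<longleftrightarrow> (\<exists>q\<in>\<rat>. 0 \<le> q \<and> Lam q < v + \<eta> \<and> s \<le> alpha q)"

definition met_surely :: "real \<Rightarrow> real \<Rightarrow> real \<Rightarrow> bool" where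
 "met_surely \<eta> v s \<longleftrightarrow> (\<forall>q\<in>\<rat>. 0 \<le> q \<longrightarrow> v - \<eta> < Lam q \<longrightarrow> s < alpha q)"

lemma met_earlyI:
 assumes "0 \<le> t" "Lam t < v + \<eta>" "s \<le> alpha t"
 shows "met_early \<eta> v s"
proof -
 have "open (Lam -` {..<v + \<eta>})" by (intro open_vimage Lam_cont) simp
 moreover have "t \<in> Lam -` {..<v + \<eta>}" using assms by simp
 ultimately obtain d where d: "0 < d" "\<And>x. dist x t < d \<Longrightarrow> x \<in> Lam -` {..<v + \<eta>}"
  unfolding open_dist by blast
 obtain q where q: "q \<in> \<rat>" "t < q" "q < t + d" using Rats_dense_in_real[of t "t + d"] d by auto
 then have "Lam q < v + \<eta>" using d(2)[of q] by (simp add: dist_real_def)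
 moreover have "s \<le> alpha q" using assms alpha_mono[of t q] q by simp
 ultimately show ?thesis unfolding met_early_def using q assms by (intro bexI[of _ q]) auto
qed

lemma met_surelyD:
 assumes "met_surely \<eta> v s" "0 \<le> t" "v - \<eta> < Lam t"
 shows "s < alpha t"
proof (cases "t = 0")
 case True
 then show ?thesis using assms unfolding met_surely_def by auto
next
 case False
 have "open (Lam -` {v - \<eta><..})" by (intro open_vimage Lam_cont) simp
 moreover have "t \<in> Lam -` {v - \<eta><..}" using assms by simp
 ultimately obtain d where d: "0 < d" "\<And>x. dist x t < d \<Longrightarrow> x \<in> Lam -` {v - \<eta><..}"
  unfolding open_dist by blast
 obtain q where q: "q \<in> \<rat>" "max 0 (t - d) < q" "q < t"
  using Rats_dense_in_real[of "max 0 (t - d)" t] d assms False by auto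
 then have "v - \<eta> < Lam q" using d(2)[of q] by (simp add: dist_real_def)
 then have "s < alpha q" using assms(1) q unfolding met_surely_def by auto
 then show ?thesis using alpha_mono[of q t] q by simp
qed

lemma met_early_mono: "met_early \<eta> v s \<Longrightarrow> v + \<eta> \<le> v' + \<eta>' \<Longrightarrow> met_early \<eta>' v' s"
 unfolding met_early_def by force

lemma met_surely_mono: "met_surely \<eta> v s \<Longrightarrow> v - \<eta> \<le> v' - \<eta>' \<Longrightarrow> met_surely \<eta>' v' s"
 unfolding met_surely_def by force

definition upper :: "real \<Rightarrow> nat \<Rightarrow> (nat \<Rightarrow> real) \<Rightarrow> (nat \<Rightarrow> real) set" where
 "upper \<eta> \<theta> v = {y \<in> space (agent_law a \<theta>). debt y 0 \<le> alpha 0 \<and> (\<forall>j\<in>{1..\<theta>}. met_early \<eta> (v j) (debt y j))}"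

definition lower :: "real \<Rightarrow> nat \<Rightarrow> (nat \<Rightarrow> real) \<Rightarrow> (nat \<Rightarrow> real) set" where
 "lower \<eta> \<theta> v = {y \<in> space (agent_law a \<theta>). debt y 0 < alpha 0 \<and> (\<forall>j\<in>{1..\<theta>}. met_surely \<eta> (v j) (debt y j))}"

abbreviation "ticks \<theta> \<equiv> PiM {1..\<theta>} (\<lambda>_. nu)"
abbreviation "joint \<theta> \<equiv> agent_law a \<theta> \<Otimes>\<^sub>M ticks \<theta>"

definition by_time :: "nat \<Rightarrow> real \<Rightarrow> (nat \<Rightarrow> real) set" where
 "by_time \<theta> t = Pi\<^sub>E {1..\<theta>} (\<lambda>_. {0<..t})"

text \<open>
  In the limit the number of a reveal divided by \<open>n\<close> becomes the value of \<open>Lam\<close> at its arrival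
  time.
\<close>

definition scaled :: "nat \<Rightarrow> (nat \<Rightarrow> real) \<Rightarrow> nat \<Rightarrow> real" where
 "scaled \<theta> u j = Lam (order_stat \<theta> u j)"

definition upper_joint :: "real \<Rightarrow> nat \<Rightarrow> real \<Rightarrow> ((nat \<Rightarrow> real) \<times> (nat \<Rightarrow> real)) set" where
 "upper_joint \<eta> \<theta> t = {z \<in> space (joint \<theta>). fst z \<in> upper \<eta> \<theta> (scaled \<theta> (snd z)) \<and> snd z \<in> by_time \<theta> t}"

definition lower_joint :: "real \<Rightarrow> nat \<Rightarrow> real \<Rightarrow> ((nat \<Rightarrow> real) \<times> (nat \<Rightarrow> real)) set" where
 "lower_joint \<eta> \<theta> t = {z \<in> space (joint \<theta>). fst z \<in> lower \<eta> \<theta> (scaled \<theta> (snd z)) \<and> snd z \<in> by_time \<theta> t}"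

definition survive :: "nat \<Rightarrow> (nat \<Rightarrow> real) \<Rightarrow> (nat \<Rightarrow> real) \<Rightarrow> bool" where
 "survive \<theta> y u \<longleftrightarrow> debt y 0 \<le> alpha 0 \<and>
   (\<forall>j\<in>{1..\<theta>}. \<exists>q\<in>\<rat>. 0 \<le> q \<and> q < order_stat \<theta> u j \<and> debt y j \<le> alpha q)"

definition true_joint :: "nat \<Rightarrow> real \<Rightarrow> ((nat \<Rightarrow> real) \<times> (nat \<Rightarrow> real)) set" where
 "true_joint \<theta> t = {z \<in> space (joint \<theta>). survive \<theta> (fst z) (snd z) \<and> snd z \<in> by_time \<theta> t}"

lemma sets_agent_law: "sets (agent_law a \<theta>) = sets (PiM {0..\<theta>} (\<lambda>_. borel))"
 unfolding agent_law_def by (rule sets_PiM_cong) auto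

lemma sets_times: "sets (ticks \<theta>) = sets (PiM {1..\<theta>} (\<lambda>_. borel))"
 by (rule sets_PiM_cong) auto

lemma agent_component [measurable]: "j \<le> \<theta> \<Longrightarrow> (\<lambda>y. y j) \<in> borel_measurable (agent_law a \<theta>)"
 unfolding measurable_cong_sets[OF sets_agent_law refl]
 by (rule measurable_component_singleton) simp

lemma debt_measurable [measurable]: "j \<le> \<theta> \<Longrightarrow> (\<lambda>y. debt y j) \<in> borel_measurable (agent_law a \<theta>)"
 unfolding debt_def
 by (intro borel_measurable_diff borel_measurable_sum borel_measurable_times borel_measurable_const agent_component) auto

lemma order_stat_times [measurable]: "j \<in> {1..\<theta>} \<Longrightarrow> (\<lambda>u. order_stat \<theta> u j) \<in> borel_measurable (ticks \<theta>)"
 unfolding measurable_cong_sets[OF sets_times refl] by (rule order_stat_measurable)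

lemma met_early_set:
 assumes [measurable]: "f \<in> borel_measurable N" "g \<in> borel_measurable N"
 shows "{z \<in> space N. met_early \<eta> (f z) (g z)} \<in> sets N"
proof -
 have "{z \<in> space N. met_early \<eta> (f z) (g z)}
  = (\<Union>q\<in>\<rat> \<inter> {0..}. {z \<in> space N. Lam q < f z + \<eta> \<and> g z \<le> alpha q})"
  unfolding met_early_def by auto
 also have "\<dots> \<in> sets N"
  by (rule sets.countable_UN') (auto simp: countable_rat intro: countable_subset[OF _ countable_rat])
 finally show ?thesis .
qed

lemma met_surely_set:
 assumes [measurable]: "f \<in> borel_measurable N" "g \<in> borel_measurable N"
 shows "{z \<in> space N. met_surely \<eta> (f z) (g z)} \<in> sets N"
proof -
 have "{z \<in> space N. met_surely \<eta> (f z) (g z)}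
  = space N - (\<Union>q\<in>\<rat> \<inter> {0..}. {z \<in> space N. f z - \<eta> < Lam q \<and> alpha q \<le> g z})"
  unfolding met_surely_def by (auto simp: not_less)
 also have "\<dots> \<in> sets N"
  by (intro sets.compl_sets sets.countable_UN')
   (auto simp: countable_rat intro: countable_subset[OF _ countable_rat])
 finally show ?thesis .
qed

lemma upper_sets: "upper \<eta> \<theta> v \<in> sets (agent_law a \<theta>)"
proof -
 have [measurable]: "(\<lambda>y. debt y 0) \<in> borel_measurable (agent_law a \<theta>)" by (rule debt_measurable) simp
 have "{y \<in> space (agent_law a \<theta>). debt y 0 \<le> alpha 0} \<inter>
  {y \<in> space (agent_law a \<theta>). \<forall>j\<in>{1..\<theta>}. met_early \<eta> (v j) (debt y j)} \<in> sets (agent_law a \<theta>)"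
 proof (rule sets.Int)
  show "{y \<in> space (agent_law a \<theta>). debt y 0 \<le> alpha 0} \<in> sets (agent_law a \<theta>)" by measurable
  show "{y \<in> space (agent_law a \<theta>). \<forall>j\<in>{1..\<theta>}. met_early \<eta> (v j) (debt y j)} \<in> sets (agent_law a \<theta>)"
   by (rule sets.sets_Collect_finite_All) (auto intro!: met_early_set debt_measurable)
 qed
 also have "{y \<in> space (agent_law a \<theta>). debt y 0 \<le> alpha 0} \<inter>
  {y \<in> space (agent_law a \<theta>). \<forall>j\<in>{1..\<theta>}. met_early \<eta> (v j) (debt y j)} = upper \<eta> \<theta> v"
  unfolding upper_def by auto
 finally show ?thesis .
qed

lemma lower_sets: "lower \<eta> \<theta> v \<in> sets (agent_law a \<theta>)"
proof -
 have [measurable]: "(\<lambda>y. debt y 0) \<in> borel_measurable (agent_law a \<theta>)" by (rule debt_measurable) simp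
 have "{y \<in> space (agent_law a \<theta>). debt y 0 < alpha 0} \<inter>
  {y \<in> space (agent_law a \<theta>). \<forall>j\<in>{1..\<theta>}. met_surely \<eta> (v j) (debt y j)} \<in> sets (agent_law a \<theta>)"
 proof (rule sets.Int)
  show "{y \<in> space (agent_law a \<theta>). debt y 0 < alpha 0} \<in> sets (agent_law a \<theta>)" by measurable
  show "{y \<in> space (agent_law a \<theta>). \<forall>j\<in>{1..\<theta>}. met_surely \<eta> (v j) (debt y j)} \<in> sets (agent_law a \<theta>)"
   by (rule sets.sets_Collect_finite_All) (auto intro!: met_surely_set debt_measurable)
 qed
 also have "{y \<in> space (agent_law a \<theta>). debt y 0 < alpha 0} \<inter>
  {y \<in> space (agent_law a \<theta>). \<forall>j\<in>{1..\<theta>}. met_surely \<eta> (v j) (debt y j)} = lower \<eta> \<theta> v"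
  unfolding lower_def by auto
 finally show ?thesis .
qed

lemma by_time_sets: "by_time \<theta> t \<in> sets (ticks \<theta>)"
 unfolding by_time_def by (rule sets_PiM_I_finite) auto

lemma joint_debt: "j \<le> \<theta> \<Longrightarrow> (\<lambda>z. debt (fst z) j) \<in> borel_measurable (joint \<theta>)"
 by (rule measurable_compose[OF measurable_fst debt_measurable])

lemma joint_order_stat: "j \<in> {1..\<theta>} \<Longrightarrow> (\<lambda>z. order_stat \<theta> (snd z) j) \<in> borel_measurable (joint \<theta>)"
 by (rule measurable_compose[OF measurable_snd order_stat_times])

lemma joint_scaled: "j \<in> {1..\<theta>} \<Longrightarrow> (\<lambda>z. scaled \<theta> (snd z) j) \<in> borel_measurable (joint \<theta>)"
 unfolding scaled_def by (rule measurable_compose[OF joint_order_stat Lam_measurable])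

lemma joint_by_time: "{z \<in> space (joint \<theta>). snd z \<in> by_time \<theta> t} \<in> sets (joint \<theta>)"
 using measurable_sets[OF measurable_snd by_time_sets]
 by (simp add: vimage_def Int_def conj_commute)

lemma upper_joint_sets: "upper_joint \<eta> \<theta> t \<in> sets (joint \<theta>)"
proof -
 have [measurable]: "(\<lambda>z. debt (fst z) 0) \<in> borel_measurable (joint \<theta>)" by (rule joint_debt) simp
 have 1: "{z \<in> space (joint \<theta>). debt (fst z) 0 \<le> alpha 0} \<in> sets (joint \<theta>)" by measurable
 have 2: "{z \<in> space (joint \<theta>). \<forall>j\<in>{1..\<theta>}. met_early \<eta> (scaled \<theta> (snd z) j) (debt (fst z) j)} \<in> sets (joint \<theta>)"
  by (rule sets.sets_Collect_finite_All, rule met_early_set, erule joint_scaled, rule joint_debt) simp_all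
 have "upper_joint \<eta> \<theta> t = {z \<in> space (joint \<theta>). debt (fst z) 0 \<le> alpha 0} \<inter>
  {z \<in> space (joint \<theta>). \<forall>j\<in>{1..\<theta>}. met_early \<eta> (scaled \<theta> (snd z) j) (debt (fst z) j)} \<inter>
  {z \<in> space (joint \<theta>). snd z \<in> by_time \<theta> t}"
  unfolding upper_joint_def upper_def by (auto simp: space_pair_measure)
 then show ?thesis using sets.Int[OF sets.Int[OF 1 2] joint_by_time] by simp
qed

lemma lower_joint_sets: "lower_joint \<eta> \<theta> t \<in> sets (joint \<theta>)"
proof -
 have [measurable]: "(\<lambda>z. debt (fst z) 0) \<in> borel_measurable (joint \<theta>)" by (rule joint_debt) simp
 have 1: "{z \<in> space (joint \<theta>). debt (fst z) 0 < alpha 0} \<in> sets (joint \<theta>)" by measurable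
 have 2: "{z \<in> space (joint \<theta>). \<forall>j\<in>{1..\<theta>}. met_surely \<eta> (scaled \<theta> (snd z) j) (debt (fst z) j)} \<in> sets (joint \<theta>)"
  by (rule sets.sets_Collect_finite_All, rule met_surely_set, erule joint_scaled, rule joint_debt) simp_all
 have "lower_joint \<eta> \<theta> t = {z \<in> space (joint \<theta>). debt (fst z) 0 < alpha 0} \<inter>
  {z \<in> space (joint \<theta>). \<forall>j\<in>{1..\<theta>}. met_surely \<eta> (scaled \<theta> (snd z) j) (debt (fst z) j)} \<inter>
  {z \<in> space (joint \<theta>). snd z \<in> by_time \<theta> t}"
  unfolding lower_joint_def lower_def by (auto simp: space_pair_measure)
 then show ?thesis using sets.Int[OF sets.Int[OF 1 2] joint_by_time] by simp
qed

lemma survive_sets: "{z \<in> space (joint \<theta>). survive \<theta> (fst z) (snd z)} \<in> sets (joint \<theta>)"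
proof -
 have [measurable]: "(\<lambda>z. debt (fst z) 0) \<in> borel_measurable (joint \<theta>)" by (rule joint_debt) simp
 have 1: "{z \<in> space (joint \<theta>). debt (fst z) 0 \<le> alpha 0} \<in> sets (joint \<theta>)" by measurable
 have 2: "{z \<in> space (joint \<theta>). \<forall>j\<in>{1..\<theta>}. \<exists>q\<in>\<rat>. 0 \<le> q \<and> q < order_stat \<theta> (snd z) j \<and> debt (fst z) j \<le> alpha q} \<in> sets (joint \<theta>)"
 proof (rule sets.sets_Collect_finite_All)
  fix j assume j: "j \<in> {1..\<theta>}"
  have [measurable]: "(\<lambda>z. debt (fst z) j) \<in> borel_measurable (joint \<theta>)"
   "(\<lambda>z. order_stat \<theta> (snd z) j) \<in> borel_measurable (joint \<theta>)"
   using joint_debt[of j] joint_order_stat[of j] j by auto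
  have "{z \<in> space (joint \<theta>). \<exists>q\<in>\<rat>. 0 \<le> q \<and> q < order_stat \<theta> (snd z) j \<and> debt (fst z) j \<le> alpha q}
   = (\<Union>q\<in>\<rat> \<inter> {0..}. {z \<in> space (joint \<theta>). q < order_stat \<theta> (snd z) j \<and> debt (fst z) j \<le> alpha q})"
   by auto
  also have "\<dots> \<in> sets (joint \<theta>)"
   by (rule sets.countable_UN', rule countable_subset[OF _ countable_rat], blast, rule image_subsetI, measurable)
  finally show "{z \<in> space (joint \<theta>). \<exists>q\<in>\<rat>. 0 \<le> q \<and> q < order_stat \<theta> (snd z) j \<and> debt (fst z) j \<le> alpha q} \<in> sets (joint \<theta>)" .
 qed simp
 have "{z \<in> space (joint \<theta>). survive \<theta> (fst z) (snd z)} = {z \<in> space (joint \<theta>). debt (fst z) 0 \<le> alpha 0} \<inter>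
  {z \<in> space (joint \<theta>). \<forall>j\<in>{1..\<theta>}. \<exists>q\<in>\<rat>. 0 \<le> q \<and> q < order_stat \<theta> (snd z) j \<and> debt (fst z) j \<le> alpha q}"
  unfolding survive_def by auto
 then show ?thesis using sets.Int[OF 1 2] by simp
qed

lemma true_joint_sets: "true_joint \<theta> t \<in> sets (joint \<theta>)"
proof -
 have "true_joint \<theta> t = {z \<in> space (joint \<theta>). survive \<theta> (fst z) (snd z)} \<inter> {z \<in> space (joint \<theta>). snd z \<in> by_time \<theta> t}"
  unfolding true_joint_def by auto
 then show ?thesis using sets.Int[OF survive_sets joint_by_time] by simp
qed

lemma order_stat_by_time:
 assumes "u \<in> by_time \<theta> t" "j \<in> {1..\<theta>}" shows "0 < order_stat \<theta> u j" "order_stat \<theta> u j \<le> t"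
 using order_stat_in[OF assms(2), of u] assms unfolding by_time_def PiE_iff by auto

lemma lower_subset_true: "0 < \<eta> \<Longrightarrow> lower_joint \<eta> \<theta> t \<subseteq> true_joint \<theta> t"
proof
 fix z assume \<eta>: "0 < \<eta>" and "z \<in> lower_joint \<eta> \<theta> t"
 then have z: "z \<in> space (joint \<theta>)" "debt (fst z) 0 < alpha 0" "snd z \<in> by_time \<theta> t"
  and l: "\<And>j. j \<in> {1..\<theta>} \<Longrightarrow> met_surely \<eta> (scaled \<theta> (snd z) j) (debt (fst z) j)"
  unfolding lower_joint_def lower_def by auto
 have "\<exists>q\<in>\<rat>. 0 \<le> q \<and> q < order_stat \<theta> (snd z) j \<and> debt (fst z) j \<le> alpha q" if j: "j \<in> {1..\<theta>}" for j
 proof -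
  define x where "x = order_stat \<theta> (snd z) j"
  have x: "0 < x" using order_stat_by_time[OF z(3) j] by (simp add: x_def)
  have "open (Lam -` {Lam x - \<eta><..})" by (intro open_vimage Lam_cont) simp
  moreover have "x \<in> Lam -` {Lam x - \<eta><..}" using \<eta> by simp
  ultimately obtain d where d: "0 < d" "\<And>y. dist y x < d \<Longrightarrow> y \<in> Lam -` {Lam x - \<eta><..}"
   unfolding open_dist by blast
  obtain q where q: "q \<in> \<rat>" "max 0 (x - d) < q" "q < x"
   using Rats_dense_in_real[of "max 0 (x - d)" x] d x by auto
  then have "Lam x - \<eta> < Lam q" using d(2)[of q] by (simp add: dist_real_def)
  then have "debt (fst z) j < alpha q"
   using l[OF j] q unfolding met_surely_def scaled_def x_def[symmetric] by auto
  then show ?thesis using q unfolding x_def by (intro bexI[of _ q]) auto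
 qed
 then show "z \<in> true_joint \<theta> t" using z unfolding true_joint_def survive_def by auto
qed

lemma true_subset_upper: "0 < \<eta> \<Longrightarrow> true_joint \<theta> t \<subseteq> upper_joint \<eta> \<theta> t"
proof
 fix z assume \<eta>: "0 < \<eta>" and z: "z \<in> true_joint \<theta> t"
 have "met_early \<eta> (scaled \<theta> (snd z) j) (debt (fst z) j)" if j: "j \<in> {1..\<theta>}" for j
 proof -
  have "\<exists>q\<in>\<rat>. 0 \<le> q \<and> q < order_stat \<theta> (snd z) j \<and> debt (fst z) j \<le> alpha q"
   using z j unfolding true_joint_def survive_def by blast
  then obtain q where q: "0 \<le> q" "q < order_stat \<theta> (snd z) j" "debt (fst z) j \<le> alpha q"
   by blast
  then have "Lam q < scaled \<theta> (snd z) j + \<eta>"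
   unfolding scaled_def using Lam_mono[of q "order_stat \<theta> (snd z) j"] \<eta> by simp
  then show ?thesis using q by (intro met_earlyI)
 qed
 then show "z \<in> upper_joint \<eta> \<theta> t"
  using z unfolding true_joint_def survive_def upper_joint_def upper_def by (auto simp: space_pair_measure)
qed

definition vec :: "nat \<Rightarrow> real \<Rightarrow> (nat \<Rightarrow> real) \<Rightarrow> nat \<Rightarrow> real" where
 "vec \<theta> e l = (\<lambda>j\<in>{0..\<theta>}. if j = 0 then e else l j)"

abbreviation "losses d \<equiv> PiM {1..d} (\<lambda>_. loss_law a)"

lemma prob_space_losses: "prob_space (losses d)"
 by (intro prob_space_PiM loss.prob_space_axioms)

lemma prob_space_times: "prob_space (ticks d)"
 by (intro prob_space_PiM nu.prob_space_axioms)

lemma vec_measurable: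
 assumes "\<theta> \<le> d"
 shows "(\<lambda>x. vec \<theta> (fst x) (snd x)) \<in> measurable (shock_law a \<Otimes>\<^sub>M losses d) (agent_law a \<theta>)"
 unfolding vec_def agent_law_def
proof (rule measurable_restrict)
 fix j assume j: "j \<in> {0..\<theta>}"
 show "(\<lambda>x. if j = 0 then fst x else snd x j) \<in> measurable (shock_law a \<Otimes>\<^sub>M losses d) (class_law a j)"
 proof (cases "j = 0")
  case False
  then have "(\<lambda>x. snd x j) \<in> measurable (shock_law a \<Otimes>\<^sub>M losses d) (loss_law a)"
   using j assms by (intro measurable_compose[OF measurable_snd] measurable_component_singleton) auto
  then show ?thesis using False by (simp add: class_law_def)
 qed (simp add: class_law_def)
qed

text \<open>
  The survival probability is defined with \<open>d\<close> losses, of which only \<open>\<theta>\<close> matter: the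
  other components integrate out.
\<close>

lemma agent_law_distr:
 assumes "\<theta> \<le> d"
 shows "distr (shock_law a \<Otimes>\<^sub>M losses d) (agent_law a \<theta>) (\<lambda>x. vec \<theta> (fst x) (snd x)) = agent_law a \<theta>"
proof -
 interpret C: prob_space "class_law a j" for j by (rule prob_space_class_law[OF valid_a])
 interpret P: product_prob_space "class_law a" "{0..\<theta>}" by standard
 interpret LP: prob_space "losses d" by (rule prob_space_losses)
 interpret L: product_prob_space "\<lambda>_. loss_law a" "{1..d}" by standard
 define Q where "Q = distr (shock_law a \<Otimes>\<^sub>M losses d) (agent_law a \<theta>) (\<lambda>x. vec \<theta> (fst x) (snd x))"
 have "Q = PiM {0..\<theta>} (class_law a)"
 proof (rule P.PiM_eqI)
  show "sets Q = sets (PiM {0..\<theta>} (class_law a))" by (simp add: Q_def agent_law_def)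
  fix A assume A: "\<And>j. j \<in> {0..\<theta>} \<Longrightarrow> A j \<in> sets (class_law a j)"
  define B where "B j = (if j \<le> \<theta> then A j else space (loss_law a))" for j
  have B: "B j \<in> sets (loss_law a)" if "j \<in> {1..d}" for j
   using A[of j] that unfolding B_def by (auto simp: class_law_def)
  have A0: "A 0 \<in> sets (shock_law a)" using A[of 0] by (simp add: class_law_def)
  have "Pi\<^sub>E {0..\<theta>} A \<in> sets (agent_law a \<theta>)" unfolding agent_law_def by (rule sets_PiM_I_finite) (use A in auto)
  then have "emeasure Q (Pi\<^sub>E {0..\<theta>} A) = emeasure (shock_law a \<Otimes>\<^sub>M losses d)
   ((\<lambda>x. vec \<theta> (fst x) (snd x)) -` Pi\<^sub>E {0..\<theta>} A \<inter> space (shock_law a \<Otimes>\<^sub>M losses d))"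
   unfolding Q_def by (intro emeasure_distr vec_measurable assms)
  also have "(\<lambda>x. vec \<theta> (fst x) (snd x)) -` Pi\<^sub>E {0..\<theta>} A \<inter> space (shock_law a \<Otimes>\<^sub>M losses d)
   = A 0 \<times> Pi\<^sub>E {1..d} B"
  proof (intro set_eqI)
   fix x :: "real \<times> (nat \<Rightarrow> real)"
   have "vec \<theta> (fst x) (snd x) \<in> Pi\<^sub>E {0..\<theta>} A \<longleftrightarrow> fst x \<in> A 0 \<and> (\<forall>j\<in>{1..\<theta>}. snd x j \<in> A j)"
   proof -
    have "vec \<theta> (fst x) (snd x) \<in> Pi\<^sub>E {0..\<theta>} A \<longleftrightarrow> (\<forall>j\<in>{0..\<theta>}. (if j = 0 then fst x else snd x j) \<in> A j)"
     unfolding vec_def by (auto simp: PiE_iff)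
    also have e: "{0..\<theta>} = insert 0 {1..\<theta>}" by auto
    also have "(\<forall>j\<in>insert 0 {1..\<theta>}. (if j = 0 then fst x else snd x j) \<in> A j) \<longleftrightarrow> fst x \<in> A 0 \<and> (\<forall>j\<in>{1..\<theta>}. snd x j \<in> A j)"
     by auto
    finally show ?thesis by (simp only: e)
   qed
   moreover have "x \<in> space (shock_law a \<Otimes>\<^sub>M losses d) \<longleftrightarrow> snd x \<in> extensional {1..d}"
    by (cases x) (simp add: space_pair_measure space_PiM PiE_iff shock_law_def loss_law_def)
   moreover have "(\<forall>j\<in>{1..d}. snd x j \<in> B j) \<longleftrightarrow> (\<forall>j\<in>{1..\<theta>}. snd x j \<in> A j)"
    using assms unfolding B_def loss_law_def by auto
   ultimately show "x \<in> (\<lambda>x. vec \<theta> (fst x) (snd x)) -` Pi\<^sub>E {0..\<theta>} A \<inter> space (shock_law a \<Otimes>\<^sub>M losses d)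
    \<longleftrightarrow> x \<in> A 0 \<times> Pi\<^sub>E {1..d} B"
    unfolding mem_Times_iff PiE_iff Int_iff vimage_eq by blast
  qed
  also have "emeasure (shock_law a \<Otimes>\<^sub>M losses d) (A 0 \<times> Pi\<^sub>E {1..d} B)
   = emeasure (shock_law a) (A 0) * emeasure (losses d) (Pi\<^sub>E {1..d} B)"
   by (rule LP.emeasure_pair_measure_Times) (use A0 B in \<open>auto intro: sets_PiM_I_finite\<close>)
  also have "emeasure (losses d) (Pi\<^sub>E {1..d} B) = (\<Prod>j\<in>{1..d}. emeasure (loss_law a) (B j))"
   by (rule L.emeasure_PiM) (use B in auto)
  also have "\<dots> = (\<Prod>j\<in>{1..\<theta>}. emeasure (loss_law a) (B j))"
   by (rule prod.mono_neutral_right) (use assms in \<open>auto simp: B_def loss.emeasure_space_1\<close>)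
  also have "\<dots> = (\<Prod>j\<in>{Suc 0..\<theta>}. emeasure (class_law a j) (A j))"
   by (rule prod.cong) (auto simp: B_def class_law_def)
  also have "emeasure (shock_law a) (A 0) = emeasure (class_law a 0) (A 0)" by (simp add: class_law_def)
  also have "\<dots> * (\<Prod>j\<in>{Suc 0..\<theta>}. emeasure (class_law a j) (A j)) = (\<Prod>j\<in>{0..\<theta>}. emeasure (class_law a j) (A j))"
   by (rule prod.atLeast_Suc_atMost[symmetric]) simp
  finally show "emeasure Q (Pi\<^sub>E {0..\<theta>} A) = (\<Prod>j\<in>{0..\<theta>}. emeasure (class_law a j) (A j))" .
 qed simp
 then show ?thesis unfolding Q_def agent_law_def .
qed

text \<open>The shock has a density, so no level is hit exactly.\<close>

lemma debt_no_atom: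
 assumes "j \<le> \<theta>"
 shows "emeasure (agent_law a \<theta>) {y \<in> space (agent_law a \<theta>). debt y j = r} = 0"
proof -
 interpret LP: prob_space "losses \<theta>" by (rule prob_space_losses)
 interpret SL: pair_prob_space "shock_law a" "losses \<theta>" by standard
 define X where "X = {y \<in> space (agent_law a \<theta>). debt y j = r}"
 have [measurable]: "(\<lambda>y. debt y j) \<in> borel_measurable (agent_law a \<theta>)" by (rule debt_measurable[OF assms])
 have X: "X \<in> sets (agent_law a \<theta>)" unfolding X_def by measurable
 have atom: "emeasure (shock_law a) {x} = 0" for x
 proof -
  have m: "(\<lambda>s. ennreal (shock_density a s)) \<in> borel_measurable lborel"
   using valid_a unfolding valid_class_def by simp
  have "(\<integral>\<^sup>+s. ennreal (shock_density a s) * indicator {x} s \<partial>lborel) = (\<integral>\<^sup>+(s::real). 0 \<partial>lborel)"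
   by (rule nn_integral_cong_AE, rule eventually_mono[OF AE_lborel_singleton[of x]]) simp
  then show ?thesis unfolding shock_law_def by (subst emeasure_density[OF m]) simp_all
 qed
 define Y where "Y = (\<lambda>x. vec \<theta> (fst x) (snd x)) -` X \<inter> space (shock_law a \<Otimes>\<^sub>M losses \<theta>)"
 have Y: "Y \<in> sets (shock_law a \<Otimes>\<^sub>M losses \<theta>)"
  unfolding Y_def by (rule measurable_sets[OF vec_measurable[OF order_refl] X])
 have "emeasure (agent_law a \<theta>) X = emeasure (distr (shock_law a \<Otimes>\<^sub>M losses \<theta>) (agent_law a \<theta>) (\<lambda>x. vec \<theta> (fst x) (snd x))) X"
  by (simp only: agent_law_distr[OF order_refl])
 also have "\<dots> = emeasure (shock_law a \<Otimes>\<^sub>M losses \<theta>) Y"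
  unfolding Y_def by (rule emeasure_distr[OF vec_measurable[OF order_refl] X])
 also have "\<dots> = (\<integral>\<^sup>+l. emeasure (shock_law a) ((\<lambda>e. (e, l)) -` Y) \<partial>losses \<theta>)"
  by (rule SL.emeasure_pair_measure_alt2[OF Y])
 also have "\<dots> = (\<integral>\<^sup>+l. 0 \<partial>losses \<theta>)"
 proof (rule nn_integral_cong)
  fix l
  have "(\<lambda>e. (e, l)) -` Y \<subseteq> {(r + init_capital a - claims a - (\<Sum>i = 1..j. l i)) / init_capital a}"
  proof
   fix e assume "e \<in> (\<lambda>e. (e, l)) -` Y"
   then have "debt (vec \<theta> e l) j = r" unfolding Y_def X_def by auto
   moreover have "(\<Sum>i = 1..j. vec \<theta> e l i) = (\<Sum>i = 1..j. l i)"
    using assms by (intro sum.cong) (auto simp: vec_def)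
   ultimately have "(\<Sum>i = 1..j. l i) - (init_capital a * (1 - e) - claims a) = r"
    unfolding debt_def by (simp add: vec_def)
   then have "init_capital a * e = r + init_capital a - claims a - (\<Sum>i = 1..j. l i)"
    by (simp add: algebra_simps)
   then show "e \<in> {(r + init_capital a - claims a - (\<Sum>i = 1..j. l i)) / init_capital a}"
    using gamma_pos by (simp add: field_simps)
  qed
  then have "emeasure (shock_law a) ((\<lambda>e. (e, l)) -` Y) \<le> emeasure (shock_law a) {(r + init_capital a - claims a - (\<Sum>i = 1..j. l i)) / init_capital a}"
   by (rule emeasure_mono) (simp add: shock_law_def)
  then show "emeasure (shock_law a) ((\<lambda>e. (e, l)) -` Y) = 0" by (simp add: atom)
 qed
 finally show ?thesis unfolding X_def by simp
qed

lemma debt_joint_no_atom: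
 assumes j: "j \<le> \<theta>" and f: "f \<in> borel_measurable (ticks \<theta>)"
 shows "{z \<in> space (joint \<theta>). debt (fst z) j = f (snd z)} \<in> null_sets (joint \<theta>)"
proof -
 interpret A: prob_space "agent_law a \<theta>" by (rule prob_space_agent_law[OF valid_a])
 interpret TP: prob_space "ticks \<theta>" by (rule prob_space_times)
 interpret P: pair_prob_space "agent_law a \<theta>" "ticks \<theta>" by standard
 define Y where "Y = {z \<in> space (joint \<theta>). debt (fst z) j = f (snd z)}"
 have [measurable]: "(\<lambda>z. debt (fst z) j) \<in> borel_measurable (joint \<theta>)" "(\<lambda>z. f (snd z)) \<in> borel_measurable (joint \<theta>)"
  by (rule joint_debt[OF j], rule measurable_compose[OF measurable_snd f])
 have Y: "Y \<in> sets (joint \<theta>)" unfolding Y_def by measurable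
 have "emeasure (joint \<theta>) Y = (\<integral>\<^sup>+u. emeasure (agent_law a \<theta>) ((\<lambda>y. (y, u)) -` Y) \<partial>ticks \<theta>)"
  by (rule P.emeasure_pair_measure_alt2[OF Y])
 also have "\<dots> = (\<integral>\<^sup>+u. 0 \<partial>ticks \<theta>)"
 proof (rule nn_integral_cong)
  fix u
  have "(\<lambda>y. (y, u)) -` Y \<subseteq> {y \<in> space (agent_law a \<theta>). debt y j = f u}"
   unfolding Y_def by (auto simp: space_pair_measure)
  then have "emeasure (agent_law a \<theta>) ((\<lambda>y. (y, u)) -` Y) \<le> emeasure (agent_law a \<theta>) {y \<in> space (agent_law a \<theta>). debt y j = f u}"
   by (rule emeasure_mono) (use debt_measurable[OF j] in measurable)
  then show "emeasure (agent_law a \<theta>) ((\<lambda>y. (y, u)) -` Y) = 0" by (simp add: debt_no_atom[OF j])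
 qed
 finally show ?thesis using Y unfolding Y_def by (intro null_setsI) auto
qed

lemma prob_space_joint: "prob_space (joint \<theta>)"
proof -
 interpret A: prob_space "agent_law a \<theta>" by (rule prob_space_agent_law[OF valid_a])
 interpret TP: prob_space "ticks \<theta>" by (rule prob_space_times)
 interpret P: pair_prob_space "agent_law a \<theta>" "ticks \<theta>" by standard
 show ?thesis by (rule P.prob_space_axioms)
qed

lemma upper_joint_mono: "\<eta> \<le> \<eta>' \<Longrightarrow> upper_joint \<eta> \<theta> t \<subseteq> upper_joint \<eta>' \<theta> t"
 unfolding upper_joint_def upper_def by (auto elim!: met_early_mono)

lemma lower_joint_antimono: "\<eta> \<le> \<eta>' \<Longrightarrow> lower_joint \<eta>' \<theta> t \<subseteq> lower_joint \<eta> \<theta> t"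
 unfolding lower_joint_def lower_def by (auto elim!: met_surely_mono)

text \<open>
  The premium is continuous and \<open>Lam\<close> is strictly increasing, so at vanishing tolerance the two
  conditions pin the debt to the premium at the arrival time.
\<close>

lemma debt_on_boundary:
 assumes x: "0 < x" and early: "\<And>\<eta>. 0 < \<eta> \<Longrightarrow> met_early \<eta> (Lam x) s"
  and late: "\<And>\<eta>. 0 < \<eta> \<Longrightarrow> \<not> met_surely \<eta> (Lam x) s"
 shows "s = alpha x"
proof (rule antisym)
 have "continuous (at x within {0..}) alpha"
  using alpha_cont x unfolding continuous_on_eq_continuous_within by (simp only: atLeast_iff less_imp_le)
 then have c: "\<forall>e>0. \<exists>d>0. \<forall>y\<in>{0..}. dist y x < d \<longrightarrow> dist (alpha y) (alpha x) < e"
  unfolding continuous_within_eps_delta .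
 have near: "\<exists>d>0. \<forall>y\<ge>0. \<bar>y - x\<bar> < d \<longrightarrow> \<bar>alpha y - alpha x\<bar> < e" if "0 < e" for e
 proof -
  from c[rule_format, OF that]
  obtain d where "0 < d" "\<forall>y\<in>{0..}. dist y x < d \<longrightarrow> dist (alpha y) (alpha x) < e"
   by blast
  then show ?thesis by (intro exI[of _ d]) (auto simp: dist_real_def)
 qed
 show "s \<le> alpha x"
 proof (rule ccontr)
  assume "\<not> s \<le> alpha x"
  then obtain d where d: "0 < d" "\<And>y. 0 \<le> y \<Longrightarrow> \<bar>y - x\<bar> < d \<Longrightarrow> \<bar>alpha y - alpha x\<bar> < s - alpha x"
   using near[of "s - alpha x"] by auto
  define y where "y = x + d / 2"
  have y: "x < y" "0 \<le> y" using d x by (auto simp: y_def)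
  have "alpha y < s" using d(2)[of y] d(1) x by (auto simp: y_def abs_less_iff)
  have "Lam x < Lam y" using Lam_strict[of x y] x y by simp
  then have "met_early (Lam y - Lam x) (Lam x) s" by (intro early) simp
  then obtain q where q: "0 \<le> q" "Lam q < Lam y" "s \<le> alpha q" unfolding met_early_def by auto
  then have "q < y" using Lam_less_iff[of q y] y by simp
  then have "alpha q \<le> alpha y" using alpha_mono[of q y] q by simp
  then show False using q \<open>alpha y < s\<close> by simp
 qed
 show "alpha x \<le> s"
 proof (rule ccontr)
  assume "\<not> alpha x \<le> s"
  then obtain d where d: "0 < d" "\<And>y. 0 \<le> y \<Longrightarrow> \<bar>y - x\<bar> < d \<Longrightarrow> \<bar>alpha y - alpha x\<bar> < alpha x - s"
   using near[of "alpha x - s"] by auto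
  define y where "y = max (x / 2) (x - d / 2)"
  have y: "y < x" "0 < y" using d x by (auto simp: y_def)
  have "\<bar>y - x\<bar> < d" using d x unfolding y_def by (auto simp: max_def abs_less_iff)
  then have "s < alpha y" using d(2)[of y] y by (auto simp: abs_less_iff)
  have "Lam y < Lam x" using Lam_strict[of y x] y by simp
  then have "\<not> met_surely (Lam x - Lam y) (Lam x) s" by (intro late) simp
  then obtain q where q: "0 \<le> q" "Lam y < Lam q" "alpha q \<le> s" unfolding met_surely_def by auto
  then have "y < q" using Lam_less_iff[of y q] y by simp
  then have "alpha y \<le> alpha q" using alpha_mono[of y q] y by simp
  then show False using q \<open>s < alpha y\<close> by simp
 qed
qed

text \<open>
  A point of the gap at every precision owes exactly the premium accumulated at one of the arrival
  times, which has probability 0.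
\<close>

lemma gap_tendsto_0:
 "(\<lambda>k. measure (joint \<theta>) (upper_joint (1 / real (Suc k)) \<theta> t)
   - measure (joint \<theta>) (lower_joint (1 / real (Suc k)) \<theta> t)) \<longlonglongrightarrow> 0"
proof -
 interpret J: prob_space "joint \<theta>" by (rule prob_space_joint)
 define e where "e k = 1 / real (Suc k)" for k
 have e0: "0 < e k" for k unfolding e_def by simp
 have em: "e k' \<le> e k" if "k \<le> k'" for k k' unfolding e_def using that by (simp add: frac_le)
 define G where "G k = upper_joint (e k) \<theta> t - lower_joint (e k) \<theta> t" for k
 have GS: "G k \<in> sets (joint \<theta>)" for k
  unfolding G_def by (intro sets.Diff upper_joint_sets lower_joint_sets)
 have dec: "decseq G"
  unfolding decseq_def G_def
  using upper_joint_mono[OF em] lower_joint_antimono[OF em] by blast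
 have lim: "(\<lambda>k. measure (joint \<theta>) (G k)) \<longlonglongrightarrow> measure (joint \<theta>) (\<Inter>k. G k)"
  by (rule J.finite_Lim_measure_decseq[OF _ dec]) (use GS in auto)
 \<comment> \<open>Arrival times are positive. The maximum gives a function that is continuous on the whole line.\<close>
 define f where "f j u = alpha (max 0 (order_stat \<theta> u j))" for j and u :: "nat \<Rightarrow> real"
 have fm: "f j \<in> borel_measurable (ticks \<theta>)" if j: "j \<in> {1..\<theta>}" for j
 proof -
  have "continuous_on UNIV (\<lambda>x. alpha (max 0 x))"
   by (rule continuous_on_compose2[OF alpha_cont]) (auto intro!: continuous_intros)
  then have "(\<lambda>x. alpha (max 0 x)) \<in> borel_measurable borel" by (rule borel_measurable_continuous_onI)
  from measurable_compose[OF order_stat_times[OF j] this] show ?thesis unfolding f_def .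
 qed
 define N where "N = {z \<in> space (joint \<theta>). debt (fst z) 0 = (\<lambda>_. alpha 0) (snd z)} \<union>
  (\<Union>j\<in>{1..\<theta>}. {z \<in> space (joint \<theta>). debt (fst z) j = f j (snd z)})"
 have N: "N \<in> null_sets (joint \<theta>)"
  unfolding N_def
 proof (rule null_sets.Un)
  show "{z \<in> space (joint \<theta>). debt (fst z) 0 = (\<lambda>_. alpha 0) (snd z)} \<in> null_sets (joint \<theta>)"
   by (rule debt_joint_no_atom) auto
  show "(\<Union>j\<in>{1..\<theta>}. {z \<in> space (joint \<theta>). debt (fst z) j = f j (snd z)}) \<in> null_sets (joint \<theta>)"
   by (rule null_sets.finite_UN, simp, rule debt_joint_no_atom[OF _ fm], auto)
 qed
 have "(\<Inter>k. G k) \<subseteq> N"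
 proof
  fix z assume z: "z \<in> (\<Inter>k. G k)"
  have zu: "z \<in> upper_joint (e k) \<theta> t" and zl: "z \<notin> lower_joint (e k) \<theta> t" for k
   using z unfolding G_def by auto
  have sp: "z \<in> space (joint \<theta>)" "debt (fst z) 0 \<le> alpha 0" "snd z \<in> by_time \<theta> t" "fst z \<in> space (agent_law a \<theta>)"
   using zu[of 0] unfolding upper_joint_def upper_def by auto
  define P where "P k j \<longleftrightarrow> met_surely (e k) (scaled \<theta> (snd z) j) (debt (fst z) j)" for k j
  have Pm: "P k' j" if "P k j" "k \<le> k'" for k k' j
   using that met_surely_mono[of "e k" _ _ _ "e k'"] em[OF that(2)] unfolding P_def by auto
  show "z \<in> N"
  proof (cases "debt (fst z) 0 = alpha 0")
   case True
   then show ?thesis using sp unfolding N_def by simp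
  next
   case False
   then have lt: "debt (fst z) 0 < alpha 0" using sp by simp
   have fail: "\<exists>j\<in>{1..\<theta>}. \<not> P k j" for k
    using zl[of k] sp lt unfolding lower_joint_def lower_def P_def by blast
   have "\<exists>j\<in>{1..\<theta>}. \<forall>k. \<not> P k j"
   proof (rule ccontr)
    assume "\<not> ?thesis"
    then have "\<forall>j\<in>{1..\<theta>}. \<exists>k. P k j" by blast
    then obtain h where h: "\<And>j. j \<in> {1..\<theta>} \<Longrightarrow> P (h j) j" by metis
    obtain j where j: "j \<in> {1..\<theta>}" "\<not> P (\<Sum>j\<in>{1..\<theta>}. h j) j" using fail by blast
    have "h j \<le> (\<Sum>j\<in>{1..\<theta>}. h j)" by (rule member_le_sum) (use j in auto)
    then show False using Pm[OF h[OF j(1)]] j(2) by blast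
   qed
   then obtain j where j: "j \<in> {1..\<theta>}" "\<And>k. \<not> P k j" by blast
   define x where "x = order_stat \<theta> (snd z) j"
   have x: "0 < x" unfolding x_def by (rule order_stat_by_time(1)[OF sp(3) j(1)])
   have small: "\<exists>k. e k \<le> \<eta>" if "0 < \<eta>" for \<eta>
    using nat_approx_posE[OF that] unfolding e_def by (metis less_imp_le)
   have "debt (fst z) j = alpha x"
   proof (rule debt_on_boundary[OF x])
    fix \<eta> :: real assume "0 < \<eta>"
    then obtain k where k: "e k \<le> \<eta>" using small by blast
    have "met_early (e k) (Lam x) (debt (fst z) j)"
     using zu[of k] j(1) unfolding upper_joint_def upper_def scaled_def x_def by blast
    then show "met_early \<eta> (Lam x) (debt (fst z) j)" by (rule met_early_mono) (use k in simp)
    show "\<not> met_surely \<eta> (Lam x) (debt (fst z) j)"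
     using j(2)[of k] met_surely_mono[of \<eta> "Lam x" _ "Lam x" "e k"] k
     unfolding P_def scaled_def x_def by auto
   qed
   then have "debt (fst z) j = f j (snd z)" unfolding f_def x_def[symmetric] using x by simp
   then show ?thesis using sp j(1) unfolding N_def by blast
  qed
 qed
 then have "emeasure (joint \<theta>) (\<Inter>k. G k) \<le> emeasure (joint \<theta>) N"
  by (rule emeasure_mono) (use N in auto)
 then have "measure (joint \<theta>) (\<Inter>k. G k) = 0" using N by (simp add: measure_def null_setsD1)
 moreover have "measure (joint \<theta>) (G k) = measure (joint \<theta>) (upper_joint (e k) \<theta> t) - measure (joint \<theta>) (lower_joint (e k) \<theta> t)" for k
  unfolding G_def
  by (rule J.finite_measure_Diff)
   (use upper_joint_sets lower_joint_sets lower_subset_true[OF e0] true_subset_upper[OF e0] in blast)+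
 ultimately show ?thesis using lim unfolding e_def by simp
qed

subsection \<open>Comparison with the survival probability\<close>

text \<open>
  Rational times turn the comparison with an infimum into countably many conditions.
\<close>

lemma threshold_less_iff:
 assumes "j \<le> \<theta>"
 shows "threshold_time a j e l < ereal x \<longleftrightarrow> (\<exists>q\<in>\<rat>. 0 \<le> q \<and> q < x \<and> debt (vec \<theta> e l) j \<le> alpha q)"
proof -
 have s: "(\<Sum>i = 1..j. vec \<theta> e l i) = (\<Sum>i = 1..j. l i)"
  using assms by (intro sum.cong) (auto simp: vec_def)
 have d: "(\<Sum>i = 1..j. l i) \<le> init_capital a * (1 - e) + alpha t - claims a \<longleftrightarrow> debt (vec \<theta> e l) j \<le> alpha t" for t
  unfolding debt_def s by (auto simp: vec_def)
 have "threshold_time a j e l < ereal x \<longleftrightarrow> (\<exists>t. 0 \<le> t \<and> debt (vec \<theta> e l) j \<le> alpha t \<and> t < x)"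
  unfolding threshold_time_def d Inf_less_iff by auto
 also have "\<dots> \<longleftrightarrow> (\<exists>q\<in>\<rat>. 0 \<le> q \<and> q < x \<and> debt (vec \<theta> e l) j \<le> alpha q)"
 proof
  assume "\<exists>t. 0 \<le> t \<and> debt (vec \<theta> e l) j \<le> alpha t \<and> t < x"
  then obtain t where t: "0 \<le> t" "debt (vec \<theta> e l) j \<le> alpha t" "t < x" by blast
  obtain q where q: "q \<in> \<rat>" "t < q" "q < x" using Rats_dense_in_real[OF t(3)] by blast
  then have "debt (vec \<theta> e l) j \<le> alpha q" using alpha_mono[of t q] t by simp
  then show "\<exists>q\<in>\<rat>. 0 \<le> q \<and> q < x \<and> debt (vec \<theta> e l) j \<le> alpha q" using q t by (intro bexI[of _ q]) auto
 qed auto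
 finally show ?thesis .
qed

lemma threshold_0_iff: "threshold_time a 0 e l = 0 \<longleftrightarrow> debt (vec \<theta> e l) 0 \<le> alpha 0"
proof
 assume t0: "threshold_time a 0 e l = 0"
 show "debt (vec \<theta> e l) 0 \<le> alpha 0"
 proof (rule ccontr)
  assume n: "\<not> ?thesis"
  have "continuous (at 0 within {0..}) alpha"
   using alpha_cont unfolding continuous_on_eq_continuous_within by (simp only: atLeast_iff order_refl)
  then have c: "\<forall>e>0. \<exists>d>0. \<forall>y\<in>{0..}. dist y 0 < d \<longrightarrow> dist (alpha y) (alpha 0) < e"
   unfolding continuous_within_eps_delta .
  have "0 < debt (vec \<theta> e l) 0 - alpha 0" using n by simp
  from c[rule_format, OF this] obtain d where d0: "0 < d"
   "\<forall>y\<in>{0..}. dist y 0 < d \<longrightarrow> dist (alpha y) (alpha 0) < debt (vec \<theta> e l) 0 - alpha 0"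
   by blast
  then have d: "0 < d" "\<And>y. 0 \<le> y \<Longrightarrow> y < d \<Longrightarrow> \<bar>alpha y - alpha 0\<bar> < debt (vec \<theta> e l) 0 - alpha 0"
   by (auto simp: dist_real_def)
  have "threshold_time a 0 e l < ereal d" unfolding t0 using d by (simp add: zero_ereal_def)
  then obtain q where "0 \<le> q" "q < d" "debt (vec \<theta> e l) 0 \<le> alpha q"
   using threshold_less_iff[of 0 \<theta> e l d] by auto
  then show False using d(2)[of q] by auto
 qed
next
 assume "debt (vec \<theta> e l) 0 \<le> alpha 0"
 then have "(\<Sum>i = 1..0. l i) \<le> init_capital a * (1 - e) + alpha 0 - claims a"
  unfolding debt_def by (simp add: vec_def)
 then have "threshold_time a 0 e l \<le> ereal 0"
  unfolding threshold_time_def by (intro Inf_lower imageI) simp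
 moreover have "0 \<le> threshold_time a 0 e l"
  unfolding threshold_time_def by (intro Inf_greatest) (auto simp: zero_ereal_def)
 ultimately show "threshold_time a 0 e l = 0" by (simp add: zero_ereal_def)
qed

lemma emeasure_arrival_law:
 assumes t: "0 < t" and A: "A \<in> sets borel"
 shows "emeasure (arrival_law R t) A = emeasure nu ({0<..t} \<inter> A) / emeasure nu {0<..t}"
proof -
 have Lt: "0 < Lam t" using Lam_strict[of 0 t] Lam_nonpos[of 0] t by simp
 have Rm: "(\<lambda>s. indicator {0..} s * R s) \<in> borel_measurable lborel"
  using int_R unfolding set_integrable_def by simp
 then have m: "(\<lambda>s. ennreal (indicator {0..} s * R s / rho)) \<in> borel_measurable lborel" by measurable
 have "set_integrable lborel {0..t} R" by (rule int_R_Icc) simp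
 then have "(\<lambda>s. indicator {0..t} s * R s) \<in> borel_measurable lborel"
  unfolding set_integrable_def by simp
 then have m2: "(\<lambda>s. ennreal (indicator {0..t} s * R s / Lam t)) \<in> borel_measurable lborel" by measurable
 have "emeasure (arrival_law R t) A = (\<integral>\<^sup>+s. ennreal (indicator {0..t} s * R s / Lam t) * indicator A s \<partial>lborel)"
  unfolding arrival_law_def Lam_def[symmetric] using A by (intro emeasure_density[OF m2]) simp
 also have "\<dots> = (\<integral>\<^sup>+s. ennreal (rho / Lam t) * (ennreal (indicator {0..} s * R s / rho) * indicator ({0<..t} \<inter> A) s) \<partial>lborel)"
 proof (rule nn_integral_cong_AE, rule eventually_mono[OF AE_lborel_singleton[of 0]])
  fix s :: real assume s: "s \<noteq> 0"
  show "ennreal (indicator {0..t} s * R s / Lam t) * indicator A s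
   = ennreal (rho / Lam t) * (ennreal (indicator {0..} s * R s / rho) * indicator ({0<..t} \<inter> A) s)"
  proof (cases "s \<in> {0<..t} \<inter> A")
   case True
   then have "ennreal (R s / Lam t) = ennreal (rho / Lam t) * ennreal (R s / rho)"
    using rho_pos Lt pos_R[of s] by (subst ennreal_mult[symmetric]) auto
   then show ?thesis using True by (simp add: indicator_def)
  next
   case False
   then show ?thesis using s by (auto simp: indicator_def)
  qed
 qed
 also have "\<dots> = ennreal (rho / Lam t) * (\<integral>\<^sup>+s. ennreal (indicator {0..} s * R s / rho) * indicator ({0<..t} \<inter> A) s \<partial>lborel)"
  using m A by (intro nn_integral_cmult borel_measurable_times borel_measurable_indicator) auto
 also have "(\<integral>\<^sup>+s. ennreal (indicator {0..} s * R s / rho) * indicator ({0<..t} \<inter> A) s \<partial>lborel) = emeasure nu ({0<..t} \<inter> A)"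
  unfolding nu_def using A by (intro emeasure_density[OF m, symmetric]) simp
 also have "ennreal (rho / Lam t) * emeasure nu ({0<..t} \<inter> A) = emeasure nu ({0<..t} \<inter> A) / emeasure nu {0<..t}"
  using rho_pos Lt nu_Ioc0[of t] t
  by (simp add: nu.emeasure_eq_measure divide_ennreal ennreal_mult[symmetric])
 finally show ?thesis .
qed

lemma emeasure_by_time:
 assumes "0 \<le> t" shows "emeasure (ticks \<theta>) (by_time \<theta> t) = ennreal ((Lam t / rho) ^ \<theta>)"
proof -
 interpret P: product_prob_space "\<lambda>_. nu" "{1..\<theta>}" by standard
 have "emeasure (ticks \<theta>) (by_time \<theta> t) = (\<Prod>j\<in>{1..\<theta>}. emeasure nu {0<..t})"
  unfolding by_time_def by (rule P.emeasure_PiM) auto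
 also have "\<dots> = ennreal ((Lam t / rho) ^ \<theta>)"
  using nu_Ioc0[OF assms] Lam_nonneg[of t] rho_pos by (simp add: nu.emeasure_eq_measure ennreal_power)
 finally show ?thesis .
qed

lemma PiM_arrival_law:
 assumes t: "0 < t"
 shows "PiM {1..\<theta>} (\<lambda>_. arrival_law R t) = uniform_measure (ticks \<theta>) (by_time \<theta> t)"
proof -
 have Lt: "0 < Lam t" using Lam_strict[of 0 t] Lam_nonpos[of 0] t by simp
 have sa: "sets (arrival_law R t) = sets borel" by (simp add: arrival_law_def)
 have pos: "emeasure nu {0<..t} \<noteq> 0" using nu_Ioc0[of t] t Lt rho_pos by (simp add: nu.emeasure_eq_measure)
 interpret AR: prob_space "arrival_law R t"
 proof
  show "emeasure (arrival_law R t) (space (arrival_law R t)) = 1"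
   using emeasure_arrival_law[OF t, of UNIV] pos sets_eq_imp_space_eq[OF sa]
   by (simp add: ennreal_divide_self nu.emeasure_eq_measure)
 qed
 interpret A: product_prob_space "\<lambda>_. arrival_law R t" "{1..\<theta>}" by standard
 interpret P: product_prob_space "\<lambda>_. nu" "{1..\<theta>}" by standard
 show ?thesis
 proof (rule A.PiM_eqI[symmetric])
  show "sets (uniform_measure (ticks \<theta>) (by_time \<theta> t)) = sets (PiM {1..\<theta>} (\<lambda>_. arrival_law R t))"
   by (simp add: sets_uniform_measure) (rule sets_PiM_cong, simp_all add: sa)
  fix B assume B: "\<And>j. j \<in> {1..\<theta>} \<Longrightarrow> B j \<in> sets (arrival_law R t)"
  have Bb: "B j \<in> sets borel" if "j \<in> {1..\<theta>}" for j using B[OF that] sa by simp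
  have box: "Pi\<^sub>E {1..\<theta>} B \<in> sets (ticks \<theta>)" by (rule sets_PiM_I_finite) (use Bb in auto)
  have "emeasure (uniform_measure (ticks \<theta>) (by_time \<theta> t)) (Pi\<^sub>E {1..\<theta>} B)
   = emeasure (ticks \<theta>) (by_time \<theta> t \<inter> Pi\<^sub>E {1..\<theta>} B) / emeasure (ticks \<theta>) (by_time \<theta> t)"
   by (rule emeasure_uniform_measure[OF by_time_sets box])
  also have "by_time \<theta> t \<inter> Pi\<^sub>E {1..\<theta>} B = Pi\<^sub>E {1..\<theta>} (\<lambda>j. {0<..t} \<inter> B j)"
   unfolding by_time_def by (rule PiE_Int)
  also have "emeasure (ticks \<theta>) (Pi\<^sub>E {1..\<theta>} (\<lambda>j. {0<..t} \<inter> B j)) = (\<Prod>j\<in>{1..\<theta>}. emeasure nu ({0<..t} \<inter> B j))"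
   by (rule P.emeasure_PiM) (use Bb in auto)
  also have "\<dots> = ennreal (\<Prod>j\<in>{1..\<theta>}. measure nu ({0<..t} \<inter> B j))"
   by (simp add: nu.emeasure_eq_measure prod_ennreal)
  also have "\<dots> / emeasure (ticks \<theta>) (by_time \<theta> t) = ennreal ((\<Prod>j\<in>{1..\<theta>}. measure nu ({0<..t} \<inter> B j)) / (Lam t / rho) ^ \<theta>)"
   using Lt rho_pos t unfolding emeasure_by_time[OF less_imp_le[OF t]]
   by (intro divide_ennreal prod_nonneg) auto
  also have "(\<Prod>j\<in>{1..\<theta>}. measure nu ({0<..t} \<inter> B j)) / (Lam t / rho) ^ \<theta>
   = (\<Prod>j\<in>{1..\<theta>}. measure nu ({0<..t} \<inter> B j) / (Lam t / rho))"
  proof -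
   have e: "(Lam t / rho) ^ \<theta> = (\<Prod>j\<in>{1..\<theta>}. Lam t / rho)" by (subst prod_constant) simp
   show ?thesis by (simp only: e prod_dividef)
  qed
  also have "ennreal \<dots> = (\<Prod>j\<in>{1..\<theta>}. ennreal (measure nu ({0<..t} \<inter> B j) / (Lam t / rho)))"
   using Lt rho_pos by (intro prod_ennreal[symmetric]) auto
  also have "\<dots> = (\<Prod>j\<in>{1..\<theta>}. emeasure (arrival_law R t) (B j))"
  proof (rule prod.cong[OF refl])
   fix j assume j: "j \<in> {1..\<theta>}"
   show "ennreal (measure nu ({0<..t} \<inter> B j) / (Lam t / rho)) = emeasure (arrival_law R t) (B j)"
    unfolding emeasure_arrival_law[OF t Bb[OF j]] nu.emeasure_eq_measure nu_Ioc0[OF less_imp_le[OF t]]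
    using Lt rho_pos by (intro divide_ennreal[symmetric]) auto
  qed
  finally show "emeasure (uniform_measure (ticks \<theta>) (by_time \<theta> t)) (Pi\<^sub>E {1..\<theta>} B) = (\<Prod>j\<in>{1..\<theta>}. emeasure (arrival_law R t) (B j))" .
 qed simp
qed

lemma survival_prob_eq_pos:
 assumes t: "0 < t" and \<theta>: "1 \<le> \<theta>" "\<theta> \<le> d_in a"
 shows "survival_prob R a \<theta> t * (Lam t / rho) ^ \<theta> = measure (joint \<theta>) (true_joint \<theta> t)"
proof -
 define d where "d = d_in a"
 define U where "U = PiM {1..\<theta>} (\<lambda>_. arrival_law R t)"
 have Lt: "0 < Lam t" using Lam_strict[of 0 t] Lam_nonpos[of 0] t by simp
 define c where "c = (Lam t / rho) ^ \<theta>"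
 have c: "0 < c" unfolding c_def using Lt rho_pos by simp
 have cU: "emeasure (ticks \<theta>) (by_time \<theta> t) = ennreal c" unfolding c_def by (rule emeasure_by_time) (use t in simp)
 have U: "U = uniform_measure (ticks \<theta>) (by_time \<theta> t)" unfolding U_def by (rule PiM_arrival_law[OF t])
 have sU: "sets U = sets (ticks \<theta>)" unfolding U by simp
 interpret TP: prob_space "ticks \<theta>" by (rule prob_space_times)
 interpret UP: prob_space U unfolding U by (rule prob_space_uniform_measure) (use c cU in auto)
 interpret A: prob_space "agent_law a \<theta>" by (rule prob_space_agent_law[OF valid_a])
 interpret LP: prob_space "losses d" by (rule prob_space_losses)
 interpret AU: pair_prob_space "agent_law a \<theta>" U by standard
 interpret LU: pair_prob_space "losses d" U by standard
 interpret SL: pair_prob_space "shock_law a" "losses d" by standard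
 have sJ: "sets (agent_law a \<theta> \<Otimes>\<^sub>M U) = sets (joint \<theta>)" by (rule sets_pair_measure_cong) (simp_all add: sU)
 have spJ: "space (agent_law a \<theta> \<Otimes>\<^sub>M U) = space (joint \<theta>)" by (rule sets_eq_imp_space_eq[OF sJ])
 define F where "F = {z \<in> space (joint \<theta>). survive \<theta> (fst z) (snd z)}"
 have F: "F \<in> sets (agent_law a \<theta> \<Otimes>\<^sub>M U)" unfolding sJ F_def by (rule survive_sets)
 define V where "V x = (vec \<theta> (fst x) (fst (snd x)), snd (snd x))" for x :: "real \<times> (nat \<Rightarrow> real) \<times> (nat \<Rightarrow> real)"
 have vm: "(\<lambda>x. vec \<theta> (fst x) (snd x)) \<in> measurable (shock_law a \<Otimes>\<^sub>M losses d) (agent_law a \<theta>)"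
  by (rule vec_measurable) (use \<theta> d_def in simp)
 have Vm: "V \<in> measurable (shock_law a \<Otimes>\<^sub>M losses d \<Otimes>\<^sub>M U) (agent_law a \<theta> \<Otimes>\<^sub>M U)"
 proof -
  have "(\<lambda>x. (fst x, fst (snd x))) \<in> measurable (shock_law a \<Otimes>\<^sub>M losses d \<Otimes>\<^sub>M U) (shock_law a \<Otimes>\<^sub>M losses d)"
   by measurable
  from measurable_compose[OF this vm]
  have "(\<lambda>x. vec \<theta> (fst x) (fst (snd x))) \<in> measurable (shock_law a \<Otimes>\<^sub>M losses d \<Otimes>\<^sub>M U) (agent_law a \<theta>)" by simp
  moreover have "(\<lambda>x. snd (snd x)) \<in> measurable (shock_law a \<Otimes>\<^sub>M losses d \<Otimes>\<^sub>M U) U" by measurable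
  ultimately show ?thesis unfolding V_def by (rule measurable_Pair)
 qed
 define E where "E = V -` F \<inter> space (shock_law a \<Otimes>\<^sub>M losses d \<Otimes>\<^sub>M U)"
 have E: "E \<in> sets (shock_law a \<Otimes>\<^sub>M losses d \<Otimes>\<^sub>M U)" unfolding E_def by (rule measurable_sets[OF Vm F])
 have "survival_prob R a \<theta> t = \<P>((e, l, u) in shock_law a \<Otimes>\<^sub>M losses d \<Otimes>\<^sub>M U. threshold_time a 0 e l = 0 \<and>
   (\<forall>j\<in>{1..\<theta>}. threshold_time a j e l < ereal (order_stat \<theta> u j)))"
  unfolding survival_prob_def U_def d_def using \<theta> by simp
 also have "\<dots> = measure (shock_law a \<Otimes>\<^sub>M losses d \<Otimes>\<^sub>M U) E"
 proof (rule arg_cong[where f = "measure (shock_law a \<Otimes>\<^sub>M losses d \<Otimes>\<^sub>M U)"], intro set_eqI)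
  fix x :: "real \<times> (nat \<Rightarrow> real) \<times> (nat \<Rightarrow> real)"
  obtain e l u where x: "x = (e, l, u)" by (cases x)
  have "(threshold_time a 0 e l = 0 \<and> (\<forall>j\<in>{1..\<theta>}. threshold_time a j e l < ereal (order_stat \<theta> u j)))
   \<longleftrightarrow> survive \<theta> (vec \<theta> e l) u"
   unfolding survive_def threshold_0_iff[of e l \<theta>] using threshold_less_iff[of _ \<theta> e l] by auto
  moreover have "V x \<in> space (joint \<theta>)" if "x \<in> space (shock_law a \<Otimes>\<^sub>M losses d \<Otimes>\<^sub>M U)"
   using measurable_space[OF Vm that] spJ by simp
  ultimately show "x \<in> {(e, l, u) \<in> space (shock_law a \<Otimes>\<^sub>M losses d \<Otimes>\<^sub>M U). threshold_time a 0 e l = 0 \<and>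
    (\<forall>j\<in>{1..\<theta>}. threshold_time a j e l < ereal (order_stat \<theta> u j))} \<longleftrightarrow> x \<in> E"
   unfolding E_def F_def x by (auto simp: V_def)
 qed
 also have "\<dots> = measure (agent_law a \<theta> \<Otimes>\<^sub>M U) F"
 proof -
  have iF: "(indicator F :: _ \<Rightarrow> ennreal) \<in> borel_measurable (agent_law a \<theta> \<Otimes>\<^sub>M U)" using F by simp
  have iE: "(indicator E :: _ \<Rightarrow> ennreal) \<in> borel_measurable (shock_law a \<Otimes>\<^sub>M losses d \<Otimes>\<^sub>M U)" using E by simp
  have ui: "(\<lambda>y. \<integral>\<^sup>+u. indicator F (y, u) \<partial>U) \<in> borel_measurable (agent_law a \<theta>)"
   using UP.borel_measurable_nn_integral_fst[OF iF] .
  have "emeasure (shock_law a \<Otimes>\<^sub>M losses d \<Otimes>\<^sub>M U) E = (\<integral>\<^sup>+x. indicator E x \<partial>(shock_law a \<Otimes>\<^sub>M losses d \<Otimes>\<^sub>M U))"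
   using E by simp
  also have "\<dots> = (\<integral>\<^sup>+e. \<integral>\<^sup>+z. indicator E (e, z) \<partial>(losses d \<Otimes>\<^sub>M U) \<partial>shock_law a)"
   by (rule LU.nn_integral_fst[OF iE, symmetric])
  also have "\<dots> = (\<integral>\<^sup>+e. \<integral>\<^sup>+l. \<integral>\<^sup>+u. indicator E (e, l, u) \<partial>U \<partial>losses d \<partial>shock_law a)"
  proof (rule nn_integral_cong)
   fix e assume e: "e \<in> space (shock_law a)"
   have "(\<lambda>z. indicator E (e, z) :: ennreal) \<in> borel_measurable (losses d \<Otimes>\<^sub>M U)"
    using measurable_compose[OF measurable_Pair1'[OF e] iE] by simp
   then show "(\<integral>\<^sup>+z. indicator E (e, z) \<partial>(losses d \<Otimes>\<^sub>M U)) = (\<integral>\<^sup>+l. \<integral>\<^sup>+u. indicator E (e, l, u) \<partial>U \<partial>losses d)"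
    by (rule UP.nn_integral_fst[symmetric])
  qed
  also have "\<dots> = (\<integral>\<^sup>+e. \<integral>\<^sup>+l. (\<lambda>x. \<integral>\<^sup>+u. indicator F (vec \<theta> (fst x) (snd x), u) \<partial>U) (e, l) \<partial>losses d \<partial>shock_law a)"
  proof (intro nn_integral_cong)
   fix e l u assume "e \<in> space (shock_law a)" "l \<in> space (losses d)" "u \<in> space U"
   then have "(e, l, u) \<in> space (shock_law a \<Otimes>\<^sub>M losses d \<Otimes>\<^sub>M U)" by (simp add: space_pair_measure)
   then show "indicator E (e, l, u) = (indicator F (vec \<theta> (fst (e, l)) (snd (e, l)), u) :: ennreal)"
    unfolding E_def V_def by (auto simp: indicator_def)
  qed
  also have "\<dots> = (\<integral>\<^sup>+x. \<integral>\<^sup>+u. indicator F (vec \<theta> (fst x) (snd x), u) \<partial>U \<partial>(shock_law a \<Otimes>\<^sub>M losses d))"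
   by (rule LP.nn_integral_fst[OF measurable_compose[OF vm ui]])
  also have "\<dots> = (\<integral>\<^sup>+y. \<integral>\<^sup>+u. indicator F (y, u) \<partial>U \<partial>distr (shock_law a \<Otimes>\<^sub>M losses d) (agent_law a \<theta>) (\<lambda>x. vec \<theta> (fst x) (snd x)))"
   by (rule nn_integral_distr[OF vm, symmetric]) (use ui in simp)
  also have "\<dots> = (\<integral>\<^sup>+y. \<integral>\<^sup>+u. indicator F (y, u) \<partial>U \<partial>agent_law a \<theta>)"
   by (subst agent_law_distr) (use \<theta> d_def in simp_all)
  also have "\<dots> = emeasure (agent_law a \<theta> \<Otimes>\<^sub>M U) F"
   using F by (simp add: UP.nn_integral_fst[OF iF])
  finally show ?thesis by (simp add: measure_def)
 qed
 also have "\<dots> = measure (joint \<theta>) (true_joint \<theta> t) / c"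
 proof -
  interpret J: prob_space "joint \<theta>" by (rule prob_space_joint)
  have TJ: "true_joint \<theta> t \<in> sets (joint \<theta>)" by (rule true_joint_sets)
  have "emeasure (agent_law a \<theta> \<Otimes>\<^sub>M U) F = (\<integral>\<^sup>+y. emeasure U (Pair y -` F) \<partial>agent_law a \<theta>)"
   by (rule UP.emeasure_pair_measure_alt[OF F])
  also have "\<dots> = (\<integral>\<^sup>+y. emeasure (ticks \<theta>) (Pair y -` true_joint \<theta> t) / ennreal c \<partial>agent_law a \<theta>)"
  proof (rule nn_integral_cong)
   fix y assume "y \<in> space (agent_law a \<theta>)"
   have "Pair y -` F \<in> sets (ticks \<theta>)" using sets_Pair1[OF F] sU by simp
   then have "emeasure U (Pair y -` F) = emeasure (ticks \<theta>) (by_time \<theta> t \<inter> Pair y -` F) / ennreal c"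
    unfolding U cU[symmetric] by (rule emeasure_uniform_measure[OF by_time_sets])
   also have "by_time \<theta> t \<inter> Pair y -` F = Pair y -` true_joint \<theta> t"
    unfolding F_def true_joint_def by auto
   finally show "emeasure U (Pair y -` F) = emeasure (ticks \<theta>) (Pair y -` true_joint \<theta> t) / ennreal c" .
  qed
  also have "\<dots> = (\<integral>\<^sup>+y. emeasure (ticks \<theta>) (Pair y -` true_joint \<theta> t) \<partial>agent_law a \<theta>) / ennreal c"
   by (rule nn_integral_divide) (rule TP.measurable_emeasure_Pair[OF TJ])
  also have "\<dots> = emeasure (joint \<theta>) (true_joint \<theta> t) / ennreal c"
   by (simp only: TP.emeasure_pair_measure_alt[OF TJ])
  finally have "emeasure (agent_law a \<theta> \<Otimes>\<^sub>M U) F = emeasure (joint \<theta>) (true_joint \<theta> t) / ennreal c" .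
  then have "emeasure (agent_law a \<theta> \<Otimes>\<^sub>M U) F = ennreal (measure (joint \<theta>) (true_joint \<theta> t) / c)"
   by (simp only: J.emeasure_eq_measure divide_ennreal[OF measure_nonneg c])
  then show ?thesis using c by (simp add: measure_def)
 qed
 finally show ?thesis unfolding c_def[symmetric] using c by simp
qed

text \<open>
  The factor is the probability that all \<open>\<theta>\<close> arrivals occur by time \<open>t\<close>. Multiplied by
  it, the survival probability becomes a function on the fixed space \<open>joint \<theta>\<close>, regular
  also at \<open>t = 0\<close> where the conditional law of the arrivals degenerates.
\<close>

lemma survival_prob_eq:
 assumes t: "0 \<le> t" and \<theta>: "\<theta> \<le> d_in a"
 shows "survival_prob R a \<theta> t * (Lam t / rho) ^ \<theta> = measure (joint \<theta>) (true_joint \<theta> t)"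
proof (cases "\<theta> = 0")
 case True
 define x where "x = (init_capital a + alpha 0 - claims a) / init_capital a"
 interpret A: prob_space "agent_law a 0" by (rule prob_space_agent_law[OF valid_a])
 interpret TP: prob_space "ticks 0" by (rule prob_space_times)
 define Y where "Y = {y \<in> space (agent_law a 0). debt y 0 \<le> alpha 0}"
 have [measurable]: "(\<lambda>y. debt y 0) \<in> borel_measurable (agent_law a 0)" by (rule debt_measurable) simp
 have Y: "Y \<in> sets (agent_law a 0)" unfolding Y_def by measurable
 have bt: "by_time 0 t = space (ticks 0)" by (simp add: by_time_def space_PiM)
 have "z \<in> true_joint 0 t \<longleftrightarrow> z \<in> Y \<times> space (ticks 0)" for z
  unfolding true_joint_def survive_def Y_def bt space_pair_measure mem_Times_iff mem_Collect_eq by simp blast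
 then have "true_joint 0 t = Y \<times> space (ticks 0)" by (rule set_eqI)
 then have "emeasure (joint 0) (true_joint 0 t) = emeasure (agent_law a 0) Y"
  by (simp only: TP.emeasure_pair_measure_Times[OF Y sets.top] TP.emeasure_space_1 mult_1_right)
 also have "Y = (\<lambda>y. y 0) -` {..x} \<inter> space (agent_law a 0)"
 proof -
  have "debt y 0 \<le> alpha 0 \<longleftrightarrow> y 0 \<le> x" for y
  proof -
   have "debt y 0 \<le> alpha 0 \<longleftrightarrow> y 0 * init_capital a \<le> init_capital a + alpha 0 - claims a"
    unfolding debt_def by (simp add: right_diff_distrib mult.commute)
     linarith
   also have "\<dots> \<longleftrightarrow> y 0 \<le> x" unfolding x_def by (rule pos_le_divide_eq[OF gamma_pos, symmetric])
   finally show ?thesis .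
  qed
  then show ?thesis unfolding Y_def by auto
 qed
 also have "emeasure (agent_law a 0) \<dots> = emeasure (distr (agent_law a 0) (class_law a 0) (\<lambda>y. y 0)) {..x}"
 proof (rule emeasure_distr[symmetric])
  show "(\<lambda>y. y 0) \<in> measurable (agent_law a 0) (class_law a 0)"
   unfolding agent_law_def by (rule measurable_component_singleton) simp
 qed simp
 also have "distr (agent_law a 0) (class_law a 0) (\<lambda>y. y 0) = class_law a 0"
  unfolding agent_law_def by (rule distr_PiM_component) (use prob_space_class_law[OF valid_a] in auto)
 also have "class_law a 0 = shock_law a" by (simp add: class_law_def)
 finally have "measure (joint 0) (true_joint 0 t) = cdf (shock_law a) x" by (simp add: measure_def cdf_def)
 then show ?thesis using True by (simp add: survival_prob_def initial_ruin_prob_def x_def)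
next
 case False
 show ?thesis
 proof (cases "t = 0")
  case True
  have "by_time \<theta> 0 = {}" unfolding by_time_def using False by (auto simp: PiE_eq_empty_iff)
  then have "true_joint \<theta> t = {}" unfolding true_joint_def True by simp
  then show ?thesis using True False Lam_nonpos[of 0] by (simp add: power_0_left)
 qed (use survival_prob_eq_pos[of t \<theta>] assms False in simp)
qed

end

subsection \<open>Uniform sets of reveals and the limiting arrival times\<close>

lemma order_stat_cong: "(\<And>j. j \<in> {1..\<theta>} \<Longrightarrow> u j = u' j) \<Longrightarrow> order_stat \<theta> u i = order_stat \<theta> u' i"
 unfolding order_stat_def by (intro arg_cong[where f = "\<lambda>xs. sort xs ! (i - 1)"] map_cong) auto

lemma order_stat_inj:
 assumes f: "inj_on f {1..\<theta>}" and i: "i \<in> {1..\<theta>}"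
 shows "order_stat \<theta> (\<lambda>j. real (f j)) i = real (nth_pos (f ` {1..\<theta>}) i)"
proof -
 have m: "mono (real :: nat \<Rightarrow> real)" by (rule monoI) simp
 have "map (\<lambda>j. real (f j)) [1..<Suc \<theta>] = map real (map f [1..<Suc \<theta>])" by simp
 then have "sort (map (\<lambda>j. real (f j)) [1..<Suc \<theta>]) = map real (sort (map f [1..<Suc \<theta>]))"
  by (simp only: sort_map_mono[OF m])
 moreover have "sort (map f [1..<Suc \<theta>]) = sorted_list_of_set (f ` {1..\<theta>})"
 proof -
  have s: "set [1..<Suc \<theta>] = {1..\<theta>}" by auto
  have "distinct (map f [1..<Suc \<theta>])" using f unfolding distinct_map s by simp
  then have "sort (map f [1..<Suc \<theta>]) = sorted_list_of_set (set (map f [1..<Suc \<theta>]))"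
   by (metis sorted_list_of_set_sort_remdups distinct_remdups_id)
  then show ?thesis by (simp only: set_map s)
 qed
 moreover have "length (sorted_list_of_set (f ` {1..\<theta>})) = \<theta>"
  using card_image[OF f] by simp
 ultimately show ?thesis unfolding order_stat_def nth_pos_def using i by (subst nth_map[symmetric]) auto
qed

text \<open>
  An injection of \<open>{1..\<theta>}\<close> onto a set of positions is an ordering of this set.
\<close>

lemma card_injections_onto:
 assumes "finite S" "card S = \<theta>"
 shows "card {f \<in> {1..\<theta>} \<rightarrow>\<^sub>E S. inj_on f {1..\<theta>}} = fact \<theta>"
proof -
 let ?F = "{f \<in> {1..\<theta>} \<rightarrow>\<^sub>E S. inj_on f {1..\<theta>}}"
 let ?L = "\<lambda>f. map f [1..<Suc \<theta>]"
 have s: "set [1..<Suc \<theta>] = {1..\<theta>}" by auto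
 have "inj_on ?L ?F"
 proof (rule inj_onI)
  fix f g assume fg: "f \<in> ?F" "g \<in> ?F" "?L f = ?L g"
  then have "f j = g j" if "j \<in> {1..\<theta>}" for j using that unfolding map_eq_conv s by blast
  then show "f = g" using fg by (intro PiE_ext[of f "{1..\<theta>}" "\<lambda>_. S" g]) auto
 qed
 moreover have "?L ` ?F = permutations_of_set S"
 proof (intro set_eqI iffI)
  fix xs assume "xs \<in> ?L ` ?F"
  then obtain f where f: "f \<in> {1..\<theta>} \<rightarrow>\<^sub>E S" "inj_on f {1..\<theta>}" "xs = ?L f" by blast
  have "f ` {1..\<theta>} \<subseteq> S" using f(1) by auto
  then have "f ` {1..\<theta>} = S" using assms card_image[OF f(2)] by (intro card_subset_eq) auto
  then have "set xs = S" unfolding f(3) set_map s .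
  moreover have "distinct xs" unfolding f(3) distinct_map s using f(2) by simp
  ultimately show "xs \<in> permutations_of_set S" by (simp add: permutations_of_set_def)
 next
  fix xs assume "xs \<in> permutations_of_set S"
  then have xs: "set xs = S" "distinct xs" by (auto simp: permutations_of_set_def)
  then have len: "length xs = \<theta>" using assms distinct_card by metis
  define f where "f = (\<lambda>j\<in>{1..\<theta>}. xs ! (j - 1))"
  have "?L f = xs"
   by (rule nth_equalityI) (auto simp: len f_def simp del: upt_Suc)
  moreover have "f \<in> {1..\<theta>} \<rightarrow>\<^sub>E S"
   unfolding f_def using xs len by (auto intro!: restrict_PiE_iff[THEN iffD2] nth_mem simp flip: xs(1))
  moreover have "inj_on f {1..\<theta>}"
   using xs(2) \<open>?L f = xs\<close> unfolding distinct_map[of f "[1..<Suc \<theta>]", unfolded s, symmetric]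
   by (metis distinct_map s)
  ultimately show "xs \<in> ?L ` ?F" by (intro image_eqI[of _ _ f]) auto
 qed
 moreover have "card (?L ` ?F) = card ?F" using \<open>inj_on ?L ?F\<close> by (rule card_image)
 ultimately have "card ?F = card (permutations_of_set S)" by (simp only:)
 then show ?thesis using assms by simp
qed

abbreviation "maps \<theta> K \<equiv> {1..\<theta> :: nat} \<rightarrow>\<^sub>E {1..K :: nat}"
abbreviation "injections \<theta> K \<equiv> {f \<in> maps \<theta> K. inj_on f {1..\<theta>}}"

lemma finite_maps: "finite (maps \<theta> K)"
 by (intro finite_PiE) auto

lemma sum_injections:
 fixes g :: "nat set \<Rightarrow> real"
 shows "(\<Sum>f\<in>injections \<theta> K. g (f ` {1..\<theta>})) = fact \<theta> * (\<Sum>S\<in>subsets_of_size \<theta> K. g S)"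
proof -
 have im: "f ` {1..\<theta>} \<in> subsets_of_size \<theta> K" if "f \<in> injections \<theta> K" for f
  using that card_image[of f "{1..\<theta>}"] unfolding subsets_of_size_def by auto
 have "(\<Sum>f\<in>injections \<theta> K. g (f ` {1..\<theta>}))
  = (\<Sum>S\<in>subsets_of_size \<theta> K. \<Sum>f\<in>{f \<in> injections \<theta> K. f ` {1..\<theta>} = S}. g (f ` {1..\<theta>}))"
  using im finite_maps by (intro sum.group[symmetric]) auto
 also have "\<dots> = (\<Sum>S\<in>subsets_of_size \<theta> K. fact \<theta> * g S)"
 proof (rule sum.cong[OF refl])
  fix S assume S: "S \<in> subsets_of_size \<theta> K"
  then have fS: "card S = \<theta>" "S \<subseteq> {1..K}" unfolding subsets_of_size_def by auto
  then have fin: "finite S" by (meson finite_atLeastAtMost finite_subset)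
  have "{f \<in> injections \<theta> K. f ` {1..\<theta>} = S} = {f \<in> {1..\<theta>} \<rightarrow>\<^sub>E S. inj_on f {1..\<theta>}}"
  proof (intro set_eqI iffI)
   fix f assume "f \<in> {f \<in> {1..\<theta>} \<rightarrow>\<^sub>E S. inj_on f {1..\<theta>}}"
   then have f: "f \<in> {1..\<theta>} \<rightarrow>\<^sub>E S" "inj_on f {1..\<theta>}" by auto
   have "f ` {1..\<theta>} \<subseteq> S" using f(1) by auto
   then have "f ` {1..\<theta>} = S" using fS fin card_image[OF f(2)] by (intro card_subset_eq) auto
   moreover have "f \<in> maps \<theta> K" using f(1) fS(2) PiE_mono[of "{1..\<theta>}" "\<lambda>_. S" "\<lambda>_. {1..K}"] by blast
   ultimately show "f \<in> {f \<in> injections \<theta> K. f ` {1..\<theta>} = S}" using f(2) by simp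
  next
   fix f assume "f \<in> {f \<in> injections \<theta> K. f ` {1..\<theta>} = S}"
   then show "f \<in> {f \<in> {1..\<theta>} \<rightarrow>\<^sub>E S. inj_on f {1..\<theta>}}" by (auto simp: PiE_iff)
  qed
  then have "card {f \<in> injections \<theta> K. f ` {1..\<theta>} = S} = fact \<theta>"
   using card_injections_onto[OF fin fS(1)] by simp
  moreover have "(\<Sum>f\<in>{f \<in> injections \<theta> K. f ` {1..\<theta>} = S}. g (f ` {1..\<theta>}))
   = (\<Sum>f\<in>{f \<in> injections \<theta> K. f ` {1..\<theta>} = S}. g S)" by (rule sum.cong) auto
  ultimately show "(\<Sum>f\<in>{f \<in> injections \<theta> K. f ` {1..\<theta>} = S}. g (f ` {1..\<theta>})) = fact \<theta> * g S" by simp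
 qed
 finally show ?thesis by (simp add: sum_distrib_left)
qed

lemma fact_binomial_falling: "fact \<theta> * real (K choose \<theta>) = falling (real K) \<theta>"
proof -
 have "real (K choose \<theta>) = (\<Prod>i<\<theta>. real K - real i) / fact \<theta>"
  by (simp add: binomial_gbinomial gbinomial_prod_rev atLeast0LessThan)
 then show ?thesis by (simp add: falling_def)
qed

lemma card_subsets_of_size: "card (subsets_of_size \<theta> K) = K choose \<theta>"
 unfolding subsets_of_size_def using n_subsets[of "{1..K}" \<theta>] by simp

lemma card_injections: "real (card (injections \<theta> K)) = falling (real K) \<theta>"
 using sum_injections[where g = "\<lambda>_. 1" and \<theta> = \<theta> and K = K] by (simp add: card_subsets_of_size fact_binomial_falling)

lemma card_maps: "card (maps \<theta> K) = K ^ \<theta>"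
 by (simp add: card_PiE)

context class_limit begin

text \<open>
  The times at which reveal number \<open>k\<close> is expected. All cells have the same probability under
  \<open>nu\<close>, so independent arrival times discretise to a uniformly distributed map into the
  positions.
\<close>

definition cell :: "nat \<Rightarrow> nat \<Rightarrow> real set" where
 "cell n k = {s. real k - 1 < real n * Lam s \<and> real n * Lam s \<le> real k}"

definition level :: "nat \<Rightarrow> real \<Rightarrow> nat" where
 "level n s = nat \<lceil>real n * Lam s\<rceil>"

lemma Lam_less_iff': "0 \<le> s \<Longrightarrow> Lam s < Lam x \<longleftrightarrow> s < x"
proof (cases "0 \<le> x")
 case False
 assume "0 \<le> s"
 then show ?thesis using False Lam_nonpos[of x] Lam_nonneg[of s] by simp
qed (rule Lam_less_iff)

lemma Lam_le_iff': "0 \<le> t \<Longrightarrow> Lam x \<le> Lam t \<longleftrightarrow> x \<le> t"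
 using Lam_less_iff'[of t x] by linarith

lemma nu_cell:
 assumes n: "1 \<le> n" and k: "1 \<le> k" and le: "real k \<le> real n * Lam t"
 shows "measure nu (cell n k) = 1 / (real n * rho)" and "cell n k \<in> sets borel"
proof -
 have "real k / real n \<le> Lam t" using le n by (simp add: divide_le_eq mult.commute)
 then have kr: "real k / real n < rho" using Lam_less_rho[of t] by simp
 obtain s where s: "0 \<le> s" "Lam s = real k / real n" using Lam_surj[of "real k / real n"] kr by auto
 have "(real k - 1) / real n \<le> real k / real n" by (intro divide_right_mono) auto
 then obtain s' where s': "0 \<le> s'" "Lam s' = (real k - 1) / real n"
  using Lam_surj[of "(real k - 1) / real n"] kr k n by auto
 have "cell n k = {s'<..s}"
 proof (intro set_eqI)
  fix x
  have "real k - 1 < real n * Lam x \<longleftrightarrow> Lam s' < Lam x" unfolding s'(2) using n by (simp add: field_simps)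
  moreover have "real n * Lam x \<le> real k \<longleftrightarrow> Lam x \<le> Lam s" unfolding s(2) using n by (simp add: field_simps)
  ultimately show "x \<in> cell n k \<longleftrightarrow> x \<in> {s'<..s}"
   unfolding cell_def using Lam_less_iff'[OF s'(1), of x] Lam_le_iff'[OF s(1), of x] by simp
 qed
 moreover have "s' \<le> s" using Lam_less_iff'[OF s(1), of s'] s s' \<open>(real k - 1) / real n \<le> real k / real n\<close> by linarith
 ultimately show "measure nu (cell n k) = 1 / (real n * rho)"
  using nu_Ioc[OF s'(1), of s] unfolding s(2) s'(2) by (simp add: diff_divide_distrib[symmetric])
 show "cell n k \<in> sets borel" unfolding \<open>cell n k = {s'<..s}\<close> by simp
qed

lemma cell_level: "s \<in> cell n k \<Longrightarrow> level n s = k"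
 unfolding cell_def level_def by (auto simp: ceiling_eq_iff nat_eq_iff intro!: ceiling_unique)

lemma level_bounds: "real n * Lam s \<le> real (level n s)" "real (level n s) < real n * Lam s + 1"
proof -
 have "0 \<le> real n * Lam s" using Lam_nonneg by simp
 then have "real (level n s) = of_int \<lceil>real n * Lam s\<rceil>" unfolding level_def by simp
 then show "real n * Lam s \<le> real (level n s)" "real (level n s) < real n * Lam s + 1"
  using ceiling_correct[of "real n * Lam s"] by linarith+
qed

lemma mono_level: "mono (\<lambda>s. real (level n s))"
 unfolding level_def
 by (rule monoI, unfold of_nat_le_iff, intro nat_mono ceiling_mono mult_left_mono Lam_mono) auto

definition box :: "nat \<Rightarrow> nat \<Rightarrow> (nat \<Rightarrow> nat) \<Rightarrow> (nat \<Rightarrow> real) set" where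
 "box n \<theta> f = Pi\<^sub>E {1..\<theta>} (\<lambda>j. cell n (f j))"

lemma box_cell: "u \<in> box n \<theta> f \<Longrightarrow> j \<in> {1..\<theta>} \<Longrightarrow> u j \<in> cell n (f j)"
 unfolding box_def by (rule PiE_mem)

definition place :: "nat \<Rightarrow> nat \<Rightarrow> (nat \<Rightarrow> nat) \<Rightarrow> nat \<Rightarrow> real" where
 "place n \<theta> f i = order_stat \<theta> (\<lambda>j. real (f j)) i / real n"

text \<open>
  Within a box the scaled order statistics are known up to \<open>1 / n\<close>, since rounding up to a level
  is monotone and hence commutes with taking order statistics.
\<close>

lemma box_place:
 assumes n: "1 \<le> n" and u: "u \<in> box n \<theta> f" and i: "i \<in> {1..\<theta>}"
 shows "scaled \<theta> u i \<le> place n \<theta> f i" "place n \<theta> f i \<le> scaled \<theta> u i + 1 / real n"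
proof -
 have "f j = level n (u j)" if "j \<in> {1..\<theta>}" for j
  using cell_level[OF box_cell[OF u that]] by simp
 then have "order_stat \<theta> (\<lambda>j. real (f j)) i = order_stat \<theta> (\<lambda>j. real (level n (u j))) i"
  by (intro order_stat_cong) simp
 also have "\<dots> = real (level n (order_stat \<theta> u i))" by (rule order_stat_mono_comp[OF mono_level i])
 finally have p: "place n \<theta> f i = real (level n (order_stat \<theta> u i)) / real n" by (simp add: place_def)
 show "scaled \<theta> u i \<le> place n \<theta> f i" "place n \<theta> f i \<le> scaled \<theta> u i + 1 / real n"
  unfolding p scaled_def using level_bounds[of n "order_stat \<theta> u i"] n by (simp_all add: field_simps)
qed

context
 fixes n K \<theta> :: nat and t :: real
 assumes n: "1 \<le> n" and t: "0 \<le> t" and K: "real K \<le> real n * Lam t"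
begin

lemma cell_ok:
 assumes "f \<in> maps \<theta> K" "j \<in> {1..\<theta>}"
 shows "1 \<le> f j" "f j \<le> K" "measure nu (cell n (f j)) = 1 / (real n * rho)" "cell n (f j) \<in> sets borel"
proof -
 have f: "f j \<in> {1..K}" by (rule PiE_mem[OF assms])
 then show "1 \<le> f j" "f j \<le> K" by simp_all
 have "real (f j) \<le> real n * Lam t" using f K by simp
 with f show "measure nu (cell n (f j)) = 1 / (real n * rho)" "cell n (f j) \<in> sets borel"
  using nu_cell[OF n, of "f j" t] by simp_all
qed

lemma box_sets: "f \<in> maps \<theta> K \<Longrightarrow> box n \<theta> f \<in> sets (ticks \<theta>)"
 unfolding box_def by (rule sets_PiM_I_finite, simp, simp only: sets_nu cell_ok)

lemma emeasure_box:
 assumes f: "f \<in> maps \<theta> K" shows "emeasure (ticks \<theta>) (box n \<theta> f) = ennreal ((1 / (real n * rho)) ^ \<theta>)"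
proof -
 interpret P: product_prob_space "\<lambda>_. nu" "{1..\<theta>}" by standard
 have "emeasure (ticks \<theta>) (box n \<theta> f) = (\<Prod>j\<in>{1..\<theta>}. emeasure nu (cell n (f j)))"
  unfolding box_def by (rule P.emeasure_PiM, simp, simp only: sets_nu cell_ok[OF f])
 also have "\<dots> = (\<Prod>j\<in>{1..\<theta>}. ennreal (1 / (real n * rho)))"
  by (rule prod.cong[OF refl]) (simp only: nu.emeasure_eq_measure cell_ok[OF f])
 also have "\<dots> = ennreal ((1 / (real n * rho)) ^ \<theta>)"
  using rho_pos by (simp add: ennreal_power)
 finally show ?thesis .
qed

lemma disjoint_box: "f \<in> maps \<theta> K \<Longrightarrow> f' \<in> maps \<theta> K \<Longrightarrow> f \<noteq> f' \<Longrightarrow> box n \<theta> f \<inter> box n \<theta> f' = {}"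
proof (rule ccontr)
 assume f: "f \<in> maps \<theta> K" "f' \<in> maps \<theta> K" "f \<noteq> f'" and "box n \<theta> f \<inter> box n \<theta> f' \<noteq> {}"
 then obtain u where u: "u \<in> box n \<theta> f" "u \<in> box n \<theta> f'" by blast
 have "f j = f' j" if "j \<in> {1..\<theta>}" for j
  using cell_level[OF box_cell[OF u(1) that]] cell_level[OF box_cell[OF u(2) that]] by simp
 then have "f = f'" using f by (intro PiE_ext[of f "{1..\<theta>}" "\<lambda>_. {1..K}" f']) auto
 then show False using f by simp
qed

lemma box_by_time: "f \<in> maps \<theta> K \<Longrightarrow> box n \<theta> f \<subseteq> by_time \<theta> t"
proof
 fix u assume f: "f \<in> maps \<theta> K" and u: "u \<in> box n \<theta> f"
 have "u j \<in> {0<..t}" if j: "j \<in> {1..\<theta>}" for j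
 proof -
  note fj = cell_ok(1,2)[OF f j]
  have uc: "real (f j) - 1 < real n * Lam (u j)" "real n * Lam (u j) \<le> real (f j)"
   using box_cell[OF u j] unfolding cell_def by auto
  have "0 < real n * Lam (u j)" using uc(1) fj by linarith
  then have "0 < Lam (u j)" by (simp add: zero_less_mult_iff)
  then have "0 < u j" using Lam_nonpos[of "u j"] by (cases "u j \<le> 0") auto
  moreover have "real n * Lam (u j) \<le> real n * Lam t" using uc(2) fj K by linarith
  then have "Lam (u j) \<le> Lam t" using n by simp
  then have "u j \<le> t" using Lam_le_iff'[OF t] by simp
  ultimately show ?thesis by simp
 qed
 then show "u \<in> by_time \<theta> t" using u unfolding by_time_def box_def by (auto simp: PiE_iff)
qed

text \<open>
  The boxes are disjoint with equal probabilities, so a sum over maps is an integral over the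
  arrival times.
\<close>

lemma measure_boxes:
 assumes D: "\<And>f. f \<in> maps \<theta> K \<Longrightarrow> D f \<in> sets (agent_law a \<theta>)"
 shows "(\<Union>f\<in>maps \<theta> K. D f \<times> box n \<theta> f) \<in> sets (joint \<theta>)"
  and "measure (joint \<theta>) (\<Union>f\<in>maps \<theta> K. D f \<times> box n \<theta> f)
   = (\<Sum>f\<in>maps \<theta> K. measure (agent_law a \<theta>) (D f)) / (real n * rho) ^ \<theta>"
proof -
 interpret J: prob_space "joint \<theta>" by (rule prob_space_joint)
 interpret A: prob_space "agent_law a \<theta>" by (rule prob_space_agent_law[OF valid_a])
 interpret TP: prob_space "ticks \<theta>" by (rule prob_space_times)
 have s: "D f \<times> box n \<theta> f \<in> sets (joint \<theta>)" if "f \<in> maps \<theta> K" for f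
  by (rule pair_measureI[OF D[OF that] box_sets[OF that]])
 show "(\<Union>f\<in>maps \<theta> K. D f \<times> box n \<theta> f) \<in> sets (joint \<theta>)"
  by (intro sets.finite_UN finite_maps s)
 have "measure (joint \<theta>) (\<Union>f\<in>maps \<theta> K. D f \<times> box n \<theta> f) = (\<Sum>f\<in>maps \<theta> K. measure (joint \<theta>) (D f \<times> box n \<theta> f))"
 proof (rule J.finite_measure_finite_Union[OF finite_maps])
  show "(\<lambda>f. D f \<times> box n \<theta> f) ` maps \<theta> K \<subseteq> sets (joint \<theta>)" using s by blast
  show "disjoint_family_on (\<lambda>f. D f \<times> box n \<theta> f) (maps \<theta> K)"
   unfolding disjoint_family_on_def using disjoint_box by blast
 qed
 also have "\<dots> = (\<Sum>f\<in>maps \<theta> K. measure (agent_law a \<theta>) (D f) / (real n * rho) ^ \<theta>)"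
 proof (rule sum.cong[OF refl])
  fix f assume f: "f \<in> maps \<theta> K"
  have "emeasure (joint \<theta>) (D f \<times> box n \<theta> f) = emeasure (agent_law a \<theta>) (D f) * emeasure (ticks \<theta>) (box n \<theta> f)"
   by (rule TP.emeasure_pair_measure_Times[OF D[OF f] box_sets[OF f]])
  also have "\<dots> = ennreal (measure (agent_law a \<theta>) (D f) * (1 / (real n * rho)) ^ \<theta>)"
   unfolding emeasure_box[OF f] A.emeasure_eq_measure using rho_pos by (intro ennreal_mult[symmetric]) auto
  finally have e: "emeasure (joint \<theta>) (D f \<times> box n \<theta> f)
   = ennreal (measure (agent_law a \<theta>) (D f) * (1 / (real n * rho)) ^ \<theta>)" .
  have "measure (joint \<theta>) (D f \<times> box n \<theta> f) = measure (agent_law a \<theta>) (D f) * (1 / (real n * rho)) ^ \<theta>"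
   unfolding measure_def[of "joint \<theta>"] e by (rule enn2real_ennreal) (use rho_pos in simp)
  then show "measure (joint \<theta>) (D f \<times> box n \<theta> f) = measure (agent_law a \<theta>) (D f) / (real n * rho) ^ \<theta>"
   unfolding power_one_over by simp
 qed
 finally show "measure (joint \<theta>) (\<Union>f\<in>maps \<theta> K. D f \<times> box n \<theta> f)
   = (\<Sum>f\<in>maps \<theta> K. measure (agent_law a \<theta>) (D f)) / (real n * rho) ^ \<theta>"
  by (simp add: sum_divide_distrib)
qed

text \<open>
  Rounding moves each scaled arrival by at most \<open>1 / n\<close>, which the larger tolerance absorbs.
\<close>

lemma sum_upper_le:
 "(\<Sum>f\<in>maps \<theta> K. measure (agent_law a \<theta>) (upper \<eta> \<theta> (place n \<theta> f)))
  \<le> (real n * rho) ^ \<theta> * measure (joint \<theta>) (upper_joint (\<eta> + 1 / real n) \<theta> t)"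
proof -
 interpret J: prob_space "joint \<theta>" by (rule prob_space_joint)
 define D where "D f = upper \<eta> \<theta> (place n \<theta> f)" for f
 have DS: "D f \<in> sets (agent_law a \<theta>)" for f unfolding D_def by (rule upper_sets)
 have "(\<Union>f\<in>maps \<theta> K. D f \<times> box n \<theta> f) \<subseteq> upper_joint (\<eta> + 1 / real n) \<theta> t"
 proof
  fix z assume "z \<in> (\<Union>f\<in>maps \<theta> K. D f \<times> box n \<theta> f)"
  then obtain f where f: "f \<in> maps \<theta> K" "fst z \<in> D f" "snd z \<in> box n \<theta> f" by auto
  have "met_early (\<eta> + 1 / real n) (scaled \<theta> (snd z) j) (debt (fst z) j)" if j: "j \<in> {1..\<theta>}" for j
  proof (rule met_early_mono)
   show "met_early \<eta> (place n \<theta> f j) (debt (fst z) j)" using f(2) j unfolding D_def upper_def by auto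
   show "place n \<theta> f j + \<eta> \<le> scaled \<theta> (snd z) j + (\<eta> + 1 / real n)" using box_place(2)[OF n f(3) j] by simp
  qed
  moreover have "fst z \<in> space (agent_law a \<theta>)" "debt (fst z) 0 \<le> alpha 0" using f(2) unfolding D_def upper_def by auto
  moreover have "snd z \<in> space (ticks \<theta>)" using sets.sets_into_space[OF box_sets[OF f(1)]] f(3) by blast
  moreover have "snd z \<in> by_time \<theta> t" using box_by_time[OF f(1)] f(3) by blast
  ultimately show "z \<in> upper_joint (\<eta> + 1 / real n) \<theta> t"
   unfolding upper_joint_def upper_def space_pair_measure mem_Times_iff mem_Collect_eq by blast
 qed
 then have "measure (joint \<theta>) (\<Union>f\<in>maps \<theta> K. D f \<times> box n \<theta> f) \<le> measure (joint \<theta>) (upper_joint (\<eta> + 1 / real n) \<theta> t)"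
  by (rule J.finite_measure_mono[OF _ upper_joint_sets])
 moreover have c: "0 < (real n * rho) ^ \<theta>" using n rho_pos by simp
 ultimately show ?thesis
  unfolding measure_boxes(2)[OF DS] pos_divide_le_eq[OF c] by (simp only: D_def mult.commute)
qed

text \<open>
  Rounding up only makes the lower condition weaker. The boxes miss the tuples in which some
  arrival has \<open>n Lam\<close> between \<open>K\<close> and \<open>n Lam t\<close>; up to scaling, the subtracted term is their
  probability.
\<close>

lemma sum_lower_ge:
 "(real n * rho) ^ \<theta> * measure (joint \<theta>) (lower_joint \<eta> \<theta> t) - ((real n * Lam t) ^ \<theta> - real K ^ \<theta>)
  \<le> (\<Sum>f\<in>maps \<theta> K. measure (agent_law a \<theta>) (lower \<eta> \<theta> (place n \<theta> f)))"
proof -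
 interpret J: prob_space "joint \<theta>" by (rule prob_space_joint)
 interpret A: prob_space "agent_law a \<theta>" by (rule prob_space_agent_law[OF valid_a])
 interpret TP: prob_space "ticks \<theta>" by (rule prob_space_times)
 define D where "D f = lower \<eta> \<theta> (place n \<theta> f)" for f
 define S where "S = space (agent_law a \<theta>)"
 have DS: "D f \<in> sets (agent_law a \<theta>)" for f unfolding D_def by (rule lower_sets)
 have SS: "S \<in> sets (agent_law a \<theta>)" unfolding S_def by (rule sets.top)
 define A where "A = (\<Union>f\<in>maps \<theta> K. D f \<times> box n \<theta> f)"
 define B where "B = (\<Union>f\<in>maps \<theta> K. S \<times> box n \<theta> f)"
 define C where "C = S \<times> by_time \<theta> t"
 have AS: "A \<in> sets (joint \<theta>)" unfolding A_def by (rule measure_boxes(1)[OF DS])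
 have BS: "B \<in> sets (joint \<theta>)" unfolding B_def by (rule measure_boxes(1)[OF SS])
 have CS: "C \<in> sets (joint \<theta>)" unfolding C_def by (rule pair_measureI[OF SS by_time_sets])
 have "B \<subseteq> C" unfolding B_def C_def using box_by_time by blast
 have mB: "measure (joint \<theta>) B = real K ^ \<theta> / (real n * rho) ^ \<theta>"
 proof -
  have "measure (agent_law a \<theta>) S = 1" unfolding S_def by (rule A.prob_space)
  then show ?thesis unfolding B_def measure_boxes(2)[OF SS]
   by (simp only: sum_constant card_maps of_nat_power mult_1_right)
 qed
 have mC: "measure (joint \<theta>) C = (Lam t / rho) ^ \<theta>"
 proof -
  have "emeasure (joint \<theta>) C = emeasure (agent_law a \<theta>) S * emeasure (ticks \<theta>) (by_time \<theta> t)"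
   unfolding C_def by (rule TP.emeasure_pair_measure_Times[OF SS by_time_sets])
  also have "\<dots> = ennreal ((Lam t / rho) ^ \<theta>)"
   unfolding emeasure_by_time[OF t] using A.emeasure_space_1 by (simp add: S_def)
  finally show ?thesis using Lam_nonneg[of t] rho_pos by (simp add: measure_def)
 qed
 have "lower_joint \<eta> \<theta> t \<subseteq> A \<union> (C - B)"
 proof
  fix z assume z: "z \<in> lower_joint \<eta> \<theta> t"
  have zs: "fst z \<in> S" "snd z \<in> by_time \<theta> t" "debt (fst z) 0 < alpha 0"
   "\<And>j. j \<in> {1..\<theta>} \<Longrightarrow> met_surely \<eta> (scaled \<theta> (snd z) j) (debt (fst z) j)"
   using z unfolding lower_joint_def lower_def S_def by auto
  show "z \<in> A \<union> (C - B)"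
  proof (cases "\<exists>f\<in>maps \<theta> K. snd z \<in> box n \<theta> f")
   case True
   then obtain f where f: "f \<in> maps \<theta> K" "snd z \<in> box n \<theta> f" by blast
   have "met_surely \<eta> (place n \<theta> f j) (debt (fst z) j)" if j: "j \<in> {1..\<theta>}" for j
    by (rule met_surely_mono[OF zs(4)[OF j]]) (use box_place(1)[OF n f(2) j] in simp)
   then have "fst z \<in> D f" using zs unfolding D_def lower_def S_def by auto
   then show ?thesis unfolding A_def using f by (cases z) auto
  next
   case False
   then have "z \<notin> B" unfolding B_def by auto
   then show ?thesis unfolding C_def using zs by (cases z) auto
  qed
 qed
 then have "measure (joint \<theta>) (lower_joint \<eta> \<theta> t) \<le> measure (joint \<theta>) (A \<union> (C - B))"
  by (rule J.finite_measure_mono) (use AS BS CS in auto)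
 also have "\<dots> \<le> measure (joint \<theta>) A + measure (joint \<theta>) (C - B)"
  by (rule measure_Un_le) (use AS BS CS in auto)
 also have "measure (joint \<theta>) (C - B) = (Lam t / rho) ^ \<theta> - real K ^ \<theta> / (real n * rho) ^ \<theta>"
  unfolding mB[symmetric] mC[symmetric] by (rule J.finite_measure_Diff[OF CS BS \<open>B \<subseteq> C\<close>])
 finally have le: "measure (joint \<theta>) (lower_joint \<eta> \<theta> t) \<le> measure (joint \<theta>) A + ((Lam t / rho) ^ \<theta> - real K ^ \<theta> / (real n * rho) ^ \<theta>)" .
 have c: "0 < (real n * rho) ^ \<theta>" using n rho_pos by simp
 have "(real n * rho) ^ \<theta> * measure (joint \<theta>) (lower_joint \<eta> \<theta> t)
  \<le> (real n * rho) ^ \<theta> * (measure (joint \<theta>) A + ((Lam t / rho) ^ \<theta> - real K ^ \<theta> / (real n * rho) ^ \<theta>))"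
  using le c by (intro mult_left_mono) auto
 also have "\<dots> = (\<Sum>f\<in>maps \<theta> K. measure (agent_law a \<theta>) (D f)) + ((real n * Lam t) ^ \<theta> - real K ^ \<theta>)"
  unfolding A_def measure_boxes(2)[OF DS] using n rho_pos
  by (simp add: distrib_left right_diff_distrib power_mult_distrib power_divide)
 finally show ?thesis unfolding D_def by simp
qed

text \<open>
  Passing from all maps to injective ones loses at most the number of non-injective maps.
\<close>

lemma subset_sum_le:
 "fact \<theta> * (subset_sum a \<theta> K (\<lambda>S. upper \<eta> \<theta> (positions n S)))
  \<le> (real n * rho) ^ \<theta> * measure (joint \<theta>) (upper_joint (\<eta> + 1 / real n) \<theta> t)"
proof -
 have "fact \<theta> * (subset_sum a \<theta> K (\<lambda>S. upper \<eta> \<theta> (positions n S)))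
  = (\<Sum>f\<in>injections \<theta> K. measure (agent_law a \<theta>) (upper \<eta> \<theta> (\<lambda>j. real (nth_pos (f ` {1..\<theta>}) j) / real n)))"
  by (rule sum_injections[symmetric])
 also have "\<dots> = (\<Sum>f\<in>injections \<theta> K. measure (agent_law a \<theta>) (upper \<eta> \<theta> (place n \<theta> f)))"
 proof (rule sum.cong[OF refl], rule arg_cong[where f = "measure (agent_law a \<theta>)"])
  fix f assume "f \<in> injections \<theta> K"
  then have "place n \<theta> f j = real (nth_pos (f ` {1..\<theta>}) j) / real n" if "j \<in> {1..\<theta>}" for j
   unfolding place_def using order_stat_inj[of f \<theta> j] that by simp
  then show "upper \<eta> \<theta> (\<lambda>j. real (nth_pos (f ` {1..\<theta>}) j) / real n) = upper \<eta> \<theta> (place n \<theta> f)"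
   unfolding upper_def by auto
 qed
 also have "\<dots> \<le> (\<Sum>f\<in>maps \<theta> K. measure (agent_law a \<theta>) (upper \<eta> \<theta> (place n \<theta> f)))"
  by (rule sum_mono2[OF finite_maps]) auto
 also note sum_upper_le
 finally show ?thesis .
qed

lemma subset_sum_ge:
 "(real n * rho) ^ \<theta> * measure (joint \<theta>) (lower_joint \<eta> \<theta> t) - ((real n * Lam t) ^ \<theta> - falling (real K) \<theta>)
  \<le> fact \<theta> * (subset_sum a \<theta> K (\<lambda>S. lower \<eta> \<theta> (positions n S)))"
proof -
 interpret A: prob_space "agent_law a \<theta>" by (rule prob_space_agent_law[OF valid_a])
 define g where "g f = measure (agent_law a \<theta>) (lower \<eta> \<theta> (place n \<theta> f))" for f
 have "fact \<theta> * (subset_sum a \<theta> K (\<lambda>S. lower \<eta> \<theta> (positions n S)))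
  = (\<Sum>f\<in>injections \<theta> K. measure (agent_law a \<theta>) (lower \<eta> \<theta> (\<lambda>j. real (nth_pos (f ` {1..\<theta>}) j) / real n)))"
  by (rule sum_injections[symmetric])
 also have "\<dots> = (\<Sum>f\<in>injections \<theta> K. g f)"
  unfolding g_def
 proof (rule sum.cong[OF refl], rule arg_cong[where f = "measure (agent_law a \<theta>)"])
  fix f assume "f \<in> injections \<theta> K"
  then have "place n \<theta> f j = real (nth_pos (f ` {1..\<theta>}) j) / real n" if "j \<in> {1..\<theta>}" for j
   unfolding place_def using order_stat_inj[of f \<theta> j] that by simp
  then show "lower \<eta> \<theta> (\<lambda>j. real (nth_pos (f ` {1..\<theta>}) j) / real n) = lower \<eta> \<theta> (place n \<theta> f)"
   unfolding lower_def by auto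
 qed
 finally have e: "fact \<theta> * (subset_sum a \<theta> K (\<lambda>S. lower \<eta> \<theta> (positions n S)))
  = (\<Sum>f\<in>injections \<theta> K. g f)" .
 have sub: "injections \<theta> K \<subseteq> maps \<theta> K" by blast
 define N where "N = maps \<theta> K - injections \<theta> K"
 have 1: "(\<Sum>f\<in>maps \<theta> K. g f) = (\<Sum>f\<in>N. g f) + (\<Sum>f\<in>injections \<theta> K. g f)"
  unfolding N_def by (rule sum.subset_diff[OF sub finite_maps])
 have 2: "(\<Sum>f\<in>N. g f) \<le> (\<Sum>f\<in>N. 1)"
  by (rule sum_mono) (unfold g_def, rule A.prob_le_1)
 have "card N = card (maps \<theta> K) - card (injections \<theta> K)"
  unfolding N_def by (rule card_Diff_subset[OF finite_subset[OF sub finite_maps] sub])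
 then have "real (card N) = real (card (maps \<theta> K)) - real (card (injections \<theta> K))"
  by (simp only: of_nat_diff[OF card_mono[OF finite_maps sub]])
 then have 3: "real (card N) = real K ^ \<theta> - falling (real K) \<theta>"
  by (simp only: card_maps card_injections of_nat_power)
 have 4: "(\<Sum>f\<in>N. 1 :: real) = real (card N)" by simp
 show ?thesis using sum_lower_ge[of \<eta>] e 1 2 3 4 unfolding g_def[symmetric] by linarith
qed

end

lemma subset_sum_bound:
 fixes D :: "nat set \<Rightarrow> (nat \<Rightarrow> real) set"
 assumes "real K \<le> real n * L"
 shows "(subset_sum a \<theta> K D) \<le> real n ^ \<theta> * L ^ \<theta>"
proof -
 interpret A: prob_space "agent_law a \<theta>" by (rule prob_space_agent_law[OF valid_a])
 have "(subset_sum a \<theta> K D) \<le> (\<Sum>S\<in>subsets_of_size \<theta> K. 1)"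
  by (rule sum_mono) (rule A.prob_le_1)
 also have "\<dots> = real (K choose \<theta>)" by (simp add: card_subsets_of_size)
 also have "\<dots> \<le> real (K ^ \<theta>)"
  unfolding of_nat_le_iff
  by (cases "\<theta> \<le> K") (simp_all add: binomial_le_pow binomial_eq_0)
 also have "\<dots> \<le> (real n * L) ^ \<theta>" unfolding of_nat_power by (rule power_mono) (use assms in auto)
 finally show ?thesis by (simp add: power_mult_distrib)
qed

end

text \<open>
  For a fixed number of factors, falling factorials and powers are asymptotically equal.
\<close>

lemma falling_limit:
 assumes "(\<lambda>n. real (b n) / real n) \<longlonglongrightarrow> x"
 shows "(\<lambda>n. falling (real (b n)) k / real n ^ k) \<longlonglongrightarrow> x ^ k"
proof -
 have "falling (real (b n)) k / real n ^ k = (\<Prod>i<k. real (b n) / real n - real i / real n)" for n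
 proof -
  have e: "real n ^ k = (\<Prod>i<k. real n)" by (subst prod_constant) simp
  show ?thesis unfolding falling_def e by (simp only: prod_dividef[symmetric] diff_divide_distrib)
 qed
 moreover have "(\<lambda>n. \<Prod>i<k. real (b n) / real n - real i / real n) \<longlonglongrightarrow> (\<Prod>i<k. x - 0)"
  by (intro tendsto_prod tendsto_diff assms lim_const_over_n)
 ultimately show ?thesis by simp
qed

text \<open>
  The limit of the second weight is the square of the limit of the first one. This makes the
  agents of a type asymptotically uncorrelated.
\<close>

lemma weight_limits:
 assumes m: "(\<lambda>n. real (m n) / real n) \<longlonglongrightarrow> lam" and K: "(\<lambda>n. real (K n) / real n) \<longlonglongrightarrow> L"
  and lam: "0 < lam" and ev: "eventually (\<lambda>n. K n \<le> m n) sequentially" and \<theta>: "\<theta> \<le> d"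
 defines "w \<equiv> falling (real d) \<theta> * (lam - L) ^ (d - \<theta>) / lam ^ d"
 shows "(\<lambda>n. weight1 (m n) d (K n) \<theta> * real n ^ \<theta>) \<longlonglongrightarrow> w"
  and "(\<lambda>n. weight2 (m n) d (K n) \<theta> * real n ^ (2 * \<theta>)) \<longlonglongrightarrow> w\<^sup>2"
proof -
 have mK: "(\<lambda>n. real (m n - K n) / real n) \<longlonglongrightarrow> lam - L"
 proof (rule Lim_transform_eventually)
  show "(\<lambda>n. real (m n) / real n - real (K n) / real n) \<longlonglongrightarrow> lam - L" by (intro tendsto_diff m K)
  show "\<forall>\<^sub>F n in sequentially. real (m n) / real n - real (K n) / real n = real (m n - K n) / real n"
   using ev by eventually_elim (simp add: of_nat_diff diff_divide_distrib)
 qed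
 have split: "x / y * real n ^ j = (x / real n ^ (e - j)) / (y / real n ^ e)" if "1 \<le> n" "j \<le> e" for x y n j e
 proof -
  have "real n ^ e = real n ^ (e - j) * real n ^ j" using that by (simp add: power_add[symmetric])
  then show ?thesis using that by (simp add: field_simps)
 qed
 show "(\<lambda>n. weight1 (m n) d (K n) \<theta> * real n ^ \<theta>) \<longlonglongrightarrow> w"
 proof (rule Lim_transform_eventually)
  show "(\<lambda>n. falling (real d) \<theta> * ((falling (real (m n - K n)) (d - \<theta>) / real n ^ (d - \<theta>)) / (falling (real (m n)) d / real n ^ d)))
   \<longlonglongrightarrow> w"
   unfolding w_def times_divide_eq_right[symmetric]
   by (intro tendsto_mult tendsto_const tendsto_divide falling_limit m mK) (use lam in simp)
  show "\<forall>\<^sub>F n in sequentially. falling (real d) \<theta> * ((falling (real (m n - K n)) (d - \<theta>) / real n ^ (d - \<theta>)) / (falling (real (m n)) d / real n ^ d))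
   = weight1 (m n) d (K n) \<theta> * real n ^ \<theta>"
   using eventually_ge_at_top[of 1]
  proof eventually_elim
   case (elim n)
   show ?case unfolding split[OF elim \<theta>, symmetric] weight1_def by simp
  qed
 qed
 have w2: "w\<^sup>2 = (falling (real d) \<theta>)\<^sup>2 * ((lam - L) ^ (2 * d - 2 * \<theta>) / lam ^ (2 * d))"
  unfolding w_def by (simp add: power_divide power_mult_distrib power_mult[symmetric] diff_mult_distrib mult.commute)
 show "(\<lambda>n. weight2 (m n) d (K n) \<theta> * real n ^ (2 * \<theta>)) \<longlonglongrightarrow> w\<^sup>2"
 proof (rule Lim_transform_eventually)
  show "(\<lambda>n. (falling (real d) \<theta>)\<^sup>2 * ((falling (real (m n - K n)) (2 * d - 2 * \<theta>) / real n ^ (2 * d - 2 * \<theta>)) / (falling (real (m n)) (2 * d) / real n ^ (2 * d))))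
   \<longlonglongrightarrow> w\<^sup>2"
   unfolding w2
   by (intro tendsto_mult tendsto_const tendsto_divide falling_limit m mK) (use lam in simp)
  show "\<forall>\<^sub>F n in sequentially. (falling (real d) \<theta>)\<^sup>2 * ((falling (real (m n - K n)) (2 * d - 2 * \<theta>) / real n ^ (2 * d - 2 * \<theta>)) / (falling (real (m n)) (2 * d) / real n ^ (2 * d)))
   = weight2 (m n) d (K n) \<theta> * real n ^ (2 * \<theta>)"
   using eventually_ge_at_top[of 1]
  proof eventually_elim
   case (elim n)
   have "2 * \<theta> \<le> 2 * d" using \<theta> by simp
   from split[OF elim this] show ?case unfolding weight2_def by (simp only: mult.assoc times_divide_eq_right[symmetric])
  qed
 qed
qed

lemma (in intensity_limit) phi_eq:
 assumes lam: "0 < lam" and t: "0 \<le> t"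
 shows "phi R lam t = min (Lam t) lam / lam"
proof (cases "rho \<le> lam")
 case True
 then have "t_limit R lam = \<infinity>" unfolding t_limit_def rho_def by simp
 then have "phi R lam t = Lam t / lam" unfolding phi_def Lam_def by simp
 moreover have "Lam t \<le> lam" using Lam_less_rho[of t] True by simp
 ultimately show ?thesis by (simp add: min_absorb1)
next
 case False
 then obtain s where s: "0 \<le> s" "Lam s = lam" using Lam_surj[of lam] lam by auto
 have "{t. 0 \<le> t \<and> lam \<le> Lam t} = {s..}"
 proof (intro set_eqI)
  fix x
  have "lam \<le> Lam x \<longleftrightarrow> s \<le> x" if "0 \<le> x" using Lam_less_iff[OF that s(1)] s(2) by linarith
  then show "x \<in> {t. 0 \<le> t \<and> lam \<le> Lam t} \<longleftrightarrow> x \<in> {s..}" using s(1) by auto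
 qed
 then have "t_limit R lam = Inf (ereal ` {s..})"
  using False unfolding t_limit_def rho_def Lam_def by simp
 also have "\<dots> = ereal s" by (intro antisym Inf_lower Inf_greatest) auto
 finally have tl: "t_limit R lam = ereal s" .
 have mi: "real_of_ereal (min (ereal t) (ereal s)) = min t s" by (auto simp: min_def)
 have "phi R lam t = Lam (min t s) / lam" unfolding phi_def Lam_def tl mi by (simp only: times_divide_eq_left mult_1)
 also have "Lam (min t s) = min (Lam t) lam"
  using Lam_mono[of t s] Lam_mono[of s t] s(2) by (auto simp: min_def)
 finally show ?thesis .
qed

context class_limit begin

definition limit_fraction :: "real \<Rightarrow> nat \<Rightarrow> real \<Rightarrow> real" where
 "limit_fraction lam \<theta> t = binom_prob (d_in a) (phi R lam t) \<theta> * survival_prob R a \<theta> t"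

text \<open>
  The probability, on the unconditioned arrival times, that exactly these \<open>\<theta>\<close> arrivals
  occur by time \<open>t\<close> and that the agent survives them.
\<close>

definition truth :: "nat \<Rightarrow> real \<Rightarrow> real" where
 "truth \<theta> t = measure (joint \<theta>) (true_joint \<theta> t)"

text \<open>
  The binomial weight divided by the probability \<open>(v / rho) ^ \<theta>\<close> of arrivals by a time
  with \<open>Lam = v\<close>. The maximum cancels this quotient against \<open>phi = min v lam / lam\<close> without a
  division by 0 at \<open>v = 0\<close>, which makes the factor continuous in \<open>v\<close>.
\<close>

definition edge_factor :: "real \<Rightarrow> nat \<Rightarrow> real \<Rightarrow> real" where
 "edge_factor lam \<theta> v = real (d_in a choose \<theta>) * (1 - min v lam / lam) ^ (d_in a - \<theta>) * (rho / max v lam) ^ \<theta>"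

lemma limit_fraction_eq:
 assumes lam: "0 < lam" and t: "0 \<le> t" and \<theta>: "\<theta> \<le> d_in a"
 shows "limit_fraction lam \<theta> t = edge_factor lam \<theta> (Lam t) * truth \<theta> t"
proof -
 have mx: "0 < max (Lam t) lam" using lam by simp
 have "min (Lam t) lam * max (Lam t) lam = Lam t * lam" by (simp add: min_def max_def mult.commute)
 then have ph: "min (Lam t) lam / lam = Lam t / max (Lam t) lam" using lam mx by (simp add: field_simps)
 have "(min (Lam t) lam / lam) ^ \<theta> = (rho / max (Lam t) lam) ^ \<theta> * (Lam t / rho) ^ \<theta>"
  unfolding ph power_mult_distrib[symmetric] using rho_pos by simp
 then show ?thesis
  unfolding limit_fraction_def edge_factor_def truth_def survival_prob_eq[OF t \<theta>, symmetric]
   binom_prob_def phi_eq[OF lam t] by (simp add: mult_ac)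
qed

lemma truth_bounds: "0 \<le> truth \<theta> t" "truth \<theta> t \<le> 1"
proof -
 interpret J: prob_space "joint \<theta>" by (rule prob_space_joint)
 show "0 \<le> truth \<theta> t" "truth \<theta> t \<le> 1" unfolding truth_def by (simp, rule J.prob_le_1)
qed

text \<open>
  Enlarging the time changes the event only if some arrival falls between the two times.
\<close>

lemma truth_modulus:
 assumes s: "0 \<le> s" "s \<le> t"
 shows "\<bar>truth \<theta> t - truth \<theta> s\<bar> \<le> (Lam t / rho) ^ \<theta> - (Lam s / rho) ^ \<theta>"
proof -
 interpret J: prob_space "joint \<theta>" by (rule prob_space_joint)
 interpret A: prob_space "agent_law a \<theta>" by (rule prob_space_agent_law[OF valid_a])
 interpret TP: prob_space "ticks \<theta>" by (rule prob_space_times)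
 define S where "S = space (agent_law a \<theta>)"
 have SS: "S \<in> sets (agent_law a \<theta>)" unfolding S_def by (rule sets.top)
 have BS: "S \<times> by_time \<theta> x \<in> sets (joint \<theta>)" for x by (rule pair_measureI[OF SS by_time_sets])
 have mB: "measure (joint \<theta>) (S \<times> by_time \<theta> x) = (Lam x / rho) ^ \<theta>" if "0 \<le> x" for x
 proof -
  have "emeasure (joint \<theta>) (S \<times> by_time \<theta> x) = emeasure (agent_law a \<theta>) S * emeasure (ticks \<theta>) (by_time \<theta> x)"
   by (rule TP.emeasure_pair_measure_Times[OF SS by_time_sets])
  also have "\<dots> = ennreal ((Lam x / rho) ^ \<theta>)"
   unfolding emeasure_by_time[OF that] using A.emeasure_space_1 by (simp add: S_def)
  finally show ?thesis using Lam_nonneg[of x] rho_pos by (simp add: measure_def)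
 qed
 have bt: "by_time \<theta> s \<subseteq> by_time \<theta> t" unfolding by_time_def by (rule PiE_mono) (use s in auto)
 have sub: "true_joint \<theta> s \<subseteq> true_joint \<theta> t" unfolding true_joint_def using bt by blast
 have "truth \<theta> t - truth \<theta> s = measure (joint \<theta>) (true_joint \<theta> t - true_joint \<theta> s)"
  unfolding truth_def by (rule J.finite_measure_Diff[OF true_joint_sets true_joint_sets sub, symmetric])
 also have "\<dots> \<le> measure (joint \<theta>) (S \<times> by_time \<theta> t - S \<times> by_time \<theta> s)"
 proof (rule J.finite_measure_mono)
  show "true_joint \<theta> t - true_joint \<theta> s \<subseteq> S \<times> by_time \<theta> t - S \<times> by_time \<theta> s"
   unfolding true_joint_def S_def by (auto simp: space_pair_measure)
  show "S \<times> by_time \<theta> t - S \<times> by_time \<theta> s \<in> sets (joint \<theta>)" using BS by (rule sets.Diff[OF BS])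
 qed
 also have "\<dots> = (Lam t / rho) ^ \<theta> - (Lam s / rho) ^ \<theta>"
  using J.finite_measure_Diff[OF BS BS, of s t] bt mB s by auto
 finally have "truth \<theta> t - truth \<theta> s \<le> (Lam t / rho) ^ \<theta> - (Lam s / rho) ^ \<theta>" .
 moreover have "truth \<theta> s \<le> truth \<theta> t"
  unfolding truth_def by (rule J.finite_measure_mono[OF sub true_joint_sets])
 ultimately show ?thesis by simp
qed

text \<open>
  Continuity in the clock \<open>Lam\<close>, whose relevant values lie in a compact interval, is uniform,
  unlike continuity in time on the half-line.
\<close>

lemma limit_fraction_modulus:
 assumes lam: "0 < lam" and \<theta>: "\<theta> \<le> d_in a" and e: "0 < e"
 shows "\<exists>\<zeta>>0. \<forall>s t. 0 \<le> s \<longrightarrow> 0 \<le> t \<longrightarrow> Lam s \<le> lam + 1 \<longrightarrow> Lam t \<le> lam + 1 \<longrightarrow> \<bar>Lam t - Lam s\<bar> \<le> \<zeta> \<longrightarrow>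
      \<bar>limit_fraction lam \<theta> t - limit_fraction lam \<theta> s\<bar> \<le> e"
proof -
 define p where "p = edge_factor lam \<theta>"
 define h where "h v = (v / rho) ^ \<theta>" for v
 have cp: "continuous_on {0..lam + 1} p"
  unfolding p_def edge_factor_def[abs_def] using lam by (intro continuous_intros) auto
 have ch: "continuous_on {0..lam + 1} h"
  unfolding h_def using rho_pos by (intro continuous_intros) auto
 have "compact (p ` {0..lam + 1})" by (rule compact_continuous_image[OF cp]) simp
 then obtain P where P: "0 < P" "\<And>v. v \<in> {0..lam + 1} \<Longrightarrow> \<bar>p v\<bar> \<le> P"
  using compact_imp_bounded[of "p ` {0..lam + 1}"] unfolding bounded_pos by (auto simp: image_iff)
 have up: "uniformly_continuous_on {0..lam + 1} p" "uniformly_continuous_on {0..lam + 1} h"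
  by (rule compact_uniformly_continuous[OF cp], simp, rule compact_uniformly_continuous[OF ch], simp)
 obtain d1 where d1: "0 < d1" "\<And>v v'. v \<in> {0..lam + 1} \<Longrightarrow> v' \<in> {0..lam + 1} \<Longrightarrow> \<bar>v' - v\<bar> < d1 \<Longrightarrow> \<bar>p v' - p v\<bar> < e / 2"
  using up(1) e unfolding uniformly_continuous_on_def dist_real_def by (meson half_gt_zero)
 have "0 < e / (2 * P)" using e P by simp
 then obtain d2 where d2: "0 < d2" "\<And>v v'. v \<in> {0..lam + 1} \<Longrightarrow> v' \<in> {0..lam + 1} \<Longrightarrow> \<bar>v' - v\<bar> < d2 \<Longrightarrow> \<bar>h v' - h v\<bar> < e / (2 * P)"
  using up(2) unfolding uniformly_continuous_on_def dist_real_def by meson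
 define z where "z = min d1 d2 / 2"
 have z: "0 < z" "z < d1" "z < d2" using d1(1) d2(1) unfolding z_def by auto
 have main: "\<bar>limit_fraction lam \<theta> t - limit_fraction lam \<theta> s\<bar> \<le> e"
  if "0 \<le> s" "s \<le> t" "Lam s \<le> lam + 1" "Lam t \<le> lam + 1" "\<bar>Lam t - Lam s\<bar> \<le> z" for s t
 proof -
  have in1: "Lam s \<in> {0..lam + 1}" "Lam t \<in> {0..lam + 1}" using that Lam_nonneg by auto
  have pp: "\<bar>p (Lam t) - p (Lam s)\<bar> < e / 2" by (rule d1(2)[OF in1]) (use that z in linarith)
  have hh: "\<bar>h (Lam t) - h (Lam s)\<bar> < e / (2 * P)" by (rule d2(2)[OF in1]) (use that z in linarith)
  have tt: "\<bar>truth \<theta> t - truth \<theta> s\<bar> \<le> e / (2 * P)"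
   using truth_modulus[OF that(1,2), of \<theta>] hh unfolding h_def by linarith
  have lf: "limit_fraction lam \<theta> x = p (Lam x) * truth \<theta> x" if "0 \<le> x" for x
   unfolding p_def by (rule limit_fraction_eq[OF lam that \<theta>])
  have "limit_fraction lam \<theta> t - limit_fraction lam \<theta> s
   = (p (Lam t) - p (Lam s)) * truth \<theta> t + p (Lam s) * (truth \<theta> t - truth \<theta> s)"
   using lf[of t] lf[of s] that by (simp add: algebra_simps)
  moreover have "\<bar>(p (Lam t) - p (Lam s)) * truth \<theta> t\<bar> \<le> e / 2 * 1"
   unfolding abs_mult by (rule mult_mono) (use pp truth_bounds[of \<theta> t] e in auto)
  moreover have "\<bar>p (Lam s) * (truth \<theta> t - truth \<theta> s)\<bar> \<le> P * (e / (2 * P))"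
   unfolding abs_mult by (rule mult_mono) (use P in1 tt in auto)
  moreover have "P * (e / (2 * P)) = e / 2" using P by simp
  ultimately show ?thesis by linarith
 qed
 have "\<bar>limit_fraction lam \<theta> t - limit_fraction lam \<theta> s\<bar> \<le> e"
  if "0 \<le> s" "0 \<le> t" "Lam s \<le> lam + 1" "Lam t \<le> lam + 1" "\<bar>Lam t - Lam s\<bar> \<le> z" for s t
  using main[of s t] main[of t s] that by (cases "s \<le> t") (auto simp: abs_minus_commute)
 then show ?thesis using z(1) by blast
qed

definition upper_sum :: "real \<Rightarrow> nat \<Rightarrow> nat \<Rightarrow> nat \<Rightarrow> real" where
 "upper_sum \<eta> \<theta> n K = (subset_sum a \<theta> K (\<lambda>S. upper \<eta> \<theta> (positions n S)))"

definition lower_sum :: "real \<Rightarrow> nat \<Rightarrow> nat \<Rightarrow> nat \<Rightarrow> real" where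
 "lower_sum \<eta> \<theta> n K = (subset_sum a \<theta> K (\<lambda>S. lower \<eta> \<theta> (positions n S)))"

definition reveals_at :: "real \<Rightarrow> nat \<Rightarrow> nat" where
 "reveals_at t n = nat \<lfloor>real n * Lam t\<rfloor>"

lemma reveals_at_le: "real (reveals_at t n) \<le> real n * Lam t"
 unfolding reveals_at_def using Lam_nonneg[of t] by simp

lemma reveals_at_ge: "real n * Lam t - 1 < real (reveals_at t n)"
 unfolding reveals_at_def using Lam_nonneg[of t] by simp

lemma reveals_at_limit: "(\<lambda>n. real (reveals_at t n) / real n) \<longlonglongrightarrow> Lam t"
proof (rule tendsto_sandwich)
 show "(\<lambda>n. Lam t - 1 / real n) \<longlonglongrightarrow> Lam t"
  using tendsto_diff[OF tendsto_const lim_const_over_n[of 1], of "Lam t"] by simp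
 show "(\<lambda>n. Lam t) \<longlonglongrightarrow> Lam t" by simp
 show "\<forall>\<^sub>F n in sequentially. Lam t - 1 / real n \<le> real (reveals_at t n) / real n"
  using eventually_ge_at_top[of 1]
 proof eventually_elim
  case (elim n)
  have "(real n * Lam t - 1) / real n \<le> real (reveals_at t n) / real n"
   using reveals_at_ge[of n t] by (intro divide_right_mono) auto
  then show ?case using elim by (simp add: diff_divide_distrib)
 qed
 show "\<forall>\<^sub>F n in sequentially. real (reveals_at t n) / real n \<le> Lam t"
  using eventually_ge_at_top[of 1]
 proof eventually_elim
  case (elim n)
  then show ?case using reveals_at_le[of t n] by (simp add: field_simps)
 qed
qed

context
 fixes m :: "nat \<Rightarrow> nat" and lam t :: real and \<theta> :: nat
 assumes m: "(\<lambda>n. real (m n) / real n) \<longlonglongrightarrow> lam" and lam: "0 < lam" and t: "0 \<le> t" "Lam t < lam"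
  and \<theta>: "\<theta> \<le> d_in a"
begin

abbreviation "K n \<equiv> reveals_at t n"
abbreviation "w1 n \<equiv> weight1 (m n) (d_in a) (K n) \<theta>"
abbreviation "w2 n \<equiv> weight2 (m n) (d_in a) (K n) \<theta>"

lemma reveals_at_le_m: "eventually (\<lambda>n. reveals_at t n \<le> m n) sequentially"
proof -
 have "\<forall>\<^sub>F n in sequentially. Lam t < real (m n) / real n" by (rule order_tendstoD(1)[OF m t(2)])
 then show ?thesis using eventually_ge_at_top[of 1]
 proof eventually_elim
  case (elim n)
  then have "real n * Lam t < real (m n)" by (simp add: field_simps)
  then show ?case using reveals_at_le[of t n] by linarith
 qed
qed

definition wlim :: real where
 "wlim = falling (real (d_in a)) \<theta> * (lam - Lam t) ^ (d_in a - \<theta>) / lam ^ d_in a"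

lemmas weights = weight_limits[OF m reveals_at_limit lam reveals_at_le_m \<theta>, folded wlim_def]

lemma wlim_truth: "wlim / fact \<theta> * rho ^ \<theta> = edge_factor lam \<theta> (Lam t)"
proof -
 have f: "falling (real (d_in a)) \<theta> = fact \<theta> * real (d_in a choose \<theta>)" by (rule fact_binomial_falling[symmetric])
 have l: "lam ^ d_in a = lam ^ (d_in a - \<theta>) * lam ^ \<theta>" using \<theta> by (simp add: power_add[symmetric])
 have "1 - Lam t / lam = (lam - Lam t) / lam" using lam by (simp add: diff_divide_distrib)
 then show ?thesis unfolding wlim_def edge_factor_def f l using t lam
  by (simp add: min_absorb1 max_absorb2 power_divide)
qed

text \<open>
  There are of the order of \<open>n ^ \<theta>\<close> position sets. The weights scaled by \<open>n ^ \<theta>\<close>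
  and \<open>n ^ (2 * \<theta>)\<close> converge, and the second limit is the square of the first one.
\<close>

lemma variance_vanishes:
 assumes D: "\<And>n. G n = (subset_sum a \<theta> (K n) (D n))"
 shows "(\<lambda>n. 1 / real n + \<bar>w2 n - (w1 n)\<^sup>2\<bar> * (G n)\<^sup>2) \<longlonglongrightarrow> 0"
proof -
 define g where "g n = \<bar>w2 n * real n ^ (2 * \<theta>) - (w1 n * real n ^ \<theta>)\<^sup>2\<bar> * (Lam t ^ \<theta>)\<^sup>2" for n
 have "g \<longlonglongrightarrow> \<bar>wlim\<^sup>2 - wlim\<^sup>2\<bar> * (Lam t ^ \<theta>)\<^sup>2"
  unfolding g_def by (intro tendsto_intros weights)
 then have g: "g \<longlonglongrightarrow> 0" by simp
 show ?thesis
 proof (rule tendsto_sandwich[OF _ _ tendsto_const])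
  show "(\<lambda>n. 1 / real n + g n) \<longlonglongrightarrow> 0" using tendsto_add[OF lim_const_over_n[of 1] g] by simp
  show "\<forall>\<^sub>F n in sequentially. 0 \<le> 1 / real n + \<bar>w2 n - (w1 n)\<^sup>2\<bar> * (G n)\<^sup>2" by simp
  show "\<forall>\<^sub>F n in sequentially. 1 / real n + \<bar>w2 n - (w1 n)\<^sup>2\<bar> * (G n)\<^sup>2 \<le> 1 / real n + g n"
  proof (rule always_eventually, rule allI)
   fix n
   have "0 \<le> G n" unfolding D by (rule sum_nonneg) simp
   moreover have "G n \<le> real n ^ \<theta> * Lam t ^ \<theta>" unfolding D by (rule subset_sum_bound[OF reveals_at_le])
   ultimately have "(G n)\<^sup>2 \<le> (real n ^ \<theta> * Lam t ^ \<theta>)\<^sup>2" by (intro power_mono)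
   then have "\<bar>w2 n - (w1 n)\<^sup>2\<bar> * (G n)\<^sup>2 \<le> \<bar>w2 n - (w1 n)\<^sup>2\<bar> * (real n ^ \<theta> * Lam t ^ \<theta>)\<^sup>2"
    by (rule mult_left_mono) simp
   also have "\<dots> = g n"
   proof -
    have r: "real n ^ (2 * \<theta>) = (real n ^ \<theta>)\<^sup>2" by (simp add: power_mult[symmetric] mult.commute)
    have "g n = \<bar>(w2 n - (w1 n)\<^sup>2) * (real n ^ \<theta>)\<^sup>2\<bar> * (Lam t ^ \<theta>)\<^sup>2"
     unfolding g_def r by (simp only: power_mult_distrib left_diff_distrib)
    then show ?thesis by (simp add: abs_mult power_mult_distrib)
   qed
   finally show "1 / real n + \<bar>w2 n - (w1 n)\<^sup>2\<bar> * (G n)\<^sup>2 \<le> 1 / real n + g n" by simp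
  qed
 qed
qed

lemma w1_nonneg: "0 \<le> w1 n"
 unfolding weight1_def by (simp add: falling_nonneg)

lemma upper_limit:
 assumes \<eta>: "0 < \<eta>" and e: "0 < e"
 shows "eventually (\<lambda>n. w1 n * upper_sum \<eta> \<theta> n (K n)
  \<le> edge_factor lam \<theta> (Lam t) * measure (joint \<theta>) (upper_joint (2 * \<eta>) \<theta> t) + e) sequentially"
proof -
 interpret J: prob_space "joint \<theta>" by (rule prob_space_joint)
 define U where "U = measure (joint \<theta>) (upper_joint (2 * \<eta>) \<theta> t)"
 have lim: "(\<lambda>n. w1 n * real n ^ \<theta> / fact \<theta> * rho ^ \<theta> * U) \<longlonglongrightarrow> edge_factor lam \<theta> (Lam t) * U"
  unfolding wlim_truth[symmetric] by (intro tendsto_intros weights) simp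
 have "\<forall>\<^sub>F n in sequentially. w1 n * real n ^ \<theta> / fact \<theta> * rho ^ \<theta> * U < edge_factor lam \<theta> (Lam t) * U + e"
  by (rule order_tendstoD(2)[OF lim]) (use e in simp)
 moreover have "\<forall>\<^sub>F n in sequentially. 1 / real n < \<eta>"
  by (rule order_tendstoD(2)[OF lim_const_over_n \<eta>])
 ultimately show ?thesis using eventually_ge_at_top[of 1]
 proof eventually_elim
  case (elim n)
  have "upper_joint (\<eta> + 1 / real n) \<theta> t \<subseteq> upper_joint (2 * \<eta>) \<theta> t" by (rule upper_joint_mono) (use elim in simp)
  then have "measure (joint \<theta>) (upper_joint (\<eta> + 1 / real n) \<theta> t) \<le> U"
   unfolding U_def by (rule J.finite_measure_mono[OF _ upper_joint_sets])
  then have "(real n * rho) ^ \<theta> * measure (joint \<theta>) (upper_joint (\<eta> + 1 / real n) \<theta> t) \<le> (real n * rho) ^ \<theta> * U"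
   by (rule mult_left_mono) (use rho_pos in simp)
  then have "fact \<theta> * upper_sum \<eta> \<theta> n (K n) \<le> (real n * rho) ^ \<theta> * U"
   using subset_sum_le[OF elim(3) t(1) reveals_at_le, of \<theta> \<eta>] unfolding upper_sum_def by linarith
  then have "upper_sum \<eta> \<theta> n (K n) \<le> (real n * rho) ^ \<theta> * U / fact \<theta>"
   by (simp add: field_simps)
  then have "w1 n * upper_sum \<eta> \<theta> n (K n) \<le> w1 n * ((real n * rho) ^ \<theta> * U / fact \<theta>)"
   by (rule mult_left_mono[OF _ w1_nonneg])
  also have "\<dots> = w1 n * real n ^ \<theta> / fact \<theta> * rho ^ \<theta> * U" by (simp add: power_mult_distrib)
  finally show ?case using elim(1) unfolding U_def by linarith
 qed
qed

lemma lower_limit: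
 assumes e: "0 < e"
 shows "eventually (\<lambda>n. edge_factor lam \<theta> (Lam t) * measure (joint \<theta>) (lower_joint \<eta> \<theta> t) - e
  \<le> w1 n * lower_sum \<eta> \<theta> n (K n)) sequentially"
proof -
 define U where "U = measure (joint \<theta>) (lower_joint \<eta> \<theta> t)"
 define r where "r n = Lam t ^ \<theta> - falling (real (K n)) \<theta> / real n ^ \<theta>" for n
 have "r \<longlonglongrightarrow> Lam t ^ \<theta> - Lam t ^ \<theta>"
  unfolding r_def by (intro tendsto_diff tendsto_const falling_limit reveals_at_limit)
 then have r: "r \<longlonglongrightarrow> 0" by simp
 have lim: "(\<lambda>n. w1 n * real n ^ \<theta> / fact \<theta> * (rho ^ \<theta> * U - r n)) \<longlonglongrightarrow> wlim / fact \<theta> * (rho ^ \<theta> * U - 0)"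
  by (intro tendsto_intros weights r) simp
 have eq: "wlim / fact \<theta> * (rho ^ \<theta> * U - 0) = edge_factor lam \<theta> (Lam t) * U"
  unfolding wlim_truth[symmetric] by simp
 have "\<forall>\<^sub>F n in sequentially. edge_factor lam \<theta> (Lam t) * U - e < w1 n * real n ^ \<theta> / fact \<theta> * (rho ^ \<theta> * U - r n)"
  by (rule order_tendstoD(1)[OF lim[unfolded eq]]) (use e in simp)
 then show ?thesis using eventually_ge_at_top[of 1]
 proof eventually_elim
  case (elim n)
  have "(real n * rho) ^ \<theta> * U - ((real n * Lam t) ^ \<theta> - falling (real (K n)) \<theta>) \<le> fact \<theta> * lower_sum \<eta> \<theta> n (K n)"
   using subset_sum_ge[OF elim(2) t(1) reveals_at_le, of \<theta> \<eta>] unfolding lower_sum_def U_def .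
  moreover have "(real n * rho) ^ \<theta> * U - ((real n * Lam t) ^ \<theta> - falling (real (K n)) \<theta>) = real n ^ \<theta> * (rho ^ \<theta> * U - r n)"
   unfolding r_def using elim(2) by (simp add: power_mult_distrib right_diff_distrib)
  ultimately have "real n ^ \<theta> * (rho ^ \<theta> * U - r n) / fact \<theta> \<le> lower_sum \<eta> \<theta> n (K n)"
   by (simp add: field_simps)
  then have "w1 n * (real n ^ \<theta> * (rho ^ \<theta> * U - r n) / fact \<theta>) \<le> w1 n * lower_sum \<eta> \<theta> n (K n)"
   by (rule mult_left_mono[OF _ w1_nonneg])
  then show ?case using elim(1) unfolding U_def[symmetric] by simp
 qed
qed

lemma edge_factor_nonneg: "0 \<le> edge_factor lam \<theta> (Lam t)"
 unfolding edge_factor_def using t lam rho_pos Lam_nonneg[of t]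
 by (intro mult_nonneg_nonneg zero_le_power) (auto simp: min_absorb1)

text \<open>
  For fixed \<open>\<eta>\<close> the means converge to the probabilities of the brackets on
  \<open>joint \<theta>\<close>. The true event lies between them, and their gap is small for small \<open>\<eta>\<close>.
\<close>

lemma brackets_converge:
 assumes e: "0 < e"
 shows "\<exists>\<eta>0>0. \<forall>\<eta>. 0 < \<eta> \<longrightarrow> \<eta> \<le> \<eta>0 \<longrightarrow>
  eventually (\<lambda>n. w1 n * upper_sum \<eta> \<theta> n (K n) \<le> limit_fraction lam \<theta> t + e \<and>
   limit_fraction lam \<theta> t - e \<le> w1 n * lower_sum \<eta> \<theta> n (K n)) sequentially"
proof -
 interpret J: prob_space "joint \<theta>" by (rule prob_space_joint)
 define c where "c = edge_factor lam \<theta> (Lam t)"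
 define u where "u \<eta> = measure (joint \<theta>) (upper_joint \<eta> \<theta> t)" for \<eta>
 define l where "l \<eta> = measure (joint \<theta>) (lower_joint \<eta> \<theta> t)" for \<eta>
 define \<epsilon> where "\<epsilon> k = 1 / real (Suc k)" for k
 have c0: "0 \<le> c" unfolding c_def by (rule edge_factor_nonneg)
 have "(\<lambda>k. c * (u (\<epsilon> k) - l (\<epsilon> k))) \<longlonglongrightarrow> c * 0"
  unfolding u_def l_def \<epsilon>_def by (intro tendsto_mult tendsto_const gap_tendsto_0)
 then have "\<forall>\<^sub>F k in sequentially. c * (u (\<epsilon> k) - l (\<epsilon> k)) < e / 2"
  by (rule order_tendstoD(2)) (use e in simp)
 then obtain k where k: "c * (u (\<epsilon> k) - l (\<epsilon> k)) < e / 2" unfolding eventually_sequentially by blast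
 have ek: "0 < \<epsilon> k" unfolding \<epsilon>_def by simp
 have lt: "l \<eta> \<le> truth \<theta> t" "truth \<theta> t \<le> u \<eta>" if "0 < \<eta>" for \<eta>
  unfolding l_def u_def truth_def
  by (rule J.finite_measure_mono[OF lower_subset_true[OF that] true_joint_sets],
    rule J.finite_measure_mono[OF true_subset_upper[OF that] upper_joint_sets])
 have um: "u \<eta> \<le> u \<eta>'" if "\<eta> \<le> \<eta>'" for \<eta> \<eta>'
  unfolding u_def by (rule J.finite_measure_mono[OF upper_joint_mono[OF that] upper_joint_sets])
 have lm: "l \<eta>' \<le> l \<eta>" if "\<eta> \<le> \<eta>'" for \<eta> \<eta>'
  unfolding l_def by (rule J.finite_measure_mono[OF lower_joint_antimono[OF that] lower_joint_sets])
 have lf: "limit_fraction lam \<theta> t = c * truth \<theta> t" unfolding c_def by (rule limit_fraction_eq[OF lam t(1) \<theta>])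
 show ?thesis
 proof (intro exI[of _ "\<epsilon> k / 2"] conjI allI impI)
  show "0 < \<epsilon> k / 2" using ek by simp
  fix \<eta> assume \<eta>: "0 < \<eta>" "\<eta> \<le> \<epsilon> k / 2"
  have e2: "0 < e / 2" using e by simp
  have "c * u (2 * \<eta>) \<le> c * u (\<epsilon> k)" by (rule mult_left_mono[OF um c0]) (use \<eta> in simp)
  moreover have "c * l (\<epsilon> k) \<le> c * l \<eta>" by (rule mult_left_mono[OF lm c0]) (use \<eta> ek in simp)
  moreover have "c * l (\<epsilon> k) \<le> c * truth \<theta> t" "c * truth \<theta> t \<le> c * u (\<epsilon> k)"
   by (rule mult_left_mono[OF lt(1)[OF ek] c0], rule mult_left_mono[OF lt(2)[OF ek] c0])
  moreover have "c * u (\<epsilon> k) - c * l (\<epsilon> k) < e / 2" using k by (simp add: right_diff_distrib)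
  ultimately have b: "c * u (2 * \<eta>) \<le> limit_fraction lam \<theta> t + e / 2" "limit_fraction lam \<theta> t - e / 2 \<le> c * l \<eta>"
   unfolding lf by linarith+
  show "eventually (\<lambda>n. w1 n * upper_sum \<eta> \<theta> n (K n) \<le> limit_fraction lam \<theta> t + e \<and>
   limit_fraction lam \<theta> t - e \<le> w1 n * lower_sum \<eta> \<theta> n (K n)) sequentially"
   using upper_limit[OF \<eta>(1) e2] lower_limit[OF e2, of \<eta>]
   unfolding c_def[symmetric] u_def[symmetric] l_def[symmetric]
  proof eventually_elim
   case (elim n)
   show ?case using elim b by linarith
  qed
 qed
qed

end

end

section \<open>Solvency along a typical trajectory\<close>

lemma initial_interval:
 assumes S: "S \<subseteq> {1..m :: nat}" and down: "\<And>i j. i \<in> S \<Longrightarrow> 1 \<le> j \<Longrightarrow> j \<le> i \<Longrightarrow> j \<in> S"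
 shows "S = {1..card S}"
proof (cases "S = {}")
 case False
 have fin: "finite S" by (rule finite_subset[OF S]) simp
 have "S = {1..Max S}"
 proof (intro set_eqI iffI)
  fix x assume "x \<in> S"
  then show "x \<in> {1..Max S}" using S fin by auto
 next
  fix x assume "x \<in> {1..Max S}"
  then show "x \<in> S" using down[OF Max_in[OF fin False], of x] by simp
 qed
 then have "card S = card {1..Max S}" by (rule arg_cong)
 then have "card S = Max S" by (simp only: card_atLeastAtMost diff_Suc_1)
 then show ?thesis using \<open>S = {1..Max S}\<close> by (simp only:)
qed simp

lemma nth_pos_less:
 assumes "finite S" "i \<in> {1..card S}" "j \<in> {1..card S}" "i < j"
 shows "nth_pos S i < nth_pos S j"
proof -
 have "sorted_wrt (<) (sorted_list_of_set S)" by (rule strict_sorted_list_of_set)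
 then show ?thesis unfolding nth_pos_def
  by (rule sorted_wrt_nth_less) (use assms in auto)
qed

lemma nth_pos_le_iff:
 assumes "finite S" "i \<in> {1..card S}" "j \<in> {1..card S}"
 shows "nth_pos S i \<le> nth_pos S j \<longleftrightarrow> i \<le> j"
proof (cases i j rule: linorder_cases)
 case less
 then show ?thesis using nth_pos_less[OF assms(1,2,3)] by simp
next
 case greater
 then show ?thesis using nth_pos_less[OF assms(1,3,2)] by simp
qed simp

lemma nth_posE:
 assumes "finite S" "l \<in> S"
 obtains l' where "l' \<in> {1..card S}" "l = nth_pos S l'"
proof -
 have "l \<in> nth_pos S ` {1..card S}"
  using bij_betw_imp_surj_on[OF bij_nth_pos[OF assms(1)]] assms(2) by (simp only:)
 then show ?thesis using that by (auto elim!: imageE)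
qed

lemma nth_pos_initial:
 fixes c :: nat
 assumes fS: "finite S"
 defines "j \<equiv> card {k \<in> S. k \<le> c}"
 shows "{k \<in> S. k \<le> c} = nth_pos S ` {1..j}" and "j \<le> card S"
  and "1 \<le> j \<Longrightarrow> nth_pos S j \<in> S \<and> nth_pos S j \<le> c"
proof -
 have bij: "bij_betw (nth_pos S) {1..card S} S" by (rule bij_nth_pos[OF fS])
 define J where "J = {i \<in> {1..card S}. nth_pos S i \<le> c}"
 have J: "J \<subseteq> {1..card S}" unfolding J_def by blast
 have whole: "J = {1..card J}"
 proof (rule initial_interval[OF J])
  fix i i' assume i: "i \<in> J" "1 \<le> i'" "i' \<le> i"
  then have "i' \<in> {1..card S}" "i \<in> {1..card S}" unfolding J_def by auto
  then have "nth_pos S i' \<le> nth_pos S i" using nth_pos_le_iff[OF fS, of i' i] i by simp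
  then show "i' \<in> J" using i \<open>i' \<in> {1..card S}\<close> unfolding J_def by simp
 qed
 have onto: "nth_pos S ` {1..card S} = S" using bij unfolding bij_betw_def by (rule conjunct2)
 have img: "{k \<in> S. k \<le> c} = nth_pos S ` J"
 proof (intro set_eqI iffI)
  fix k assume "k \<in> {k \<in> S. k \<le> c}"
  then have k: "k \<in> nth_pos S ` {1..card S}" "k \<le> c" using onto by auto
  from k(1) obtain l where l: "k = nth_pos S l" "l \<in> {1..card S}" by (rule imageE)
  then have "l \<in> J" using k(2) unfolding J_def by simp
  then show "k \<in> nth_pos S ` J" unfolding l(1) by (rule imageI)
 next
  fix k assume "k \<in> nth_pos S ` J"
  then obtain l where l: "k = nth_pos S l" "l \<in> J" by (rule imageE)
  then have "l \<in> {1..card S}" "nth_pos S l \<le> c" unfolding J_def by simp_all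
  then show "k \<in> {k \<in> S. k \<le> c}" using nth_pos_in[OF fS, of l] l(1) by simp
 qed
 have inj: "inj_on (nth_pos S) J" by (rule inj_on_subset[OF bij_betw_imp_inj_on[OF bij] J])
 have cJ: "card J = j" unfolding j_def img by (rule card_image[OF inj, symmetric])
 have J': "J = {1..j}" using whole unfolding cJ .
 show "{k \<in> S. k \<le> c} = nth_pos S ` {1..j}" using img unfolding J' .
 have "card J \<le> card {1..card S}" by (rule card_mono[OF _ J]) simp
 then show "j \<le> card S" unfolding cJ by simp
 assume "1 \<le> j"
 then have "j \<in> J" unfolding J' by simp
 then have "nth_pos S j \<in> {k \<in> S. k \<le> c}" unfolding img by (rule imageI)
 then show "nth_pos S j \<in> S \<and> nth_pos S j \<le> c" by simp
qed

context network begin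

lemma agent_losses_eq: "good \<omega> \<Longrightarrow> agent_losses par n ty p i t \<omega> = arrivals i (num \<omega> t) \<omega>"
 unfolding agent_losses_def arrivals_def using revealed_eq(1)[of \<omega> t] by simp

lemma hit_count_diff:
 assumes "K \<le> K'"
 shows "\<bar>real (hit_count x K \<theta> D \<omega>) - real (hit_count x K' \<theta> D \<omega>)\<bar> \<le> real (K' - K)"
proof -
 define A where "A L = {i \<in> {1..n}. ty i = x \<and> \<omega> \<in> hit i L \<theta> D}" for L
 define C where "C = (\<lambda>k. fst (in_edge p k \<omega>)) ` {K<..K'}"
 have fA: "finite (A L)" for L unfolding A_def by simp
 have fC: "finite C" unfolding C_def by simp
 have cC: "card C \<le> K' - K" unfolding C_def using card_image_le[of "{K<..K'}" "\<lambda>k. fst (in_edge p k \<omega>)"] by simp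
 have same: "arrivals i K \<omega> = arrivals i K' \<omega>" if "i \<notin> C" for i
 proof (intro set_eqI iffI)
  fix k assume "k \<in> arrivals i K' \<omega>"
  then have k: "k \<in> {1..K'}" "fst (in_edge p k \<omega>) = i" unfolding arrivals_def by auto
  then have "k \<notin> {K<..K'}" using that unfolding C_def by blast
  then show "k \<in> arrivals i K \<omega>" using k unfolding arrivals_def by auto
 qed (use assms in \<open>auto simp: arrivals_def\<close>)
 then have "\<omega> \<in> hit i K \<theta> D \<longleftrightarrow> \<omega> \<in> hit i K' \<theta> D" if "i \<notin> C" for i
  using that unfolding hit_def by simp
 then have "A K \<subseteq> A K' \<union> C" "A K' \<subseteq> A K \<union> C" unfolding A_def by blast+
 then have "card (A K) \<le> card (A K' \<union> C)" "card (A K') \<le> card (A K \<union> C)"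
  using fA fC by (auto intro: card_mono)
 then have "card (A K) \<le> card (A K') + card C" "card (A K') \<le> card (A K) + card C"
  using card_Un_le[of "A K'" C] card_Un_le[of "A K" C] by linarith+
 then have "card (A K) \<le> card (A K') + (K' - K)" "card (A K') \<le> card (A K) + (K' - K)" using cC by linarith+
 then show ?thesis unfolding hit_count_def A_def[symmetric] by linarith
qed

text \<open>
  One further reveal changes the positions of at most one agent.
\<close>

lemma hit_count_lipschitz:
 "\<bar>real (hit_count x K \<theta> D \<omega>) - real (hit_count x K' \<theta> D \<omega>)\<bar> \<le> \<bar>real K - real K'\<bar>"
proof (cases "K \<le> K'")
 case True
 then show ?thesis using hit_count_diff[OF True, of x \<theta> D \<omega>] by simp
next
 case False
 then have "K' \<le> K" by simp
 from hit_count_diff[OF this, of x \<theta> D \<omega>] \<open>K' \<le> K\<close> show ?thesis by simp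
qed

lemma ruined_mono: "ruined par n ty p i s \<omega> \<Longrightarrow> s \<le> t \<Longrightarrow> ruined par n ty p i t \<omega>"
 unfolding ruined_def by (auto intro: order_trans)

lemma reveal_instant:
 assumes g: "good \<omega>" and t: "0 \<le> t" and k: "1 \<le> k" "k \<le> num \<omega> t"
 obtains r where "T k \<omega> = ereal r" "0 \<le> r" "r \<le> t" "num \<omega> r = k"
proof -
 have km: "k \<le> m" using k revealed_eq(2)[OF g, of t] by simp
 have "T k \<omega> \<le> ereal t" using le_num_iff[OF g km t] k by simp
 moreover have "0 \<le> T k \<omega>" by (rule T_nonneg[OF g km])
 ultimately obtain r where r: "T k \<omega> = ereal r" by (cases "T k \<omega>") auto
 show ?thesis using that[OF r] num_at_T[OF g km r] \<open>T k \<omega> \<le> ereal t\<close> r by simp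
qed

text \<open>
  Between two losses the capital can only grow, so solvency is decided at time 0 and at the
  instants of the losses.
\<close>

lemma solvency_sandwich:
 assumes cl: "class_limit R (par (ty i))" and g: "good \<omega>" and i: "i \<in> {1..n}" and n: "1 \<le> n" and \<eta>: "0 < \<eta>"
  and t: "0 \<le> t" "ereal t \<le> \<tau>"
  and close: "\<And>s. 0 \<le> s \<Longrightarrow> ereal s \<le> \<tau> \<Longrightarrow> \<bar>real (num \<omega> s) / real n - intensity_limit.Lam R s\<bar> \<le> \<eta> / 2"
 shows "\<omega> \<in> hit i (num \<omega> t) \<theta> (\<lambda>S. class_limit.lower R (par (ty i)) \<eta> \<theta> (positions n S))
   \<Longrightarrow> \<not> ruined par n ty p i t \<omega> \<and> card (agent_losses par n ty p i t \<omega>) = \<theta>"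
  and "\<not> ruined par n ty p i t \<omega> \<and> card (agent_losses par n ty p i t \<omega>) = \<theta>
   \<Longrightarrow> \<omega> \<in> hit i (num \<omega> t) \<theta> (\<lambda>S. class_limit.upper R (par (ty i)) \<eta> \<theta> (positions n S))"
proof -
 define a where "a = par (ty i)"
 interpret C: class_limit R a unfolding a_def by (rule cl)
 have w: "\<omega> \<in> space M" using g unfolding good_def by simp
 define S where "S = arrivals i (num \<omega> t) \<omega>"
 define y where "y = agent_vec i S \<omega>"
 have SK: "S \<subseteq> {1..num \<omega> t}" unfolding S_def arrivals_def by auto
 have fS: "finite S" by (rule finite_subset[OF SK]) simp
 have al: "agent_losses par n ty p i t \<omega> = S" unfolding S_def by (rule agent_losses_eq[OF g])
 have cap: "capital par n ty p i s \<omega> = premium a s - C.debt y (card {k \<in> S. k \<le> num \<omega> s})"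
  if s: "0 \<le> s" "s \<le> t" for s
 proof -
  define j where "j = card {k \<in> S. k \<le> num \<omega> s}"
  note ini = nth_pos_initial[OF fS, of "num \<omega> s", folded j_def]
  have "arrivals i (num \<omega> s) \<omega> = {k \<in> S. k \<le> num \<omega> s}"
   unfolding S_def arrivals_def using num_mono[OF g s] by auto
  then have als: "agent_losses par n ty p i s \<omega> = nth_pos S ` {1..j}"
   using agent_losses_eq[OF g, of i s] ini(1) by simp
  have "inj_on (nth_pos S) {1..j}"
   using ini(2) by (intro inj_on_subset[OF bij_betw_imp_inj_on[OF bij_nth_pos[OF fS]]]) auto
  then have "(\<Sum>k\<in>nth_pos S ` {1..j}. loss p k \<omega>) = (\<Sum>l = 1..j. loss p (nth_pos S l) \<omega>)"
   by (simp add: sum.reindex)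
  also have "\<dots> = (\<Sum>l = 1..j. y l)"
   by (rule sum.cong[OF refl]) (use ini(2) in \<open>auto simp: y_def agent_vec_def\<close>)
  finally have s1: "(\<Sum>k\<in>agent_losses par n ty p i s \<omega>. loss p k \<omega>) = (\<Sum>l = 1..j. y l)" unfolding als .
  have y0: "y 0 = shock p i \<omega>" by (simp add: y_def agent_vec_def)
  show ?thesis unfolding capital_def s1 C.debt_def y0 a_def[symmetric] j_def[symmetric] by simp
 qed
 show "\<not> ruined par n ty p i t \<omega> \<and> card (agent_losses par n ty p i t \<omega>) = \<theta>"
  if h: "\<omega> \<in> hit i (num \<omega> t) \<theta> (\<lambda>S. class_limit.lower R (par (ty i)) \<eta> \<theta> (positions n S))"
 proof -
  have c: "card S = \<theta>" and d0: "C.debt y 0 < premium a 0"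
   and dj: "\<And>j. j \<in> {1..\<theta>} \<Longrightarrow> C.met_surely \<eta> (real (nth_pos S j) / real n) (C.debt y j)"
  proof -
   have "card S = \<theta> \<and> y \<in> C.lower \<eta> \<theta> (positions n S)"
    using h unfolding hit_def a_def[symmetric] mem_Collect_eq S_def[symmetric] y_def[symmetric]
    by (elim conjE) (intro conjI)
   then have all: "card S = \<theta> \<and> C.debt y 0 < premium a 0 \<and>
     (\<forall>j\<in>{1..\<theta>}. C.met_surely \<eta> (real (nth_pos S j) / real n) (C.debt y j))"
    unfolding C.lower_def mem_Collect_eq by (elim conjE) (intro conjI)
   show "card S = \<theta>" by (rule conjunct1[OF all])
   show "C.debt y 0 < premium a 0" by (rule conjunct1[OF conjunct2[OF all]])
   show "C.met_surely \<eta> (real (nth_pos S j) / real n) (C.debt y j)" if "j \<in> {1..\<theta>}" for j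
    using bspec[OF conjunct2[OF conjunct2[OF all]] that] .
  qed
  have "0 < capital par n ty p i s \<omega>" if s: "s \<in> {0..t}" for s
  proof -
   define j where "j = card {k \<in> S. k \<le> num \<omega> s}"
   note ini = nth_pos_initial[OF fS, of "num \<omega> s", folded j_def]
   have "C.debt y j < premium a s"
   proof (cases "j = 0")
    case True
    then show ?thesis using d0 C.alpha_mono[of 0 s] s by simp
   next
    case False
    then have j: "1 \<le> j" by simp
    define k where "k = nth_pos S j"
    have k: "k \<in> S" "k \<le> num \<omega> s" using ini(3)[OF j] unfolding k_def by auto
    then have k1: "1 \<le> k" using SK by auto
    obtain r where r: "0 \<le> r" "r \<le> s" "num \<omega> r = k"
     using reveal_instant[OF g _ k1 k(2)] s by auto
    have "ereal r \<le> \<tau>" using r s t by (meson atLeastAtMost_iff ereal_less_eq(3) order_trans)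
    then have "\<bar>real (num \<omega> r) / real n - C.Lam r\<bar> \<le> \<eta> / 2" by (rule close[OF r(1)])
    then have "real k / real n - \<eta> < C.Lam r" unfolding r(3) using \<eta> by linarith
    moreover have "C.met_surely \<eta> (real k / real n) (C.debt y j)"
     unfolding k_def by (rule dj) (use j ini(2) c in simp)
    ultimately have "C.debt y j < premium a r" using C.met_surelyD r(1) by blast
    then show ?thesis using C.alpha_mono[OF r(1,2)] by simp
   qed
   then show ?thesis using cap[of s] s unfolding j_def by simp
  qed
  then have "\<not> ruined par n ty p i t \<omega>" unfolding ruined_def by (simp add: not_le)
  then show ?thesis using al c by simp
 qed
 show "\<omega> \<in> hit i (num \<omega> t) \<theta> (\<lambda>S. class_limit.upper R (par (ty i)) \<eta> \<theta> (positions n S))"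
  if h: "\<not> ruined par n ty p i t \<omega> \<and> card (agent_losses par n ty p i t \<omega>) = \<theta>"
 proof -
  have c: "card S = \<theta>" using h al by simp
  have pos: "0 < capital par n ty p i s \<omega>" if "0 \<le> s" "s \<le> t" for s
   using h that unfolding ruined_def by (auto simp: not_le)
  have sp: "y \<in> space (agent_law a \<theta>)"
   using measurable_space[OF agent_vec_M[OF i SK revealed_eq(2)[OF g]] w] c unfolding y_def a_def by simp
  have d0: "C.debt y 0 \<le> premium a 0"
  proof -
   have "num \<omega> 0 = 0" using num_at_T(1)[OF g, of 0 0] by (simp add: zero_ereal_def)
   then have "{k \<in> S. k \<le> num \<omega> 0} = {}" using SK by auto
   then have "capital par n ty p i 0 \<omega> = premium a 0 - C.debt y 0"
    using cap[OF order_refl t(1)] by (simp only: card.empty)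
   then show ?thesis using pos[OF order_refl t(1)] by linarith
  qed
  have dj: "C.met_early \<eta> (real (nth_pos S j) / real n) (C.debt y j)" if j: "j \<in> {1..\<theta>}" for j
  proof -
   define k where "k = nth_pos S j"
   have jS: "j \<in> {1..card S}" using j c by simp
   have kS: "k \<in> S" unfolding k_def by (rule nth_pos_in[OF fS jS])
   then have k1: "1 \<le> k" "k \<le> num \<omega> t" using SK by auto
   obtain r where r: "0 \<le> r" "r \<le> t" "num \<omega> r = k"
    using reveal_instant[OF g t(1) k1] by auto
   have "{l \<in> S. l \<le> k} = nth_pos S ` {1..j}"
   proof (intro set_eqI iffI)
    fix l assume l: "l \<in> {l \<in> S. l \<le> k}"
    then obtain l' where l': "l' \<in> {1..card S}" "l = nth_pos S l'"
     using nth_posE[OF fS, of l] by blast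
    then have "l' \<le> j" using l nth_pos_le_iff[OF fS l'(1) jS] unfolding k_def by simp
    then show "l \<in> nth_pos S ` {1..j}" using l' by auto
   next
    fix l assume "l \<in> nth_pos S ` {1..j}"
    then obtain l' where l': "l' \<in> {1..j}" "l = nth_pos S l'" by blast
    then have l'S: "l' \<in> {1..card S}" using jS by auto
    then show "l \<in> {l \<in> S. l \<le> k}"
     using nth_pos_in[OF fS l'S] nth_pos_le_iff[OF fS l'S jS] l' unfolding k_def by simp
   qed
   moreover have "inj_on (nth_pos S) {1..j}"
    using jS by (intro inj_on_subset[OF bij_betw_imp_inj_on[OF bij_nth_pos[OF fS]]]) auto
   ultimately have "card {l \<in> S. l \<le> k} = j" by (simp add: card_image)
   then have "C.debt y j \<le> premium a r" using cap[of r] pos[of r] r by simp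
   moreover have "ereal r \<le> \<tau>" using r t by (meson ereal_less_eq(3) order_trans)
   then have "\<bar>real (num \<omega> r) / real n - C.Lam r\<bar> \<le> \<eta> / 2" by (rule close[OF r(1)])
   then have "C.Lam r < real k / real n + \<eta>" unfolding r(3) using \<eta> by linarith
   ultimately show ?thesis unfolding k_def[symmetric] by (intro C.met_earlyI[OF r(1)]) auto
  qed
  have "y \<in> C.upper \<eta> \<theta> (positions n S)"
   unfolding C.upper_def using sp d0 dj by simp
  then show ?thesis
   unfolding hit_def a_def[symmetric] mem_Collect_eq S_def[symmetric] y_def[symmetric]
   using w c by (intro conjI)
 qed
qed

lemma solvent_count_sandwich:
 assumes cl: "class_limit R (par x)" and g: "good \<omega>" and n: "1 \<le> n" and \<eta>: "0 < \<eta>"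
  and t: "0 \<le> t" "ereal t \<le> \<tau>"
  and close: "\<And>s. 0 \<le> s \<Longrightarrow> ereal s \<le> \<tau> \<Longrightarrow> \<bar>real (num \<omega> s) / real n - intensity_limit.Lam R s\<bar> \<le> \<eta> / 2"
 shows "hit_count x (num \<omega> t) \<theta> (\<lambda>S. class_limit.lower R (par x) \<eta> \<theta> (positions n S)) \<omega>
   \<le> num_solvent_type par n ty p x \<theta> t \<omega>"
  and "num_solvent_type par n ty p x \<theta> t \<omega>
   \<le> hit_count x (num \<omega> t) \<theta> (\<lambda>S. class_limit.upper R (par x) \<eta> \<theta> (positions n S)) \<omega>"
 unfolding hit_count_def num_solvent_type_def
 by (intro card_mono subsetI; use solvency_sandwich[OF _ g _ n \<eta> t close] cl in auto)+

text \<open>Every reveal before the end of the process uses up a half-edge of a ruined agent.\<close>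

lemma num_ruinous_eq:
 assumes g: "good \<omega>" and t: "0 \<le> t" "ereal t \<le> stop_time par n ty p \<omega>"
 shows "real (num_ruinous par n ty p t \<omega>)
  = (\<Sum>i | i \<in> {1..n} \<and> ruined par n ty p i t \<omega>. real (d_out (par (ty i)))) - real (num \<omega> t)"
proof -
 define Q where "Q = {i \<in> {1..n}. ruined par n ty p i t \<omega>}"
 define E where "E = {e \<in> out_edges par n ty. ruined par n ty p (fst e) t \<omega>}"
 define N where "N = num \<omega> t"
 define O' where "O' = (\<lambda>k. out_edge p k \<omega>) ` {1..N}"
 have rev: "revealed par n ty p t \<omega> = {1..N}" unfolding N_def by (rule revealed_eq(1)[OF g])
 have num_m: "N \<le> m" unfolding N_def by (rule revealed_eq(2)[OF g])
 have ruinous: "ruinous par n ty p t \<omega> = E - O'"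
  unfolding ruinous_def E_def O'_def rev by blast
 have inj: "inj_on (\<lambda>k. out_edge p k \<omega>) {1..m}" using g unfolding good_def by simp
 have fE: "finite E" unfolding E_def out_edges_def by simp
 have "O' \<subseteq> E"
 proof
  fix e assume "e \<in> O'"
  then obtain k where k: "1 \<le> k" "k \<le> N" "e = out_edge p k \<omega>" unfolding O'_def by auto
  obtain l where l: "k = Suc l" using k by (cases k) auto
  have lm: "l < m" using k l num_m by simp
  obtain r' where r': "T k \<omega> = ereal r'" "r' \<le> t" using reveal_instant[OF g t(1) k(1) k(2)[unfolded N_def]] by blast
  have "T l \<omega> \<le> T k \<omega>" using T_mono[OF g, of l k] l lm by simp
  moreover have "0 \<le> T l \<omega>" using T_nonneg[OF g] lm by simp
  ultimately obtain r where r: "T l \<omega> = ereal r" "0 \<le> r" using r' by (cases "T l \<omega>") auto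
  have "T l \<omega> < T k \<omega>" using T_less[OF g lm] r l by simp
  then have rt: "r < t" using r r' by simp
  have "num_ruinous par n ty p r \<omega> \<noteq> 0"
  proof
   assume "num_ruinous par n ty p r \<omega> = 0"
   then have "stop_time par n ty p \<omega> \<le> ereal r" unfolding stop_time_def using r(2) by (intro Inf_lower imageI) simp
   then have "ereal t \<le> ereal r" using t(2) by (rule order_trans[rotated])
   then show False using rt by simp
  qed
  then have "out_edge p (Suc l) \<omega> \<in> ruinous par n ty p (real_of_ereal (T l \<omega>)) \<omega>"
  proof -
   have "\<forall>k<m. T k \<omega> < \<infinity> \<longrightarrow> num_ruinous par n ty p (real_of_ereal (T k \<omega>)) \<omega> \<noteq> 0 \<longrightarrow>
    out_edge p (Suc k) \<omega> \<in> ruinous par n ty p (real_of_ereal (T k \<omega>)) \<omega>"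
    using g unfolding good_def by (elim conjE)
   from this[rule_format, OF lm] show ?thesis using \<open>num_ruinous par n ty p r \<omega> \<noteq> 0\<close> r(1) by simp
  qed
  then have "e \<in> ruinous par n ty p r \<omega>" using k l r by simp
  then have "e \<in> out_edges par n ty" "ruined par n ty p (fst e) r \<omega>" unfolding ruinous_def by simp_all
  then show "e \<in> E" unfolding E_def using ruined_mono[of "fst e" r \<omega> t] rt by simp
 qed
 then have "card (E - O') = card E - card O'" by (intro card_Diff_subset finite_subset[OF _ fE])
 moreover have "card O' \<le> card E" by (rule card_mono[OF fE \<open>O' \<subseteq> E\<close>])
 moreover have "card O' = N"
  unfolding O'_def using num_m by (subst card_image) (auto intro: inj_on_subset[OF inj])
 moreover have "card E = (\<Sum>i\<in>Q. d_out (par (ty i)))"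
 proof -
  have "E = (SIGMA i:Q. {1..d_out (par (ty i))})" unfolding E_def Q_def out_edges_def by auto
  then show ?thesis by (simp add: Q_def)
 qed
 ultimately show ?thesis unfolding num_ruinous_def ruinous N_def[symmetric] Q_def[symmetric] by (simp add: of_nat_diff)
qed

lemma card_losses_le:
 assumes g: "good \<omega>" and i: "i \<in> {1..n}"
 shows "card (agent_losses par n ty p i t \<omega>) \<le> indeg i"
proof -
 have inj: "inj_on (\<lambda>k. in_edge p k \<omega>) {1..m}" and H: "(\<lambda>k. in_edge p k \<omega>) ` {1..m} \<subseteq> H"
  using g unfolding good_def proper_edges_def by auto
 have sub: "arrivals i (num \<omega> t) \<omega> \<subseteq> {1..m}" unfolding arrivals_def using revealed_eq(2)[OF g, of t] by auto
 have "card (arrivals i (num \<omega> t) \<omega>) = card ((\<lambda>k. in_edge p k \<omega>) ` arrivals i (num \<omega> t) \<omega>)"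
  by (rule card_image[symmetric]) (rule inj_on_subset[OF inj sub])
 also have "\<dots> \<le> card {h \<in> H. fst h = i}"
 proof (rule card_mono)
  show "(\<lambda>k. in_edge p k \<omega>) ` arrivals i (num \<omega> t) \<omega> \<subseteq> {h \<in> H. fst h = i}"
   using H sub unfolding arrivals_def by blast
 qed (simp add: finite_H)
 also have "\<dots> = indeg i" by (rule card_edges_of[OF i])
 finally show ?thesis unfolding agent_losses_eq[OF g] .
qed

lemma intensity_measurable:
 "(\<lambda>s. intensity par n ty p s \<omega>) \<in> borel_measurable borel"
proof -
 define N where "N s = real (num \<omega> s)" for s
 have N: "N s = (\<Sum>k\<in>{1..m}. indicator {s. T k \<omega> \<le> ereal s} s)" for s
  unfolding N_def revealed_def by (simp add: indicator_def sum.If_cases Int_def)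
 have [measurable]: "N \<in> borel_measurable borel"
  unfolding N[abs_def]
 proof (rule borel_measurable_sum)
  fix k
  have "{s \<in> space borel. T k \<omega> \<le> ereal s} \<in> sets borel" by measurable
  then show "(\<lambda>s. indicator {s. T k \<omega> \<le> ereal s} s :: real) \<in> borel_measurable borel" by simp
 qed
 have le: "num \<omega> s \<le> m" for s
 proof -
  have "revealed par n ty p s \<omega> \<subseteq> {1..m}" unfolding revealed_def by (rule Collect_restrict)
  then have "num \<omega> s \<le> card {1..m}" by (rule card_mono[OF finite_atLeastAtMost])
  then show ?thesis by (simp only: card_atLeastAtMost diff_Suc_1)
 qed
 have "intensity par n ty p s \<omega> = (\<Sum>k\<le>m. rate p k \<omega> * indicator {s. N s = real k} s)" for s
 proof -
  have "(\<Sum>k\<le>m. rate p k \<omega> * indicator {s. N s = real k} s) = (\<Sum>k\<le>m. if k = num \<omega> s then rate p k \<omega> else 0)"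
   by (rule sum.cong) (auto simp: N_def indicator_def)
  also have "\<dots> = rate p (num \<omega> s) \<omega>" using le[of s] by simp
  finally show ?thesis by (simp add: intensity_def)
 qed
 moreover have "(\<lambda>s. \<Sum>k\<le>m. rate p k \<omega> * indicator {s. N s = real k} s) \<in> borel_measurable borel"
  by measurable
 ultimately show ?thesis by simp
qed

end

text \<open>
  The integrated intensity is within \<open>b + 1\<close> of \<open>num\<close> by the martingale bound and within \<open>c n\<close>
  of \<open>n Lam\<close> by the assumption on the intensity.
\<close>

lemma (in balanced_network) num_close:
 assumes R: "intensity_limit R" and n: "1 \<le> n" and g: "good \<omega>"
  and dev: "\<And>k. k \<le> m \<Longrightarrow> \<bar>deviation k \<omega>\<bar> \<le> b" and c: "0 \<le> c"
  and err: "(\<integral>\<^sup>+t\<in>{t. 0 \<le> t \<and> ereal t \<le> \<tau>}. ennreal \<bar>intensity par n ty p t \<omega> / real n - R t\<bar> \<partial>lborel) \<le> ennreal c"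
  and t: "0 \<le> t" "ereal t \<le> \<tau>"
 shows "\<bar>real (num \<omega> t) / real n - intensity_limit.Lam R t\<bar> \<le> c + (b + 1) / real n"
proof -
 interpret L: intensity_limit R by (rule R)
 define i where "i s = intensity par n ty p s \<omega> / real n" for s
 define r where "r s = indicator {0..} s * R s" for s
 define A where "A = {s. 0 \<le> s \<and> ereal s \<le> \<tau>}"
 note intensity_measurable [measurable]
 have im [measurable]: "i \<in> borel_measurable borel" unfolding i_def using intensity_measurable[of \<omega>] by simp
 have rm [measurable]: "r \<in> borel_measurable borel"
  unfolding r_def using L.int_R unfolding set_integrable_def by simp
 have [measurable]: "A \<in> sets borel"
 proof -
  have "{s \<in> space borel. 0 \<le> s \<and> ereal s \<le> \<tau>} \<in> sets borel" by measurable
  then show ?thesis unfolding A_def by simp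
 qed
 have w: "\<omega> \<in> space M" using g unfolding good_def by simp
 have i0: "0 \<le> i s" for s
  unfolding i_def intensity_def using rate_nonneg[OF revealed_eq(2)[OF g] w] by simp
 have r0: "0 \<le> r s" for s unfolding r_def using L.pos_R[of s] by (auto simp: indicator_def less_imp_le)
 have tA: "{0..<t} \<subseteq> A"
 proof
  fix s assume "s \<in> {0..<t}"
  then have s: "0 \<le> s" "ereal s \<le> ereal t" by auto
  then show "s \<in> A" unfolding A_def using order_trans[OF s(2) t(2)] by simp
 qed
 obtain I where I: "0 \<le> I" "(\<integral>\<^sup>+s. ennreal (intensity par n ty p s \<omega>) * indicator {0..<t} s \<partial>lborel) = ennreal I"
  "\<bar>I - real (num \<omega> t)\<bar> \<le> b + 1"
  using integrated_intensity[OF g t(1) dev] by blast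
 have int_i: "(\<integral>\<^sup>+s. ennreal (i s) * indicator {0..<t} s \<partial>lborel) = ennreal (I / real n)"
 proof -
  have "(\<integral>\<^sup>+s. ennreal (i s) * indicator {0..<t} s \<partial>lborel)
   = (\<integral>\<^sup>+s. ennreal (1 / real n) * (ennreal (intensity par n ty p s \<omega>) * indicator {0..<t} s) \<partial>lborel)"
  proof (rule nn_integral_cong)
   fix s
   have "ennreal (i s) = ennreal (1 / real n) * ennreal (intensity par n ty p s \<omega>)"
    unfolding i_def by (subst ennreal_mult'[symmetric]) auto
   then show "ennreal (i s) * indicator {0..<t} s = ennreal (1 / real n) * (ennreal (intensity par n ty p s \<omega>) * indicator {0..<t} s)"
    by (simp add: mult.assoc)
  qed
  also have "\<dots> = ennreal (1 / real n) * ennreal I"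
   unfolding I(2)[symmetric] by (intro nn_integral_cmult) measurable
  also have "\<dots> = ennreal (I / real n)" using I(1) by (subst ennreal_mult[symmetric]) auto
  finally show ?thesis .
 qed
 have int_r: "(\<integral>\<^sup>+s. ennreal (r s) * indicator {0..<t} s \<partial>lborel) = ennreal (L.Lam t)"
 proof -
  have "(\<integral>\<^sup>+s. ennreal (r s) * indicator {0..<t} s \<partial>lborel) = (\<integral>\<^sup>+s. ennreal (indicator {0..t} s *\<^sub>R R s) \<partial>lborel)"
   by (rule nn_integral_cong_AE, rule eventually_mono[OF AE_lborel_singleton[of t]])
    (auto simp: r_def indicator_def)
  also have "\<dots> = ennreal (LBINT s. indicator {0..t} s *\<^sub>R R s)"
  proof (rule nn_integral_eq_integral)
   show "integrable lborel (\<lambda>s. indicator {0..t} s *\<^sub>R R s)"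
    using L.int_R_Icc[of 0 t] unfolding set_integrable_def by simp
   show "AE s in lborel. 0 \<le> indicator {0..t} s *\<^sub>R R s"
    using L.pos_R by (intro AE_I2) (auto simp: indicator_def less_imp_le)
  qed
  finally show ?thesis unfolding L.Lam_def set_lebesgue_integral_def .
 qed
 have int_e: "(\<integral>\<^sup>+s. ennreal \<bar>i s - r s\<bar> * indicator A s \<partial>lborel) \<le> ennreal c"
 proof -
  have "(\<integral>\<^sup>+s. ennreal \<bar>i s - r s\<bar> * indicator A s \<partial>lborel)
   = (\<integral>\<^sup>+t\<in>{t. 0 \<le> t \<and> ereal t \<le> \<tau>}. ennreal \<bar>intensity par n ty p t \<omega> / real n - R t\<bar> \<partial>lborel)"
   by (rule nn_integral_cong) (auto simp: A_def i_def r_def indicator_def)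
  then show ?thesis using err by simp
 qed
 have tri: "ennreal u * indicator {0..<t} s \<le> ennreal v * indicator {0..<t} s + ennreal \<bar>u - v\<bar> * indicator A s"
  if "0 \<le> v" for u v s
 proof -
  have "ennreal u \<le> ennreal (v + \<bar>u - v\<bar>)" by (rule ennreal_leI) arith
  then have "ennreal u \<le> ennreal v + ennreal \<bar>u - v\<bar>" using that by simp
  then show ?thesis using tA by (auto simp: indicator_def)
 qed
 have comb: "x \<le> y + c"
  if "ennreal x \<le> ennreal y + (\<integral>\<^sup>+s. ennreal \<bar>i s - r s\<bar> * indicator A s \<partial>lborel)" "0 \<le> y" for x y
 proof -
  have "ennreal x \<le> ennreal y + ennreal c" using that(1) int_e by (meson add_left_mono order_trans)
  then have "ennreal x \<le> ennreal (y + c)" using that(2) c by simp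
  then show ?thesis using that(2) c by (subst (asm) ennreal_le_iff) auto
 qed
 have "I / real n \<le> L.Lam t + c"
 proof (rule comb)
  have "ennreal (I / real n) \<le> (\<integral>\<^sup>+s. ennreal (r s) * indicator {0..<t} s + ennreal \<bar>i s - r s\<bar> * indicator A s \<partial>lborel)"
   unfolding int_i[symmetric] by (intro nn_integral_mono tri r0)
  also have "\<dots> = ennreal (L.Lam t) + (\<integral>\<^sup>+s. ennreal \<bar>i s - r s\<bar> * indicator A s \<partial>lborel)"
   unfolding int_r[symmetric] by (rule nn_integral_add) measurable
  finally show "ennreal (I / real n) \<le> ennreal (L.Lam t) + (\<integral>\<^sup>+s. ennreal \<bar>i s - r s\<bar> * indicator A s \<partial>lborel)" .
 qed (rule L.Lam_nonneg)
 moreover have "L.Lam t \<le> I / real n + c"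
 proof (rule comb)
  have "ennreal (L.Lam t) \<le> (\<integral>\<^sup>+s. ennreal (i s) * indicator {0..<t} s + ennreal \<bar>r s - i s\<bar> * indicator A s \<partial>lborel)"
   unfolding int_r[symmetric] by (intro nn_integral_mono tri i0)
  also have "\<dots> = (\<integral>\<^sup>+s. ennreal (i s) * indicator {0..<t} s + ennreal \<bar>i s - r s\<bar> * indicator A s \<partial>lborel)"
   by (simp only: abs_minus_commute)
  also have "\<dots> = ennreal (I / real n) + (\<integral>\<^sup>+s. ennreal \<bar>i s - r s\<bar> * indicator A s \<partial>lborel)"
   unfolding int_i[symmetric] by (rule nn_integral_add) measurable
  finally show "ennreal (L.Lam t) \<le> ennreal (I / real n) + (\<integral>\<^sup>+s. ennreal \<bar>i s - r s\<bar> * indicator A s \<partial>lborel)" .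
 qed (use I in simp)
 moreover have "\<bar>real (num \<omega> t) / real n - I / real n\<bar> \<le> (b + 1) / real n"
  using I(3) n unfolding diff_divide_distrib[symmetric] abs_divide by (simp add: divide_right_mono abs_minus_commute)
 ultimately show ?thesis by linarith
qed

section \<open>Convergence along a sequence of networks\<close>

lemma whp_eventually:
 assumes "whp M P" "eventually E sequentially"
  and "\<And>n \<omega>. E n \<Longrightarrow> P n \<omega> \<Longrightarrow> Q n \<omega>"
 shows "whp M Q"
 by (rule whp_mono[OF assms(1)], rule eventually_mono[OF assms(2)]) (use assms(3) in blast)

text \<open>
  At \<open>t = 0\<close> the conditional law of the arrivals degenerates, but there the binomial weight of
  every \<open>\<theta> \<ge> 1\<close> is 0.
\<close>

lemma (in class_limit) limit_fraction_bounds: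
 assumes lam: "0 < lam" and t: "0 \<le> t" and \<theta>: "\<theta> \<le> d_in a"
 shows "0 \<le> limit_fraction lam \<theta> t" and "limit_fraction lam \<theta> t \<le> binom_prob (d_in a) (phi R lam t) \<theta>"
proof -
 define s where "s = survival_prob R a \<theta> t"
 define c where "c = (Lam t / rho) ^ \<theta>"
 define b where "b = binom_prob (d_in a) (phi R lam t) \<theta>"
 interpret A: prob_space "agent_law a \<theta>" by (rule prob_space_agent_law[OF valid_a])
 interpret TP: prob_space "ticks \<theta>" by (rule prob_space_times)
 have phi: "0 \<le> phi R lam t" "phi R lam t \<le> 1"
  unfolding phi_eq[OF lam t] using lam Lam_nonneg[of t] by (simp_all add: min_def)
 have b0: "0 \<le> b" unfolding b_def binom_prob_def using phi by simp
 have c0: "0 \<le> c" unfolding c_def using Lam_nonneg[of t] rho_pos by simp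
 have st: "s * c = truth \<theta> t" unfolding s_def c_def truth_def by (rule survival_prob_eq[OF t \<theta>])
 have "true_joint \<theta> t \<subseteq> space (agent_law a \<theta>) \<times> by_time \<theta> t"
  unfolding true_joint_def space_pair_measure by (auto simp: mem_Times_iff)
 then have "emeasure (joint \<theta>) (true_joint \<theta> t) \<le> emeasure (joint \<theta>) (space (agent_law a \<theta>) \<times> by_time \<theta> t)"
  by (rule emeasure_mono) (rule pair_measureI[OF sets.top by_time_sets])
 also have "\<dots> = ennreal c"
  unfolding TP.emeasure_pair_measure_Times[OF sets.top by_time_sets] A.emeasure_space_1 c_def emeasure_by_time[OF t] by simp
 finally have tc: "truth \<theta> t \<le> c" unfolding truth_def using c0 by (simp add: measure_def enn2real_leI)
 have "0 \<le> b * s \<and> b * s \<le> b"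
 proof (cases "c = 0")
  case True
  then have "Lam t = 0" "\<theta> \<noteq> 0" unfolding c_def using rho_pos by (auto simp: power_0_left)
  then have "b = 0" unfolding b_def binom_prob_def phi_eq[OF lam t] using lam by simp
  then show ?thesis by simp
 next
  case False
  then have c: "0 < c" using c0 by simp
  have "0 * c \<le> s * c" "s * c \<le> 1 * c" using truth_bounds(1)[of \<theta> t] tc st by simp_all
  then have "0 \<le> s" "s \<le> 1" using c by (simp_all only: mult_le_cancel_right_pos)
  then show ?thesis using b0 by (simp add: mult_left_le)
 qed
 then show "0 \<le> limit_fraction lam \<theta> t" and "limit_fraction lam \<theta> t \<le> binom_prob (d_in a) (phi R lam t) \<theta>"
  unfolding limit_fraction_def s_def b_def by simp_all
qed

lemma sum_binom_prob: "(\<Sum>\<theta> = 0..d. binom_prob d z \<theta>) = 1"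
 using binomial_ring[of z "1 - z" d] unfolding binom_prob_def by (simp add: atLeast0AtMost)

lemma binom_prob_le_1:
 assumes "0 \<le> z" "z \<le> 1" "\<theta> \<le> d" shows "binom_prob d z \<theta> \<le> 1"
proof -
 have "binom_prob d z \<theta> \<le> (\<Sum>\<theta> = 0..d. binom_prob d z \<theta>)"
  by (rule member_le_sum) (use assms in \<open>auto simp: binom_prob_def\<close>)
 then show ?thesis unfolding sum_binom_prob .
qed

text \<open>
  A finite set of times whose images under \<open>Lam\<close> are \<open>\<zeta>\<close>-dense below \<open>lam\<close>. The times stay
  strictly below the exhaustion of all half-edges, where the falling factorials are controlled.
\<close>

lemma (in intensity_limit) time_grid:
 assumes lam: "0 < lam" and \<zeta>: "0 < \<zeta>"
 obtains G where "finite G" "\<And>s. s \<in> G \<Longrightarrow> 0 \<le> s \<and> Lam s < lam"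
  "\<And>t. 0 \<le> t \<Longrightarrow> Lam t \<le> lam + \<zeta> / 4 \<Longrightarrow> \<exists>s\<in>G. \<bar>Lam t - Lam s\<bar> \<le> \<zeta>"
proof -
 define c where "c = min lam rho"
 have c: "0 < c" unfolding c_def using lam rho_pos by simp
 define I where "I = {k :: nat. real k * (\<zeta> / 2) < c}"
 have "I \<subseteq> {..nat \<lceil>c / (\<zeta> / 2)\<rceil>}"
 proof
  fix k assume "k \<in> I"
  then have "real k < c / (\<zeta> / 2)" unfolding I_def using \<zeta> by (simp add: field_simps)
  then show "k \<in> {..nat \<lceil>c / (\<zeta> / 2)\<rceil>}" unfolding atMost_iff by linarith
 qed
 then have fI: "finite I" by (rule finite_subset) simp
 have "\<forall>k\<in>I. \<exists>s\<ge>0. Lam s = real k * (\<zeta> / 2)"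
 proof
  fix k assume "k \<in> I"
  then show "\<exists>s\<ge>0. Lam s = real k * (\<zeta> / 2)"
   unfolding I_def c_def using \<zeta> by (intro Lam_surj) auto
 qed
 then obtain g where g: "\<And>k. k \<in> I \<Longrightarrow> 0 \<le> g k \<and> Lam (g k) = real k * (\<zeta> / 2)" by metis
 show ?thesis
 proof (rule that[of "g ` I"])
  show "finite (g ` I)" using fI by (rule finite_imageI)
  fix s assume "s \<in> g ` I"
  then obtain k where k: "k \<in> I" "s = g k" by (auto elim: imageE)
  then show "0 \<le> s \<and> Lam s < lam" using g[OF k(1)] unfolding I_def c_def by simp
 next
  fix t :: real assume t: "0 \<le> t" "Lam t \<le> lam + \<zeta> / 4"
  define w where "w = (if Lam t < c then Lam t else max 0 (c - \<zeta> / 4))"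
  have w0: "0 \<le> w" "w < c" unfolding w_def using c \<zeta> Lam_nonneg[of t] by auto
  have "\<bar>Lam t - w\<bar> \<le> \<zeta> / 2"
   using t Lam_less_rho[of t] c \<zeta> unfolding w_def c_def min_def max_def by (auto split: if_splits)
  define k where "k = nat \<lfloor>w / (\<zeta> / 2)\<rfloor>"
  have wz: "0 \<le> w / (\<zeta> / 2)" using w0 \<zeta> by simp
  have kw: "real k \<le> w / (\<zeta> / 2)" "w / (\<zeta> / 2) < real k + 1" unfolding k_def using wz by linarith+
  have kb: "real k * (\<zeta> / 2) \<le> w" "w < real k * (\<zeta> / 2) + \<zeta> / 2"
   using kw \<zeta> by (simp_all add: field_simps)
  then have kI: "k \<in> I" unfolding I_def using w0 by simp
  have "\<bar>Lam t - Lam (g k)\<bar> \<le> \<zeta>" using g[OF kI] kb \<open>\<bar>Lam t - w\<bar> \<le> \<zeta> / 2\<close> by linarith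
  then show "\<exists>s\<in>g ` I. \<bar>Lam t - Lam s\<bar> \<le> \<zeta>" using kI by (intro bexI[of _ "g k"] imageI)
 qed
qed

text \<open>
  The hypotheses on the sequence of networks that carry the convergence. Those on \<open>R\<close> are in
  \<open>intensity_limit\<close>.
\<close>

locale convergent_networks = intensity_limit R for R :: "real \<Rightarrow> real" +
 fixes X :: "'x set" and par :: "'x \<Rightarrow> agent_class" and ty :: "nat \<Rightarrow> nat \<Rightarrow> 'x"
  and p :: "nat \<Rightarrow> 'w reveal_data" and \<mu> :: "'x \<Rightarrow> real" and lam :: real
 assumes valid_X: "\<And>x. x \<in> X \<Longrightarrow> valid_class (par x)"
  and ty_X: "\<And>n i. i \<in> {1..n} \<Longrightarrow> ty n i \<in> X"
  and process: "\<And>n. 1 \<le> n \<Longrightarrow> loss_reveal_process par n (ty n) (p n)"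
  and mu_nonneg: "\<And>x. x \<in> X \<Longrightarrow> 0 \<le> \<mu> x" and mu_sum: "(\<mu> has_sum 1) X"
  and fractions: "\<And>x. x \<in> X \<Longrightarrow> (\<lambda>n. type_fraction n (ty n) x) \<longlonglongrightarrow> \<mu> x"
  and half_edges: "\<And>n. 1 \<le> n \<Longrightarrow>
      (\<Sum>\<^sub>\<infinity>x\<in>X. real (d_in (par x)) * type_fraction n (ty n) x)
     = (\<Sum>\<^sub>\<infinity>x\<in>X. real (d_out (par x)) * type_fraction n (ty n) x)"
  and mean_degree: "(\<lambda>n. \<Sum>\<^sub>\<infinity>x\<in>X. real (d_in (par x)) * type_fraction n (ty n) x) \<longlonglongrightarrow> lam"
  and lam_pos: "0 < lam"
  and asymp: "intensity_asymp par ty p R"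
begin

abbreviation "laws n \<equiv> prb (p n)"
abbreviation "reveals n t \<omega> \<equiv> card (revealed par n (ty n) (p n) t \<omega>)"
abbreviation "edges n \<equiv> card (in_edges par n (ty n))"
abbreviation "stop n \<omega> \<equiv> stop_time par n (ty n) (p n) \<omega>"
abbreviation "before_stop n \<omega> P \<equiv> \<forall>t. 0 \<le> t \<longrightarrow> ereal t \<le> stop n \<omega> \<longrightarrow> P t"
abbreviation "solvents n t \<omega> \<equiv> {i \<in> {1..n}. \<not> ruined par n (ty n) (p n) i t \<omega>}"
abbreviation "typical n \<equiv> network.good par n (ty n) (p n)"
abbreviation "hits n x K \<theta> D \<omega> \<equiv> network.hit_count n (ty n) (p n) x K \<theta> D \<omega>"
abbreviation "fraction x \<theta> t \<equiv> binom_prob (d_in (par x)) (phi R lam t) \<theta> * survival_prob R (par x) \<theta> t"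
abbreviation "limit_sum c t \<equiv> \<Sum>\<^sub>\<infinity>x\<in>X. \<mu> x * c x * (\<Sum>\<theta> = 0..d_in (par x). fraction x \<theta> t)"

lemma class_limit_X: "x \<in> X \<Longrightarrow> class_limit R (par x)"
 unfolding class_limit_def class_limit_axioms_def using intensity_limit_axioms valid_X by simp

lemma fraction_eq: "x \<in> X \<Longrightarrow> fraction x \<theta> t = class_limit.limit_fraction R (par x) lam \<theta> t"
 using class_limit.limit_fraction_def[OF class_limit_X, of x lam \<theta> t] by simp

lemma phi_bounds: "0 \<le> t \<Longrightarrow> 0 \<le> phi R lam t" "0 \<le> t \<Longrightarrow> phi R lam t \<le> 1"
 unfolding phi_eq[OF lam_pos] using lam_pos Lam_nonneg[of t] by (simp_all add: phi_eq[OF lam_pos] min_def)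

lemma average_over_types:
 assumes n: "1 \<le> n" shows "(\<Sum>\<^sub>\<infinity>x\<in>X. c x * type_fraction n (ty n) x) = (\<Sum>i = 1..n. c (ty n i)) / real n"
proof (rule infsumI, rule has_sum_finite_neutralI)
 show "finite (ty n ` {1..n})" by simp
 show "ty n ` {1..n} \<subseteq> X" using ty_X by blast
 show "c x * type_fraction n (ty n) x = 0" if "x \<in> X - ty n ` {1..n}" for x
 proof -
  have "{i \<in> {1..n}. ty n i = x} = {}" using that by blast
  then show ?thesis unfolding type_fraction_def by simp
 qed
 have "(\<Sum>i = 1..n. c (ty n i)) = (\<Sum>x\<in>ty n ` {1..n}. \<Sum>i\<in>{i \<in> {1..n}. ty n i = x}. c (ty n i))"
  by (rule sum.image_gen) simp
 also have "\<dots> = (\<Sum>x\<in>ty n ` {1..n}. c x * real (card {i \<in> {1..n}. ty n i = x}))"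
  by (rule sum.cong[OF refl]) simp
 finally show "(\<Sum>i = 1..n. c (ty n i)) / real n = (\<Sum>x\<in>ty n ` {1..n}. c x * type_fraction n (ty n) x)"
  unfolding type_fraction_def by (simp add: sum_divide_distrib)
qed

lemma edges_eq: "real (edges n) = (\<Sum>i = 1..n. real (d_in (par (ty n i))))"
 unfolding in_edges_def by simp

lemma out_edges_eq: "real (card (out_edges par n (ty n))) = (\<Sum>i = 1..n. real (d_out (par (ty n i))))"
 unfolding out_edges_def by simp

lemma networkI: "1 \<le> n \<Longrightarrow> network par n (ty n) (p n)"
 by (rule network.intro[OF process valid_X[OF ty_X]])

lemma balancedI:
 assumes n: "1 \<le> n" shows "balanced_network par n (ty n) (p n)"
proof (rule balanced_network.intro[OF networkI[OF n]], rule balanced_network_axioms.intro)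
 have "real (card (out_edges par n (ty n))) = real (edges n)"
  using half_edges[OF n] average_over_types[OF n, of "\<lambda>x. real (d_in (par x))"]
   average_over_types[OF n, of "\<lambda>x. real (d_out (par x))"] n unfolding edges_eq out_edges_eq by simp
 then show "card (out_edges par n (ty n)) = edges n" by simp
qed

lemma out_degree: "1 \<le> n \<Longrightarrow> (\<Sum>i = 1..n. real (d_out (par (ty n i)))) = real (edges n)"
 using balanced_network.balanced[OF balancedI] out_edges_eq[of n] by simp

lemma edge_density: "(\<lambda>n. real (edges n) / real n) \<longlonglongrightarrow> lam"
proof (rule Lim_transform_eventually[OF mean_degree])
 show "\<forall>\<^sub>F n in sequentially. (\<Sum>\<^sub>\<infinity>x\<in>X. real (d_in (par x)) * type_fraction n (ty n) x) = real (edges n) / real n"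
  using eventually_ge_at_top[of 1]
 proof eventually_elim
  case (elim n)
  show ?case using average_over_types[OF elim, of "\<lambda>x. real (d_in (par x))"] unfolding edges_eq by simp
 qed
qed

lemma laws_prob: "1 \<le> n \<Longrightarrow> prob_space (laws n)"
 by (rule network.prob_space_M[OF networkI])

lemma whp_typical: "whp laws typical"
 by (rule whp_AE) (rule network.AE_good[OF networkI])

lemma type_fraction_bounds: "0 \<le> type_fraction n f x" "type_fraction n f x \<le> 1"
proof -
 show "0 \<le> type_fraction n f x" unfolding type_fraction_def by simp
 have "card {i \<in> {1..n}. f i = x} \<le> card {1..n}" by (rule card_mono) auto
 then show "type_fraction n f x \<le> 1" unfolding type_fraction_def by (cases "n = 0") auto
qed

lemma mu_le_1: "x \<in> X \<Longrightarrow> \<mu> x \<le> 1"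
 by (rule LIMSEQ_le_const2[OF fractions]) (auto intro: type_fraction_bounds)

text \<open>
  The reveal count, compensated by the integrated intensity, fluctuates by \<open>o(n)\<close> up to the last
  reveal, so it follows the integrated intensity.
\<close>

lemma reveals_close:
 assumes \<eta>: "0 < \<eta>"
 shows "whp laws (\<lambda>n \<omega>. before_stop n \<omega> (\<lambda>t. \<bar>real (reveals n t \<omega>) / real n - Lam t\<bar> \<le> \<eta>))"
proof -
 \<comment> \<open>Three errors share \<open>\<eta>\<close>: \<open>\<eta> / 4\<close> for the intensity, \<open>\<eta> / 8\<close> at the grid points and about \<open>\<eta> / 8\<close> between them; the rest absorbs terms of order \<open>1 / n\<close>.\<close>
 define a where "a n = \<eta> * real n / 8" for n
 define q where "q n = nat \<lceil>a n\<rceil>" for n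
 define b where "b n = (8 / \<eta> * (real (edges n) / real n) + 2) * (real (edges n) / real n * (64 / \<eta>\<^sup>2) * (1 / real n))" for n
 have a0: "0 < a n" if "1 \<le> n" for n unfolding a_def using \<eta> that by simp
 have q1: "1 \<le> q n" "a n \<le> real (q n)" "real (q n) \<le> a n + 1" if "1 \<le> n" for n
  unfolding q_def using a0[OF that] by linarith+
 have dev: "whp laws (\<lambda>n \<omega>. \<forall>k\<le>edges n. \<bar>network.deviation (p n) k \<omega>\<bar> \<le> a n + real (q n))"
 proof (rule whp_prob[where b = b])
  fix n :: nat assume n: "1 \<le> n"
  show "prob_space (laws n)" by (rule laws_prob[OF n])
  show "{\<omega> \<in> space (laws n). \<not> (\<forall>k\<le>edges n. \<bar>network.deviation (p n) k \<omega>\<bar> \<le> a n + real (q n))} \<in> sets (laws n)"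
   by (rule network.max_deviation_tail(1)[OF networkI[OF n] q1(1)[OF n] a0[OF n]])
 next
  show "\<forall>\<^sub>F n in sequentially. measure (laws n) {\<omega> \<in> space (laws n). \<not> (\<forall>k\<le>edges n. \<bar>network.deviation (p n) k \<omega>\<bar> \<le> a n + real (q n))} \<le> b n"
   using eventually_ge_at_top[of 1]
  proof eventually_elim
   case (elim n)
   have "real (edges n div q n) \<le> real (edges n) / real (q n)" by (rule of_nat_div_le_of_nat)
   also have "\<dots> \<le> real (edges n) / a n" using q1[OF elim] a0[OF elim] by (intro divide_left_mono) auto
   also have "\<dots> = 8 / \<eta> * (real (edges n) / real n)" unfolding a_def using \<eta> by (simp add: field_simps)
   finally have f: "real (edges n div q n + 2) \<le> 8 / \<eta> * (real (edges n) / real n) + 2" by simp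
   have s: "real (edges n) / (a n)\<^sup>2 = real (edges n) / real n * (64 / \<eta>\<^sup>2) * (1 / real n)"
    unfolding a_def by (simp add: power2_eq_square)
   have "real (edges n div q n + 2) * (real (edges n) / (a n)\<^sup>2) \<le> b n"
    unfolding b_def s[symmetric] by (rule mult_right_mono[OF f]) simp
   then show ?case
    by (rule order_trans[OF network.max_deviation_tail(2)[OF networkI[OF elim] q1(1)[OF elim] a0[OF elim]]])
  qed
  have "b \<longlonglongrightarrow> (8 / \<eta> * lam + 2) * (lam * (64 / \<eta>\<^sup>2) * 0)"
   unfolding b_def by (intro tendsto_mult tendsto_add tendsto_const edge_density lim_const_over_n)
  then show "b \<longlonglongrightarrow> 0" by simp
 qed
 have "0 < \<eta> / 4" using \<eta> by simp
 then have err: "whp laws (\<lambda>n \<omega>. (\<integral>\<^sup>+t\<in>{t. 0 \<le> t \<and> ereal t \<le> stop n \<omega>}.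
   ennreal \<bar>intensity par n (ty n) (p n) t \<omega> / real n - R t\<bar> \<partial>lborel) \<le> ennreal (\<eta> / 4))"
  using asymp unfolding intensity_asymp_def tends_to_zero_in_prob_iff_whp by blast
 show ?thesis
 proof (rule whp_eventually[OF whp_conj[OF whp_typical whp_conj[OF dev err]] eventually_ge_at_top[of "nat \<lceil>4 / \<eta>\<rceil> + 1"]], elim conjE, intro allI impI)
  fix n \<omega> t
  assume elim: "nat \<lceil>4 / \<eta>\<rceil> + 1 \<le> n" and g: "typical n \<omega>"
   and h: "\<forall>k\<le>edges n. \<bar>network.deviation (p n) k \<omega>\<bar> \<le> a n + real (q n)"
   and er: "(\<integral>\<^sup>+t\<in>{t. 0 \<le> t \<and> ereal t \<le> stop n \<omega>}.
    ennreal \<bar>intensity par n (ty n) (p n) t \<omega> / real n - R t\<bar> \<partial>lborel) \<le> ennreal (\<eta> / 4)"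
   and t: "0 \<le> t" "ereal t \<le> stop n \<omega>"
  have n: "1 \<le> n" using elim by simp
  have "4 / \<eta> \<le> real n" using elim by linarith
  then have n4: "4 \<le> \<eta> * real n" using \<eta> by (simp add: field_simps)
  have "\<bar>real (reveals n t \<omega>) / real n - Lam t\<bar> \<le> \<eta> / 4 + (a n + real (q n) + 1) / real n"
  proof (rule balanced_network.num_close[OF balancedI[OF n] intensity_limit_axioms n _ _ _ _ t])
   show "typical n \<omega>" by (rule g)
   show "\<bar>network.deviation (p n) k \<omega>\<bar> \<le> a n + real (q n)" if "k \<le> edges n" for k
    using h that by simp
   show "(\<integral>\<^sup>+t\<in>{t. 0 \<le> t \<and> ereal t \<le> stop n \<omega>}. ennreal \<bar>intensity par n (ty n) (p n) t \<omega> / real n - R t\<bar> \<partial>lborel) \<le> ennreal (\<eta> / 4)"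
    by (rule er)
  qed (use \<eta> in simp)
  also have "(a n + real (q n) + 1) / real n \<le> 3 * \<eta> / 4"
  proof -
   have "a n + real (q n) + 1 \<le> 3 * \<eta> / 4 * real n" using q1(3)[OF n] n4 unfolding a_def by linarith
   then show ?thesis using n by (simp add: pos_divide_le_eq)
  qed
  finally show "\<bar>real (reveals n t \<omega>) / real n - Lam t\<bar> \<le> \<eta>" by simp
 qed
qed

text \<open>
  The law of large numbers at the deterministic number of reveals expected by time \<open>s\<close>. Since
  \<open>Lam s < lam\<close>, eventually that many half-edges exist.
\<close>

lemma hits_concentrate:
 assumes x: "x \<in> X" and \<theta>: "\<theta> \<le> d_in (par x)" and s: "0 \<le> s" "Lam s < lam" and \<delta>: "0 < \<delta>"
  and D: "\<And>n S. D n S \<in> sets (agent_law (par x) \<theta>)"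
 defines "K \<equiv> class_limit.reveals_at R s"
 shows "whp laws (\<lambda>n \<omega>. \<bar>real (hits n x (K n) \<theta> (D n) \<omega>) / real n
  - type_fraction n (ty n) x * (weight1 (edges n) (d_in (par x)) (K n) \<theta>
    * (subset_sum (par x) \<theta> (K n) (D n)))\<bar> \<le> \<delta>)"
proof -
 interpret C: class_limit R "par x" by (rule class_limit_X[OF x])
 define G where "G n = (subset_sum (par x) \<theta> (K n) (D n))" for n
 define w1 where "w1 n = weight1 (edges n) (d_in (par x)) (K n) \<theta>" for n
 define w2 where "w2 n = weight2 (edges n) (d_in (par x)) (K n) \<theta>" for n
 define P where "P n \<omega> \<longleftrightarrow> \<bar>real (hits n x (K n) \<theta> (D n) \<omega>) / real n - type_fraction n (ty n) x * (w1 n * G n)\<bar> \<le> \<delta>" for n \<omega>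
 have Km: "\<forall>\<^sub>F n in sequentially. K n \<le> edges n"
  unfolding K_def by (rule C.reveals_at_le_m[OF edge_density lam_pos s \<theta>])
 have lln: "{\<omega> \<in> space (laws n). \<not> P n \<omega>} \<in> sets (laws n)"
  "measure (laws n) {\<omega> \<in> space (laws n). \<not> P n \<omega>} \<le> (1 / real n + \<bar>w2 n - (w1 n)\<^sup>2\<bar> * (G n)\<^sup>2) / \<delta>\<^sup>2"
  if "1 \<le> n" "K n \<le> edges n" for n
  unfolding P_def G_def w1_def w2_def
  by (rule network.hit_count_lln(1)[OF networkI[OF that(1)] that \<theta> D \<delta>],
    rule network.hit_count_lln(2)[OF networkI[OF that(1)] that \<theta> D \<delta>])
 have "whp laws (\<lambda>n \<omega>. K n \<le> edges n \<longrightarrow> P n \<omega>)"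
 proof (rule whp_prob[where b = "\<lambda>n. (1 / real n + \<bar>w2 n - (w1 n)\<^sup>2\<bar> * (G n)\<^sup>2) / \<delta>\<^sup>2"])
  fix n :: nat assume n: "1 \<le> n"
  show "prob_space (laws n)" by (rule laws_prob[OF n])
  show "{\<omega> \<in> space (laws n). \<not> (K n \<le> edges n \<longrightarrow> P n \<omega>)} \<in> sets (laws n)"
   by (cases "K n \<le> edges n") (simp_all add: lln(1)[OF n])
 next
  show "\<forall>\<^sub>F n in sequentially. measure (laws n) {\<omega> \<in> space (laws n). \<not> (K n \<le> edges n \<longrightarrow> P n \<omega>)}
    \<le> (1 / real n + \<bar>w2 n - (w1 n)\<^sup>2\<bar> * (G n)\<^sup>2) / \<delta>\<^sup>2"
   using Km eventually_ge_at_top[of 1]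
  proof eventually_elim
   case (elim n)
   then show ?case using lln(2)[of n] by simp
  qed
  have "(\<lambda>n. (1 / real n + \<bar>w2 n - (w1 n)\<^sup>2\<bar> * (G n)\<^sup>2) / \<delta>\<^sup>2) \<longlonglongrightarrow> 0 / \<delta>\<^sup>2"
   unfolding w1_def w2_def K_def
   by (intro tendsto_divide tendsto_const C.variance_vanishes[where D = D, OF edge_density lam_pos s \<theta>])
    (use \<delta> in \<open>simp_all add: G_def K_def\<close>)
  then show "(\<lambda>n. (1 / real n + \<bar>w2 n - (w1 n)\<^sup>2\<bar> * (G n)\<^sup>2) / \<delta>\<^sup>2) \<longlonglongrightarrow> 0" by simp
 qed
 then have "whp laws P"
  by (rule whp_mono) (use Km in \<open>auto elim: eventually_mono\<close>)
 then show ?thesis unfolding P_def G_def w1_def .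
qed

text \<open>
  At the times of a grid the bracketing counts concentrate. Between two grid times both the counts
  and the limit move little, because the number of reveals does.
\<close>

lemma solvent_type_converges:
 assumes x: "x \<in> X" and \<theta>: "\<theta> \<le> d_in (par x)" and e: "0 < e"
 shows "whp laws (\<lambda>n \<omega>. before_stop n \<omega> (\<lambda>t. \<bar>real (num_solvent_type par n (ty n) (p n) x \<theta> t \<omega>) / real n - \<mu> x * fraction x \<theta> t\<bar> \<le> e))"
proof -
 interpret C: class_limit R "par x" by (rule class_limit_X[OF x])
 define f where "f = C.limit_fraction lam \<theta>"
 define K where "K s n = C.reveals_at s n" for s n
 define w where "w s n = weight1 (edges n) (d_in (par x)) (K s n) \<theta>" for s n
 \<comment> \<open>The errors collected below add up to \<open>7 * \<delta>\<close>.\<close>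
 define \<delta> where "\<delta> = e / 10"
 have \<delta>: "0 < \<delta>" unfolding \<delta>_def using e by simp
 have m0: "0 \<le> \<mu> x" by (rule mu_nonneg[OF x])
 have m1: "\<mu> x \<le> 1" by (rule mu_le_1[OF x])
 have f01: "0 \<le> f t" "f t \<le> 1" if "0 \<le> t" for t
 proof -
  show "0 \<le> f t" unfolding f_def by (rule C.limit_fraction_bounds(1)[OF lam_pos that \<theta>])
  show "f t \<le> 1" unfolding f_def
   by (rule order_trans[OF C.limit_fraction_bounds(2)[OF lam_pos that \<theta>] binom_prob_le_1[OF phi_bounds[OF that] \<theta>]])
 qed
 obtain \<zeta>0 where z0: "0 < \<zeta>0" and mod0: "\<forall>s t. 0 \<le> s \<longrightarrow> 0 \<le> t \<longrightarrow> Lam s \<le> lam + 1 \<longrightarrow> Lam t \<le> lam + 1 \<longrightarrow>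
   \<bar>Lam t - Lam s\<bar> \<le> \<zeta>0 \<longrightarrow> \<bar>f t - f s\<bar> \<le> \<delta>"
  unfolding f_def using C.limit_fraction_modulus[OF lam_pos \<theta> \<delta>] by (elim exE conjE)
 define \<zeta> where "\<zeta> = min \<zeta>0 (min \<delta> 1)"
 have \<zeta>: "0 < \<zeta>" "\<zeta> \<le> \<zeta>0" "\<zeta> \<le> \<delta>" "\<zeta> \<le> 1" unfolding \<zeta>_def using z0 \<delta> by simp_all
 from time_grid[OF lam_pos \<zeta>(1)] obtain G where fG: "finite G"
  and G: "\<And>s. s \<in> G \<Longrightarrow> 0 \<le> s \<and> Lam s < lam"
  and dense: "\<And>t. 0 \<le> t \<Longrightarrow> Lam t \<le> lam + \<zeta> / 4 \<Longrightarrow> \<exists>s\<in>G. \<bar>Lam t - Lam s\<bar> \<le> \<zeta>"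
  by blast
 have "\<forall>s\<in>G. \<exists>h>0. \<forall>\<eta>>0. \<eta> \<le> h \<longrightarrow> (\<forall>\<^sub>F n in sequentially.
   w s n * C.upper_sum \<eta> \<theta> n (K s n) \<le> f s + \<delta> \<and> f s - \<delta> \<le> w s n * C.lower_sum \<eta> \<theta> n (K s n))"
 proof
  fix s assume "s \<in> G"
  then have s: "0 \<le> s" "Lam s < lam" using G by blast+
  show "\<exists>h>0. \<forall>\<eta>>0. \<eta> \<le> h \<longrightarrow> (\<forall>\<^sub>F n in sequentially.
   w s n * C.upper_sum \<eta> \<theta> n (K s n) \<le> f s + \<delta> \<and> f s - \<delta> \<le> w s n * C.lower_sum \<eta> \<theta> n (K s n))"
   unfolding w_def K_def f_def by (rule C.brackets_converge[OF edge_density lam_pos s \<theta> \<delta>])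
 qed
 from bchoice[OF this] obtain h where h: "\<forall>s\<in>G. 0 < h s \<and> (\<forall>\<eta>>0. \<eta> \<le> h s \<longrightarrow> (\<forall>\<^sub>F n in sequentially.
   w s n * C.upper_sum \<eta> \<theta> n (K s n) \<le> f s + \<delta> \<and> f s - \<delta> \<le> w s n * C.lower_sum \<eta> \<theta> n (K s n)))"
  by (rule exE)
 define \<eta> where "\<eta> = Min (insert (\<zeta> / 4) (h ` G))"
 have fin: "finite (insert (\<zeta> / 4) (h ` G))" using fG by simp
 have "\<eta> \<in> insert (\<zeta> / 4) (h ` G)" unfolding \<eta>_def by (rule Min_in[OF fin]) simp
 then have \<eta>0: "0 < \<eta>" using \<zeta>(1) h by auto
 have \<eta>z: "\<eta> \<le> \<zeta> / 4" unfolding \<eta>_def by (rule Min_le[OF fin]) simp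
 have \<eta>h: "\<eta> \<le> h s" if "s \<in> G" for s unfolding \<eta>_def by (rule Min_le[OF fin]) (use that in simp)
 define U where "U n S = C.upper \<eta> \<theta> (positions n S)" for n :: nat and S
 define L where "L n S = C.lower \<eta> \<theta> (positions n S)" for n :: nat and S
 define F where "F n = type_fraction n (ty n) x" for n
 have F01: "0 \<le> F n" "F n \<le> 1" for n unfolding F_def by (rule type_fraction_bounds)+
 define conc where "conc n \<omega> s \<longleftrightarrow>
  \<bar>real (hits n x (K s n) \<theta> (U n) \<omega>) / real n - F n * (w s n * C.upper_sum \<eta> \<theta> n (K s n))\<bar> \<le> \<delta> \<and>
  \<bar>real (hits n x (K s n) \<theta> (L n) \<omega>) / real n - F n * (w s n * C.lower_sum \<eta> \<theta> n (K s n))\<bar> \<le> \<delta>" for n \<omega> s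
 have conc: "whp laws (\<lambda>n \<omega>. \<forall>s\<in>G. conc n \<omega> s)"
 proof (rule whp_ball[OF fG])
  fix s assume "s \<in> G"
  then have s: "0 \<le> s" "Lam s < lam" using G by blast+
  show "whp laws (\<lambda>n \<omega>. conc n \<omega> s)"
   unfolding conc_def F_def w_def K_def C.upper_sum_def C.lower_sum_def U_def L_def
   by (rule whp_conj; rule hits_concentrate[OF x \<theta> s \<delta>]; rule C.upper_sets C.lower_sets)
 qed
 have "0 < \<eta> / 2" using \<eta>0 by simp
 note close = reveals_close[OF this]
 have ev1: "\<forall>\<^sub>F n in sequentially. \<forall>s\<in>G.
   w s n * C.upper_sum \<eta> \<theta> n (K s n) \<le> f s + \<delta> \<and> f s - \<delta> \<le> w s n * C.lower_sum \<eta> \<theta> n (K s n)"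
 proof (rule eventually_ball_finite[OF fG], rule ballI)
  fix s assume s: "s \<in> G"
  show "\<forall>\<^sub>F n in sequentially. w s n * C.upper_sum \<eta> \<theta> n (K s n) \<le> f s + \<delta> \<and> f s - \<delta> \<le> w s n * C.lower_sum \<eta> \<theta> n (K s n)"
   using bspec[OF h s] \<eta>0 \<eta>h[OF s] by blast
 qed
 have ev2: "\<forall>\<^sub>F n in sequentially. dist (F n) (\<mu> x) < \<delta>"
  unfolding F_def by (rule tendstoD[OF fractions[OF x] \<delta>])
 have ev3: "\<forall>\<^sub>F n in sequentially. real (edges n) / real n < lam + \<zeta> / 8"
  by (rule order_tendstoD(2)[OF edge_density]) (use \<zeta>(1) in simp)
 show ?thesis
 proof (rule whp_eventually[OF whp_conj[OF whp_typical whp_conj[OF close conc]] eventually_conj[OF ev1 eventually_conj[OF ev2 eventually_conj[OF ev3 eventually_ge_at_top[of "nat \<lceil>1 / \<delta>\<rceil> + 1"]]]]], elim conjE, intro allI impI)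
  fix n \<omega> t
  assume elim: "\<forall>s\<in>G. w s n * C.upper_sum \<eta> \<theta> n (K s n) \<le> f s + \<delta> \<and> f s - \<delta> \<le> w s n * C.lower_sum \<eta> \<theta> n (K s n)"
    "dist (F n) (\<mu> x) < \<delta>" "real (edges n) / real n < lam + \<zeta> / 8" "nat \<lceil>1 / \<delta>\<rceil> + 1 \<le> n"
   and g: "typical n \<omega>" and cl: "before_stop n \<omega> (\<lambda>t. \<bar>real (reveals n t \<omega>) / real n - Lam t\<bar> \<le> \<eta> / 2)"
   and hc: "\<forall>s\<in>G. conc n \<omega> s"
   and t: "0 \<le> t" "ereal t \<le> stop n \<omega>"
  have n: "1 \<le> n" using elim(4) by simp
  have "1 / \<delta> \<le> real n" using elim(4) by linarith
  then have n\<delta>: "1 / real n \<le> \<delta>" using \<delta> n by (simp add: field_simps)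
  have F\<mu>: "\<bar>F n - \<mu> x\<bar> \<le> \<delta>" using elim(2) unfolding dist_real_def by simp
  note cl = cl[rule_format]
  have "reveals n t \<omega> \<le> edges n" by (rule network.revealed_eq(2)[OF networkI[OF n] g])
  then have "real (reveals n t \<omega>) / real n \<le> real (edges n) / real n" by (intro divide_right_mono) auto
  then have Lt: "Lam t \<le> lam + \<zeta> / 4" using cl[OF t] elim(3) \<eta>z \<eta>0 by linarith
  obtain s where s: "s \<in> G" "\<bar>Lam t - Lam s\<bar> \<le> \<zeta>" using dense[OF t(1) Lt] by blast
  have s0: "0 \<le> s" "Lam s < lam" using G[OF s(1)] by blast+
  have fts: "\<bar>f t - f s\<bar> \<le> \<delta>"
   using mod0 t(1) s0 s(2) Lt \<zeta> by (auto intro!: mod0[rule_format])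
  define N where "N = reveals n t \<omega>"
  have NK: "\<bar>real N - real (K s n)\<bar> / real n \<le> 3 * \<delta>"
  proof -
   have "\<bar>real (K s n) - real n * Lam s\<bar> \<le> 1"
    using C.reveals_at_le[of s n] C.reveals_at_ge[of n s] unfolding K_def by linarith
   then have "\<bar>real (K s n) - real n * Lam s\<bar> / real n \<le> 1 / real n" by (intro divide_right_mono) auto
   then have k: "\<bar>real (K s n) / real n - Lam s\<bar> \<le> 1 / real n"
   proof -
    have "real (K s n) / real n - Lam s = (real (K s n) - real n * Lam s) / real n"
     using n by (simp add: field_simps)
    then show ?thesis using \<open>\<bar>real (K s n) - real n * Lam s\<bar> / real n \<le> 1 / real n\<close> by (simp only: abs_divide abs_of_nat)
   qed
   have "\<bar>real N / real n - real (K s n) / real n\<bar> \<le> 3 * \<delta>"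
    using k cl[OF t] s(2) n\<delta> \<eta>z \<eta>0 \<zeta>(3) \<zeta>(1) unfolding N_def[symmetric] by linarith
   then show ?thesis unfolding diff_divide_distrib[symmetric] abs_divide by simp
  qed
  have lip: "\<bar>real (hits n x N \<theta> D \<omega>) / real n - real (hits n x (K s n) \<theta> D \<omega>) / real n\<bar> \<le> 3 * \<delta>" for D
  proof -
   have "\<bar>real (hits n x N \<theta> D \<omega>) - real (hits n x (K s n) \<theta> D \<omega>)\<bar> / real n \<le> \<bar>real N - real (K s n)\<bar> / real n"
    by (rule divide_right_mono[OF network.hit_count_lipschitz[OF networkI[OF n]]]) simp
   then show ?thesis using NK unfolding diff_divide_distrib[symmetric] abs_divide by simp
  qed
  define V where "V = real (num_solvent_type par n (ty n) (p n) x \<theta> t \<omega>) / real n"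
  have V1: "V \<le> real (hits n x N \<theta> (U n) \<omega>) / real n"
   unfolding V_def U_def N_def
   by (intro divide_right_mono of_nat_mono network.solvent_count_sandwich(2)[OF networkI[OF n] C.class_limit_axioms g n \<eta>0 t cl]) auto
  have V2: "real (hits n x N \<theta> (L n) \<omega>) / real n \<le> V"
   unfolding V_def L_def N_def
   by (intro divide_right_mono of_nat_mono network.solvent_count_sandwich(1)[OF networkI[OF n] C.class_limit_axioms g n \<eta>0 t cl]) auto
  have cs: "conc n \<omega> s" using hc s(1) by blast
  have up: "F n * (w s n * C.upper_sum \<eta> \<theta> n (K s n)) \<le> F n * f s + \<delta>"
  proof -
   have "F n * (w s n * C.upper_sum \<eta> \<theta> n (K s n)) \<le> F n * (f s + \<delta>)"
    by (rule mult_left_mono) (use elim(1) s(1) F01 in auto)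
   also have "\<dots> \<le> F n * f s + \<delta>" using mult_right_mono[OF F01(2)[of n], of \<delta>] \<delta> by (simp add: distrib_left)
   finally show ?thesis .
  qed
  have lo: "F n * f s - \<delta> \<le> F n * (w s n * C.lower_sum \<eta> \<theta> n (K s n))"
  proof -
   have "F n * f s - \<delta> \<le> F n * (f s - \<delta>)" using mult_right_mono[OF F01(2)[of n], of \<delta>] \<delta> by (simp add: right_diff_distrib)
   also have "\<dots> \<le> F n * (w s n * C.lower_sum \<eta> \<theta> n (K s n))"
    by (rule mult_left_mono) (use elim(1) s(1) F01 in auto)
   finally show ?thesis .
  qed
  have Ff: "\<bar>F n * f s - \<mu> x * f s\<bar> \<le> \<delta>"
  proof -
   have "\<bar>F n * f s - \<mu> x * f s\<bar> = \<bar>F n - \<mu> x\<bar> * f s"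
    using f01(1)[OF s0(1)] unfolding left_diff_distrib[symmetric] abs_mult by simp
   also have "\<dots> \<le> \<bar>F n - \<mu> x\<bar> * 1" by (rule mult_left_mono[OF f01(2)[OF s0(1)]]) simp
   finally show ?thesis using F\<mu> by simp
  qed
  have mf: "\<bar>\<mu> x * f t - \<mu> x * f s\<bar> \<le> \<delta>"
  proof -
   have "\<bar>\<mu> x * f t - \<mu> x * f s\<bar> = \<mu> x * \<bar>f t - f s\<bar>"
    using m0 unfolding right_diff_distrib[symmetric] abs_mult by simp
   also have "\<dots> \<le> 1 * \<bar>f t - f s\<bar>" by (rule mult_right_mono[OF m1]) simp
   finally show ?thesis using fts by simp
  qed
  have "\<bar>V - \<mu> x * f t\<bar> \<le> 10 * \<delta>"
   using V1 V2 lip[of "U n"] lip[of "L n"] cs up lo Ff mf \<delta> unfolding conc_def by linarith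
  then show "\<bar>real (num_solvent_type par n (ty n) (p n) x \<theta> t \<omega>) / real n - \<mu> x * fraction x \<theta> t\<bar> \<le> e"
   unfolding V_def[symmetric] fraction_eq[OF x] f_def[symmetric] \<delta>_def by simp
 qed
qed

lemma solvent_fraction_bounds:
 assumes x: "x \<in> X" and t: "0 \<le> t"
 shows "0 \<le> (\<Sum>\<theta> = 0..d_in (par x). fraction x \<theta> t)" and "(\<Sum>\<theta> = 0..d_in (par x). fraction x \<theta> t) \<le> 1"
proof -
 interpret C: class_limit R "par x" by (rule class_limit_X[OF x])
 show "0 \<le> (\<Sum>\<theta> = 0..d_in (par x). fraction x \<theta> t)"
  by (rule sum_nonneg) (use C.limit_fraction_bounds(1)[OF lam_pos t] in \<open>simp add: fraction_eq[OF x]\<close>)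
 have "(\<Sum>\<theta> = 0..d_in (par x). fraction x \<theta> t) \<le> (\<Sum>\<theta> = 0..d_in (par x). binom_prob (d_in (par x)) (phi R lam t) \<theta>)"
  by (rule sum_mono) (use C.limit_fraction_bounds(2)[OF lam_pos t] in \<open>simp add: fraction_eq[OF x]\<close>)
 then show "(\<Sum>\<theta> = 0..d_in (par x). fraction x \<theta> t) \<le> 1" unfolding sum_binom_prob .
qed

lemma num_solvent_types:
 assumes n: "1 \<le> n" and g: "typical n \<omega>"
 shows "card {i \<in> {1..n}. ty n i = x \<and> \<not> ruined par n (ty n) (p n) i t \<omega>}
  = (\<Sum>\<theta> = 0..d_in (par x). num_solvent_type par n (ty n) (p n) x \<theta> t \<omega>)"
proof -
 define B where "B \<theta> = {i \<in> {1..n}. ty n i = x \<and> \<not> ruined par n (ty n) (p n) i t \<omega> \<and> card (agent_losses par n (ty n) (p n) i t \<omega>) = \<theta>}" for \<theta>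
 have "{i \<in> {1..n}. ty n i = x \<and> \<not> ruined par n (ty n) (p n) i t \<omega>} = (\<Union>\<theta>\<in>{0..d_in (par x)}. B \<theta>)"
 proof (intro set_eqI iffI)
  fix i assume i: "i \<in> {i \<in> {1..n}. ty n i = x \<and> \<not> ruined par n (ty n) (p n) i t \<omega>}"
  then have i1: "i \<in> {1..n}" by simp
  have "card (agent_losses par n (ty n) (p n) i t \<omega>) \<in> {0..d_in (par x)}"
   using network.card_losses_le[OF networkI[OF n] g i1, of t] i by simp
  then show "i \<in> (\<Union>\<theta>\<in>{0..d_in (par x)}. B \<theta>)" unfolding B_def using i by simp
 qed (auto simp: B_def)
 then have "card {i \<in> {1..n}. ty n i = x \<and> \<not> ruined par n (ty n) (p n) i t \<omega>} = card (\<Union>\<theta>\<in>{0..d_in (par x)}. B \<theta>)" by simp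
 also have "\<dots> = (\<Sum>\<theta>\<in>{0..d_in (par x)}. card (B \<theta>))"
  by (rule card_UN_disjoint) (auto simp: B_def)
 finally show ?thesis unfolding B_def num_solvent_type_def .
qed

text \<open>
  Weighted sums over all solvent agents. Finitely many types carry the weight up to \<open>\<epsilon>\<close>, in the
  limit and, because the total weight converges, also in large networks.
\<close>

lemma weighted_solvent_converges:
 assumes c: "\<And>x. 0 \<le> c x" and total: "((\<lambda>x. c x * \<mu> x) has_sum s) X"
  and average: "(\<lambda>n. (\<Sum>i = 1..n. c (ty n i)) / real n) \<longlonglongrightarrow> s" and e: "0 < e"
 shows "whp laws (\<lambda>n \<omega>. before_stop n \<omega> (\<lambda>t. \<bar>(\<Sum>i\<in>solvents n t \<omega>. c (ty n i)) / real n
   - limit_sum c t\<bar> \<le> e))"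
proof -
 define \<epsilon> where "\<epsilon> = e / 4"
 have \<epsilon>: "0 < \<epsilon>" unfolding \<epsilon>_def using e by simp
 define a where "a x = c x * \<mu> x" for x
 have a0: "0 \<le> a x" if "x \<in> X" for x unfolding a_def using c mu_nonneg[OF that] by simp
 have asum: "(a has_sum s) X" using total unfolding a_def .
 define g where "g x t = (\<Sum>\<theta> = 0..d_in (par x). fraction x \<theta> t)" for x t
 have g01: "0 \<le> g x t" "g x t \<le> 1" if "x \<in> X" "0 \<le> t" for x t
  unfolding g_def by (rule solvent_fraction_bounds[OF that])+
 have "\<exists>F. finite F \<and> F \<subseteq> X \<and> dist (sum a F) s \<le> \<epsilon>"
  using has_sum_finite_approximation[OF asum \<epsilon>] by blast
 then obtain F where F: "finite F" "F \<subseteq> X" "dist (sum a F) s \<le> \<epsilon>" by blast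
 have rest: "(a has_sum (s - sum a F)) (X - F)"
  by (rule has_sum_Diff[OF asum has_sum_finite[OF F(1)] F(2)])
 have rest_small: "s - sum a F \<le> \<epsilon>" using F(3) unfolding dist_real_def by linarith
 have limit: "\<exists>r. 0 \<le> r \<and> r \<le> \<epsilon> \<and>
   (\<Sum>\<^sub>\<infinity>x\<in>X. \<mu> x * c x * g x t) = (\<Sum>x\<in>F. a x * g x t) + r" if t: "0 \<le> t" for t
 proof -
  have ag: "0 \<le> a x * g x t" "a x * g x t \<le> a x" if "x \<in> X" for x
   using a0[OF that] g01[OF that t] by (simp_all add: mult_left_le)
  have summ: "(\<lambda>x. a x * g x t) summable_on X"
   by (rule summable_on_comparison_test[OF has_sum_imp_summable[OF asum]]) (use ag in auto)
  have summR: "(\<lambda>x. a x * g x t) summable_on (X - F)"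
   by (rule summable_on_comparison_test[OF has_sum_imp_summable[OF rest]]) (use ag in auto)
  define r where "r = (\<Sum>\<^sub>\<infinity>x\<in>X - F. a x * g x t)"
  have "((\<lambda>x. a x * g x t) has_sum ((\<Sum>x\<in>F. a x * g x t) + r)) (F \<union> (X - F))"
   unfolding r_def by (rule has_sum_Un_disjoint[OF has_sum_finite[OF F(1)] has_sum_infsum[OF summR]]) blast
  moreover have "F \<union> (X - F) = X" using F(2) by blast
  ultimately have "(\<Sum>\<^sub>\<infinity>x\<in>X. a x * g x t) = (\<Sum>x\<in>F. a x * g x t) + r"
   by (simp only: infsumI)
  moreover have "0 \<le> r" unfolding r_def by (rule infsum_nonneg) (use ag in auto)
  moreover have "r \<le> s - sum a F"
   unfolding r_def by (rule has_sum_mono[OF has_sum_infsum[OF summR] rest]) (use ag in auto)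
  moreover have "(\<lambda>x. \<mu> x * c x * g x t) = (\<lambda>x. a x * g x t)" unfolding a_def by (simp add: mult.commute)
  ultimately show ?thesis using rest_small by (intro exI[of _ r]) simp
 qed
 \<comment> \<open>\<open>B\<close> counts, with weights, the pairs of a type in \<open>F\<close> and a number of losses; each contributes an error \<open>\<delta>\<close>.\<close>
 define B where "B = (\<Sum>x\<in>F. c x * real (d_in (par x) + 1))"
 have B0: "0 \<le> B" unfolding B_def using c by (intro sum_nonneg) simp
 define \<delta> where "\<delta> = \<epsilon> / (1 + B)"
 have \<delta>: "0 < \<delta>" unfolding \<delta>_def using \<epsilon> B0 by simp
 have B\<delta>: "B * \<delta> \<le> \<epsilon>" unfolding \<delta>_def using \<epsilon> B0 by (simp add: field_simps)
 have types: "whp laws (\<lambda>n \<omega>. \<forall>x\<in>F. \<forall>\<theta>\<in>{0..d_in (par x)}. before_stop n \<omega> (\<lambda>t. \<bar>real (num_solvent_type par n (ty n) (p n) x \<theta> t \<omega>) / real n - \<mu> x * fraction x \<theta> t\<bar> \<le> \<delta>))"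
  by (intro whp_ball F(1) finite_atLeastAtMost solvent_type_converges \<delta>) (use F(2) in auto)
 define tail where "tail n = (\<Sum>i = 1..n. c (ty n i)) / real n - (\<Sum>x\<in>F. c x * type_fraction n (ty n) x)" for n
 have "tail \<longlonglongrightarrow> s - sum a F"
  unfolding tail_def a_def by (intro tendsto_diff average tendsto_sum tendsto_mult tendsto_const fractions) (use F(2) in blast)
 then have tail: "\<forall>\<^sub>F n in sequentially. tail n < 2 * \<epsilon>"
  by (rule order_tendstoD(2)) (use rest_small \<epsilon> in simp)
 show ?thesis
 proof (rule whp_eventually[OF whp_conj[OF whp_typical types] eventually_conj[OF tail eventually_ge_at_top[of 1]]], elim conjE, intro allI impI)
  fix n \<omega> t
  assume elim: "tail n < 2 * \<epsilon>" "1 \<le> n" and g: "typical n \<omega>"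
   and ht: "\<forall>x\<in>F. \<forall>\<theta>\<in>{0..d_in (par x)}. before_stop n \<omega> (\<lambda>t.
    \<bar>real (num_solvent_type par n (ty n) (p n) x \<theta> t \<omega>) / real n - \<mu> x * fraction x \<theta> t\<bar> \<le> \<delta>)"
   and t: "0 \<le> t" "ereal t \<le> stop n \<omega>"
  define Sv where "Sv = solvents n t \<omega>"
  define In where "In = {i \<in> Sv. ty n i \<in> F}"
  have fS: "finite Sv" "finite In" unfolding Sv_def In_def by simp_all
  define V where "V x = real (card {i \<in> {1..n}. ty n i = x \<and> \<not> ruined par n (ty n) (p n) i t \<omega>}) / real n" for x
  have V: "\<bar>V x - \<mu> x * g x t\<bar> \<le> real (d_in (par x) + 1) * \<delta>" if x: "x \<in> F" for x
  proof -
   define v where "v \<theta> = real (num_solvent_type par n (ty n) (p n) x \<theta> t \<omega>) / real n" for \<theta>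
   have "V x = (\<Sum>\<theta> = 0..d_in (par x). v \<theta>)"
    unfolding V_def v_def num_solvent_types[OF elim(2) g] by (simp add: sum_divide_distrib)
   then have "V x - \<mu> x * g x t = (\<Sum>\<theta> = 0..d_in (par x). v \<theta> - \<mu> x * fraction x \<theta> t)"
    unfolding g_def sum_subtractf sum_distrib_left by simp
   also have "\<bar>\<dots>\<bar> \<le> (\<Sum>\<theta> = 0..d_in (par x). \<bar>v \<theta> - \<mu> x * fraction x \<theta> t\<bar>)" by (rule sum_abs)
   also have "\<dots> \<le> (\<Sum>\<theta> = 0..d_in (par x). \<delta>)"
    unfolding v_def using ht x t by (intro sum_mono) blast
   finally show ?thesis by simp
  qed
  have "(\<Sum>i\<in>In. c (ty n i)) = (\<Sum>x\<in>F. \<Sum>i\<in>{i \<in> In. ty n i = x}. c (ty n i))"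
   by (rule sum.group[symmetric]) (use fS F(1) in \<open>auto simp: In_def\<close>)
  also have "\<dots> = (\<Sum>x\<in>F. c x * real (card {i \<in> {1..n}. ty n i = x \<and> \<not> ruined par n (ty n) (p n) i t \<omega>}))"
  proof (rule sum.cong[OF refl])
   fix x assume "x \<in> F"
   then have "{i \<in> In. ty n i = x} = {i \<in> {1..n}. ty n i = x \<and> \<not> ruined par n (ty n) (p n) i t \<omega>}"
    unfolding In_def Sv_def by blast
   moreover have "(\<Sum>i\<in>{i \<in> In. ty n i = x}. c (ty n i)) = (\<Sum>i\<in>{i \<in> In. ty n i = x}. c x)"
    by (rule sum.cong) auto
   ultimately show "(\<Sum>i\<in>{i \<in> In. ty n i = x}. c (ty n i)) = c x * real (card {i \<in> {1..n}. ty n i = x \<and> \<not> ruined par n (ty n) (p n) i t \<omega>})"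
    by (simp add: mult.commute)
  qed
  finally have In: "(\<Sum>i\<in>In. c (ty n i)) / real n = (\<Sum>x\<in>F. c x * V x)"
   unfolding V_def by (simp add: sum_divide_distrib)
  have main: "\<bar>(\<Sum>i\<in>In. c (ty n i)) / real n - (\<Sum>x\<in>F. a x * g x t)\<bar> \<le> \<epsilon>"
  proof -
   have "(\<Sum>i\<in>In. c (ty n i)) / real n - (\<Sum>x\<in>F. a x * g x t) = (\<Sum>x\<in>F. c x * (V x - \<mu> x * g x t))"
    unfolding In a_def sum_subtractf[symmetric] by (rule sum.cong) (simp_all add: algebra_simps)
   also have "\<bar>\<dots>\<bar> \<le> (\<Sum>x\<in>F. \<bar>c x * (V x - \<mu> x * g x t)\<bar>)" by (rule sum_abs)
   also have "\<dots> \<le> (\<Sum>x\<in>F. c x * (real (d_in (par x) + 1) * \<delta>))"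
   proof (rule sum_mono)
    fix x assume x: "x \<in> F"
    show "\<bar>c x * (V x - \<mu> x * g x t)\<bar> \<le> c x * (real (d_in (par x) + 1) * \<delta>)"
     unfolding abs_mult using c[of x] V[OF x] by (simp only: abs_of_nonneg mult_left_mono)
   qed
   also have "\<dots> = B * \<delta>" unfolding B_def sum_distrib_right by (simp only: mult.assoc)
   finally show ?thesis using B\<delta> by linarith
  qed
  have split: "(\<Sum>i\<in>Sv. c (ty n i)) = (\<Sum>i\<in>In. c (ty n i)) + (\<Sum>i\<in>Sv - In. c (ty n i))"
   using sum.subset_diff[of In Sv "\<lambda>i. c (ty n i)"] fS unfolding In_def by (simp add: add.commute)
  have out0: "0 \<le> (\<Sum>i\<in>Sv - In. c (ty n i))" using c by (intro sum_nonneg) simp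
  have "(\<Sum>i\<in>Sv - In. c (ty n i)) \<le> (\<Sum>i\<in>{i \<in> {1..n}. ty n i \<notin> F}. c (ty n i))"
   by (rule sum_mono2) (use c in \<open>auto simp: Sv_def In_def\<close>)
  also have "\<dots> = (\<Sum>i = 1..n. c (ty n i)) - (\<Sum>i\<in>{i \<in> {1..n}. ty n i \<in> F}. c (ty n i))"
  proof -
   have compl: "{i \<in> {1..n}. ty n i \<notin> F} = {1..n} - {i \<in> {1..n}. ty n i \<in> F}" by blast
   show ?thesis unfolding compl by (rule sum_diff[OF finite_atLeastAtMost Collect_restrict])
  qed
  also have "(\<Sum>i\<in>{i \<in> {1..n}. ty n i \<in> F}. c (ty n i)) = (\<Sum>x\<in>F. c x * real (card {i \<in> {1..n}. ty n i = x}))"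
  proof -
   have "(\<Sum>i\<in>{i \<in> {1..n}. ty n i \<in> F}. c (ty n i))
    = (\<Sum>x\<in>F. \<Sum>i\<in>{i \<in> {i \<in> {1..n}. ty n i \<in> F}. ty n i = x}. c (ty n i))"
    by (rule sum.group[symmetric]) (use F(1) in auto)
   also have "\<dots> = (\<Sum>x\<in>F. c x * real (card {i \<in> {1..n}. ty n i = x}))"
   proof (rule sum.cong[OF refl])
    fix x assume x: "x \<in> F"
    have "(\<Sum>i\<in>{i \<in> {i \<in> {1..n}. ty n i \<in> F}. ty n i = x}. c (ty n i)) = (\<Sum>i\<in>{i \<in> {1..n}. ty n i = x}. c x)"
     by (rule sum.cong) (use x in auto)
    then show "(\<Sum>i\<in>{i \<in> {i \<in> {1..n}. ty n i \<in> F}. ty n i = x}. c (ty n i)) = c x * real (card {i \<in> {1..n}. ty n i = x})"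
     by (simp add: mult.commute)
   qed
   finally show ?thesis .
  qed
  finally have "(\<Sum>i\<in>Sv - In. c (ty n i)) / real n
   \<le> ((\<Sum>i = 1..n. c (ty n i)) - (\<Sum>x\<in>F. c x * real (card {i \<in> {1..n}. ty n i = x}))) / real n"
   by (rule divide_right_mono) simp
  also have "\<dots> = tail n" unfolding tail_def type_fraction_def by (simp add: diff_divide_distrib sum_divide_distrib)
  finally have out: "(\<Sum>i\<in>Sv - In. c (ty n i)) / real n \<le> 2 * \<epsilon>" using elim(1) by linarith
  have out0': "0 \<le> (\<Sum>i\<in>Sv - In. c (ty n i)) / real n" using out0 by simp
  obtain r where r: "0 \<le> r" "r \<le> \<epsilon>"
   "(\<Sum>\<^sub>\<infinity>x\<in>X. \<mu> x * c x * g x t) = (\<Sum>x\<in>F. a x * g x t) + r"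
   using limit[OF t(1)] by blast
  have "\<bar>(\<Sum>i\<in>Sv. c (ty n i)) / real n - (\<Sum>\<^sub>\<infinity>x\<in>X. \<mu> x * c x * g x t)\<bar> \<le> 4 * \<epsilon>"
   unfolding split add_divide_distrib r(3) using main out out0' r(1,2) \<epsilon> by linarith
  then show "\<bar>(\<Sum>i\<in>solvents n t \<omega>. c (ty n i)) / real n
   - limit_sum c t\<bar> \<le> e"
   unfolding Sv_def g_def \<epsilon>_def by simp
 qed
qed

lemma solvent_converges:
 assumes e: "0 < e"
 shows "whp laws (\<lambda>n \<omega>. before_stop n \<omega> (\<lambda>t. \<bar>real (num_solvent par n (ty n) (p n) t \<omega>) / real n - f_S R lam par X \<mu> t\<bar> \<le> e))"
proof -
 have "((\<lambda>x. 1 * \<mu> x) has_sum 1) X" using mu_sum by simp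
 moreover have "(\<lambda>n. (\<Sum>i = 1..n. 1) / real n) \<longlonglongrightarrow> (1 :: real)"
  by (rule tendsto_eventually, rule eventually_sequentiallyI[of 1]) simp
 ultimately show ?thesis
  using weighted_solvent_converges[of "\<lambda>_. 1" 1 e] e
  unfolding num_solvent_def f_S_def by (simp only: mult_1_right sum_constant)
qed

lemma ruined_eq:
 assumes "1 \<le> n"
 shows "real (num_ruined par n f d t \<omega>) / real n = 1 - real (num_solvent par n f d t \<omega>) / real n"
proof -
 have "card {1..n} = card ({i \<in> {1..n}. ruined par n f d i t \<omega>} \<union> {i \<in> {1..n}. \<not> ruined par n f d i t \<omega>})"
  by (rule arg_cong[where f = card]) blast
 also have "\<dots> = num_ruined par n f d t \<omega> + num_solvent par n f d t \<omega>"
  unfolding num_ruined_def num_solvent_def by (rule card_Un_disjoint) auto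
 finally have "real n = real (num_ruined par n f d t \<omega>) + real (num_solvent par n f d t \<omega>)" by simp
 then have "(real (num_ruined par n f d t \<omega>) + real (num_solvent par n f d t \<omega>)) / real n = 1" using assms by simp
 then show ?thesis by (simp add: add_divide_distrib)
qed

lemma ruined_converges:
 assumes e: "0 < e"
 shows "whp laws (\<lambda>n \<omega>. before_stop n \<omega> (\<lambda>t. \<bar>real (num_ruined par n (ty n) (p n) t \<omega>) / real n - f_D R lam par X \<mu> t\<bar> \<le> e))"
proof (rule whp_mono'[OF solvent_converges[OF e]], intro allI impI)
 fix n \<omega> t
 assume n: "1 \<le> n" and h: "before_stop n \<omega> (\<lambda>t. \<bar>real (num_solvent par n (ty n) (p n) t \<omega>) / real n - f_S R lam par X \<mu> t\<bar> \<le> e)"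
  and t: "0 \<le> t" "ereal t \<le> stop n \<omega>"
 have "\<bar>real (num_solvent par n (ty n) (p n) t \<omega>) / real n - f_S R lam par X \<mu> t\<bar> \<le> e" using h t by blast
 then show "\<bar>real (num_ruined par n (ty n) (p n) t \<omega>) / real n - f_D R lam par X \<mu> t\<bar> \<le> e"
  unfolding ruined_eq[OF n] f_D_def by linarith
qed

lemma ruinous_converges:
 assumes out: "((\<lambda>x. real (d_out (par x)) * \<mu> x) has_sum lam) X" and e: "0 < e"
 shows "whp laws (\<lambda>n \<omega>. before_stop n \<omega> (\<lambda>t. \<bar>real (num_ruinous par n (ty n) (p n) t \<omega>) / real n - f_W R lam par X \<mu> t\<bar> \<le> e))"
proof -
 define \<delta> where "\<delta> = e / 4"
 have \<delta>: "0 < \<delta>" unfolding \<delta>_def using e by simp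
 define c where "c x = real (d_out (par x))" for x
 have avg: "(\<lambda>n. (\<Sum>i = 1..n. c (ty n i)) / real n) \<longlonglongrightarrow> lam"
  by (rule Lim_transform_eventually[OF edge_density], rule eventually_sequentiallyI[of 1])
   (simp only: out_degree c_def)
 have w: "whp laws (\<lambda>n \<omega>. before_stop n \<omega> (\<lambda>t. \<bar>(\<Sum>i\<in>solvents n t \<omega>. c (ty n i)) / real n
   - limit_sum c t\<bar> \<le> \<delta>))"
  by (rule weighted_solvent_converges[OF _ _ avg \<delta>]) (use out in \<open>simp_all add: c_def\<close>)
 have dens: "\<forall>\<^sub>F n in sequentially. dist (real (edges n) / real n) lam < \<delta>"
  by (rule tendstoD[OF edge_density \<delta>])
 show ?thesis
 proof (rule whp_eventually[OF whp_conj[OF whp_typical whp_conj[OF w reveals_close[OF \<delta>]]] eventually_conj[OF dens eventually_ge_at_top[of 1]]], elim conjE, intro allI impI)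
  fix n \<omega> t
  assume elim: "dist (real (edges n) / real n) lam < \<delta>" "1 \<le> n" and g: "typical n \<omega>"
   and hw: "before_stop n \<omega> (\<lambda>t. \<bar>(\<Sum>i\<in>solvents n t \<omega>. c (ty n i)) / real n - limit_sum c t\<bar> \<le> \<delta>)"
   and hr: "before_stop n \<omega> (\<lambda>t. \<bar>real (reveals n t \<omega>) / real n - Lam t\<bar> \<le> \<delta>)"
   and t: "0 \<le> t" "ereal t \<le> stop n \<omega>"
  have ed: "\<bar>real (edges n) / real n - lam\<bar> < \<delta>" using elim(1) unfolding dist_real_def .
  define A where "A = (\<Sum>i\<in>solvents n t \<omega>. c (ty n i)) / real n"
  define Q where "Q = limit_sum c t"
  have AQ: "\<bar>A - Q\<bar> \<le> \<delta>" unfolding A_def Q_def using hw t by blast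
  have cl: "\<bar>real (reveals n t \<omega>) / real n - Lam t\<bar> \<le> \<delta>" using hr t by blast
  have "reveals n t \<omega> \<le> edges n" by (rule network.revealed_eq(2)[OF networkI[OF elim(2)] g])
  then have "real (reveals n t \<omega>) / real n \<le> real (edges n) / real n" by (intro divide_right_mono) auto
  then have rv: "\<bar>real (reveals n t \<omega>) / real n - min (Lam t) lam\<bar> \<le> 2 * \<delta>"
   using cl ed by (simp add: min_def abs_le_iff) linarith
  have lphi: "lam * (1 - phi R lam t) = lam - min (Lam t) lam"
   unfolding phi_eq[OF lam_pos t(1)] using lam_pos by (simp add: right_diff_distrib)
  have "(\<Sum>i = 1..n. c (ty n i)) = (\<Sum>i\<in>{i \<in> {1..n}. ruined par n (ty n) (p n) i t \<omega>}. c (ty n i))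
    + (\<Sum>i\<in>solvents n t \<omega>. c (ty n i))"
   by (subst sum.union_disjoint[symmetric]) (auto intro!: sum.cong)
  then have owed: "(\<Sum>i\<in>{i \<in> {1..n}. ruined par n (ty n) (p n) i t \<omega>}. c (ty n i))
    = real (edges n) - (\<Sum>i\<in>solvents n t \<omega>. c (ty n i))"
   using out_degree[OF elim(2)] unfolding c_def by linarith
  have "(\<Sum>i\<in>{i \<in> {1..n}. ruined par n (ty n) (p n) i t \<omega>}. c (ty n i)) / real n = real (edges n) / real n - A"
   unfolding A_def owed by (rule diff_divide_distrib)
  moreover have "real (num_ruinous par n (ty n) (p n) t \<omega>)
    = (\<Sum>i\<in>{i \<in> {1..n}. ruined par n (ty n) (p n) i t \<omega>}. c (ty n i)) - real (reveals n t \<omega>)"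
   unfolding c_def by (rule network.num_ruinous_eq[OF networkI[OF elim(2)] g t])
  ultimately have W: "real (num_ruinous par n (ty n) (p n) t \<omega>) / real n
    = real (edges n) / real n - A - real (reveals n t \<omega>) / real n"
   by (simp add: diff_divide_distrib)
  have fW: "f_W R lam par X \<mu> t = lam - min (Lam t) lam - Q"
   unfolding f_W_def lphi Q_def c_def ..
  show "\<bar>real (num_ruinous par n (ty n) (p n) t \<omega>) / real n - f_W R lam par X \<mu> t\<bar> \<le> e"
   unfolding W fW using AQ rv ed \<delta>_def by linarith
 qed
qed

end

theorem theorem3p4:
  fixes X :: "'x set" and par :: "'x \<Rightarrow> agent_class" and ty :: "nat \<Rightarrow> nat \<Rightarrow> 'x"
    and p :: "nat \<Rightarrow> 'w reveal_data" and \<mu> :: "'x \<Rightarrow> real" and lam :: real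
    and R :: "real \<Rightarrow> real"
  assumes "countable X"
    and "\<And>x. x \<in> X \<Longrightarrow> valid_class (par x)"
    and "\<And>n i. i \<in> {1..n} \<Longrightarrow> ty n i \<in> X"
    and "\<And>n. 1 \<le> n \<Longrightarrow> loss_reveal_process par n (ty n) (p n)"
    and "\<And>x. x \<in> X \<Longrightarrow> 0 \<le> \<mu> x" and "(\<mu> has_sum 1) X"
    and "\<And>x. x \<in> X \<Longrightarrow> (\<lambda>n. type_fraction n (ty n) x) \<longlonglongrightarrow> \<mu> x"
    and "\<And>n. 1 \<le> n \<Longrightarrow>
           (\<Sum>\<^sub>\<infinity>x\<in>X. real (d_in (par x)) * type_fraction n (ty n) x)
         = (\<Sum>\<^sub>\<infinity>x\<in>X. real (d_out (par x)) * type_fraction n (ty n) x)"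
    and "(\<lambda>n. \<Sum>\<^sub>\<infinity>x\<in>X. real (d_in (par x)) * type_fraction n (ty n) x) \<longlonglongrightarrow> lam"
    and "((\<lambda>x. real (d_in (par x)) * \<mu> x) has_sum lam) X" and "0 < lam"
    and "continuous_on {0..} R" and "\<And>t. 0 \<le> t \<Longrightarrow> 0 < R t"
    and "set_integrable lborel {0..} R"
    and "\<And>n. 1 \<le> n \<Longrightarrow> AE \<omega> in prb (p n). \<forall>t.
           stop_time par n (ty n) (p n) \<omega> < ereal t \<longrightarrow> intensity par n (ty n) (p n) t \<omega> = 0"
    and "intensity_asymp par ty p R"
  shows "(\<forall>x\<in>X. \<forall>\<theta>\<le>d_in (par x).
            tends_to_zero_in_prob (\<lambda>n. prb (p n))
              (\<lambda>n \<omega>. sup_until (stop_time par n (ty n) (p n) \<omega>)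
                 (\<lambda>t. real (num_solvent_type par n (ty n) (p n) x \<theta> t \<omega>) / real n
                        - \<mu> x * binom_prob (d_in (par x)) (phi R lam t) \<theta>
                            * survival_prob R (par x) \<theta> t)))
       \<and> tends_to_zero_in_prob (\<lambda>n. prb (p n))
            (\<lambda>n \<omega>. sup_until (stop_time par n (ty n) (p n) \<omega>)
               (\<lambda>t. real (num_solvent par n (ty n) (p n) t \<omega>) / real n - f_S R lam par X \<mu> t))
       \<and> tends_to_zero_in_prob (\<lambda>n. prb (p n))
            (\<lambda>n \<omega>. sup_until (stop_time par n (ty n) (p n) \<omega>)
               (\<lambda>t. real (num_ruined par n (ty n) (p n) t \<omega>) / real n - f_D R lam par X \<mu> t))
       \<and> (((\<lambda>x. real (d_out (par x)) * \<mu> x) has_sum lam) X \<longrightarrow>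
          tends_to_zero_in_prob (\<lambda>n. prb (p n))
            (\<lambda>n \<omega>. sup_until (stop_time par n (ty n) (p n) \<omega>)
               (\<lambda>t. real (num_ruinous par n (ty n) (p n) t \<omega>) / real n - f_W R lam par X \<mu> t)))"
proof -
  interpret convergent_networks R X par ty p \<mu> lam
  proof (rule convergent_networks.intro)
    show "intensity_limit R" by (rule intensity_limit.intro) (fact assms)+
    show "convergent_networks_axioms R X par ty p \<mu> lam"
      by (rule convergent_networks_axioms.intro) (fact assms)+
  qed
  show ?thesis
    by (intro conjI ballI allI impI tends_to_zero_sup_untilI solvent_type_converges[unfolded mult.assoc[symmetric]]
      solvent_converges ruined_converges ruinous_converges)
qed

end
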